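(* Let $\mathcal V=\{(M,y_0):0<M<\infty,\ y_0\in X\setminus\{0\}\}$ and let $\mathcal V_1,\mathcal V_{2,1},\dots,\mathcal V_{2,4},\mathcal V_{3,1},\mathcal V_{3,2},\mathcal V_{3,3}\subset\mathcal V$ be the subsets defined in the context. Consider the two conditions: (a) there is $p_0\in[2,\infty)$ so that $\mathcal A_{p_0}(T,\hat t)\subset\mathcal A_\infty(T,\hat t)$ for all $0<\hat t<T<\infty$; (b) whenever $T\in(0,\infty)$, $E\subset(0,T)$ is a measurable set of positive measure and $f\in Y_T$ satisfies $f=0$ over $E$, then $f=0$ over $(0,T)$. Then: (i) $\mathcal V$ is the disjoint union of $\mathcal V_1$, $\mathcal V_{2,j}$ ($j=1,2,3,4$) and $\mathcal V_{3,j}$ ($j=1,2,3$). (ii) Suppose that (a) and (b) hold. Then for each $(M,y_0)\in\mathcal V_{2,2}\cup\mathcal V_{3,2}$, $(TP)^{M,y_0}$ has the bang-bang property. (iii) Suppose that (a) holds. Then for each $(M,y_0)\in\mathcal V_{2,4}$, $(TP)^{M,y_0}$ has infinitely many different minimal time controls (the null control not being one of them), and does not hold the bang-bang property. (iv) Suppose that (a) holds. Then for each $(M,y_0)\in\mathcal V_1$, $(TP)^{M,y_0}$ has infinitely many different minimal time controls (including the null control), and does not hold the bang-bang property. (v) For each $(M,y_0)\in\mathcal V_{3,3}$, $(TP)^{M,y_0}$ has no admissible control and does not hold the bang-bang property. If (a) holds, then for each $(M,y_0)\in\mathcal V_{2,1}\cup\mathcal V_{3,1}$, $(TP)^{M,y_0}$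 has no admissible control and does not hold the bang-bang property. (vi) For each $(M,y_0)\in\mathcal V_{2,3}$, $(TP)^{M,y_0}$ has at least one minimal time control.
   Context: Setting. $\mathbb R^+=[0,\infty)$. $X$ (state space) and $U$ (control space) are real Hilbert spaces. $A:D(A)\subset X\to X$ generates a $C_0$-semigroup $\{S(t)\}_{t\ge 0}$ on $X$; $S^*(t)$ is the adjoint semigroup, generated by $A^*$. $X_{-1}=D(A^* )'$ is the dual of $D(A^* )$ with respect to the pivot space $X$, and $S_{-1}(t)$ is the extension of $S(t)$ to $X_{-1}$. $B\in\mathcal L(U,X_{-1})$, $B\ne 0$, is an admissible control operator: for each $\hat t\in(0,\infty)$ there is $C(\hat t)>0$ with $\|\int_0^{\hat t}S_{-1}(\hat t-\tau)Bu(\tau)\,d\tau\|_X\le C(\hat t)\|u\|_{L^2(0,\hat t;U)}$ for all $u\in L^2_{loc}(\mathbb R^+;U)$. $B^*\in\mathcal L(D(A^* ),U)$ is its adjoint. For $y_0\in X$, $T\in(0,\infty)$, $v\in L^2(0,T;U)$, put $\hat y(t;y_0,v)=S(t)y_0+\int_0^tS_{-1}(t-\tau)Bv(\tau)\,d\tau$, $t\in[0,T]$ (the solution in $C([0,T];X)$ of $y'=Ay+Bv$, $y(0)=y_0$). For $u\in L^\infty(\mathbb R^+;U)$, $y(t;y_0,u)$, $t\ge0$, denotes the same expression with $v$ replaced by $u$. Minimal time problem. For $M\in(0,\infty)$, $y_0\in X\setminus\{0\}$, let $\mathcal U^M=\{u:\mathbb R^+\to U\text{ strongly measurable}:\|u(t)\|_U\le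 M\text{ a.e.}\}$. $(TP)^{M,y_0}$: $T(M,y_0)=\inf\{\hat t\in(0,\infty):\exists u\in\mathcal U^M\text{ s.t. }y(\hat t;y_0,u)=0\}$ ($\inf\emptyset=\infty$). An admissible control is $u\in\mathcal U^M$ with $y(\hat t;y_0,u)=0$ for some $\hat t\in(0,\infty)$. A minimal time control (when $T(M,y_0)<\infty$) is $u^*\in\mathcal U^M$ with $y(T(M,y_0);y_0,u^* )=0$ and $u^*=0$ over $(T(M,y_0),\infty)$. $(TP)^{M,y_0}$ has the bang-bang property if it has an admissible control and every minimal time control $u^*$ satisfies $\|u^*(t)\|_U=M$ for a.e. $t\in(0,T(M,y_0))$; if there is no admissible control, the bang-bang property is said not to hold. Minimal norm function. For $T\in(0,\infty)$, $y_0\in X\setminus\{0\}$: $N(T,y_0)=\inf\{\|v\|_{L^\infty(0,T;U)}: v\in L^\infty(0,T;U),\ \hat y(T;y_0,v)=0\}$ ($\inf\emptyset=\infty$); it is decreasing in $T$ and extended by $N(\infty,y_0)=\lim_{t\to\infty}N(t,y_0)$, $N(0,y_0)=\lim_{t\to0^+}N(t,y_0)$. For $y_0\in X$: $T^0(y_0)=\inf\{\hat t\in\mathbb R^+:\exists u\in L^\infty(\mathbb R^+;U)\text{ s.t. }y(\hat t;y_0,u)=0\}$ and $T^1(y_0)=\inf\{\hat t\in\mathbb R^+: S(\hat t)y_0=0\}$ ($\inf\emptyset=\infty$). Spaces. $\mathcal A_{p_0}(T,\hat t)=\{\hat y(T;0,u):u\in L^{p_0}(0,T;U),\ u|_{(\hat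 t,T)}=0\}$; $\mathcal A_\infty(T,\hat t)=\{\hat y(T;0,v):v\in L^\infty(0,T;U),\ v|_{(0,\hat t)}=0\}$. $Y_T$ is the closure in $L^1(0,T;U)$ of $X_T=\{B^*S^*(T-\cdot)z|_{(0,T)}:z\in D(A^* )\}$. Subsets of $\mathcal V$. $\mathcal V_1=\{(M,y_0)\in\mathcal V:N(T^0(y_0),y_0)=0\}$, $\mathcal V_2=\{(M,y_0)\in\mathcal V:0<N(T^0(y_0),y_0)<\infty\}$, $\mathcal V_3=\{(M,y_0)\in\mathcal V:N(T^0(y_0),y_0)=\infty\}$. $\mathcal V_{2,1}=\{(M,y_0)\in\mathcal V_2:M\le N(T^1(y_0),y_0)\}$, $\mathcal V_{2,2}=\{(M,y_0)\in\mathcal V_2:N(T^1(y_0),y_0)<M<N(T^0(y_0),y_0)\}$, $\mathcal V_{2,3}=\{(M,y_0)\in\mathcal V_2:N(T^1(y_0),y_0)<M,\ M=N(T^0(y_0),y_0)\}$, $\mathcal V_{2,4}=\{(M,y_0)\in\mathcal V_2:N(T^1(y_0),y_0)<M,\ M>N(T^0(y_0),y_0)\}$. $\mathcal V_{3,1}=\{(M,y_0)\in\mathcal V_3:T^0(y_0)<\infty,\ M\le N(T^1(y_0),y_0)\}$, $\mathcal V_{3,2}=\{(M,y_0)\in\mathcal V_3:T^0(y_0)<\infty,\ M>N(T^1(y_0),y_0)\}$, $\mathcal V_{3,3}=\{(M,y_0)\in\mathcal V_3:T^0(y_0)=\infty\}$. *)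

theory Defs
  imports "HOL-Analysis.Analysis" "HOL-Probability.Essential_Supremum"
begin

section \<open>Semigroups, generators and adjoints\<close>

definition C0_semigroup :: "(real \<Rightarrow> 'x \<Rightarrow> 'x::real_normed_vector) \<Rightarrow> bool" where
  "C0_semigroup S \<longleftrightarrow>
     (\<forall>t\<ge>0. bounded_linear (S t)) \<and>
     (\<forall>x. S 0 x = x) \<and>
     (\<forall>s\<ge>0. \<forall>t\<ge>0. \<forall>x. S (s + t) x = S s (S t x)) \<and>
     (\<forall>x. ((\<lambda>t. S t x) \<longlongrightarrow> x) (at_right 0))"

(* A partial operator is a total function A together with its domain DA;
   the values of A outside DA are irrelevant. *)
definition generates ::
    "('x \<Rightarrow> 'x) \<Rightarrow> 'x set \<Rightarrow> (real \<Rightarrow> 'x \<Rightarrow> 'x::real_normed_vector) \<Rightarrow> bool" where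
  "generates A DA S \<longleftrightarrow>
     DA = {x. \<exists>l. ((\<lambda>h. (S h x - x) /\<^sub>R h) \<longlongrightarrow> l) (at_right 0)} \<and>
     (\<forall>x\<in>DA. ((\<lambda>h. (S h x - x) /\<^sub>R h) \<longlongrightarrow> A x) (at_right 0))"

definition adj_dom :: "('x \<Rightarrow> 'x) \<Rightarrow> 'x set \<Rightarrow> 'x::real_inner set" where
  "adj_dom A DA = {z. \<exists>w. \<forall>x\<in>DA. A x \<bullet> z = x \<bullet> w}"

(* w is unique on adj_dom A DA because the domain of a generator is dense *)
definition adj_op :: "('x \<Rightarrow> 'x) \<Rightarrow> 'x set \<Rightarrow> 'x \<Rightarrow> 'x::real_inner" where
  "adj_op A DA z = (THE w. \<forall>x\<in>DA. A x \<bullet> z = x \<bullet> w)"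

(* The Hilbert space D(A^* ) with its graph inner product is presented as a type 'd together
   with the inclusion \<iota> of D(A^* ) into X.  Its dual X_{-1} is then the Banach space
   'd \<Rightarrow>\<^sub>L real.  For every generator A such a 'd exists, e.g. 'd = 'x: as a topological
   vector space D(A^* ) is isomorphic to X via a resolvent of A^*, so the two Hilbert spaces
   have the same Hilbert dimension and hence are isometric. *)
definition represents_adj_dom ::
    "('x \<Rightarrow> 'x) \<Rightarrow> 'x set \<Rightarrow> ('d::real_inner \<Rightarrow> 'x::real_inner) \<Rightarrow> bool" where
  "represents_adj_dom A DA \<iota> \<longleftrightarrow>
     linear \<iota> \<and> bij_betw \<iota> UNIV (adj_dom A DA) \<and>
     (\<forall>d e. d \<bullet> e = \<iota> d \<bullet> \<iota> e + adj_op A DA (\<iota> d) \<bullet> adj_op A DA (\<iota> e))"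

definition adj_semigroup_dom ::
    "(real \<Rightarrow> 'x \<Rightarrow> 'x::real_inner) \<Rightarrow> ('d \<Rightarrow> 'x) \<Rightarrow> real \<Rightarrow> 'd \<Rightarrow> 'd" where
  "adj_semigroup_dom S \<iota> t d = inv \<iota> (adjoint (S t) (\<iota> d))"

(* the embedding X \<rightarrow> X_{-1} given by the pivot space X *)
definition emb ::
    "('d::real_inner \<Rightarrow> 'x::real_inner) \<Rightarrow> 'x \<Rightarrow> ('d \<Rightarrow>\<^sub>L real)" where
  "emb \<iota> x = Blinfun (\<lambda>d. x \<bullet> \<iota> d)"

(* S_{-1}(t) is the transpose of S^*(t) restricted to D(A^* ): it is bounded on X_{-1} and maps
   emb \<iota> x to emb \<iota> (S t x). *)
definition S_ext ::
    "(real \<Rightarrow> 'x \<Rightarrow> 'x::real_inner) \<Rightarrow> ('d::real_inner \<Rightarrow> 'x) \<Rightarrow> real \<Rightarrow>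
     ('d \<Rightarrow>\<^sub>L real) \<Rightarrow> ('d \<Rightarrow>\<^sub>L real)" where
  "S_ext S \<iota> t \<phi> = Blinfun (\<lambda>d. blinfun_apply \<phi> (adj_semigroup_dom S \<iota> t d))"

(* B^* : D(A^* ) \<rightarrow> U, where U is identified with its dual *)
definition adj_control ::
    "('u::real_inner \<Rightarrow>\<^sub>L ('d::real_inner \<Rightarrow>\<^sub>L real)) \<Rightarrow> 'd \<Rightarrow> 'u" where
  "adj_control B d = (THE w. \<forall>u. u \<bullet> w = blinfun_apply (blinfun_apply B u) d)"

section \<open>Lebesgue spaces of vector-valued functions\<close>

(* U is not assumed to be separable, so borel_measurable would be too weak and the Bochner
   spaces of the library (which need second_countable_topology) are not available.
   Members of L^p are represented by functions; everything below is invariant under changes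
   on null sets. *)
definition strongly_measurable ::
    "'a measure \<Rightarrow> ('a \<Rightarrow> 'b::topological_space) \<Rightarrow> bool" where
  "strongly_measurable M f \<longleftrightarrow>
     (\<exists>s :: nat \<Rightarrow> 'a \<Rightarrow> 'b. (\<forall>n. simple_function M (s n)) \<and>
        (AE x in M. (\<lambda>n. s n x) \<longlonglongrightarrow> f x))"

definition in_Lp :: "real \<Rightarrow> real set \<Rightarrow> (real \<Rightarrow> 'u::real_normed_vector) \<Rightarrow> bool" where
  "in_Lp p I u \<longleftrightarrow> strongly_measurable (lebesgue_on I) u \<and>
     integrable (lebesgue_on I) (\<lambda>t. norm (u t) powr p)"

definition Lp_norm :: "real \<Rightarrow> real set \<Rightarrow> (real \<Rightarrow> 'u::real_normed_vector) \<Rightarrow> real" where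
  "Lp_norm p I u = (LINT t|lebesgue_on I. norm (u t) powr p) powr (1 / p)"

definition in_Linf :: "real set \<Rightarrow> (real \<Rightarrow> 'u::real_normed_vector) \<Rightarrow> bool" where
  "in_Linf I u \<longleftrightarrow> strongly_measurable (lebesgue_on I) u \<and>
     (\<exists>C. AE t in lebesgue_on I. norm (u t) \<le> C)"

definition Linf_norm :: "real set \<Rightarrow> (real \<Rightarrow> 'u::real_normed_vector) \<Rightarrow> ereal" where
  "Linf_norm I u = esssup (lebesgue_on I) (\<lambda>t. ereal (norm (u t)))"

section \<open>Admissible control operators and solutions\<close>

(* The integral over [0,t] of S_{-1}(t - s) B u(s) is the X_{-1}-valued Henstock-Kurzweil
   integral, which extends the Bochner integral (here again unavailable because X_{-1} need
   not be separable). *)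
definition admissible_control_operator ::
    "(real \<Rightarrow> 'x \<Rightarrow> 'x::real_inner) \<Rightarrow> ('d::real_inner \<Rightarrow> 'x) \<Rightarrow>
     ('u::real_inner \<Rightarrow>\<^sub>L ('d \<Rightarrow>\<^sub>L real)) \<Rightarrow> bool" where
  "admissible_control_operator S \<iota> B \<longleftrightarrow>
     (\<forall>t>0. \<exists>C>0. \<forall>u. (\<forall>T>0. in_Lp 2 {0<..<T} u) \<longrightarrow>
        (\<exists>x. ((\<lambda>s. S_ext S \<iota> (t - s) (blinfun_apply B (u s))) has_integral emb \<iota> x) {0..t} \<and>
             norm x \<le> C * Lp_norm 2 {0<..<t} u))"

(* emb \<iota> is injective because D(A^* ) is dense in X *)
definition sol ::
    "(real \<Rightarrow> 'x \<Rightarrow> 'x::real_inner) \<Rightarrow> ('d::real_inner \<Rightarrow> 'x) \<Rightarrow>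
     ('u::real_inner \<Rightarrow>\<^sub>L ('d \<Rightarrow>\<^sub>L real)) \<Rightarrow> 'x \<Rightarrow> (real \<Rightarrow> 'u) \<Rightarrow> real \<Rightarrow> 'x" where
  "sol S \<iota> B y0 u t =
     S t y0 + inv (emb \<iota>) (integral {0..t} (\<lambda>s. S_ext S \<iota> (t - s) (blinfun_apply B (u s))))"

section \<open>The minimal time problem\<close>

definition controls :: "real \<Rightarrow> (real \<Rightarrow> 'u::real_normed_vector) set" where
  "controls M = {u. strongly_measurable (lebesgue_on {0..}) u \<and>
     (AE t in lebesgue_on {0..}. norm (u t) \<le> M)}"

definition min_time ::
    "(real \<Rightarrow> 'x \<Rightarrow> 'x::real_inner) \<Rightarrow> ('d::real_inner \<Rightarrow> 'x) \<Rightarrow>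
     ('u::real_inner \<Rightarrow>\<^sub>L ('d \<Rightarrow>\<^sub>L real)) \<Rightarrow> real \<Rightarrow> 'x \<Rightarrow> ereal" where
  "min_time S \<iota> B M y0 =
     Inf {ereal t | t. 0 < t \<and> (\<exists>u\<in>controls M. sol S \<iota> B y0 u t = 0)}"

definition admissible_control ::
    "(real \<Rightarrow> 'x \<Rightarrow> 'x::real_inner) \<Rightarrow> ('d::real_inner \<Rightarrow> 'x) \<Rightarrow>
     ('u::real_inner \<Rightarrow>\<^sub>L ('d \<Rightarrow>\<^sub>L real)) \<Rightarrow> real \<Rightarrow> 'x \<Rightarrow> (real \<Rightarrow> 'u) \<Rightarrow> bool" where
  "admissible_control S \<iota> B M y0 u \<longleftrightarrow>
     u \<in> controls M \<and> (\<exists>t>0. sol S \<iota> B y0 u t = 0)"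

definition min_time_control ::
    "(real \<Rightarrow> 'x \<Rightarrow> 'x::real_inner) \<Rightarrow> ('d::real_inner \<Rightarrow> 'x) \<Rightarrow>
     ('u::real_inner \<Rightarrow>\<^sub>L ('d \<Rightarrow>\<^sub>L real)) \<Rightarrow> real \<Rightarrow> 'x \<Rightarrow> (real \<Rightarrow> 'u) \<Rightarrow> bool" where
  "min_time_control S \<iota> B M y0 u \<longleftrightarrow>
     min_time S \<iota> B M y0 < \<infinity> \<and> u \<in> controls M \<and>
     sol S \<iota> B y0 u (real_of_ereal (min_time S \<iota> B M y0)) = 0 \<and>
     (AE t in lebesgue_on {real_of_ereal (min_time S \<iota> B M y0)<..}. u t = 0)"

definition bang_bang ::
    "(real \<Rightarrow> 'x \<Rightarrow> 'x::real_inner) \<Rightarrow> ('d::real_inner \<Rightarrow> 'x) \<Rightarrow>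
     ('u::real_inner \<Rightarrow>\<^sub>L ('d \<Rightarrow>\<^sub>L real)) \<Rightarrow> real \<Rightarrow> 'x \<Rightarrow> bool" where
  "bang_bang S \<iota> B M y0 \<longleftrightarrow>
     (\<exists>u. admissible_control S \<iota> B M y0 u) \<and>
     (\<forall>u. min_time_control S \<iota> B M y0 u \<longrightarrow>
        (AE t in lebesgue_on {0<..<real_of_ereal (min_time S \<iota> B M y0)}. norm (u t) = M))"

(* Two controls are the same if they agree almost everywhere, so different minimal time
   controls are counted by their classes. *)
definition control_class :: "(real \<Rightarrow> 'u) \<Rightarrow> (real \<Rightarrow> 'u) set" where
  "control_class u = {v. AE t in lebesgue_on {0..}. v t = u t}"

definition infinitely_many_min_time_controls ::
    "(real \<Rightarrow> 'x \<Rightarrow> 'x::real_inner) \<Rightarrow> ('d::real_inner \<Rightarrow> 'x) \<Rightarrow>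
     ('u::real_inner \<Rightarrow>\<^sub>L ('d \<Rightarrow>\<^sub>L real)) \<Rightarrow> real \<Rightarrow> 'x \<Rightarrow> bool" where
  "infinitely_many_min_time_controls S \<iota> B M y0 \<longleftrightarrow>
     infinite (control_class ` {u. min_time_control S \<iota> B M y0 u})"

section \<open>The minimal norm function\<close>

definition min_norm_fin ::
    "(real \<Rightarrow> 'x \<Rightarrow> 'x::real_inner) \<Rightarrow> ('d::real_inner \<Rightarrow> 'x) \<Rightarrow>
     ('u::real_inner \<Rightarrow>\<^sub>L ('d \<Rightarrow>\<^sub>L real)) \<Rightarrow> real \<Rightarrow> 'x \<Rightarrow> ereal" where
  "min_norm_fin S \<iota> B T y0 =
     Inf {Linf_norm {0<..<T} v | v. in_Linf {0<..<T} v \<and> sol S \<iota> B y0 v T = 0}"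

definition min_norm ::
    "(real \<Rightarrow> 'x \<Rightarrow> 'x::real_inner) \<Rightarrow> ('d::real_inner \<Rightarrow> 'x) \<Rightarrow>
     ('u::real_inner \<Rightarrow>\<^sub>L ('d \<Rightarrow>\<^sub>L real)) \<Rightarrow> ereal \<Rightarrow> 'x \<Rightarrow> ereal" where
  "min_norm S \<iota> B T y0 =
     (if T = \<infinity> then Lim at_top (\<lambda>t. min_norm_fin S \<iota> B t y0)
      else if T = 0 then Lim (at_right 0) (\<lambda>t. min_norm_fin S \<iota> B t y0)
      else min_norm_fin S \<iota> B (real_of_ereal T) y0)"

definition T0 ::
    "(real \<Rightarrow> 'x \<Rightarrow> 'x::real_inner) \<Rightarrow> ('d::real_inner \<Rightarrow> 'x) \<Rightarrow>
     ('u::real_inner \<Rightarrow>\<^sub>L ('d \<Rightarrow>\<^sub>L real)) \<Rightarrow> 'x \<Rightarrow> ereal" where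
  "T0 S \<iota> B y0 = Inf {ereal t | t. 0 \<le> t \<and> (\<exists>u. in_Linf {0..} u \<and> sol S \<iota> B y0 u t = 0)}"

definition T1 :: "(real \<Rightarrow> 'x \<Rightarrow> 'x::zero) \<Rightarrow> 'x \<Rightarrow> ereal" where
  "T1 S y0 = Inf {ereal t | t. 0 \<le> t \<and> S t y0 = 0}"

section \<open>Reachable subspaces and unique continuation\<close>

definition reach_Lp ::
    "(real \<Rightarrow> 'x \<Rightarrow> 'x::real_inner) \<Rightarrow> ('d::real_inner \<Rightarrow> 'x) \<Rightarrow>
     ('u::real_inner \<Rightarrow>\<^sub>L ('d \<Rightarrow>\<^sub>L real)) \<Rightarrow> real \<Rightarrow> real \<Rightarrow> real \<Rightarrow> 'x set" where
  "reach_Lp S \<iota> B p T t =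
     {sol S \<iota> B 0 u T | u. in_Lp p {0<..<T} u \<and> (AE s in lebesgue_on {t<..<T}. u s = 0)}"

definition reach_Linf ::
    "(real \<Rightarrow> 'x \<Rightarrow> 'x::real_inner) \<Rightarrow> ('d::real_inner \<Rightarrow> 'x) \<Rightarrow>
     ('u::real_inner \<Rightarrow>\<^sub>L ('d \<Rightarrow>\<^sub>L real)) \<Rightarrow> real \<Rightarrow> real \<Rightarrow> 'x set" where
  "reach_Linf S \<iota> B T t =
     {sol S \<iota> B 0 v T | v. in_Linf {0<..<T} v \<and> (AE s in lebesgue_on {0<..<t}. v s = 0)}"

definition condition_a ::
    "(real \<Rightarrow> 'x \<Rightarrow> 'x::real_inner) \<Rightarrow> ('d::real_inner \<Rightarrow> 'x) \<Rightarrow>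
     ('u::real_inner \<Rightarrow>\<^sub>L ('d \<Rightarrow>\<^sub>L real)) \<Rightarrow> bool" where
  "condition_a S \<iota> B \<longleftrightarrow>
     (\<exists>p\<ge>2. \<forall>t T. 0 < t \<and> t < T \<longrightarrow> reach_Lp S \<iota> B p T t \<subseteq> reach_Linf S \<iota> B T t)"

definition X_space ::
    "(real \<Rightarrow> 'x \<Rightarrow> 'x::real_inner) \<Rightarrow> ('d::real_inner \<Rightarrow> 'x) \<Rightarrow>
     ('u::real_inner \<Rightarrow>\<^sub>L ('d \<Rightarrow>\<^sub>L real)) \<Rightarrow> real \<Rightarrow> (real \<Rightarrow> 'u) set" where
  "X_space S \<iota> B T = {\<lambda>t. adj_control B (adj_semigroup_dom S \<iota> (T - t) d) | d. True}"

(* the closure of X_space in L^1(0,T;U) *)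
definition Y_space ::
    "(real \<Rightarrow> 'x \<Rightarrow> 'x::real_inner) \<Rightarrow> ('d::real_inner \<Rightarrow> 'x) \<Rightarrow>
     ('u::real_inner \<Rightarrow>\<^sub>L ('d \<Rightarrow>\<^sub>L real)) \<Rightarrow> real \<Rightarrow> (real \<Rightarrow> 'u) set" where
  "Y_space S \<iota> B T = {f. in_Lp 1 {0<..<T} f \<and>
     (\<forall>\<epsilon>>0. \<exists>g\<in>X_space S \<iota> B T. Lp_norm 1 {0<..<T} (\<lambda>t. f t - g t) < \<epsilon>)}"

definition condition_b ::
    "(real \<Rightarrow> 'x \<Rightarrow> 'x::real_inner) \<Rightarrow> ('d::real_inner \<Rightarrow> 'x) \<Rightarrow>
     ('u::real_inner \<Rightarrow>\<^sub>L ('d \<Rightarrow>\<^sub>L real)) \<Rightarrow> bool" where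
  "condition_b S \<iota> B \<longleftrightarrow>
     (\<forall>T>0. \<forall>E\<in>sets lebesgue. E \<subseteq> {0<..<T} \<and> emeasure lebesgue E > 0 \<longrightarrow>
        (\<forall>f\<in>Y_space S \<iota> B T. (AE t in lebesgue_on E. f t = 0) \<longrightarrow>
           (AE t in lebesgue_on {0<..<T}. f t = 0)))"

section \<open>The decomposition of the parameter set\<close>

definition VV :: "(real \<times> 'x::zero) set" where
  "VV = {(M, y0). 0 < M \<and> y0 \<noteq> 0}"

context
  fixes S :: "real \<Rightarrow> 'x \<Rightarrow> 'x::real_inner"
    and \<iota> :: "'d::real_inner \<Rightarrow> 'x"
    and B :: "'u::real_inner \<Rightarrow>\<^sub>L ('d \<Rightarrow>\<^sub>L real)"
begin

definition V1 :: "(real \<times> 'x) set" where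
  "V1 = {(M, y0) \<in> VV. min_norm S \<iota> B (T0 S \<iota> B y0) y0 = 0}"

definition V2 :: "(real \<times> 'x) set" where
  "V2 = {(M, y0) \<in> VV. 0 < min_norm S \<iota> B (T0 S \<iota> B y0) y0 \<and>
                         min_norm S \<iota> B (T0 S \<iota> B y0) y0 < \<infinity>}"

definition V3 :: "(real \<times> 'x) set" where
  "V3 = {(M, y0) \<in> VV. min_norm S \<iota> B (T0 S \<iota> B y0) y0 = \<infinity>}"

definition V21 :: "(real \<times> 'x) set" where
  "V21 = {(M, y0) \<in> V2. ereal M \<le> min_norm S \<iota> B (T1 S y0) y0}"

definition V22 :: "(real \<times> 'x) set" where
  "V22 = {(M, y0) \<in> V2. min_norm S \<iota> B (T1 S y0) y0 < ereal M \<and>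
                          ereal M < min_norm S \<iota> B (T0 S \<iota> B y0) y0}"

definition V23 :: "(real \<times> 'x) set" where
  "V23 = {(M, y0) \<in> V2. min_norm S \<iota> B (T1 S y0) y0 < ereal M \<and>
                          ereal M = min_norm S \<iota> B (T0 S \<iota> B y0) y0}"

definition V24 :: "(real \<times> 'x) set" where
  "V24 = {(M, y0) \<in> V2. min_norm S \<iota> B (T1 S y0) y0 < ereal M \<and>
                          ereal M > min_norm S \<iota> B (T0 S \<iota> B y0) y0}"

definition V31 :: "(real \<times> 'x) set" where
  "V31 = {(M, y0) \<in> V3. T0 S \<iota> B y0 < \<infinity> \<and> ereal M \<le> min_norm S \<iota> B (T1 S y0) y0}"

definition V32 :: "(real \<times> 'x) set" where
  "V32 = {(M, y0) \<in> V3. T0 S \<iota> B y0 < \<infinity> \<and> ereal M > min_norm S \<iota> B (T1 S y0) y0}"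

definition V33 :: "(real \<times> 'x) set" where
  "V33 = {(M, y0) \<in> V3. T0 S \<iota> B y0 = \<infinity>}"

end

end

theory Submission
  imports Defs
begin

text \<open>Duality turns the state at time \<open>T\<close> into the pairing of the control with \<open>B\<^sup>* S\<^sup>*(T - t) z\<close>.
  Minimal norm controls exist by weak compactness, so \<open>N(T, y)\<close> is attained and the minimal time problem at \<open>M\<close>
  is governed by the sublevel set \<open>N(T, y) \<le> M\<close>.  Under (a) a control on \<open>(0, t)\<close> can be traded for a bounded one
  on \<open>(t, T)\<close>, with a uniform bound by Baire's theorem.  Hence \<open>N\<close> decreases strictly and is
  left continuous, and there are nonzero bounded controls with the same effect as the null control; adding
  small multiples of such a control to a minimal time control with slack gives infinitely many others.  The bang-bang
  property at \<open>T\<^sup>0 < T\<close> comes from a Hahn--Banach functional supporting the ball of controls at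
  the optimal one: (a) represents it by a function in \<open>Y\<close>, and (b) excludes that this function vanishes on a set of
  positive measure.\<close>

section \<open>Hilbert spaces\<close>

text \<open>The spaces may be nonseparable, so limits are produced by strong convergence:
  near-minimisers of a uniformly convex functional over convex sets form a Cauchy sequence in L^p
  (\<open>nested_minimisers\<close>), and an a.e. convergent subsequence carries pointwise bounds to
  the limit. The attained minimal norm, the representation of functionals and the L^1-closure result
  are three uses of this scheme. The delicate step is left continuity of \<open>N\<close> beyond
  T^0. Arriving earlier by delta leaves an error made of a translate difference and of the initial
  piece of a control. It is small in L^p for finite p, but in general not in L^\<infinity>; this is
  where the finite exponent in (a) matters. Left continuity makes M the exact minimal norm at the
  minimal time, so the target lies on the boundary of the set that the Hahn-Banach functional
  supports. That functional is represented only on (0, t) with t < T, because (a) moves controls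
  from (0, t) to (t, T). A control that already reaches zero at T' < t links the representing
  function with the positive value of the functional at the target.\<close>

lemma almost_minimising_Cauchy:
  fixes x :: "nat \<Rightarrow> 'a::real_inner"
  assumes C: "convex C" and x: "\<And>n. x n \<in> C"
    and lower: "\<And>c. c \<in> C \<Longrightarrow> m \<le> c \<bullet> c" and lim: "(\<lambda>n. x n \<bullet> x n) \<longlonglongrightarrow> m"
  shows "Cauchy x"
proof (rule metric_CauchyI)
  fix e :: real assume e: "e > 0"
  have "eventually (\<lambda>n. x n \<bullet> x n < m + e^2/4) sequentially"
    using lim e by (intro order_tendstoD(2)[OF lim]) auto
  then obtain N where N: "\<And>n. n \<ge> N \<Longrightarrow> x n \<bullet> x n < m + e^2/4"
    by (auto simp: eventually_sequentially)
  show "\<exists>M. \<forall>k\<ge>M. \<forall>n\<ge>M. dist (x k) (x n) < e"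
  proof (intro exI allI impI)
    fix k n assume kn: "N \<le> k" "N \<le> n"
    have "(1/2) *\<^sub>R x k + (1/2) *\<^sub>R x n \<in> C"
      using C x by (intro convexD) auto
    then have "m \<le> ((1/2) *\<^sub>R x k + (1/2) *\<^sub>R x n) \<bullet> ((1/2) *\<^sub>R x k + (1/2) *\<^sub>R x n)"
      by (rule lower)
    \<comment> \<open>The parallelogram law. As the midpoint has squared norm at least
      \<open>m\<close>, the right-hand side is below 4 (m + e^2/4) - 4 m = e^2.\<close>
    moreover have "(x k - x n) \<bullet> (x k - x n) = 2 * (x k \<bullet> x k) + 2 * (x n \<bullet> x n) -
       4 * (((1/2) *\<^sub>R x k + (1/2) *\<^sub>R x n) \<bullet> ((1/2) *\<^sub>R x k + (1/2) *\<^sub>R x n))"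
      by (simp add: inner_simps algebra_simps inner_commute)
    ultimately have "(norm (x k - x n))^2 < e^2"
      using N[OF kn(1)] N[OF kn(2)] by (simp add: power2_norm_eq_inner)
    then show "dist (x k) (x n) < e"
      using e by (simp add: dist_norm power2_less_imp_less)
  qed
qed

text \<open>With \<open>C\<close> merely convex the minimiser lies in its closure. The second
  conclusion is the variational inequality: compare \<open>w\<close> with points of the segment from
  \<open>w\<close> to \<open>c\<close>, divide by the parameter \<open>s\<close> and let it tend to
  0.\<close>

lemma nearest_point:
  fixes C :: "'a::{real_inner,complete_space} set"
  assumes C: "convex C" and ne: "C \<noteq> {}"
  obtains w where "w \<in> closure C" "\<And>c. c \<in> C \<Longrightarrow> w \<bullet> w \<le> w \<bullet> c"
proof -
  define m where "m = (INF c\<in>C. c \<bullet> c)"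
  have bdd: "bdd_below ((\<lambda>c. c \<bullet> c) ` C)"
    by (rule bdd_belowI[of _ 0]) auto
  have lower: "m \<le> c \<bullet> c" if "c \<in> C" for c
    unfolding m_def using that bdd by (intro cINF_lower) auto
  have "\<exists>c\<in>C. c \<bullet> c < m + 1 / real (Suc n)" for n
  proof -
    have "Inf ((\<lambda>c. c \<bullet> c) ` C) < m + 1 / real (Suc n)"
      unfolding m_def by simp
    then show ?thesis
      using ne bdd by (subst (asm) cINF_less_iff) auto
  qed
  then obtain x where x: "\<And>n. x n \<in> C" and xm: "\<And>n. x n \<bullet> x n < m + 1 / real (Suc n)"
    by metis
  have lim: "(\<lambda>n. x n \<bullet> x n) \<longlonglongrightarrow> m"
  proof (rule tendsto_sandwich)
    show "eventually (\<lambda>n. m \<le> x n \<bullet> x n) sequentially" by (simp add: lower x)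
    show "eventually (\<lambda>n. x n \<bullet> x n \<le> m + 1 / real (Suc n)) sequentially"
      using xm by (simp add: less_imp_le)
    show "(\<lambda>n. m + 1 / real (Suc n)) \<longlonglongrightarrow> m"
      using tendsto_add[OF tendsto_const LIMSEQ_inverse_real_of_nat, of m] by (simp add: divide_inverse)
  qed simp
  have "Cauchy x" by (rule almost_minimising_Cauchy[OF C x lower lim])
  then obtain w where w: "x \<longlonglongrightarrow> w"
    by (auto simp: Cauchy_convergent_iff convergent_def)
  have ww: "w \<bullet> w = m"
    using tendsto_inner[OF w w] lim LIMSEQ_unique by blast
  have wc: "w \<in> closure C"
    unfolding closure_sequential using x w by blast
  have "w \<bullet> w \<le> w \<bullet> c" if c: "c \<in> C" for c
  proof -
    have ineq: "0 \<le> 2 * (w \<bullet> c - w \<bullet> w) + s * ((c - w) \<bullet> (c - w))" if s: "0 < s" "s \<le> 1" for s :: real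
    proof -
      have "m \<le> ((1 - s) *\<^sub>R x n + s *\<^sub>R c) \<bullet> ((1 - s) *\<^sub>R x n + s *\<^sub>R c)" for n
        using C x c s by (intro lower convexD) auto
      moreover have "(\<lambda>n. ((1 - s) *\<^sub>R x n + s *\<^sub>R c) \<bullet> ((1 - s) *\<^sub>R x n + s *\<^sub>R c)) \<longlonglongrightarrow>
          ((1 - s) *\<^sub>R w + s *\<^sub>R c) \<bullet> ((1 - s) *\<^sub>R w + s *\<^sub>R c)"
        by (intro tendsto_intros w)
      ultimately have "m \<le> ((1 - s) *\<^sub>R w + s *\<^sub>R c) \<bullet> ((1 - s) *\<^sub>R w + s *\<^sub>R c)"
        by (intro LIMSEQ_le_const) auto
      also have "\<dots> = m + s * (2 * (w \<bullet> c - w \<bullet> w) + s * ((c - w) \<bullet> (c - w)))"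
        unfolding ww[symmetric] by (simp add: inner_simps algebra_simps inner_commute)
      finally show ?thesis using s(1) by (simp add: zero_le_mult_iff)
    qed
    have "((\<lambda>s. 2 * (w \<bullet> c - w \<bullet> w) + s * ((c - w) \<bullet> (c - w))) \<longlongrightarrow> 2 * (w \<bullet> c - w \<bullet> w) + 0 * ((c - w) \<bullet> (c - w))) (at_right 0)"
      by (intro tendsto_intros)
    moreover have "eventually (\<lambda>s::real. 0 \<le> 2 * (w \<bullet> c - w \<bullet> w) + s * ((c - w) \<bullet> (c - w))) (at_right 0)"
      using ineq by (auto simp: eventually_at_right_field intro!: exI[of _ 1])
    ultimately have "0 \<le> 2 * (w \<bullet> c - w \<bullet> w) + 0 * ((c - w) \<bullet> (c - w))"
      by (intro tendsto_lowerbound) auto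
    then show ?thesis by simp
  qed
  with wc show ?thesis using that by blast
qed

text \<open>The point \<open>w\<close> of least norm on the hyperplane f = 1 is orthogonal to the
  kernel, because w + s z stays on the hyperplane for every \<open>z\<close> in the kernel and every
  \<open>s\<close> of either sign. Rescaling \<open>w\<close> gives the representing vector.\<close>

lemma Riesz_representation:
  fixes f :: "'a::{real_inner,complete_space} \<Rightarrow> real"
  assumes f: "bounded_linear f"
  shows "\<exists>w. \<forall>x. f x = x \<bullet> w"
proof (cases "\<forall>x. f x = 0")
  case True
  then show ?thesis by (intro exI[of _ 0]) auto
next
  case False
  interpret bounded_linear f by fact
  obtain x0 where "f x0 \<noteq> 0" using False by blast
  then have x1: "f ((1 / f x0) *\<^sub>R x0) = 1" by (simp add: scaleR)
  let ?C = "{x. f x = 1}"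
  have "convex ?C" by (auto simp: convex_def add scaleR)
  moreover have "?C \<noteq> {}" using x1 by blast
  ultimately obtain w where w: "w \<in> closure ?C" "\<And>c. c \<in> ?C \<Longrightarrow> w \<bullet> w \<le> w \<bullet> c"
    using nearest_point by blast
  have "closed ?C"
    using linear_continuous_on[OF f, of UNIV] by (intro closed_Collect_eq) (auto intro: continuous_intros)
  then have fw: "f w = 1" using w(1) by (simp add: closure_closed)
  have ker: "w \<bullet> z = 0" if z: "f z = 0" for z
  proof -
    have "w \<bullet> w \<le> w \<bullet> (w + s *\<^sub>R z)" for s
      using w(2)[of "w + s *\<^sub>R z"] by (simp add: add scaleR fw z)
    then have *: "0 \<le> s * (w \<bullet> z)" for s by (simp add: inner_simps)
    show ?thesis using *[of "- (w \<bullet> z)"] by (auto simp: mult_le_0_iff)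
  qed
  have "w \<noteq> 0" using fw zero by auto
  have "f x = x \<bullet> ((1 / (w \<bullet> w)) *\<^sub>R w)" for x
  proof -
    have "w \<bullet> (x - f x *\<^sub>R w) = 0" by (rule ker) (simp add: diff scaleR fw)
    then have "w \<bullet> x = f x * (w \<bullet> w)" by (simp add: inner_simps)
    then show ?thesis using \<open>w \<noteq> 0\<close> by (simp add: inner_commute field_simps)
  qed
  then show ?thesis by blast
qed

text \<open>\<open>adjoint\<close> is a Hilbert choice. Riesz representation of x \<mapsto> T x
  \<bullet> y shows that there is something to choose.\<close>

lemma inner_adjoint:
  fixes T :: "'a::{real_inner,complete_space} \<Rightarrow> 'b::real_inner"
  assumes T: "bounded_linear T"
  shows "T x \<bullet> y = x \<bullet> adjoint T y"
proof -
  interpret bounded_linear T by fact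
  have "bounded_linear (\<lambda>x. T x \<bullet> y)" for y
    using T by (rule bounded_linear_compose[OF bounded_linear_inner_left])
  then have "\<forall>y. \<exists>w. \<forall>x. T x \<bullet> y = x \<bullet> w"
    using Riesz_representation by blast
  then have "\<exists>f'. \<forall>y x. T x \<bullet> y = x \<bullet> f' y" by (rule choice)
  then have "\<exists>f'. \<forall>x y. T x \<bullet> y = x \<bullet> f' y" by blast
  then have "\<forall>x y. T x \<bullet> y = x \<bullet> adjoint T y"
    unfolding adjoint_def by (rule someI_ex)
  then show ?thesis by blast
qed

text \<open>The point of least norm in the closure of the translate z - D is orthogonal to
  \<open>D\<close>, hence 0, and then \<open>z\<close> is a limit of points of
  \<open>D\<close>.\<close>

lemma dense_if_orthogonal_trivial:
  fixes D :: "'a::{real_inner,complete_space} set"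
  assumes D: "subspace D" and orth: "\<And>w. (\<And>d. d \<in> D \<Longrightarrow> w \<bullet> d = 0) \<Longrightarrow> w = 0"
  shows "closure D = UNIV"
proof -
  have "z \<in> closure D" for z
  proof -
    let ?C = "(\<lambda>d. z - d) ` D"
    have "convex D" using D by (rule subspace_imp_convex)
    then have "convex ((\<lambda>d. z + (-1) *\<^sub>R d) ` D)"
      by (rule convex_affinity)
    then have "convex ?C" by simp
    moreover have "?C \<noteq> {}" using subspace_0[OF D] by blast
    ultimately obtain w where w: "w \<in> closure ?C" "\<And>c. c \<in> ?C \<Longrightarrow> w \<bullet> w \<le> w \<bullet> c"
      using nearest_point by blast
    have "w \<bullet> d = 0" if d: "d \<in> D" for d
    proof -
      have ineq: "w \<bullet> w \<le> w \<bullet> z - s * (w \<bullet> d)" for s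
        using w(2)[of "z - s *\<^sub>R d"] subspace_scale[OF D d] by (auto simp: inner_simps)
      show ?thesis
      proof (rule ccontr)
        assume "w \<bullet> d \<noteq> 0"
        \<comment> \<open>The multiple of \<open>d\<close> is chosen so that the right-hand side
          becomes -1.\<close>
        then have "w \<bullet> w \<le> w \<bullet> z - (w \<bullet> z + 1)"
          using ineq[of "(w \<bullet> z + 1) / (w \<bullet> d)"] by simp
        then show False using inner_ge_zero[of w] by linarith
      qed
    qed
    then have "w = 0" by (rule orth)
    with w(1) obtain c where c: "\<And>n. c n \<in> ?C" "c \<longlonglongrightarrow> 0"
      by (auto simp: closure_sequential)
    have "\<forall>n. \<exists>d. d \<in> D \<and> c n = z - d" using c(1) by auto
    then obtain d where d: "\<And>n. d n \<in> D" "\<And>n. c n = z - d n" by metis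
    have "(\<lambda>n. z - c n) \<longlonglongrightarrow> z - 0" by (intro tendsto_intros c)
    then have "d \<longlonglongrightarrow> z" by (simp add: d(2))
    then show ?thesis using d(1) by (auto simp: closure_sequential)
  qed
  then show ?thesis by blast
qed

section \<open>Baire category and the Hahn--Banach theorem\<close>

text \<open>The constant \<^term>\<open>K\<close> admits the quasi-metric \<open>\<integral> |u - v|\<^sup>p\<close>.\<close>

lemma quasi_metric_Baire:
  fixes d :: "'a \<Rightarrow> 'a \<Rightarrow> real" and F :: "nat \<Rightarrow> 'a set"
  assumes "V \<noteq> {}" and K: "K \<ge> 1"
    and refl: "\<And>x. x \<in> V \<Longrightarrow> d x x = 0"
    and nonneg: "\<And>x y. 0 \<le> d x y" and sym: "\<And>x y. d x y = d y x"
    and tri: "\<And>x y z. x \<in> V \<Longrightarrow> y \<in> V \<Longrightarrow> z \<in> V \<Longrightarrow> d x z \<le> K * (d x y + d y z)"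
    and complete: "\<And>x. (\<And>n. x n \<in> V) \<Longrightarrow> (\<And>e. e > 0 \<Longrightarrow> \<exists>N. \<forall>i\<ge>N. \<forall>j\<ge>N. d (x i) (x j) < e) \<Longrightarrow>
          \<exists>l\<in>V. (\<lambda>n. d (x n) l) \<longlonglongrightarrow> 0"
    and cover: "V \<subseteq> (\<Union>k. F k)"
    and closed: "\<And>k x l. (\<And>n. x n \<in> F k \<inter> V) \<Longrightarrow> l \<in> V \<Longrightarrow> (\<lambda>n. d (x n) l) \<longlonglongrightarrow> 0 \<Longrightarrow> l \<in> F k"
  shows "\<exists>k. \<exists>x\<in>V. \<exists>r>0. \<forall>y\<in>V. d x y < r \<longrightarrow> y \<in> F k"
proof -
  have False if no: "\<And>k x r. x \<in> V \<Longrightarrow> r > 0 \<Longrightarrow> \<exists>y\<in>V. d x y < r \<and> y \<notin> F k"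
  proof -
    have gap: "\<exists>r>0. \<forall>y\<in>V. d x y < r \<longrightarrow> y \<notin> F k" if x: "x \<in> V" "x \<notin> F k" for x k
    proof (rule ccontr)
      assume "\<not> ?thesis"
      then have "\<forall>n. \<exists>y\<in>V. d x y < inverse (real (Suc n)) \<and> y \<in> F k"
        by (metis inverse_positive_iff_positive of_nat_0_less_iff zero_less_Suc)
      then obtain y where y: "\<And>n. y n \<in> V" "\<And>n. d x (y n) < inverse (real (Suc n))" "\<And>n. y n \<in> F k"
        by metis
      have "(\<lambda>n. d (y n) x) \<longlonglongrightarrow> 0"
      proof (rule tendsto_sandwich[OF _ _ tendsto_const LIMSEQ_inverse_real_of_nat])
        show "eventually (\<lambda>n. d (y n) x \<le> inverse (real (Suc n))) sequentially"
          using y(2) by (simp add: sym[of _ x] less_imp_le)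
      qed (simp add: nonneg)
      then have "x \<in> F k" using y x by (intro closed[of y k x]) auto
      with x show False by blast
    qed
    define P where "P = (\<lambda>(n::nat) (q::'a \<times> real). fst q \<in> V \<and> snd q > 0 \<and> snd q \<le> (1/2)^n \<and>
        (\<forall>y\<in>V. d (fst q) y < snd q \<longrightarrow> y \<notin> F n))"
    \<comment> \<open>Every use of the quasi-triangle inequality costs a factor \<open>K\<close>.
      The divisor 4 K^2 absorbs it: a first step below r n / (4 K^2) and the bound r (Suc n) / (2 K)
      for the rest of the chain combine to r n / (2 K) again.\<close>
    define Q where "Q = (\<lambda>(n::nat) (q::'a \<times> real) (q'::'a \<times> real).
        d (fst q) (fst q') < snd q / (4 * K^2) \<and> snd q' \<le> snd q / (4 * K^2))"
    have ex: "\<exists>q. P n q \<and> d x (fst q) < r \<and> snd q \<le> r" if x: "x \<in> V" "r > 0" for x r n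
    proof -
      obtain y where y: "y \<in> V" "d x y < r" "y \<notin> F n" using no[OF x] by blast
      obtain r' where r': "r' > 0" "\<forall>z\<in>V. d y z < r' \<longrightarrow> z \<notin> F n" using gap[OF y(1,3)] by blast
      show ?thesis
        using y r' x by (intro exI[of _ "(y, min r' (min r ((1/2)^n)))"]) (auto simp: P_def)
    qed
    obtain x0 where "x0 \<in> V" using \<open>V \<noteq> {}\<close> by blast
    have "\<exists>f. \<forall>n. P n (f n) \<and> Q n (f n) (f (Suc n))"
    proof (rule dependent_nat_choice)
      show "\<exists>q. P 0 q" using ex[OF \<open>x0 \<in> V\<close>, of 1 0] by auto
      fix q n assume "P n q"
      then show "\<exists>q'. P (Suc n) q' \<and> Q n q q'"
        using ex[of "fst q" "snd q / (4 * K^2)" "Suc n"] K by (auto simp: P_def Q_def)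
    qed
    then obtain f where f: "\<And>n. P n (f n)" "\<And>n. Q n (f n) (f (Suc n))" by blast
    define x where "x = (\<lambda>n. fst (f n))"
    define r where "r = (\<lambda>n. snd (f n))"
    have xV: "x n \<in> V" and r0: "r n > 0" and rle: "r n \<le> (1/2)^n" for n
      using f(1)[of n] by (auto simp: P_def x_def r_def)
    have miss: "y \<notin> F n" if "y \<in> V" "d (x n) y < r n" for y n
      using f(1)[of n] that by (auto simp: P_def x_def r_def)
    have step: "d (x n) (x (Suc n)) < r n / (4 * K^2)" "r (Suc n) \<le> r n / (4 * K^2)" for n
      using f(2)[of n] by (auto simp: Q_def x_def r_def)
    have step': "r (Suc n) \<le> r n / (2 * K)" for n
    proof -
      have "2 * K \<le> 4 * K^2" using K mult_mono[of 1 K 1 K] by (simp add: power2_eq_square)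
      then have "r n / (4 * K^2) \<le> r n / (2 * K)"
        using r0[of n] K by (intro divide_left_mono) auto
      then show ?thesis using step(2)[of n] by linarith
    qed
    have chain: "d (x n) (x (n + j)) \<le> r n / (2 * K)" for n j
    proof (induction j arbitrary: n)
      case 0
      then show ?case using refl[OF xV[of n]] r0[of n] K by simp
    next
      case (Suc j)
      have "d (x n) (x (n + Suc j)) \<le> K * (d (x n) (x (Suc n)) + d (x (Suc n)) (x (n + Suc j)))"
        by (intro tri xV)
      also have "\<dots> \<le> K * (r n / (4 * K^2) + r (Suc n) / (2 * K))"
        using step(1)[of n] Suc.IH[of "Suc n"] K by (intro mult_left_mono add_mono) auto
      also have "\<dots> = r n / (4 * K) + r (Suc n) / 2"
        using K by (simp add: field_simps power2_eq_square)
      also have "\<dots> \<le> r n / (4 * K) + (r n / (2 * K)) / 2"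
        using step'[of n] by (intro add_left_mono divide_right_mono) auto
      also have "\<dots> = r n / (2 * K)" by simp
      finally show ?case .
    qed
    have "\<exists>l\<in>V. (\<lambda>n. d (x n) l) \<longlonglongrightarrow> 0"
    proof (rule complete[OF xV])
      fix e :: real assume e: "e > 0"
      obtain N where N: "(1/2::real)^N < e" using real_arch_pow_inv[of e "1/2"] e by auto
      have "d (x i) (x j) < e" if ij: "i \<ge> N" "j \<ge> N" for i j
      proof -
        have "d (x i) (x j) \<le> K * (d (x N) (x i) + d (x N) (x j))"
          using tri[OF xV[of i] xV[of N] xV[of j]] by (simp add: sym[of "x i" "x N"])
        also have "\<dots> \<le> K * (r N / (2 * K) + r N / (2 * K))"
          using chain[of N "i - N"] chain[of N "j - N"] ij K by (intro mult_left_mono add_mono) auto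
        also have "\<dots> = r N" using K by simp
        also have "\<dots> \<le> (1/2)^N" by (rule rle)
        also have "\<dots> < e" by (rule N)
        finally show ?thesis .
      qed
      then show "\<exists>N. \<forall>i\<ge>N. \<forall>j\<ge>N. d (x i) (x j) < e" by blast
    qed
    then obtain l where l: "l \<in> V" "(\<lambda>n. d (x n) l) \<longlonglongrightarrow> 0" by blast
    have "l \<notin> F n" for n
    proof (rule miss[OF l(1)])
      have "eventually (\<lambda>j. d (x j) l < r n / (2*K)) sequentially"
        using l(2) r0[of n] K by (intro order_tendstoD) auto
      then obtain N where N: "\<And>j. j \<ge> N \<Longrightarrow> d (x j) l < r n / (2*K)"
        by (auto simp: eventually_sequentially)
      have "d (x n) l \<le> K * (d (x n) (x (n + N)) + d (x (n + N)) l)" by (intro tri xV l)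
      also have "\<dots> < K * (r n / (2*K) + r n / (2*K))"
        using chain[of n N] N[of "n + N"] K by (intro mult_strict_left_mono add_le_less_mono) auto
      also have "\<dots> = r n" using K by simp
      finally show "d (x n) l < r n" .
    qed
    then show False using cover l(1) by blast
  qed
  then show ?thesis by blast
qed


text \<open>The Banach-Steinhaus theorem, obtained from the Baire lemma with the metric and K = 1.
  It serves to bound a semigroup near time 0, where each single orbit is bounded by
  continuity.\<close>

lemma uniform_boundedness:
  fixes A :: "nat \<Rightarrow> 'a::{real_normed_vector,complete_space} \<Rightarrow> 'b::real_normed_vector"
  assumes A: "\<And>n. bounded_linear (A n)" and ptw: "\<And>x. \<exists>C. \<forall>n. norm (A n x) \<le> C"
  obtains K where "\<And>n x. norm (A n x) \<le> K * norm x"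
proof -
  define F where "F = (\<lambda>k::nat. {x. \<forall>n. norm (A n x) \<le> real k})"
  have cover: "UNIV \<subseteq> (\<Union>k. F k)"
  proof
    fix x
    obtain C where C: "\<forall>n. norm (A n x) \<le> C" using ptw by blast
    obtain k where "C \<le> real k" using real_arch_simple by blast
    then have "x \<in> F k" using C unfolding F_def by (auto intro: order.trans)
    then show "x \<in> (\<Union>k. F k)" by blast
  qed
  have cl: "l \<in> F k" if x: "\<And>n. x n \<in> F k \<inter> UNIV" and l: "(\<lambda>n. dist (x n) l) \<longlonglongrightarrow> 0" for k x l
  proof -
    have "x \<longlonglongrightarrow> l" using l tendsto_dist_iff by blast
    have "norm (A n l) \<le> real k" for n
    proof (rule LIMSEQ_le_const2)
      show "(\<lambda>j. norm (A n (x j))) \<longlonglongrightarrow> norm (A n l)"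
        by (intro tendsto_norm bounded_linear.tendsto[OF A] \<open>x \<longlonglongrightarrow> l\<close>)
      show "\<exists>N. \<forall>j\<ge>N. norm (A n (x j)) \<le> real k" using x unfolding F_def by auto
    qed
    then show ?thesis by (simp add: F_def)
  qed
  have compl: "\<exists>l\<in>UNIV. (\<lambda>n. dist (x n) l) \<longlonglongrightarrow> 0"
    if "\<And>e. e > 0 \<Longrightarrow> \<exists>N. \<forall>i\<ge>N. \<forall>j\<ge>N. dist (x i) (x j) < e" for x :: "nat \<Rightarrow> 'a"
  proof -
    have "Cauchy x" using that by (auto intro!: metric_CauchyI)
    then obtain l where "x \<longlonglongrightarrow> l" by (auto simp: Cauchy_convergent_iff convergent_def)
    then show ?thesis using tendsto_dist_iff by blast
  qed
  have "\<exists>k. \<exists>x\<in>UNIV. \<exists>r>0. \<forall>y\<in>UNIV. dist x y < r \<longrightarrow> y \<in> F k"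
  proof (rule quasi_metric_Baire[where K = 1])
    fix x y z :: 'a
    show "dist x z \<le> 1 * (dist x y + dist y z)" by (simp add: dist_triangle)
  next
    fix x :: "nat \<Rightarrow> 'a"
    assume "\<And>e. 0 < e \<Longrightarrow> \<exists>N. \<forall>i\<ge>N. \<forall>j\<ge>N. dist (x i) (x j) < e"
    then show "\<exists>l\<in>UNIV. (\<lambda>n. dist (x n) l) \<longlonglongrightarrow> 0" by (rule compl)
  next
    fix k x l
    assume "\<And>n. x n \<in> F k \<inter> UNIV" "(\<lambda>n. dist (x n) l) \<longlonglongrightarrow> 0"
    then show "l \<in> F k" by (rule cl)
  qed (use cover in \<open>auto simp: dist_commute\<close>)
  then obtain k x r where r: "r > 0" and ball: "\<And>y. dist x y < r \<Longrightarrow> y \<in> F k"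
    by blast
  have bound: "norm (A n y) \<le> 2 * real k" if y: "norm y < r" for n y
  proof -
    interpret bounded_linear "A n" by (rule A)
    have "norm (A n (x + y)) \<le> k" "norm (A n x) \<le> k"
      using ball[of "x + y"] ball[of x] y r by (auto simp: F_def dist_norm)
    then show ?thesis using norm_triangle_ineq4[of "A n (x + y)" "A n x"] by (simp add: add)
  qed
  have "norm (A n y) \<le> (4 * real k / r) * norm y" for n y
  proof (cases "y = 0")
    case True
    then show ?thesis using linear_0[OF bounded_linear.linear[OF A]] by simp
  next
    case False
    interpret bounded_linear "A n" by (rule A)
    have "norm ((r / (2 * norm y)) *\<^sub>R y) < r" using False r by simp
    from bound[OF this, of n] show ?thesis using False r by (simp add: scaleR field_simps)
  qed
  then show ?thesis using that by blast
qed

section \<open>Sublinear functionals and the Hahn-Banach theorem\<close>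

text \<open>Homogeneity is an inequality for positive scalars only, which passes easily to infima.
  Equality, also for the scalar 0, is recovered in \<open>sublinear_on_scale\<close>.\<close>

definition sublinear_on :: "'a::real_vector set \<Rightarrow> ('a \<Rightarrow> real) \<Rightarrow> bool" where
  "sublinear_on Z q \<longleftrightarrow> (\<forall>x\<in>Z. \<forall>y\<in>Z. q (x + y) \<le> q x + q y) \<and>
     (\<forall>c>0. \<forall>x\<in>Z. q (c *\<^sub>R x) \<le> c * q x)"

lemma sublinear_on_scale:
  assumes Z: "subspace Z" and q: "sublinear_on Z q" and x: "x \<in> Z" and c: "c \<ge> 0"
  shows "q (c *\<^sub>R x) = c * q x"
proof (cases "c = 0")
  case True
  \<comment> \<open>The factor 2 forces q 0 >= 0 and the factor 1/2 forces q 0 <= 0.\<close>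
  have "q 0 \<le> 2 * q 0" "q 0 \<le> (1/2) * q 0"
    using q subspace_0[OF Z] unfolding sublinear_on_def
    by (metis scaleR_zero_right zero_less_numeral, metis half_gt_zero_iff scaleR_zero_right zero_less_one)
  then show ?thesis using True by simp
next
  case False
  have *: "q (b *\<^sub>R y) \<le> b * q y" if "b > 0" "y \<in> Z" for b y
    using q that unfolding sublinear_on_def by blast
  have "q ((1/c) *\<^sub>R (c *\<^sub>R x)) \<le> (1/c) * q (c *\<^sub>R x)"
    using c False subspace_scale[OF Z x, of c] by (intro *) auto
  then have "c * q x \<le> q (c *\<^sub>R x)" using c False by (simp add: field_simps)
  moreover have "q (c *\<^sub>R x) \<le> c * q x" using q c False x unfolding sublinear_on_def by simp
  ultimately show ?thesis by simp
qed

lemma sublinear_on_lower: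
  assumes Z: "subspace Z" and q: "sublinear_on Z q" and x: "x \<in> Z"
  shows "- q (- x) \<le> q x"
proof -
  have "q (x + (- x)) \<le> q x + q (- x)"
    using q x subspace_neg[OF Z x] unfolding sublinear_on_def by blast
  moreover have "q 0 = 0" using sublinear_on_scale[OF Z q x, of 0] by simp
  ultimately show ?thesis by simp
qed

text \<open>The new functional is the infimum of q (x + t y) - t q y over t >= 0, which is bounded
  below by - q (- x). For a minimal \<open>q\<close> it equals \<open>q\<close>, and then t = 1 in
  the last conclusion gives superadditivity. The value 0 outside \<open>Z\<close> fixes each
  functional on the whole type, so that the pointwise order used with Zorn's lemma can range over
  all arguments.\<close>

lemma sublinear_on_directional_lowering:
  assumes Z: "subspace Z" and q: "sublinear_on Z q" and y: "y \<in> Z"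
  obtains q' where "sublinear_on Z q'" "\<And>x. x \<in> Z \<Longrightarrow> q' x \<le> q x" "\<And>x. x \<notin> Z \<Longrightarrow> q' x = 0"
    "\<And>x t. x \<in> Z \<Longrightarrow> t \<ge> 0 \<Longrightarrow> q' x \<le> q (x + t *\<^sub>R y) - t * q y"
proof -
  define g where "g = (\<lambda>x t. q (x + t *\<^sub>R y) - t * q y)"
  define q' where "q' = (\<lambda>x. if x \<in> Z then INF t\<in>{0..}. g x t else 0)"
  have mem: "x + t *\<^sub>R y \<in> Z" if "x \<in> Z" for x t
    using that y Z by (intro subspace_add subspace_scale)
  have low: "- q (- x) \<le> g x t" if x: "x \<in> Z" and t: "t \<ge> 0" for x t
  proof -
    have "q ((x + t *\<^sub>R y) + (- x)) \<le> q (x + t *\<^sub>R y) + q (- x)"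
      using q mem[OF x] subspace_neg[OF Z x] unfolding sublinear_on_def by blast
    then show ?thesis using sublinear_on_scale[OF Z q y t] by (simp add: g_def)
  qed
  have bdd: "bdd_below (g x ` {0..})" if "x \<in> Z" for x
    using low[OF that] by (intro bdd_belowI2[of _ "- q (- x)"]) auto
  have upper: "q' x \<le> g x t" if "x \<in> Z" "t \<ge> 0" for x t
    unfolding q'_def using that bdd by (auto intro!: cINF_lower)
  have greatest: "m \<le> q' x" if "x \<in> Z" "\<And>t. t \<ge> 0 \<Longrightarrow> m \<le> g x t" for x m
    unfolding q'_def using that by (auto intro!: cINF_greatest)
  have "sublinear_on Z q'"
    unfolding sublinear_on_def
  proof (intro conjI ballI allI impI)
    fix x x' assume x: "x \<in> Z" "x' \<in> Z"
    have "q' (x + x') \<le> g x t + g x' t'" if t: "t \<ge> 0" "t' \<ge> 0" for t t'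
    proof -
      have "q' (x + x') \<le> g (x + x') (t + t')"
        using x t by (intro upper subspace_add Z) auto
      also have "q ((x + t *\<^sub>R y) + (x' + t' *\<^sub>R y)) \<le> q (x + t *\<^sub>R y) + q (x' + t' *\<^sub>R y)"
        using q mem[OF x(1), of t] mem[OF x(2), of t'] unfolding sublinear_on_def by blast
      then have "g (x + x') (t + t') \<le> g x t + g x' t'"
        unfolding g_def by (simp add: algebra_simps)
      finally show ?thesis .
    qed
    then have "q' (x + x') - g x t \<le> q' x'" if "t \<ge> 0" for t
      using that by (intro greatest x) (simp add: diff_le_eq add.commute)
    then have "q' (x + x') - q' x' \<le> q' x"
      by (intro greatest x) (auto simp: algebra_simps)
    then show "q' (x + x') \<le> q' x + q' x'" by simp
  next
    fix c :: real and x assume c: "c > 0" and x: "x \<in> Z"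
    have "q' (c *\<^sub>R x) / c \<le> g x t" if t: "t \<ge> 0" for t
    proof -
      have "q' (c *\<^sub>R x) \<le> g (c *\<^sub>R x) (c * t)"
        using x t c by (intro upper subspace_scale Z) auto
      also have "\<dots> = c * g x t"
        using sublinear_on_scale[OF Z q mem[OF x, of t], of c] c by (simp add: g_def algebra_simps)
      finally show ?thesis using c by (simp add: field_simps)
    qed
    then have "q' (c *\<^sub>R x) / c \<le> q' x" by (intro greatest x)
    then show "q' (c *\<^sub>R x) \<le> c * q' x" using c by (simp add: field_simps)
  qed
  moreover have "q' x \<le> q x" if "x \<in> Z" for x
    using upper[OF that, of 0] by (simp add: g_def)
  moreover have "q' x = 0" if "x \<notin> Z" for x using that by (simp add: q'_def)
  ultimately show ?thesis using that upper by (simp add: g_def)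
qed

text \<open>A minimal sublinear functional below \<open>p\<close> is linear: lowering it in a direction \<open>y\<close>
  changes nothing, so it is superadditive.\<close>

lemma Hahn_Banach_dominated:
  fixes p :: "'a::real_vector \<Rightarrow> real"
  assumes Z: "subspace Z" and p: "sublinear_on Z p" and a: "a \<in> Z"
  obtains \<xi> where "\<And>x y. x \<in> Z \<Longrightarrow> y \<in> Z \<Longrightarrow> \<xi> (x + y) = \<xi> x + \<xi> y"
    "\<And>c x. x \<in> Z \<Longrightarrow> \<xi> (c *\<^sub>R x) = c * \<xi> x"
    "\<And>x. x \<in> Z \<Longrightarrow> \<xi> x \<le> p x" "\<xi> a = p a"
proof -
  \<comment> \<open>Lowering \<open>p\<close> in the direction \<open>a\<close> beforehand gives pa
    (- a) <= - p a. This forces the value p a at \<open>a\<close> for every linear functional below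
    \<open>pa\<close>.\<close>
  obtain pa where pa: "sublinear_on Z pa" "\<And>x. x \<in> Z \<Longrightarrow> pa x \<le> p x" "\<And>x. x \<notin> Z \<Longrightarrow> pa x = 0"
    "\<And>x t. x \<in> Z \<Longrightarrow> t \<ge> 0 \<Longrightarrow> pa x \<le> p (x + t *\<^sub>R a) - t * p a"
    using sublinear_on_directional_lowering[OF Z p a] by blast
  define A where "A = {q. sublinear_on Z q \<and> (\<forall>x. q x \<le> pa x) \<and> (\<forall>x. x \<notin> Z \<longrightarrow> q x = 0)}"
  \<comment> \<open>Zorn's lemma for the reversed pointwise order. The bound of a nonempty chain is
    its pointwise infimum.\<close>
  have "\<exists>m\<in>A. \<forall>q\<in>A. (\<forall>x. q x \<le> m x) \<longrightarrow> q = m"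
  proof (rule predicate_Zorn)
    show "partial_order_on A (relation_of (\<lambda>q q'. \<forall>x. q' x \<le> q x) A)"
      by (rule partial_order_on_relation_ofI) (auto simp: fun_eq_iff intro: order.trans antisym)
    fix C assume C: "C \<in> Chains (relation_of (\<lambda>q q'. \<forall>x. q' x \<le> q x) A)"
    then have CA: "C \<subseteq> A" using Chains_relation_of by blast
    have chain: "(\<forall>x. q x \<le> q' x) \<or> (\<forall>x. q' x \<le> q x)" if "q \<in> C" "q' \<in> C" for q q'
      using C that by (auto simp: Chains_def relation_of_def)
    show "\<exists>u\<in>A. \<forall>q\<in>C. \<forall>x. u x \<le> q x"
    proof (cases "C = {}")
      case True
      then show ?thesis using pa by (intro bexI[of _ pa]) (auto simp: A_def)
    next
      case False
      define u where "u = (\<lambda>x. INF q\<in>C. q x)"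
      have bdd: "bdd_below ((\<lambda>q. q x) ` C)" for x
      proof (cases "x \<in> Z")
        case True
        have "- pa (- x) \<le> q x" if "q \<in> C" for q
        proof -
          have qA: "q \<in> A" using that CA by blast
          then have "- q (- x) \<le> q x" using sublinear_on_lower[OF Z _ True] by (auto simp: A_def)
          moreover have "q (- x) \<le> pa (- x)" using qA by (auto simp: A_def)
          ultimately show ?thesis by linarith
        qed
        then show ?thesis by (intro bdd_belowI2)
      next
        case False
        then have "0 \<le> q x" if "q \<in> C" for q using that CA by (auto simp: A_def)
        then show ?thesis by (intro bdd_belowI2)
      qed
      have upper: "u x \<le> q x" if "q \<in> C" for q x
        unfolding u_def using that bdd by (intro cINF_lower) auto
      have greatest: "m \<le> u x" if "\<And>q. q \<in> C \<Longrightarrow> m \<le> q x" for m x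
        unfolding u_def using that False by (intro cINF_greatest) auto
      have "sublinear_on Z u"
        unfolding sublinear_on_def
      proof (intro conjI ballI allI impI)
        fix x y assume xy: "x \<in> Z" "y \<in> Z"
        \<comment> \<open>The smaller of two members of the chain lies below both summands at once,
          so the infimum over the chain stays subadditive.\<close>
        have st: "u (x + y) \<le> q x + q' y" if q: "q \<in> C" "q' \<in> C" for q q'
        proof -
          obtain r where r: "r \<in> C" "r x \<le> q x" "r y \<le> q' y" using chain[OF q] q by blast
          have "u (x + y) \<le> r (x + y)" by (rule upper[OF r(1)])
          also have "\<dots> \<le> r x + r y" using r(1) CA xy by (auto simp: A_def sublinear_on_def)
          finally show ?thesis using r by linarith
        qed
        have "u (x + y) - q x \<le> u y" if q: "q \<in> C" for q
        proof (rule greatest)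
          show "u (x + y) - q x \<le> q' y" if "q' \<in> C" for q'
            using st[OF q that] by simp
        qed
        then have "u (x + y) - u y \<le> u x"
          by (intro greatest) (auto simp: algebra_simps)
        then show "u (x + y) \<le> u x + u y" by simp
      next
        fix c :: real and x assume c: "c > 0" and x: "x \<in> Z"
        have "u (c *\<^sub>R x) / c \<le> q x" if q: "q \<in> C" for q
        proof -
          have "u (c *\<^sub>R x) \<le> q (c *\<^sub>R x)" by (rule upper[OF q])
          also have "\<dots> \<le> c * q x" using q CA x c by (auto simp: A_def sublinear_on_def)
          finally show ?thesis using c by (simp add: field_simps)
        qed
        then have "u (c *\<^sub>R x) / c \<le> u x" by (rule greatest)
        then show "u (c *\<^sub>R x) \<le> c * u x" using c by (simp add: field_simps)
      qed
      moreover have "u x \<le> pa x" for x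
      proof -
        obtain q where "q \<in> C" using False by blast
        then have "q x \<le> pa x" using CA by (auto simp: A_def)
        then show ?thesis using upper[OF \<open>q \<in> C\<close>, of x] by linarith
      qed
      moreover have "u x = 0" if "x \<notin> Z" for x
      proof -
        have "q x = 0" if "q \<in> C" for q using that CA \<open>x \<notin> Z\<close> by (auto simp: A_def)
        then have "(\<lambda>q. q x) ` C = {0}" using \<open>C \<noteq> {}\<close> by force
        then show ?thesis by (simp add: u_def)
      qed
      ultimately have "u \<in> A" by (simp add: A_def)
      then show ?thesis using upper by blast
    qed
  qed
  then obtain m where m: "m \<in> A" and min: "\<And>q. q \<in> A \<Longrightarrow> (\<And>x. q x \<le> m x) \<Longrightarrow> q = m"
    by blast
  have ms: "sublinear_on Z m" and mle: "\<And>x. m x \<le> pa x" and m0: "\<And>x. x \<notin> Z \<Longrightarrow> m x = 0"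
    using m by (auto simp: A_def)
  have super: "m x + m y \<le> m (x + y)" if x: "x \<in> Z" and y: "y \<in> Z" for x y
  proof -
    obtain q' where q': "sublinear_on Z q'" "\<And>x. x \<in> Z \<Longrightarrow> q' x \<le> m x" "\<And>x. x \<notin> Z \<Longrightarrow> q' x = 0"
      "\<And>x t. x \<in> Z \<Longrightarrow> t \<ge> 0 \<Longrightarrow> q' x \<le> m (x + t *\<^sub>R y) - t * m y"
      using sublinear_on_directional_lowering[OF Z ms y] by blast
    have le: "q' x \<le> m x" for x using q'(2)[of x] q'(3)[of x] m0[of x] by (cases "x \<in> Z") auto
    then have "q' x \<le> pa x" for x using mle[of x] order.trans by blast
    then have "q' \<in> A" using q' by (auto simp: A_def)
    then have "q' = m" using le by (rule min)
    then show ?thesis using q'(4)[OF x, of 1] by simp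
  qed
  have add: "m (x + y) = m x + m y" if "x \<in> Z" "y \<in> Z" for x y
    using super[OF that] ms that by (auto simp: sublinear_on_def intro: antisym)
  have neg: "m (- x) = - m x" if x: "x \<in> Z" for x
    using add[OF x subspace_neg[OF Z x]] sublinear_on_scale[OF Z ms x, of 0] by simp
  have scale: "m (c *\<^sub>R x) = c * m x" if x: "x \<in> Z" for c x
  proof (cases "c \<ge> 0")
    case True
    then show ?thesis by (rule sublinear_on_scale[OF Z ms x])
  next
    case False
    then have "m ((-c) *\<^sub>R x) = (-c) * m x" by (intro sublinear_on_scale[OF Z ms x]) auto
    then show ?thesis using neg[OF subspace_scale[OF Z x, of c]] by simp
  qed
  have le: "m x \<le> p x" if "x \<in> Z" for x using mle[of x] pa(2)[OF that] by linarith
  have "m (- a) \<le> p (- a + 1 *\<^sub>R a) - 1 * p a"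
    using mle[of "- a"] pa(4)[OF subspace_neg[OF Z a], of 1] by linarith
  moreover have "p 0 = 0" using sublinear_on_scale[OF Z p a, of 0] by simp
  ultimately have "m a = p a" using neg[OF a] le[OF a] by simp
  with add scale le show ?thesis using that by blast
qed

section \<open>Strongly measurable functions\<close>

lemma strongly_measurable_compose2:
  assumes u: "strongly_measurable M u" and v: "strongly_measurable M v"
    and h: "\<And>f g a b. f \<longlonglongrightarrow> a \<Longrightarrow> g \<longlonglongrightarrow> b \<Longrightarrow> (\<lambda>n. h (f n) (g n)) \<longlonglongrightarrow> h a b"
  shows "strongly_measurable M (\<lambda>x. h (u x) (v x))"
proof -
  obtain s where s: "\<And>n. simple_function M (s n)" "AE x in M. (\<lambda>n. s n x) \<longlonglongrightarrow> u x"
    using u unfolding strongly_measurable_def by blast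
  obtain r where r: "\<And>n. simple_function M (r n)" "AE x in M. (\<lambda>n. r n x) \<longlonglongrightarrow> v x"
    using v unfolding strongly_measurable_def by blast
  show ?thesis
    unfolding strongly_measurable_def
  proof (intro exI conjI allI)
    show "simple_function M (\<lambda>x. h (s n x) (r n x))" for n
      using s(1) r(1) by (rule simple_function_compose2)
    show "AE x in M. (\<lambda>n. h (s n x) (r n x)) \<longlonglongrightarrow> h (u x) (v x)"
      using s(2) r(2) by eventually_elim (rule h)
  qed
qed

lemma strongly_measurable_const [simp]: "strongly_measurable M (\<lambda>x. c)"
  unfolding strongly_measurable_def by (intro exI[of _ "\<lambda>n x. c"]) auto

lemma strongly_measurable_add:
  fixes u v :: "'a \<Rightarrow> 'b::real_normed_vector"
  shows "strongly_measurable M u \<Longrightarrow> strongly_measurable M v \<Longrightarrow> strongly_measurable M (\<lambda>x. u x + v x)"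
  by (rule strongly_measurable_compose2) (auto intro: tendsto_add)

lemma strongly_measurable_diff:
  fixes u v :: "'a \<Rightarrow> 'b::real_normed_vector"
  shows "strongly_measurable M u \<Longrightarrow> strongly_measurable M v \<Longrightarrow> strongly_measurable M (\<lambda>x. u x - v x)"
  by (rule strongly_measurable_compose2) (auto intro: tendsto_diff)

lemma strongly_measurable_scaleR:
  fixes v :: "'a \<Rightarrow> 'b::real_normed_vector"
  shows "strongly_measurable M u \<Longrightarrow> strongly_measurable M v \<Longrightarrow> strongly_measurable M (\<lambda>x. u x *\<^sub>R v x)"
  by (rule strongly_measurable_compose2) (auto intro: tendsto_scaleR)

lemma strongly_measurable_borel:
  fixes f :: "'a \<Rightarrow> real"
  assumes "f \<in> borel_measurable M"
  shows "strongly_measurable M f"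
proof -
  obtain F where "\<forall>i. simple_function M (F i)" "\<forall>x\<in>space M. (\<lambda>i. F i x) \<longlonglongrightarrow> f x"
    using borel_measurable_implies_sequence_metric[OF assms, of 0] by blast
  then show ?thesis unfolding strongly_measurable_def by (intro exI[of _ F]) auto
qed

lemma strongly_measurable_cong_AE:
  assumes u: "strongly_measurable M u" and uv: "AE x in M. u x = v x"
  shows "strongly_measurable M v"
proof -
  obtain s where s: "\<And>n. simple_function M (s n)" "AE x in M. (\<lambda>n. s n x) \<longlonglongrightarrow> u x"
    using u unfolding strongly_measurable_def by blast
  have "AE x in M. (\<lambda>n. s n x) \<longlonglongrightarrow> v x"
    using s(2) uv by eventually_elim simp
  then show ?thesis using s(1) unfolding strongly_measurable_def by blast
qed

text \<open>Completeness of Lebesgue measure enters here: the simple functions converge only off a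
  null set, and the arbitrary values on that set must not spoil measurability.\<close>

lemma borel_measurable_strongly:
  fixes f :: "real \<Rightarrow> real"
  assumes "strongly_measurable lebesgue f"
  shows "f \<in> borel_measurable lebesgue"
proof -
  obtain s where s: "\<And>n. simple_function lebesgue (s n)" "AE x in lebesgue. (\<lambda>n. s n x) \<longlonglongrightarrow> f x"
    using assms unfolding strongly_measurable_def by blast
  obtain N where N: "N \<in> null_sets lebesgue" "\<And>x. x \<notin> N \<Longrightarrow> (\<lambda>n. s n x) \<longlonglongrightarrow> f x"
    using s(2) unfolding completion.AE_iff_null_sets by auto
  have [measurable]: "s n \<in> borel_measurable lebesgue" for n
    using s(1) by (rule borel_measurable_simple_function)
  have [measurable]: "N \<in> sets lebesgue" using N(1) by auto
  have "(\<lambda>x. if x \<in> N then 0 else f x) \<in> borel_measurable lebesgue"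
  proof (rule borel_measurable_LIMSEQ_real)
    show "(\<lambda>x. if x \<in> N then 0 else s n x) \<in> borel_measurable lebesgue" for n
      by measurable
    show "(\<lambda>n. if x \<in> N then 0 else s n x) \<longlonglongrightarrow> (if x \<in> N then 0 else f x)" for x
      using N(2) by auto
  qed
  moreover have "AE x in lebesgue. (if x \<in> N then 0 else f x) = f x"
    using AE_not_in[OF N(1)] by eventually_elim simp
  ultimately show ?thesis by (rule borel_measurable_AE)
qed

lemma borel_measurable_norm_strongly [measurable_dest]:
  fixes u :: "real \<Rightarrow> 'u::real_normed_vector"
  assumes "strongly_measurable lebesgue u"
  shows "(\<lambda>t. norm (u t)) \<in> borel_measurable lebesgue"
  by (rule borel_measurable_strongly, rule strongly_measurable_compose2[OF assms assms])
    (auto intro: tendsto_norm)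

lemma borel_measurable_inner_strongly:
  fixes u v :: "real \<Rightarrow> 'u::real_inner"
  assumes "strongly_measurable lebesgue u" "strongly_measurable lebesgue v"
  shows "(\<lambda>t. u t \<bullet> v t) \<in> borel_measurable lebesgue"
  by (rule borel_measurable_strongly, rule strongly_measurable_compose2[OF assms])
    (auto intro: tendsto_inner)

lemma strongly_measurable_cut:
  fixes u :: "real \<Rightarrow> 'u::real_normed_vector"
  assumes "strongly_measurable lebesgue u" and A: "A \<in> sets lebesgue"
  shows "strongly_measurable lebesgue (\<lambda>t. if t \<in> A then u t else 0)"
proof -
  have "strongly_measurable lebesgue (\<lambda>t. indicator A t *\<^sub>R u t)"
    using A by (intro strongly_measurable_scaleR strongly_measurable_borel assms(1)) auto
  then show ?thesis
    by (rule strongly_measurable_cong_AE) (auto simp: indicator_def)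
qed

text \<open>A function on a subset is traded for its extension by 0, so that the arguments below can
  be carried out with one measure on the whole line.\<close>

lemma strongly_measurable_lebesgue_on:
  fixes u :: "real \<Rightarrow> 'u::real_normed_vector"
  assumes A: "A \<in> sets lebesgue"
  shows "strongly_measurable (lebesgue_on A) u \<longleftrightarrow>
    strongly_measurable lebesgue (\<lambda>t. if t \<in> A then u t else 0)"
proof
  assume "strongly_measurable (lebesgue_on A) u"
  then obtain s where s: "\<And>n. simple_function (lebesgue_on A) (s n)"
      "AE x in lebesgue_on A. (\<lambda>n. s n x) \<longlonglongrightarrow> u x"
    unfolding strongly_measurable_def by blast
  show "strongly_measurable lebesgue (\<lambda>t. if t \<in> A then u t else 0)"
    unfolding strongly_measurable_def
  proof (intro exI conjI allI)
    show "simple_function lebesgue (\<lambda>x. indicator A x *\<^sub>R s n x)" for n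
      using s(1)[of n] A by (subst (asm) simple_function_restrict_space) auto
    have "AE x in lebesgue. x \<in> A \<longrightarrow> (\<lambda>n. s n x) \<longlonglongrightarrow> u x"
      using s(2) A by (subst (asm) AE_restrict_space_iff) auto
    then show "AE x in lebesgue. (\<lambda>n. indicator A x *\<^sub>R s n x) \<longlonglongrightarrow> (if x \<in> A then u x else 0)"
      by eventually_elim auto
  qed
next
  assume "strongly_measurable lebesgue (\<lambda>t. if t \<in> A then u t else 0)"
  then obtain s where s: "\<And>n. simple_function lebesgue (s n)"
      "AE x in lebesgue. (\<lambda>n. s n x) \<longlonglongrightarrow> (if x \<in> A then u x else 0)"
    unfolding strongly_measurable_def by blast
  show "strongly_measurable (lebesgue_on A) u"
    unfolding strongly_measurable_def
  proof (intro exI conjI allI)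
    show "simple_function (lebesgue_on A) (s n)" for n
    proof (subst simple_function_restrict_space)
      have "simple_function lebesgue (\<lambda>x. if x \<in> A then s n x else 0)"
        using s(1) A by (intro simple_function_If_set) auto
      moreover have "(\<lambda>x. if x \<in> A then s n x else 0) = (\<lambda>x. indicator A x *\<^sub>R s n x)"
        by (auto simp: indicator_def)
      ultimately show "simple_function lebesgue (\<lambda>x. indicator A x *\<^sub>R s n x)" by simp
    qed (use A in auto)
    have "AE x in lebesgue. x \<in> A \<longrightarrow> (\<lambda>n. s n x) \<longlonglongrightarrow> u x"
      using s(2) by eventually_elim auto
    then show "AE x in lebesgue_on A. (\<lambda>n. s n x) \<longlonglongrightarrow> u x"
      using A by (subst AE_restrict_space_iff) auto
  qed
qed

lemma AE_lebesgue_shift: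
  fixes P :: "real \<Rightarrow> bool"
  assumes "AE t in lebesgue. P t"
  shows "AE t in lebesgue. P (t - c)"
proof -
  have "AE t in lborel. P t" using assms by (simp add: AE_completion_iff)
  then obtain N where N: "N \<in> null_sets lborel" "{t. \<not> P t} \<subseteq> N"
    unfolding eventually_ae_filter by auto
  have "AE t in lborel. P (t - c)"
    by (rule AE_I'[OF null_sets_translation[OF N(1), of c]]) (use N(2) in auto)
  then show ?thesis by (rule AE_completion)
qed

lemma measurable_shift: "(\<lambda>t::real. t - c) \<in> lebesgue \<rightarrow>\<^sub>M lebesgue"
  using lebesgue_affine_measurable[of "\<lambda>_. 1" "-c"] by (simp add: algebra_simps)

lemma strongly_measurable_shift:
  fixes u :: "real \<Rightarrow> 'u::real_normed_vector"
  assumes "strongly_measurable lebesgue u"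
  shows "strongly_measurable lebesgue (\<lambda>t. u (t - c))"
proof -
  obtain s where s: "\<And>n. simple_function lebesgue (s n)" "AE x in lebesgue. (\<lambda>n. s n x) \<longlonglongrightarrow> u x"
    using assms unfolding strongly_measurable_def by blast
  show ?thesis
    unfolding strongly_measurable_def
  proof (intro exI conjI allI)
    show "simple_function lebesgue (\<lambda>t. s n (t - c))" for n
    proof -
      have *: "s n -` B \<inter> space lebesgue \<in> sets lebesgue" if "finite B" for B
        using simple_functionD(2)[OF s(1)] .
      have "finite ((\<lambda>t. s n (t - c)) ` UNIV)"
        by (rule finite_subset[OF _ simple_functionD(1)[OF s(1), of n]]) auto
      moreover have "(\<lambda>t. s n (t - c)) -` {x} \<inter> space lebesgue \<in> sets lebesgue" for x
      proof -
        have "(\<lambda>t. t - c) -` (s n -` {x}) \<inter> space lebesgue \<in> sets lebesgue"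
          using simple_functionD(2)[OF s(1), of n "{x}"]
          by (intro measurable_sets[OF measurable_shift]) auto
        then show ?thesis by (simp add: vimage_def)
      qed
      ultimately show ?thesis unfolding simple_function_def by auto
    qed
    show "AE t in lebesgue. (\<lambda>n. s n (t - c)) \<longlonglongrightarrow> u (t - c)"
      by (rule AE_lebesgue_shift[OF s(2)])
  qed
qed

section \<open>Vector-valued Lebesgue spaces\<close>

definition Lp :: "real \<Rightarrow> (real \<Rightarrow> 'u::real_normed_vector) \<Rightarrow> bool" where
  "Lp p u \<longleftrightarrow> strongly_measurable lebesgue u \<and> integrable lebesgue (\<lambda>t. norm (u t) powr p)"

text \<open>The p-th power of the L^p norm, without the root. It is an integral and so linear in its
  integrand, at the price of a triangle inequality with the constant 2 powr p.\<close>

definition np :: "real \<Rightarrow> (real \<Rightarrow> 'u::real_normed_vector) \<Rightarrow> real" where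
  "np p u = (\<integral>t. norm (u t) powr p \<partial>lebesgue)"

lemma np_nonneg [simp]: "0 \<le> np p u"
  unfolding np_def by (rule integral_nonneg_AE) auto

lemma np_zero [simp]: "np p (\<lambda>t. 0) = 0"
  by (simp add: np_def)

lemma Lp_zero [simp]: "Lp p (\<lambda>t. 0)"
  by (simp add: Lp_def)

lemma np_minus_commute: "np p (\<lambda>t. u t - v t) = np p (\<lambda>t. v t - u t)"
  by (simp add: np_def norm_minus_commute)

lemma Lp_meas: "Lp p u \<Longrightarrow> strongly_measurable lebesgue u"
  by (simp add: Lp_def)

lemma powr_norm_add_le:
  fixes a b :: "'u::real_normed_vector"
  assumes "p \<ge> 0"
  shows "norm (a + b) powr p \<le> 2 powr p * (norm a powr p + norm b powr p)"
proof -
  let ?m = "max (norm a) (norm b)"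
  have "norm (a + b) \<le> 2 * ?m" using norm_triangle_ineq[of a b] by linarith
  then have "norm (a + b) powr p \<le> (2 * ?m) powr p" using assms by (intro powr_mono2) auto
  also have "\<dots> = 2 powr p * ?m powr p" by (simp add: powr_mult)
  also have "?m powr p \<le> norm a powr p + norm b powr p" by (auto simp: max_def)
  finally show ?thesis by simp
qed

lemma Lp_dominated:
  fixes v :: "real \<Rightarrow> 'u::real_normed_vector"
  assumes v: "strongly_measurable lebesgue v" and g: "integrable lebesgue g"
    and le: "AE t in lebesgue. norm (v t) powr p \<le> g t"
  shows "Lp p v"
proof -
  have [measurable]: "(\<lambda>t. norm (v t)) \<in> borel_measurable lebesgue"
    by (rule borel_measurable_norm_strongly[OF v])
  have "integrable lebesgue (\<lambda>t. norm (v t) powr p)"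
  proof (rule Bochner_Integration.integrable_bound[OF g])
    show "(\<lambda>t. norm (v t) powr p) \<in> borel_measurable lebesgue" by measurable
    show "AE t in lebesgue. norm (norm (v t) powr p) \<le> norm (g t)"
      using le by eventually_elim auto
  qed
  then show ?thesis using v by (simp add: Lp_def)
qed

lemma np_mono:
  assumes "Lp p u" "integrable lebesgue g" "AE t in lebesgue. norm (u t) powr p \<le> g t"
  shows "np p u \<le> (\<integral>t. g t \<partial>lebesgue)"
  unfolding np_def using assms by (intro integral_mono_AE) (auto simp: Lp_def)

lemma
  fixes u v :: "real \<Rightarrow> 'u::real_normed_vector"
  assumes p: "p \<ge> 0" and u: "Lp p u" and v: "Lp p v"
  shows Lp_add: "Lp p (\<lambda>t. u t + v t)"
    and np_add_le: "np p (\<lambda>t. u t + v t) \<le> 2 powr p * (np p u + np p v)"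
proof -
  let ?g = "\<lambda>t. 2 powr p * (norm (u t) powr p + norm (v t) powr p)"
  have g: "integrable lebesgue ?g" using u v by (auto simp: Lp_def)
  have le: "AE t in lebesgue. norm (u t + v t) powr p \<le> ?g t" using powr_norm_add_le[OF p] by auto
  show L: "Lp p (\<lambda>t. u t + v t)"
    using u v by (intro Lp_dominated[OF _ g le] strongly_measurable_add) (auto simp: Lp_def)
  show "np p (\<lambda>t. u t + v t) \<le> 2 powr p * (np p u + np p v)"
    using np_mono[OF L g le] u v by (simp add: Lp_def np_def)
qed

lemma
  fixes u :: "real \<Rightarrow> 'u::real_normed_vector"
  assumes u: "Lp p u"
  shows Lp_scaleR: "Lp p (\<lambda>t. c *\<^sub>R u t)"
    and np_scaleR: "np p (\<lambda>t. c *\<^sub>R u t) = \<bar>c\<bar> powr p * np p u"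
  using u by (auto simp: Lp_def np_def powr_mult intro!: strongly_measurable_scaleR)

lemma Lp_diff:
  fixes u v :: "real \<Rightarrow> 'u::real_normed_vector"
  assumes p: "p \<ge> 0" and u: "Lp p u" and v: "Lp p v"
  shows "Lp p (\<lambda>t. u t - v t)"
  using Lp_add[OF p u Lp_scaleR[OF v, of "-1"]] by simp

lemma np_triangle:
  fixes u v w :: "real \<Rightarrow> 'u::real_normed_vector"
  assumes p: "p \<ge> 0" and "Lp p u" "Lp p v" "Lp p w"
  shows "np p (\<lambda>t. u t - w t) \<le> 2 powr p * (np p (\<lambda>t. u t - v t) + np p (\<lambda>t. v t - w t))"
  using np_add_le[OF p Lp_diff[OF p assms(2,3)] Lp_diff[OF p assms(3,4)]] by simp

lemma Lp_cut:
  fixes u :: "real \<Rightarrow> 'u::real_normed_vector"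
  assumes u: "Lp p u" and A: "A \<in> sets lebesgue"
  shows "Lp p (\<lambda>t. if t \<in> A then u t else 0)"
  using u by (intro Lp_dominated[of _ "\<lambda>t. norm (u t) powr p"] strongly_measurable_cut A) (auto simp: Lp_def)

lemma Lp_bounded:
  fixes u :: "real \<Rightarrow> 'u::real_normed_vector"
  assumes u: "strongly_measurable lebesgue u" and M: "\<And>t. norm (u t) \<le> M" and p: "p \<ge> 0"
    and supp: "\<And>t. t \<notin> {a<..<b} \<Longrightarrow> u t = 0" and ab: "a \<le> b"
  shows "Lp p u" and "np p u \<le> M powr p * (b - a)"
proof -
  let ?g = "\<lambda>t. M powr p * indicator {a<..<b} t"
  have "integrable lebesgue (indicat_real {a<..<b})" by (rule integrable_real_indicator) (use ab in auto)
  then have g: "integrable lebesgue ?g" by simp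
  have le: "AE t in lebesgue. norm (u t) powr p \<le> ?g t"
    using M p supp by (auto simp: indicator_def intro!: powr_mono2)
  show L: "Lp p u" by (rule Lp_dominated[OF u g le])
  show "np p u \<le> M powr p * (b - a)"
    using np_mono[OF L g le] ab by simp
qed

lemma Lp_shift:
  fixes u :: "real \<Rightarrow> 'u::real_normed_vector"
  assumes "Lp p u"
  shows "Lp p (\<lambda>t. u (t - c))"
  using assms lebesgue_integrable_real_affine[of "\<lambda>t. norm (u t) powr p" 1 "-c"]
  by (simp add: Lp_def strongly_measurable_shift)

text \<open>Weighted by 2 powr (p k), the integrals still have a finite sum. Hence almost everywhere
  the weighted p-th powers are bounded by their finite sum \<open>S\<close>, and |v k t| <= S^(1/p)
  2^(-k) is summable.\<close>

lemma AE_summable_of_np: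
  fixes v :: "nat \<Rightarrow> real \<Rightarrow> 'u::real_normed_vector"
  assumes p: "p > 0" and v: "\<And>k. Lp p (v k)" and C: "\<And>k. np p (v k) \<le> C * (1/2)^k / 2 powr (p * real k)"
  shows "AE t in lebesgue. summable (\<lambda>k. norm (v k t))"
proof -
  define g where "g = (\<lambda>k t. ennreal (2 powr (p * real k) * norm (v k t) powr p))"
  have [measurable]: "(\<lambda>t. norm (v k t)) \<in> borel_measurable lebesgue" for k
    using v[of k] by (intro borel_measurable_norm_strongly) (auto simp: Lp_def)
  have C0: "C \<ge> 0" using order.trans[OF np_nonneg C[of 0]] by simp
  have gk: "(\<integral>\<^sup>+ t. g k t \<partial>lebesgue) \<le> ennreal (C * (1/2)^k)" for k
  proof -
    have "(\<integral>\<^sup>+ t. g k t \<partial>lebesgue) = ennreal (\<integral>t. 2 powr (p * real k) * norm (v k t) powr p \<partial>lebesgue)"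
      unfolding g_def using v[of k] by (intro nn_integral_eq_integral) (auto simp: Lp_def)
    also have "(\<integral>t. 2 powr (p * real k) * norm (v k t) powr p \<partial>lebesgue) = 2 powr (p * real k) * np p (v k)"
      by (simp add: np_def)
    also have "\<dots> \<le> 2 powr (p * real k) * (C * (1/2)^k / 2 powr (p * real k))"
      by (intro mult_left_mono C) auto
    also have "\<dots> = C * (1/2)^k" by simp
    finally show ?thesis by (simp add: ennreal_leI)
  qed
  have "(\<integral>\<^sup>+ t. (\<Sum>k. g k t) \<partial>lebesgue) = (\<Sum>k. \<integral>\<^sup>+ t. g k t \<partial>lebesgue)"
    by (rule nn_integral_suminf) (simp add: g_def)
  also have "\<dots> \<le> (\<Sum>k. ennreal (C * (1/2)^k))"
    by (intro suminf_le gk) auto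
  also have "\<dots> = ennreal (\<Sum>k. C * (1/2)^k)"
    using C0 by (intro suminf_ennreal2) (auto intro!: summable_mult summable_geometric)
  finally have fin: "(\<integral>\<^sup>+ t. (\<Sum>k. g k t) \<partial>lebesgue) \<noteq> \<infinity>"
    by (auto simp: top_unique)
  have "AE t in lebesgue. (\<Sum>k. g k t) \<noteq> \<infinity>"
    by (rule nn_integral_PInf_AE[OF _ fin]) (simp add: g_def)
  then show ?thesis
  proof eventually_elim
    fix t assume t: "(\<Sum>k. g k t) \<noteq> \<infinity>"
    define S where "S = enn2real (\<Sum>k. g k t)"
    have S: "ennreal S = (\<Sum>k. g k t)" using t by (simp add: S_def less_top)
    have "2 powr (p * real k) * norm (v k t) powr p \<le> S" for k
    proof -
      have "g k t \<le> (\<Sum>k. g k t)" using sum_le_suminf[of "\<lambda>k. g k t" "{k}"] by simp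
      then have "ennreal (2 powr (p * real k) * norm (v k t) powr p) \<le> ennreal S"
        unfolding S by (simp add: g_def)
      then show ?thesis by (subst (asm) ennreal_le_iff) (auto simp: S_def)
    qed
    then have *: "(2 powr real k * norm (v k t)) powr p \<le> S" for k
      by (simp add: powr_mult powr_powr mult.commute)
    have bd: "norm (v k t) \<le> S powr (1/p) * (1/2)^k" for k
    proof -
      have "((2 powr real k * norm (v k t)) powr p) powr (1/p) \<le> S powr (1/p)"
        using *[of k] p by (intro powr_mono2) auto
      then have "2 powr real k * norm (v k t) \<le> S powr (1/p)"
        using p by (simp add: powr_powr)
      then show ?thesis by (simp add: powr_realpow power_one_over field_simps)
    qed
    have "summable (\<lambda>k. S powr (1/p) * (1/2::real)^k)"
      by (intro summable_mult summable_geometric) simp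
    then show "summable (\<lambda>k. norm (v k t))"
      by (rule summable_comparison_test'[where N = 0]) (simp add: bd)
  qed
qed

section \<open>Simple approximation and completeness of L^p\<close>

text \<open>Values of norm above 2 |u t| are replaced by 0. Eventually this changes nothing where u
  t is nonzero, it supplies the dominating function, and it makes the approximants vanish wherever
  \<open>u\<close> does.\<close>

lemma Lp_simple_approximation:
  fixes u :: "real \<Rightarrow> 'u::real_normed_vector"
  assumes p: "p \<ge> 0" "p \<noteq> 0" and u: "Lp p u" and e: "e > 0"
  obtains s where "simple_function lebesgue s" "Lp p s" "np p (\<lambda>t. u t - s t) < e" "\<And>t. norm (s t) \<le> 2 * norm (u t)"
proof -
  obtain r where r: "\<And>n. simple_function lebesgue (r n)" "AE x in lebesgue. (\<lambda>n. r n x) \<longlonglongrightarrow> u x"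
    using u unfolding strongly_measurable_def Lp_def by blast
  define s where "s = (\<lambda>n t. if norm (r n t) \<le> 2 * norm (u t) then r n t else 0)"
  have um: "strongly_measurable lebesgue u" using u by (simp add: Lp_def)
  have rm: "strongly_measurable lebesgue (r n)" for n
    unfolding strongly_measurable_def by (intro exI[of _ "\<lambda>_. r n"]) (auto simp: r)
  have [measurable]: "(\<lambda>t. norm (u t)) \<in> borel_measurable lebesgue" "(\<lambda>t. norm (r n t)) \<in> borel_measurable lebesgue" for n
    using um rm borel_measurable_norm_strongly by blast+
  have ss: "simple_function lebesgue (s n)" for n
  proof -
    have "{t \<in> space lebesgue. norm (r n t) \<le> 2 * norm (u t)} \<in> sets lebesgue" by measurable
    then show ?thesis unfolding s_def by (intro simple_function_If[OF r(1)]) auto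
  qed
  have sm: "strongly_measurable lebesgue (s n)" for n
    unfolding strongly_measurable_def by (intro exI[of _ "\<lambda>_. s n"]) (auto simp: ss)
  have lim: "AE x in lebesgue. (\<lambda>n. s n x) \<longlonglongrightarrow> u x"
    using r(2)
  proof eventually_elim
    fix x assume x: "(\<lambda>n. r n x) \<longlonglongrightarrow> u x"
    show "(\<lambda>n. s n x) \<longlonglongrightarrow> u x"
    proof (cases "u x = 0")
      case True
      then have "s n x = 0" for n by (simp add: s_def)
      then show ?thesis using True by simp
    next
      case False
      then have "eventually (\<lambda>n. norm (r n x) < 2 * norm (u x)) sequentially"
        using tendsto_norm[OF x] by (intro order_tendstoD(2)) auto
      then have "eventually (\<lambda>n. r n x = s n x) sequentially"
        by eventually_elim (simp add: s_def)
      then show ?thesis using x tendsto_cong by fast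
    qed
  qed
  have bound: "norm (s n t) \<le> 2 * norm (u t)" for n t by (simp add: s_def)
  have ui: "integrable lebesgue (\<lambda>t. 3 powr p * norm (u t) powr p)" using u by (simp add: Lp_def)
  have "norm (s n t) powr p \<le> 3 powr p * norm (u t) powr p" for n t
  proof -
    have "norm (s n t) \<le> 3 * norm (u t)"
      using bound[of n t] norm_ge_zero[of "u t"] by linarith
    then have "norm (s n t) powr p \<le> (3 * norm (u t)) powr p"
      using p by (intro powr_mono2) auto
    then show ?thesis by (simp add: powr_mult)
  qed
  then have sL: "Lp p (s n)" for n by (intro Lp_dominated[OF sm ui]) auto
  have dm: "strongly_measurable lebesgue (\<lambda>t. u t - s n t)" for n by (intro strongly_measurable_diff um sm)
  have [measurable]: "(\<lambda>t. norm (u t - s n t)) \<in> borel_measurable lebesgue" for n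
    by (rule borel_measurable_norm_strongly[OF dm])
  have "(\<lambda>n. \<integral>t. norm (u t - s n t) powr p \<partial>lebesgue) \<longlonglongrightarrow> (\<integral>t. 0 \<partial>(lebesgue::real measure))"
  proof (rule integral_dominated_convergence[OF _ _ ui])
    show "AE t in lebesgue. (\<lambda>n. norm (u t - s n t) powr p) \<longlonglongrightarrow> 0"
      using lim
    proof eventually_elim
      fix t assume t: "(\<lambda>n. s n t) \<longlonglongrightarrow> u t"
      have "(\<lambda>n. norm (u t - s n t)) \<longlonglongrightarrow> norm (u t - u t)" by (intro tendsto_intros t)
      then have "(\<lambda>n. norm (u t - s n t) powr p) \<longlonglongrightarrow> norm (u t - u t) powr p"
        using p by (intro tendsto_powr') auto
      then show "(\<lambda>n. norm (u t - s n t) powr p) \<longlonglongrightarrow> 0" using p by simp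
    qed
    show "AE t in lebesgue. norm (norm (u t - s n t) powr p) \<le> 3 powr p * norm (u t) powr p" for n
    proof (rule AE_I2)
      fix t
      have "norm (u t - s n t) \<le> 3 * norm (u t)"
        using bound[of n t] norm_triangle_ineq4[of "u t" "s n t"] by linarith
      then have "norm (u t - s n t) powr p \<le> (3 * norm (u t)) powr p"
        using p by (intro powr_mono2) auto
      then show "norm (norm (u t - s n t) powr p) \<le> 3 powr p * norm (u t) powr p"
        by (simp add: powr_mult)
    qed
  qed auto
  then have "(\<lambda>n. np p (\<lambda>t. u t - s n t)) \<longlonglongrightarrow> 0" by (simp add: np_def)
  then have "eventually (\<lambda>n. np p (\<lambda>t. u t - s n t) < e) sequentially"
    using e by (intro order_tendstoD) auto
  then obtain n where "np p (\<lambda>t. u t - s n t) < e" by (auto simp: eventually_sequentially)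
  then show ?thesis using that[of "s n"] ss sL bound by blast
qed

text \<open>Strong measurability of the limit asks for simple functions that converge to it.
  Therefore each member of a fast subsequence is first approximated by a simple function
  \<open>s k\<close>, and the differences of these are summed. The a.e. convergent subsequence in
  the conclusion is what later lets pointwise bounds survive the limit.\<close>

lemma Lp_complete:
  fixes u :: "nat \<Rightarrow> real \<Rightarrow> 'u::{real_normed_vector,complete_space}"
  assumes p: "p > 0" and u: "\<And>n. Lp p (u n)"
    and cauchy: "\<And>e. e > 0 \<Longrightarrow> \<exists>N. \<forall>i\<ge>N. \<forall>j\<ge>N. np p (\<lambda>t. u i t - u j t) < e"
  obtains l r where "Lp p l" "(\<lambda>n. np p (\<lambda>t. u n t - l t)) \<longlonglongrightarrow> 0" "strict_mono (r :: nat \<Rightarrow> nat)"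
    "AE t in lebesgue. (\<lambda>k. u (r k) t) \<longlonglongrightarrow> l t"
proof -
  \<comment> \<open>The geometric factor divided by 2 powr (p k) is the rate that
    \<open>AE_summable_of_np\<close> asks for. As it decreases, the estimate with index k + 1 may be
    quoted with index k.\<close>
  define \<delta> where "\<delta> = (\<lambda>k::nat. (1/2::real)^k / 2 powr (p * real k))"
  have \<delta>0: "\<delta> k > 0" for k by (simp add: \<delta>_def)
  have \<delta>dec: "\<delta> (Suc k) \<le> \<delta> k" for k
    unfolding \<delta>_def using p by (intro frac_le power_decreasing powr_mono mult_left_mono) auto
  obtain R where R: "\<And>k i j. i \<ge> R k \<Longrightarrow> j \<ge> R k \<Longrightarrow> np p (\<lambda>t. u i t - u j t) < \<delta> k"
    using cauchy[OF \<delta>0] by metis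
  define r where "r = rec_nat (R 0) (\<lambda>k n. max (Suc n) (R (Suc k)))"
  have r_Suc: "r (Suc k) = max (Suc (r k)) (R (Suc k))" for k by (simp add: r_def)
  have rmono: "strict_mono r" by (rule strict_monoI_Suc) (simp add: r_Suc)
  have rR: "r k \<ge> R k" for k by (cases k) (auto simp: r_Suc, simp add: r_def)
  have "\<exists>s. simple_function lebesgue s \<and> Lp p s \<and> np p (\<lambda>t. u (r k) t - s t) < \<delta> k" for k
    using Lp_simple_approximation[of p "u (r k)" "\<delta> k"] p u \<delta>0 by (metis less_eq_real_def less_irrefl)
  then obtain s where s: "\<And>k. simple_function lebesgue (s k)" "\<And>k. Lp p (s k)"
    "\<And>k. np p (\<lambda>t. u (r k) t - s k t) < \<delta> k" by metis
  have p0: "p \<ge> 0" using p by simp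
  have B1: "np p (\<lambda>t. u (r k) t - s k t) \<le> 1 * (1/2)^k / 2 powr (p * real k)" for k
    using s(3)[of k] by (simp add: \<delta>_def)
  have B2: "np p (\<lambda>t. s (Suc k) t - s k t) \<le> (3 * 2 powr p * 2 powr p) * (1/2)^k / 2 powr (p * real k)" for k
  proof -
    have "np p (\<lambda>t. s (Suc k) t - s k t) \<le> 2 powr p * (np p (\<lambda>t. s (Suc k) t - u (r (Suc k)) t) + np p (\<lambda>t. u (r (Suc k)) t - s k t))"
      by (intro np_triangle p0 s u)
    also have "np p (\<lambda>t. u (r (Suc k)) t - s k t) \<le> 2 powr p * (np p (\<lambda>t. u (r (Suc k)) t - u (r k) t) + np p (\<lambda>t. u (r k) t - s k t))"
      by (intro np_triangle p0 s u)
    also have "np p (\<lambda>t. u (r (Suc k)) t - u (r k) t) \<le> \<delta> k"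
    proof -
      have "r (Suc k) \<ge> r k" using rmono by (simp add: strict_mono_less_eq)
      then have "r (Suc k) \<ge> R k" using rR[of k] by linarith
      then show ?thesis using R[OF _ rR[of k]] by (simp add: less_imp_le)
    qed
    also have "np p (\<lambda>t. u (r k) t - s k t) \<le> \<delta> k" using s(3)[of k] by simp
    also have "np p (\<lambda>t. s (Suc k) t - u (r (Suc k)) t) \<le> 2 powr p * \<delta> k"
    proof -
      have "np p (\<lambda>t. s (Suc k) t - u (r (Suc k)) t) \<le> 1 * \<delta> k"
        using s(3)[of "Suc k"] \<delta>dec[of k] by (subst np_minus_commute) simp
      also have "\<dots> \<le> 2 powr p * \<delta> k"
        using p \<delta>0[of k] by (intro mult_right_mono) (auto intro: ge_one_powr_ge_zero)
      finally show ?thesis .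
    qed
    finally show ?thesis by (simp add: \<delta>_def algebra_simps)
  qed
  have A1: "AE t in lebesgue. summable (\<lambda>k. norm (u (r k) t - s k t))"
    by (rule AE_summable_of_np[OF p _ B1]) (intro Lp_diff p0 u s)
  have A2: "AE t in lebesgue. summable (\<lambda>k. norm (s (Suc k) t - s k t))"
    by (rule AE_summable_of_np[OF p _ B2]) (intro Lp_diff p0 u s)
  define l where "l = (\<lambda>t. lim (\<lambda>k. s k t))"
  have A3: "AE t in lebesgue. (\<lambda>k. s k t) \<longlonglongrightarrow> l t"
    using A2
  proof eventually_elim
    fix t assume sm: "summable (\<lambda>k. norm (s (Suc k) t - s k t))"
    have "Cauchy (\<lambda>n. s n t)"
    proof (rule metric_CauchyI)
      fix e :: real assume "e > 0"
      then obtain N where N: "\<And>m n. m \<ge> N \<Longrightarrow> norm (\<Sum>k\<in>{m..<n}. norm (s (Suc k) t - s k t)) < e"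
        using sm unfolding summable_Cauchy by blast
      have half: "dist (s m t) (s n t) < e" if "N \<le> m" "m \<le> n" for m n
      proof -
        have "norm (s n t - s m t) = norm (\<Sum>k\<in>{m..<n}. s (Suc k) t - s k t)"
          using that by (subst sum_Suc_diff') auto
        also have "\<dots> \<le> (\<Sum>k\<in>{m..<n}. norm (s (Suc k) t - s k t))" by (rule norm_sum)
        also have "\<dots> < e" using N[OF that(1), of n] by simp
        finally show ?thesis by (simp add: dist_norm norm_minus_commute)
      qed
      show "\<exists>M. \<forall>m\<ge>M. \<forall>n\<ge>M. dist (s m t) (s n t) < e"
        using half by (metis dist_commute linear)
    qed
    then show "(\<lambda>k. s k t) \<longlonglongrightarrow> l t"
      unfolding l_def using Cauchy_convergent_iff convergent_LIMSEQ_iff by blast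
  qed
  have lm: "strongly_measurable lebesgue l"
    unfolding strongly_measurable_def using s(1) A3 by blast
  have A4: "AE t in lebesgue. (\<lambda>k. u (r k) t) \<longlonglongrightarrow> l t"
    using A1 A3
  proof eventually_elim
    fix t assume "summable (\<lambda>k. norm (u (r k) t - s k t))" and sl: "(\<lambda>k. s k t) \<longlonglongrightarrow> l t"
    then have "(\<lambda>k. norm (u (r k) t - s k t)) \<longlonglongrightarrow> 0"
      by (intro summable_LIMSEQ_zero)
    then have "(\<lambda>k. u (r k) t - s k t) \<longlonglongrightarrow> 0" by (rule tendsto_norm_zero_cancel)
    from tendsto_add[OF this sl] show "(\<lambda>k. u (r k) t) \<longlonglongrightarrow> l t" by simp
  qed
  \<comment> \<open>Fatou's lemma along the a.e. convergent subsequence carries the Cauchy estimate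
    for u i - u j over to u i - l.\<close>
  have fatou: "Lp p (\<lambda>t. u i t - l t) \<and> np p (\<lambda>t. u i t - l t) \<le> e"
    if e: "e > 0" and i: "\<And>j. j \<ge> N \<Longrightarrow> np p (\<lambda>t. u i t - u j t) \<le> e" for i e N
  proof -
    have um: "strongly_measurable lebesgue (u n)" for n using u by (simp add: Lp_def)
    have [measurable]: "(\<lambda>t. norm (u i t - l t)) \<in> borel_measurable lebesgue"
      "(\<lambda>t. norm (u i t - u j t)) \<in> borel_measurable lebesgue" for j
      by (intro borel_measurable_norm_strongly strongly_measurable_diff um lm)+
    have "(\<integral>\<^sup>+ t. ennreal (norm (u i t - l t) powr p) \<partial>lebesgue) =
       (\<integral>\<^sup>+ t. liminf (\<lambda>k. ennreal (norm (u i t - u (r k) t) powr p)) \<partial>lebesgue)"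
    proof (rule nn_integral_cong_AE)
      show "AE t in lebesgue. ennreal (norm (u i t - l t) powr p) = liminf (\<lambda>k. ennreal (norm (u i t - u (r k) t) powr p))"
        using A4
      proof eventually_elim
        fix t assume t: "(\<lambda>k. u (r k) t) \<longlonglongrightarrow> l t"
        have "(\<lambda>k. norm (u i t - u (r k) t)) \<longlonglongrightarrow> norm (u i t - l t)" by (intro tendsto_intros t)
        then have "(\<lambda>k. norm (u i t - u (r k) t) powr p) \<longlonglongrightarrow> norm (u i t - l t) powr p"
          using p by (intro tendsto_powr') auto
        then have "(\<lambda>k. ennreal (norm (u i t - u (r k) t) powr p)) \<longlonglongrightarrow> ennreal (norm (u i t - l t) powr p)"
          by (rule tendsto_ennrealI)
        then show "ennreal (norm (u i t - l t) powr p) = liminf (\<lambda>k. ennreal (norm (u i t - u (r k) t) powr p))"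
          by (intro lim_imp_Liminf[symmetric]) auto
      qed
    qed
    also have "\<dots> \<le> liminf (\<lambda>k. \<integral>\<^sup>+ t. ennreal (norm (u i t - u (r k) t) powr p) \<partial>lebesgue)"
      by (rule nn_integral_liminf) measurable
    also have "\<dots> \<le> limsup (\<lambda>k. \<integral>\<^sup>+ t. ennreal (norm (u i t - u (r k) t) powr p) \<partial>lebesgue)"
      by (rule Liminf_le_Limsup) simp
    also have "\<dots> \<le> ennreal e"
    proof (rule Limsup_bounded)
      have "(\<integral>\<^sup>+ t. ennreal (norm (u i t - u (r k) t) powr p) \<partial>lebesgue) \<le> ennreal e" if "k \<ge> N" for k
      proof -
        have "r k \<ge> N" using strict_mono_imp_increasing[OF rmono, of k] that by linarith
        have "(\<integral>\<^sup>+ t. ennreal (norm (u i t - u (r k) t) powr p) \<partial>lebesgue) = ennreal (np p (\<lambda>t. u i t - u (r k) t))"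
          unfolding np_def using Lp_diff[OF p0 u u, of i "r k"] by (intro nn_integral_eq_integral) (auto simp: Lp_def)
        then show ?thesis using i[OF \<open>r k \<ge> N\<close>] by (simp add: ennreal_leI)
      qed
      then show "eventually (\<lambda>k. (\<integral>\<^sup>+ t. ennreal (norm (u i t - u (r k) t) powr p) \<partial>lebesgue) \<le> ennreal e) sequentially"
        by (auto simp: eventually_sequentially)
    qed
    finally have le: "(\<integral>\<^sup>+ t. ennreal (norm (u i t - l t) powr p) \<partial>lebesgue) \<le> ennreal e" .
    have "integrable lebesgue (\<lambda>t. norm (u i t - l t) powr p)"
      by (rule integrableI_bounded) (use le_less_trans[OF le ennreal_less_top] in auto)
    moreover have "np p (\<lambda>t. u i t - l t) \<le> e"
    proof -
      have "ennreal (np p (\<lambda>t. u i t - l t)) = (\<integral>\<^sup>+ t. ennreal (norm (u i t - l t) powr p) \<partial>lebesgue)"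
        unfolding np_def using calculation by (intro nn_integral_eq_integral[symmetric]) auto
      then have "ennreal (np p (\<lambda>t. u i t - l t)) \<le> ennreal e" using le by (simp only:)
      then show ?thesis using e by (subst (asm) ennreal_le_iff) auto
    qed
    ultimately show ?thesis using strongly_measurable_diff[OF um lm] by (simp add: Lp_def)
  qed
  have tail: "\<exists>N. \<forall>i\<ge>N. Lp p (\<lambda>t. u i t - l t) \<and> np p (\<lambda>t. u i t - l t) \<le> e" if e: "e > 0" for e
  proof -
    obtain N where N: "\<forall>i\<ge>N. \<forall>j\<ge>N. np p (\<lambda>t. u i t - u j t) < e" using cauchy[OF e] by blast
    have "Lp p (\<lambda>t. u i t - l t) \<and> np p (\<lambda>t. u i t - l t) \<le> e" if i: "i \<ge> N" for i
    proof (rule fatou[OF e])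
      show "np p (\<lambda>t. u i t - u j t) \<le> e" if "N \<le> j" for j
        using N i that by (simp add: less_imp_le)
    qed
    then show ?thesis by blast
  qed
  obtain N where "Lp p (\<lambda>t. u N t - l t)" using tail[of 1] by auto
  then have "Lp p (\<lambda>t. u N t - (u N t - l t))" by (rule Lp_diff[OF p0 u])
  then have lL: "Lp p l" by simp
  have "(\<lambda>n. np p (\<lambda>t. u n t - l t)) \<longlonglongrightarrow> 0"
  proof (rule LIMSEQ_I)
    fix e :: real assume "e > 0"
    then obtain N where N: "\<forall>i\<ge>N. np p (\<lambda>t. u i t - l t) \<le> e/2" using tail[of "e/2"] by auto
    have "norm (np p (\<lambda>t. u n t - l t) - 0) < e" if "n \<ge> N" for n
    proof -
      have "np p (\<lambda>t. u n t - l t) \<le> e/2" using N that by blast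
      then show ?thesis using \<open>e > 0\<close> by simp
    qed
    then show "\<exists>N. \<forall>n\<ge>N. norm (np p (\<lambda>t. u n t - l t) - 0) < e" by blast
  qed
  with lL rmono A4 show ?thesis using that by blast
qed

section \<open>Uniform convexity and convergence of minimising sequences\<close>

lemma powr_midpoint_convex:
  fixes x y q :: real
  assumes "q \<ge> 1" "x \<ge> 0" "y \<ge> 0"
  shows "((x + y) / 2) powr q \<le> (x powr q + y powr q) / 2"
proof -
  have half: "(z / 2) powr q \<le> z powr q / 2" if "z \<ge> 0" for z :: real
  proof -
    have "(2::real) powr 1 \<le> 2 powr q" using assms(1) by (intro powr_mono) auto
    then have "z powr q / 2 powr q \<le> z powr q / 2" by (intro divide_left_mono) auto
    then show ?thesis using that by (simp add: powr_divide)
  qed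
  show ?thesis
  proof (cases "x = 0 \<or> y = 0")
    case True
    then show ?thesis using half assms by auto
  next
    case False
    then have "((1 - 1/2) *\<^sub>R x + (1/2) *\<^sub>R y) powr q \<le> (1 - 1/2) * x powr q + (1/2) * y powr q"
      using assms by (intro convex_onD[OF powr_convex[OF assms(1)]]) auto
    then show ?thesis by (simp add: add_divide_distrib)
  qed
qed

text \<open>This makes minimising sequences in \<open>L\<^sup>p\<close> converge.\<close>

lemma Clarkson_pointwise:
  fixes a b :: "'u::real_inner"
  assumes p: "p \<ge> 2"
  shows "norm ((1/2) *\<^sub>R (a + b)) powr p + norm ((1/2) *\<^sub>R (a - b)) powr p \<le> (norm a powr p + norm b powr p) / 2"
proof -
  define q where "q = p / 2"
  have q: "q \<ge> 1" using p by (simp add: q_def)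
  have pq: "norm c powr p = ((norm c)^2) powr q" for c :: 'u
  proof -
    show ?thesis
    proof (cases "c = 0")
      case False
      then have "((norm c)^2) powr q = (norm c powr 2) powr q" by (simp add: powr_numeral)
      also have "\<dots> = norm c powr p" by (simp only: powr_powr) (simp add: q_def)
      finally show ?thesis by simp
    qed (use p in simp)
  qed
  define x where "x = (norm ((1/2) *\<^sub>R (a + b)))^2"
  define y where "y = (norm ((1/2) *\<^sub>R (a - b)))^2"
  have xy: "x + y = ((norm a)^2 + (norm b)^2) / 2"
    unfolding x_def y_def power2_norm_eq_inner by (simp add: inner_simps inner_commute field_simps)
  have nn: "x \<ge> 0" "y \<ge> 0" by (simp_all add: x_def y_def)
  have one: "z powr q \<le> z * (x + y) powr (q - 1)" if "0 \<le> z" "z \<le> x + y" for z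
  proof (cases "z = 0")
    case False
    then have "z powr q = z * z powr (q - 1)" using that by (simp add: powr_mult_base)
    also have "\<dots> \<le> z * (x + y) powr (q - 1)"
      using that q by (intro mult_left_mono powr_mono2) auto
    finally show ?thesis .
  qed simp
  have "x powr q + y powr q \<le> x * (x + y) powr (q - 1) + y * (x + y) powr (q - 1)"
    using nn by (intro add_mono one) auto
  also have "\<dots> = (x + y) * (x + y) powr (q - 1)" by (simp add: algebra_simps)
  also have "\<dots> = (x + y) powr q" using nn by (cases "x + y = 0") (auto simp: powr_mult_base)
  also have "\<dots> \<le> (((norm a)^2) powr q + ((norm b)^2) powr q) / 2"
    unfolding xy using q by (intro powr_midpoint_convex) auto
  finally show ?thesis unfolding pq x_def y_def .
qed

lemma np_Clarkson:
  fixes u v :: "real \<Rightarrow> 'u::real_inner"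
  assumes p: "p \<ge> 2" and u: "Lp p u" and v: "Lp p v"
  shows "np p (\<lambda>t. (1/2) *\<^sub>R (u t + v t)) + (1 / 2 powr p) * np p (\<lambda>t. u t - v t) \<le> (np p u + np p v) / 2"
proof -
  have p0: "p \<ge> 0" using p by simp
  have L: "Lp p (\<lambda>t. (1/2) *\<^sub>R (u t + v t))" "Lp p (\<lambda>t. (1/2) *\<^sub>R (u t - v t))"
    by (intro Lp_scaleR Lp_add Lp_diff p0 u v)+
  have "np p (\<lambda>t. (1/2) *\<^sub>R (u t + v t)) + np p (\<lambda>t. (1/2) *\<^sub>R (u t - v t)) =
     (\<integral>t. norm ((1/2) *\<^sub>R (u t + v t)) powr p + norm ((1/2) *\<^sub>R (u t - v t)) powr p \<partial>lebesgue)"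
    unfolding np_def using L by (intro Bochner_Integration.integral_add[symmetric]) (auto simp: Lp_def)
  also have "\<dots> \<le> (\<integral>t. (norm (u t) powr p + norm (v t) powr p) / 2 \<partial>lebesgue)"
    using L u v Clarkson_pointwise[OF p] by (intro integral_mono) (auto simp: Lp_def)
  also have "\<dots> = (np p u + np p v) / 2" using u v by (simp add: np_def Lp_def)
  also have "np p (\<lambda>t. (1/2) *\<^sub>R (u t - v t)) = (1 / 2 powr p) * np p (\<lambda>t. u t - v t)"
    by (subst np_scaleR[OF Lp_diff[OF p0 u v]]) (simp add: powr_divide)
  finally show ?thesis .
qed

text \<open>The infima \<open>m k\<close> of \<open>J\<close> over the shrinking sets increase to a
  limit M. Two near-minimisers with indices beyond N lie in \<open>C N\<close>, hence so does their
  midpoint, whose value is at least m N. The uniform convexity \<open>mid\<close> then bounds their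
  distance by M - m N plus an error 1/(N+1), so the near-minimisers are Cauchy. For a constant
  sequence of sets the last conclusion says that the limit value is a lower bound of
  \<open>J\<close>.\<close>

lemma nested_minimisers:
  fixes C :: "nat \<Rightarrow> (real \<Rightarrow> 'u::{real_normed_vector,complete_space}) set" and J :: "(real \<Rightarrow> 'u) \<Rightarrow> real"
  assumes p: "p > 0" and c: "c > 0"
    and mid: "\<And>u v. Lp p u \<Longrightarrow> Lp p v \<Longrightarrow> J (\<lambda>t. (1/2) *\<^sub>R (u t + v t)) + c * np p (\<lambda>t. u t - v t) \<le> (J u + J v) / 2"
    and dec: "\<And>k. C (Suc k) \<subseteq> C k" and sub: "\<And>k u. u \<in> C k \<Longrightarrow> Lp p u"
    and conv: "\<And>k u v. u \<in> C k \<Longrightarrow> v \<in> C k \<Longrightarrow> (\<lambda>t. (1/2) *\<^sub>R (u t + v t)) \<in> C k"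
    and lower: "\<And>u. u \<in> C 0 \<Longrightarrow> L \<le> J u" and upper: "\<And>k. \<exists>u\<in>C k. J u \<le> K"
  obtains v l m where "\<And>k. v k \<in> C k" "Lp p l" "(\<lambda>k. np p (\<lambda>t. v k t - l t)) \<longlonglongrightarrow> 0"
    "AE t in lebesgue. (\<lambda>k. v k t) \<longlonglongrightarrow> l t" "(\<lambda>k. J (v k)) \<longlonglongrightarrow> m" "m \<le> K"
    "\<And>e. e > 0 \<Longrightarrow> \<exists>k. \<forall>u\<in>C k. m - e \<le> J u"
proof -
  have anti: "C k \<subseteq> C j" if "j \<le> k" for j k using lift_Suc_antimono_le[of C, OF dec that] .
  have lowerk: "L \<le> J u" if "u \<in> C k" for u k using lower anti[of 0 k] that by blast
  have bdd: "bdd_below (J ` C k)" for k using lowerk by (intro bdd_belowI2) auto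
  have ne: "C k \<noteq> {}" for k using upper by blast
  define m where "m = (\<lambda>k. Inf (J ` C k))"
  have m_le: "m k \<le> J u" if "u \<in> C k" for u k unfolding m_def using that bdd by (intro cINF_lower)
  have m_mono: "m j \<le> m k" if "j \<le> k" for j k
    unfolding m_def using anti[OF that] ne bdd by (intro cINF_superset_mono) auto
  have mK: "m k \<le> K" for k using upper[of k] m_le by (meson order.trans)
  have "incseq m" using m_mono by (simp add: incseq_def)
  then obtain M where M: "m \<longlonglongrightarrow> M" "\<And>k. m k \<le> M"
    using incseq_convergent[of m K] mK by blast
  have "\<exists>w\<in>C k. J w < m k + inverse (real (Suc k))" for k
  proof -
    have "Inf (J ` C k) < m k + inverse (real (Suc k))" unfolding m_def by simp
    then show ?thesis using ne bdd by (subst (asm) cINF_less_iff) auto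
  qed
  then obtain w where w: "\<And>k. w k \<in> C k" "\<And>k. J (w k) < m k + inverse (real (Suc k))" by metis
  have diff: "c * np p (\<lambda>t. w j t - w k t) \<le> (M - m N) + inverse (real (Suc N))" if jk: "N \<le> j" "N \<le> k" for j k N
  proof -
    have "w j \<in> C N" "w k \<in> C N" using w(1) anti jk by blast+
    then have A1: "m N \<le> J (\<lambda>t. (1/2) *\<^sub>R (w j t + w k t))" by (intro m_le conv)
    have A2: "J (\<lambda>t. (1/2) *\<^sub>R (w j t + w k t)) + c * np p (\<lambda>t. w j t - w k t) \<le> (J (w j) + J (w k)) / 2"
      using w(1) sub by (intro mid) auto
    have Jw: "J (w i) \<le> M + inverse (real (Suc N))" if "N \<le> i" for i
    proof -
      have "inverse (real (Suc i)) \<le> inverse (real (Suc N))" using that by (intro le_imp_inverse_le) auto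
      then show ?thesis using w(2)[of i] M(2)[of i] by linarith
    qed
    have "x \<le> (M + d) - a" if "a \<le> b" "b + x \<le> (y + z) / 2" "y \<le> M + d" "z \<le> M + d" for a b d x y z :: real
      using that by argo
    from this[OF A1 A2 Jw[OF jk(1)] Jw[OF jk(2)]] show ?thesis by simp
  qed
  have cauchy: "\<exists>N. \<forall>i\<ge>N. \<forall>j\<ge>N. np p (\<lambda>t. w i t - w j t) < e" if e: "e > 0" for e
  proof -
    have "(\<lambda>N. (M - m N) + inverse (real (Suc N))) \<longlonglongrightarrow> (M - M) + 0"
      by (intro tendsto_intros M LIMSEQ_inverse_real_of_nat)
    then have "eventually (\<lambda>N. (M - m N) + inverse (real (Suc N)) < c * e) sequentially"
      using c e by (intro order_tendstoD) auto
    then obtain N where N: "(M - m N) + inverse (real (Suc N)) < c * e" by (auto simp: eventually_sequentially)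
    have "np p (\<lambda>t. w i t - w j t) < e" if "i \<ge> N" "j \<ge> N" for i j
    proof -
      have "c * np p (\<lambda>t. w i t - w j t) < c * e" using diff[OF that] N by linarith
      then show ?thesis using c by simp
    qed
    then show ?thesis by blast
  qed
  obtain l r where l: "Lp p l" "(\<lambda>n. np p (\<lambda>t. w n t - l t)) \<longlonglongrightarrow> 0" "strict_mono r"
    "AE t in lebesgue. (\<lambda>k. w (r k) t) \<longlonglongrightarrow> l t"
    using Lp_complete[OF p _ cauchy] w(1) sub by blast
  have Jw: "(\<lambda>k. J (w k)) \<longlonglongrightarrow> M"
  proof (rule tendsto_sandwich)
    show "eventually (\<lambda>k. m k \<le> J (w k)) sequentially" using m_le w(1) by simp
    show "eventually (\<lambda>k. J (w k) \<le> m k + inverse (real (Suc k))) sequentially" using w(2) by (simp add: less_imp_le)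
    show "(\<lambda>k. m k + inverse (real (Suc k))) \<longlonglongrightarrow> M"
      using tendsto_add[OF M(1) LIMSEQ_inverse_real_of_nat] by simp
  qed (rule M)
  show ?thesis
  proof (rule that[of "\<lambda>k. w (r k)" l M])
    show "w (r k) \<in> C k" for k using w(1)[of "r k"] anti[OF strict_mono_imp_increasing[OF l(3)]] by blast
    show "(\<lambda>k. np p (\<lambda>t. w (r k) t - l t)) \<longlonglongrightarrow> 0"
      using LIMSEQ_subseq_LIMSEQ[OF l(2) l(3)] by (simp add: o_def)
    show "(\<lambda>k. J (w (r k))) \<longlonglongrightarrow> M"
      using LIMSEQ_subseq_LIMSEQ[OF Jw l(3)] by (simp add: o_def)
    show "M \<le> K" using M(1) mK by (intro LIMSEQ_le_const2) auto
    fix e :: real assume "e > 0"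
    then have "eventually (\<lambda>k. M - e < m k) sequentially" using M(1) by (intro order_tendstoD) auto
    then obtain k where "M - e < m k" by (auto simp: eventually_sequentially)
    then have "M - e \<le> J u" if "u \<in> C k" for u using m_le[OF that] by linarith
    then show "\<exists>k. \<forall>u\<in>C k. M - e \<le> J u" by blast
  qed (use l in auto)
qed

section \<open>The pairing of square integrable functions\<close>

lemma powr_2_norm: "norm x powr 2 = (norm x)^2"
  by (cases "norm x = 0") (auto simp: powr_numeral)

lemma pairing_integrable:
  fixes u v :: "real \<Rightarrow> 'u::real_inner"
  assumes u: "Lp 2 u" and v: "Lp 2 v"
  shows "integrable lebesgue (\<lambda>t. u t \<bullet> v t)"
proof (rule Bochner_Integration.integrable_bound)
  show "integrable lebesgue (\<lambda>t. norm (u t) powr 2 + norm (v t) powr 2)" using u v by (simp add: Lp_def)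
  show "(\<lambda>t. u t \<bullet> v t) \<in> borel_measurable lebesgue"
    by (intro borel_measurable_inner_strongly Lp_meas[OF u] Lp_meas[OF v])
  show "AE t in lebesgue. norm (u t \<bullet> v t) \<le> norm (norm (u t) powr 2 + norm (v t) powr 2)"
  proof (rule AE_I2)
    fix t
    have "\<bar>u t \<bullet> v t\<bar> \<le> norm (u t) * norm (v t)" by (rule Cauchy_Schwarz_ineq2)
    also have "\<dots> \<le> 2 * norm (u t) * norm (v t)" by simp
    also have "\<dots> \<le> (norm (u t))^2 + (norm (v t))^2" by (rule sum_squares_bound)
    finally show "norm (u t \<bullet> v t) \<le> norm (norm (u t) powr 2 + norm (v t) powr 2)"
      by (simp add: powr_2_norm)
  qed
qed

lemma np2_expand:
  fixes u v :: "real \<Rightarrow> 'u::real_inner"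
  assumes u: "Lp 2 u" and v: "Lp 2 v"
  shows "np 2 (\<lambda>t. u t + s *\<^sub>R v t) = np 2 u + 2 * s * (\<integral>t. u t \<bullet> v t \<partial>lebesgue) + s^2 * np 2 v"
proof -
  have i: "integrable lebesgue (\<lambda>t. (norm (u t))^2)" "integrable lebesgue (\<lambda>t. (norm (v t))^2)"
    using u v by (simp_all add: Lp_def powr_2_norm)
  have "(norm (u t + s *\<^sub>R v t))^2 = (norm (u t))^2 + 2 * s * (u t \<bullet> v t) + s^2 * (norm (v t))^2" for t
    unfolding power2_norm_eq_inner by (simp add: inner_simps inner_commute power2_eq_square algebra_simps)
  then show ?thesis
    using i pairing_integrable[OF u v] by (simp add: np_def powr_2_norm)
qed

lemma pairing_Cauchy_Schwarz:
  fixes u v :: "real \<Rightarrow> 'u::real_inner"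
  assumes u: "Lp 2 u" and v: "Lp 2 v"
  shows "(\<integral>t. u t \<bullet> v t \<partial>lebesgue)^2 \<le> np 2 u * np 2 v"
proof -
  define x where "x = (\<integral>t. u t \<bullet> v t \<partial>lebesgue)"
  have pos: "0 \<le> np 2 u + 2 * s * x + s^2 * np 2 v" for s
    using np2_expand[OF u v, of s] np_nonneg[of 2 "\<lambda>t. u t + s *\<^sub>R v t"] by (simp add: x_def)
  show ?thesis
  proof (cases "np 2 v = 0")
    case True
    have "x = 0"
    proof (rule ccontr)
      assume "x \<noteq> 0"
      then show False using pos[of "- (np 2 u + 1) / (2 * x)"] True by (simp add: field_simps)
    qed
    then show ?thesis by (simp add: x_def)
  next
    case False
    then have v0: "np 2 v > 0" using np_nonneg[of 2 v] by linarith
    have "0 \<le> np 2 u - x^2 / np 2 v"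
      using pos[of "- x / np 2 v"] v0 by (simp add: field_simps power2_eq_square)
    then show ?thesis using v0 by (simp add: x_def field_simps)
  qed
qed

lemma pairing_tendsto:
  fixes v :: "nat \<Rightarrow> real \<Rightarrow> 'u::real_inner"
  assumes v: "\<And>n. Lp 2 (v n)" and l: "Lp 2 l" and c: "Lp 2 c"
    and lim: "(\<lambda>n. np 2 (\<lambda>t. v n t - l t)) \<longlonglongrightarrow> 0"
  shows "(\<lambda>n. \<integral>t. v n t \<bullet> c t \<partial>lebesgue) \<longlonglongrightarrow> (\<integral>t. l t \<bullet> c t \<partial>lebesgue)"
proof -
  let ?d = "\<lambda>n. \<integral>t. (v n t - l t) \<bullet> c t \<partial>lebesgue"
  have d: "Lp 2 (\<lambda>t. v n t - l t)" for n by (intro Lp_diff v l) simp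
  have "(\<lambda>n. ?d n) \<longlonglongrightarrow> 0"
  proof (rule Lim_null_comparison)
    have "norm (?d n) \<le> sqrt (np 2 (\<lambda>t. v n t - l t) * np 2 c)" for n
      using real_sqrt_le_mono[OF pairing_Cauchy_Schwarz[OF d c, of n]] by simp
    then show "eventually (\<lambda>n. norm (?d n) \<le> sqrt (np 2 (\<lambda>t. v n t - l t) * np 2 c)) sequentially" by simp
    have "(\<lambda>n. sqrt (np 2 (\<lambda>t. v n t - l t) * np 2 c)) \<longlonglongrightarrow> sqrt (0 * np 2 c)"
      by (intro tendsto_intros lim)
    then show "(\<lambda>n. sqrt (np 2 (\<lambda>t. v n t - l t) * np 2 c)) \<longlonglongrightarrow> 0" by simp
  qed
  moreover have "?d n = (\<integral>t. v n t \<bullet> c t \<partial>lebesgue) - (\<integral>t. l t \<bullet> c t \<partial>lebesgue)" for n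
    using pairing_integrable[OF v c] pairing_integrable[OF l c] by (simp add: inner_diff_left)
  ultimately show ?thesis by (simp add: LIM_zero_iff)
qed

text \<open>Fatou's lemma. The constant in the triangle inequality of \<open>np\<close> would spoil
  the sharp bound, so the a.e. convergence is used.\<close>

lemma np_lower_semicontinuous:
  fixes v :: "nat \<Rightarrow> real \<Rightarrow> 'u::real_normed_vector"
  assumes p: "p > 0" and v: "\<And>k. Lp p (v k)" and l: "Lp p l"
    and ae: "AE t in lebesgue. (\<lambda>k. v k t) \<longlonglongrightarrow> l t" and lim: "(\<lambda>k. np p (v k)) \<longlonglongrightarrow> m"
  shows "np p l \<le> m"
proof -
  have [measurable]: "(\<lambda>t. norm (v k t)) \<in> borel_measurable lebesgue" for k
    by (intro borel_measurable_norm_strongly Lp_meas[OF v])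
  have eq: "ennreal (np p w) = (\<integral>\<^sup>+ t. ennreal (norm (w t) powr p) \<partial>lebesgue)" if "Lp p w" for w :: "real \<Rightarrow> 'u"
    unfolding np_def using that by (intro nn_integral_eq_integral[symmetric]) (auto simp: Lp_def)
  have "ennreal (np p l) = (\<integral>\<^sup>+ t. liminf (\<lambda>k. ennreal (norm (v k t) powr p)) \<partial>lebesgue)"
    unfolding eq[OF l]
  proof (rule nn_integral_cong_AE)
    show "AE t in lebesgue. ennreal (norm (l t) powr p) = liminf (\<lambda>k. ennreal (norm (v k t) powr p))"
      using ae
    proof eventually_elim
      fix t assume t: "(\<lambda>k. v k t) \<longlonglongrightarrow> l t"
      have "(\<lambda>k. norm (v k t) powr p) \<longlonglongrightarrow> norm (l t) powr p"
        using p by (intro tendsto_powr' tendsto_norm t) auto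
      then have "(\<lambda>k. ennreal (norm (v k t) powr p)) \<longlonglongrightarrow> ennreal (norm (l t) powr p)"
        by (rule tendsto_ennrealI)
      then show "ennreal (norm (l t) powr p) = liminf (\<lambda>k. ennreal (norm (v k t) powr p))"
        by (intro lim_imp_Liminf[symmetric]) auto
    qed
  qed
  also have "\<dots> \<le> liminf (\<lambda>k. \<integral>\<^sup>+ t. ennreal (norm (v k t) powr p) \<partial>lebesgue)"
    by (rule nn_integral_liminf) measurable
  also have "\<dots> = liminf (\<lambda>k. ennreal (np p (v k)))" by (simp add: eq[OF v])
  also have "\<dots> = ennreal m"
    by (intro lim_imp_Liminf tendsto_ennrealI lim) auto
  finally show ?thesis
    using LIMSEQ_le_const[OF lim, of 0] by (subst (asm) ennreal_le_iff) auto
qed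

section \<open>The duality map and the representation of functionals on L^p\<close>

lemma powr_tangent:
  fixes x y p :: real
  assumes p: "p \<ge> 1" and y: "y > 0" and x: "x \<ge> 0"
  shows "y powr p + p * y powr (p - 1) * (x - y) \<le> x powr p"
proof (cases "x = 0")
  case True
  \<comment> \<open>Convexity is applied on the open half-line. At its end point 0 the claim reduces
    to y^p <= p y^p.\<close>
  have "y powr (p - 1) * y = y powr p" using y using powr_mult_base[of y "p - 1"] by (simp add: mult.commute)
  then have "p * (y powr (p - 1) * y) = p * y powr p" by (simp only:)
  then have "p * y powr (p - 1) * (x - y) = - (p * y powr p)" using True by (simp add: mult.assoc)
  moreover have "1 * y powr p \<le> p * y powr p" using p by (intro mult_right_mono) auto
  moreover have "x powr p = 0" using True by simp
  ultimately show ?thesis by linarith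
next
  case False
  have "x powr p - y powr p \<ge> (p * y powr (p - 1)) * (x - y)"
  proof (rule convex_on_imp_above_tangent[where A = "{0<..}"])
    show "((\<lambda>x. x powr p) has_real_derivative p * y powr (p - 1)) (at y within {0<..})"
      using y by (auto intro!: derivative_eq_intros)
  qed (use x y False powr_convex[OF p] in \<open>auto simp: interior_open\<close>)
  then show ?thesis by simp
qed

text \<open>The gradient of |.|^p at \<open>c\<close> is p |c|^(p-2) c. The Cauchy-Schwarz
  inequality reduces the tangent inequality to the scalar one at |c|.\<close>

lemma norm_powr_tangent:
  fixes a c :: "'u::real_inner"
  assumes p: "p \<ge> 1"
  shows "norm c powr p + p * ((norm c powr (p - 2)) *\<^sub>R c \<bullet> (a - c)) \<le> norm a powr p"
proof (cases "c = 0")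
  case False
  have e: "norm c powr (p - 2) * norm c = norm c powr (p - 1)"
    using powr_mult_base[of "norm c" "p - 2"] by (simp add: mult.commute)
  have "norm c powr (p - 2) * (c \<bullet> (a - c)) \<le> norm c powr (p - 2) * (norm c * (norm a - norm c))"
  proof (rule mult_left_mono)
    have "c \<bullet> (a - c) = c \<bullet> a - (norm c)^2" by (simp add: inner_diff_right power2_norm_eq_inner)
    then show "c \<bullet> (a - c) \<le> norm c * (norm a - norm c)"
      using norm_cauchy_schwarz[of c a] by (simp add: power2_eq_square algebra_simps)
  qed simp
  also have "\<dots> = norm c powr (p - 1) * (norm a - norm c)" by (simp add: e mult.assoc[symmetric])
  finally have "p * ((norm c powr (p - 2)) *\<^sub>R c \<bullet> (a - c)) \<le> p * (norm c powr (p - 1) * (norm a - norm c))"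
    using p by (intro mult_left_mono) auto
  then show ?thesis using powr_tangent[OF p, of "norm c" "norm a"] False by (simp add: mult.assoc)
qed (use p in simp)

text \<open>The gradient of |x|^p / p, that is, the duality map of L^p without normalisation. It
  takes L^p into the conjugate space.\<close>

definition dual_map :: "real \<Rightarrow> 'u::real_normed_vector \<Rightarrow> 'u" where
  "dual_map p x = norm x powr (p - 2) *\<^sub>R x"

lemma norm_dual_map: "norm (dual_map p x) = norm x powr (p - 1)"
  by (cases "x = 0") (auto simp: dual_map_def powr_mult_base[of "norm x" "p - 2", simplified mult.commute[of "norm x"]])

lemma dual_map_tendsto:
  fixes f :: "nat \<Rightarrow> 'u::real_normed_vector"
  assumes p: "p \<ge> 2" and f: "f \<longlonglongrightarrow> x"
  shows "(\<lambda>n. dual_map p (f n)) \<longlonglongrightarrow> dual_map p x"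
proof (cases "x = 0")
  case False
  then show ?thesis unfolding dual_map_def by (intro tendsto_intros f) auto
next
  case True
  have "(\<lambda>n. norm (f n) powr (p - 1)) \<longlonglongrightarrow> norm x powr (p - 1)"
    using p by (intro tendsto_powr' tendsto_norm f) auto
  then have "(\<lambda>n. norm (dual_map p (f n))) \<longlonglongrightarrow> 0" using True p by (simp add: norm_dual_map)
  then show ?thesis using True by (simp add: tendsto_norm_zero_cancel dual_map_def)
qed

lemma strongly_measurable_dual_map:
  fixes u :: "real \<Rightarrow> 'u::real_normed_vector"
  assumes u: "strongly_measurable lebesgue u"
  shows "strongly_measurable lebesgue (\<lambda>t. dual_map p (u t))"
proof -
  have [measurable]: "(\<lambda>t. norm (u t)) \<in> borel_measurable lebesgue"
    by (rule borel_measurable_norm_strongly[OF u])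
  show ?thesis unfolding dual_map_def
    by (intro strongly_measurable_scaleR u strongly_measurable_borel) measurable
qed

text \<open>A crude form of Young's inequality, through the larger of the two norms. It is meant for
  integrability and domination, where the constant is immaterial.\<close>

lemma dual_map_pairing_le:
  fixes a b :: "'u::real_inner"
  assumes p: "p \<ge> 2"
  shows "\<bar>dual_map p a \<bullet> b\<bar> \<le> norm a powr p + norm b powr p"
proof -
  let ?m = "max (norm a) (norm b)"
  have "\<bar>dual_map p a \<bullet> b\<bar> \<le> norm a powr (p - 1) * norm b"
    using Cauchy_Schwarz_ineq2[of "dual_map p a" b] by (simp add: norm_dual_map)
  also have "\<dots> \<le> ?m powr (p - 1) * ?m" using p by (intro mult_mono powr_mono2) auto
  also have "\<dots> = ?m powr p"
    using powr_mult_base[of ?m "p - 1"] by (simp add: mult.commute le_max_iff_disj)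
  also have "\<dots> \<le> norm a powr p + norm b powr p" by (auto simp: max_def)
  finally show ?thesis .
qed

lemma dual_map_pairing_integrable:
  fixes u w :: "real \<Rightarrow> 'u::real_inner"
  assumes p: "p \<ge> 2" and u: "Lp p u" and w: "Lp p w"
  shows "integrable lebesgue (\<lambda>t. dual_map p (u t) \<bullet> w t)"
proof (rule Bochner_Integration.integrable_bound)
  show "integrable lebesgue (\<lambda>t. norm (u t) powr p + norm (w t) powr p)" using u w by (simp add: Lp_def)
  show "(\<lambda>t. dual_map p (u t) \<bullet> w t) \<in> borel_measurable lebesgue"
    by (intro borel_measurable_inner_strongly strongly_measurable_dual_map Lp_meas[OF u] Lp_meas[OF w])
  show "AE t in lebesgue. norm (dual_map p (u t) \<bullet> w t) \<le> norm (norm (u t) powr p + norm (w t) powr p)"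
    using dual_map_pairing_le[OF p] by auto
qed

text \<open>The representing function is the derivative at the minimiser of \<open>\<integral> |u|\<^sup>p - ell u\<close>;
  the \<open>p\<close>-th power of the norm avoids both separability and the Radon--Nikodym theorem.\<close>

lemma Lp_Riesz_aux:
  fixes ell :: "(real \<Rightarrow> 'u::{real_inner,complete_space}) \<Rightarrow> real"
  assumes p: "p \<ge> 2" and r: "r > 0"
    and add: "\<And>u v. Lp p u \<Longrightarrow> Lp p v \<Longrightarrow> ell (\<lambda>t. u t + v t) = ell u + ell v"
    and scale: "\<And>c u. Lp p u \<Longrightarrow> ell (\<lambda>t. c *\<^sub>R u t) = c * ell u"
    and bound: "\<And>u. Lp p u \<Longrightarrow> np p u \<le> r \<Longrightarrow> \<bar>ell u\<bar> \<le> c"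
  obtains l where "Lp p l" "\<And>w. Lp p w \<Longrightarrow> ell w = (\<integral>t. p * (dual_map p (l t) \<bullet> w t) \<partial>lebesgue)"
proof -
  have p0: "p > 0" "p \<ge> 0" using p by auto
  have c0: "c \<ge> 0" using bound[OF Lp_zero] r by (metis abs_ge_zero np_zero order.trans less_imp_le)
  \<comment> \<open>By homogeneity the bound on one ball controls \<open>ell\<close> everywhere.
    This gives the lower bound of \<open>J\<close> and also the continuity of \<open>ell\<close>
    along the minimising sequence.\<close>
  have scaled: "\<bar>ell u\<bar> \<le> c * s" if u: "Lp p u" and s: "s > 0" "np p u \<le> r * s powr p" for u s
  proof -
    have "np p (\<lambda>t. (1/s) *\<^sub>R u t) = np p u / s powr p"
      using np_scaleR[OF u, of "1/s"] s by (simp add: powr_divide)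
    also have "\<dots> \<le> r" using s by (simp add: field_simps)
    finally have "\<bar>ell (\<lambda>t. (1/s) *\<^sub>R u t)\<bar> \<le> c" by (intro bound Lp_scaleR u)
    then show ?thesis using s by (simp add: scale[OF u] field_simps abs_mult)
  qed
  define J where "J = (\<lambda>u. np p u - ell u)"
  have lower: "- c - c^2 / (4 * r) \<le> J u" if u: "Lp p u" for u
  proof (cases "np p u \<le> r")
    case True
    have "0 \<le> c^2 / (4 * r)" using r by simp
    then show ?thesis using bound[OF u True] np_nonneg[of p u] unfolding J_def by linarith
  next
    case False
    \<comment> \<open>With this \<open>s\<close>, np p u = r s^p >= r s^2 because s >= 1 and p >= 2,
      whereas |ell u| <= c s. Completing the square in r s^2 - c s yields the constant c^2 / (4
      r).\<close>
    define s where "s = (np p u / r) powr (1/p)"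
    have q1: "np p u / r > 1" using False r by (simp add: field_simps)
    then have s1: "s \<ge> 1" unfolding s_def using p by (intro ge_one_powr_ge_zero) auto
    have sp: "s powr p = np p u / r" unfolding s_def using p q1 r by (simp add: powr_powr)
    have "s^2 \<le> s powr p" using powr_mono[OF p s1] s1 by (simp add: powr_numeral)
    then have "r * s^2 \<le> np p u" using r by (simp add: sp field_simps)
    moreover have "\<bar>ell u\<bar> \<le> c * s" using s1 r by (intro scaled u) (auto simp: sp)
    moreover have "0 \<le> (2 * r * s - c)^2 / (4 * r)" using r by simp
    moreover have "(2 * r * s - c)^2 / (4 * r) = r * s^2 - c * s + c^2 / (4 * r)"
      using r by (simp add: power2_diff field_simps power2_eq_square)
    ultimately show ?thesis unfolding J_def using c0 by linarith
  qed
  have mid: "J (\<lambda>t. (1/2) *\<^sub>R (u t + v t)) + (1 / 2 powr p) * np p (\<lambda>t. u t - v t) \<le> (J u + J v) / 2"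
    if "Lp p u" "Lp p v" for u v
  proof -
    have "ell (\<lambda>t. (1/2) *\<^sub>R (u t + v t)) = (1/2) * (ell u + ell v)"
      using scale[OF Lp_add[OF p0(2) that], of "1/2"] add[OF that] by simp
    then show ?thesis using np_Clarkson[OF p that] unfolding J_def by argo
  qed
  obtain v l m where v: "\<And>k. v k \<in> {u. Lp p u}" and l: "Lp p l" and vl: "(\<lambda>k. np p (\<lambda>t. v k t - l t)) \<longlonglongrightarrow> 0"
    and ae: "AE t in lebesgue. (\<lambda>k. v k t) \<longlonglongrightarrow> l t" and Jm: "(\<lambda>k. J (v k)) \<longlonglongrightarrow> m"
    and min: "\<And>e. e > 0 \<Longrightarrow> \<exists>k::nat. \<forall>u\<in>{u. Lp p u}. m - e \<le> J u"
  proof (rule nested_minimisers[of p "1 / 2 powr p" J "\<lambda>k. {u. Lp p u}" "- c - c^2 / (4 * r)" "J (\<lambda>t. 0)"])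
    show "(\<lambda>t. (1/2) *\<^sub>R (u t + v t)) \<in> {u. Lp p u}" if "u \<in> {u. Lp p u}" "v \<in> {u. Lp p u}" for k :: nat and u v
      using that by (simp only: mem_Collect_eq) (intro Lp_scaleR Lp_add[OF p0(2)])
    show "\<exists>u\<in>{u. Lp p u}. J u \<le> J (\<lambda>t. 0)" for k :: nat by (rule bexI[of _ "\<lambda>t. 0"]) auto
  qed (use p0 mid lower that in auto)
  have mJ: "m \<le> J u" if "Lp p u" for u
  proof (rule field_le_epsilon)
    fix e :: real assume "e > 0"
    then show "m \<le> J u + e" using min[of e] that by fastforce
  qed
  have "(\<lambda>k. ell (v k)) \<longlonglongrightarrow> ell l"
  proof (rule LIMSEQ_I)
    fix e :: real assume e: "e > 0"
    define s where "s = e / (2 * (c + 1))"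
    have s: "s > 0" using e c0 by (simp add: s_def)
    have "eventually (\<lambda>k. np p (\<lambda>t. v k t - l t) < r * s powr p) sequentially"
      using vl r s by (intro order_tendstoD) auto
    then obtain N where N: "\<And>k. k \<ge> N \<Longrightarrow> np p (\<lambda>t. v k t - l t) < r * s powr p"
      by (auto simp: eventually_sequentially)
    have "norm (ell (v k) - ell l) < e" if k: "k \<ge> N" for k
    proof -
      have vk: "Lp p (v k)" using v by simp
      have "\<bar>ell (\<lambda>t. v k t - l t)\<bar> \<le> c * s"
        using N[OF k] by (intro scaled Lp_diff p0 vk l s) simp
      moreover have "ell (\<lambda>t. v k t - l t) = ell (v k) - ell l"
        using add[OF vk Lp_scaleR[OF l, of "-1"]] scale[OF l, of "-1"] by simp
      moreover have "c * s < e"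
      proof -
        have "c * s = e * (c / (2 * (c + 1)))" by (simp add: s_def)
        also have "\<dots> < e * 1" using e c0 by (intro mult_strict_left_mono) (auto simp: field_simps)
        finally show ?thesis by simp
      qed
      ultimately show ?thesis by simp
    qed
    then show "\<exists>N. \<forall>k\<ge>N. norm (ell (v k) - ell l) < e" by blast
  qed
  from tendsto_add[OF Jm this] have "(\<lambda>k. np p (v k)) \<longlonglongrightarrow> m + ell l" by (simp add: J_def)
  then have "np p l \<le> m + ell l"
    using v by (intro np_lower_semicontinuous[OF p0(1) _ l ae]) auto
  then have Jl: "J l \<le> J u" if "Lp p u" for u using mJ[OF that] by (simp add: J_def)
  \<comment> \<open>The tangent inequality is taken at the perturbed point g n = l + w / (n+1) and
    evaluated at \<open>l\<close>. Minimality of \<open>l\<close> cancels the p-th powers, division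
    by 1/(n+1) leaves an inequality, and a dominated limit moves g n back to
    \<open>l\<close>.\<close>
  have half: "ell w \<le> (\<integral>t. p * (dual_map p (l t) \<bullet> w t) \<partial>lebesgue)" if w: "Lp p w" for w
  proof -
    define g where "g = (\<lambda>n t. l t + (1 / real (Suc n)) *\<^sub>R w t)"
    have gL: "Lp p (g n)" for n unfolding g_def by (intro Lp_add Lp_scaleR l w p0)
    have le: "ell w \<le> (\<integral>t. p * (dual_map p (g n t) \<bullet> w t) \<partial>lebesgue)" for n
    proof -
      define s where "s = 1 / real (Suc n)"
      have s: "s > 0" by (simp add: s_def)
      have gi: "integrable lebesgue (\<lambda>t. dual_map p (g n t) \<bullet> w t)"
        by (rule dual_map_pairing_integrable[OF p gL w])
      have "np p (g n) + p * (\<integral>t. dual_map p (g n t) \<bullet> (l t - g n t) \<partial>lebesgue) =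
          (\<integral>t. norm (g n t) powr p + p * (dual_map p (g n t) \<bullet> (l t - g n t)) \<partial>lebesgue)"
        unfolding np_def using gL[of n] dual_map_pairing_integrable[OF p gL Lp_diff[OF p0(2) l gL], of n n]
        by (simp add: Lp_def)
      also have "\<dots> \<le> np p l"
        unfolding np_def using gL[of n] l dual_map_pairing_integrable[OF p gL Lp_diff[OF p0(2) l gL], of n n] p
        by (intro integral_mono) (auto simp: Lp_def dual_map_def intro!: norm_powr_tangent[simplified])
      finally have "np p (g n) + p * (\<integral>t. dual_map p (g n t) \<bullet> (l t - g n t) \<partial>lebesgue) \<le> np p l" .
      moreover have "(\<integral>t. dual_map p (g n t) \<bullet> (l t - g n t) \<partial>lebesgue) = - s * (\<integral>t. dual_map p (g n t) \<bullet> w t \<partial>lebesgue)"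
        using gi by (simp add: g_def s_def)
      moreover have "J l \<le> J (g n)" by (rule Jl[OF gL])
      moreover have "ell (g n) = ell l + s * ell w"
        unfolding g_def using add[OF l Lp_scaleR[OF w]] scale[OF w] by (simp add: s_def)
      ultimately have "s * ell w \<le> s * (p * (\<integral>t. dual_map p (g n t) \<bullet> w t \<partial>lebesgue))"
        unfolding J_def by (simp add: algebra_simps)
      then have "ell w \<le> p * (\<integral>t. dual_map p (g n t) \<bullet> w t \<partial>lebesgue)" using s by simp
      then show ?thesis by simp
    qed
    have "(\<lambda>n. \<integral>t. p * (dual_map p (g n t) \<bullet> w t) \<partial>lebesgue) \<longlonglongrightarrow> (\<integral>t. p * (dual_map p (l t) \<bullet> w t) \<partial>lebesgue)"
    proof (rule integral_dominated_convergence)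
      let ?h = "\<lambda>t. p * (2 powr p * (norm (l t) powr p + norm (w t) powr p) + norm (w t) powr p)"
      show "integrable lebesgue ?h" using l w by (auto simp: Lp_def)
      show "(\<lambda>t. p * (dual_map p (l t) \<bullet> w t)) \<in> borel_measurable lebesgue"
        "(\<lambda>t. p * (dual_map p (g n t) \<bullet> w t)) \<in> borel_measurable lebesgue" for n
        using dual_map_pairing_integrable[OF p l w] dual_map_pairing_integrable[OF p gL w, of n] by auto
      show "AE t in lebesgue. (\<lambda>n. p * (dual_map p (g n t) \<bullet> w t)) \<longlonglongrightarrow> p * (dual_map p (l t) \<bullet> w t)"
      proof (rule AE_I2)
        fix t
        have "(\<lambda>n. l t + inverse (real (Suc n)) *\<^sub>R w t) \<longlonglongrightarrow> l t + 0 *\<^sub>R w t"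
          by (intro tendsto_intros LIMSEQ_inverse_real_of_nat)
        then have "(\<lambda>n. g n t) \<longlonglongrightarrow> l t" by (simp add: g_def divide_inverse)
        then show "(\<lambda>n. p * (dual_map p (g n t) \<bullet> w t)) \<longlonglongrightarrow> p * (dual_map p (l t) \<bullet> w t)"
          by (intro tendsto_intros dual_map_tendsto p)
      qed
      show "AE t in lebesgue. norm (p * (dual_map p (g n t) \<bullet> w t)) \<le> ?h t" for n
      proof (rule AE_I2)
        fix t
        have "norm (g n t) powr p \<le> 2 powr p * (norm (l t) powr p + norm (w t) powr p)"
        proof -
          have "norm (g n t) powr p \<le> 2 powr p * (norm (l t) powr p + norm ((1 / real (Suc n)) *\<^sub>R w t) powr p)"
            unfolding g_def by (rule powr_norm_add_le[OF p0(2)])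
          also have "norm ((1 / real (Suc n)) *\<^sub>R w t) \<le> norm (w t)"
            by (simp add: divide_le_eq mult_right_le_one_le mult_le_cancel_left1)
          then have "norm ((1 / real (Suc n)) *\<^sub>R w t) powr p \<le> norm (w t) powr p"
            using p0 by (intro powr_mono2) auto
          then have "2 powr p * (norm (l t) powr p + norm ((1 / real (Suc n)) *\<^sub>R w t) powr p) \<le> 2 powr p * (norm (l t) powr p + norm (w t) powr p)"
            by simp
          finally show ?thesis .
        qed
        then have "\<bar>dual_map p (g n t) \<bullet> w t\<bar> \<le> 2 powr p * (norm (l t) powr p + norm (w t) powr p) + norm (w t) powr p"
          using dual_map_pairing_le[OF p, of "g n t" "w t"] by linarith
        then show "norm (p * (dual_map p (g n t) \<bullet> w t)) \<le> ?h t"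
          using p0 by (simp add: abs_mult)
      qed
    qed
    then show ?thesis using le by (intro LIMSEQ_le_const) auto
  qed
  have "ell w = (\<integral>t. p * (dual_map p (l t) \<bullet> w t) \<partial>lebesgue)" if w: "Lp p w" for w
  proof (rule antisym[OF half[OF w]])
    have "ell (\<lambda>t. (-1) *\<^sub>R w t) \<le> (\<integral>t. p * (dual_map p (l t) \<bullet> ((-1) *\<^sub>R w t)) \<partial>lebesgue)"
      by (rule half[OF Lp_scaleR[OF w]])
    then show "(\<integral>t. p * (dual_map p (l t) \<bullet> w t) \<partial>lebesgue) \<le> ell w"
      by (subst (asm) scale[OF w]) simp
  qed
  with l show ?thesis using that by blast
qed

text \<open>Cutting off to the interval transports a functional on \<open>V\<close> to all of L^p.
  The representing function p |l|^(p-2) l is integrable because |l|^(p-1) <= 1 + |l|^p on a bounded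
  interval; integrability is what membership in \<open>Y_space\<close> asks for.\<close>

lemma Lp_Riesz:
  fixes ell :: "(real \<Rightarrow> 'u::{real_inner,complete_space}) \<Rightarrow> real"
  assumes p: "p \<ge> 2" and r: "r > 0" and ab: "a \<le> b"
  defines "V \<equiv> {u. Lp p u \<and> (\<forall>t. t \<notin> {a<..<b} \<longrightarrow> u t = 0)}"
  assumes add: "\<And>u v. u \<in> V \<Longrightarrow> v \<in> V \<Longrightarrow> ell (\<lambda>t. u t + v t) = ell u + ell v"
    and scale: "\<And>c u. u \<in> V \<Longrightarrow> ell (\<lambda>t. c *\<^sub>R u t) = c * ell u"
    and bound: "\<And>u. u \<in> V \<Longrightarrow> np p u \<le> r \<Longrightarrow> \<bar>ell u\<bar> \<le> c"
  obtains f where "strongly_measurable lebesgue f" "integrable lebesgue (\<lambda>t. norm (f t))"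
    "\<And>t. t \<notin> {a<..<b} \<Longrightarrow> f t = 0" "\<And>u. u \<in> V \<Longrightarrow> integrable lebesgue (\<lambda>t. u t \<bullet> f t)"
    "\<And>u. u \<in> V \<Longrightarrow> ell u = (\<integral>t. u t \<bullet> f t \<partial>lebesgue)"
proof -
  define cut where "cut = (\<lambda>u t. if t \<in> {a<..<b} then u t else (0::'u))"
  have cutV: "cut u \<in> V" if "Lp p u" for u
    using Lp_cut[OF that, of "{a<..<b}"] by (auto simp: V_def cut_def)
  have cut_le: "np p (cut u) \<le> np p u" if "Lp p u" for u
    using that cutV[OF that] unfolding np_def V_def by (intro integral_mono) (auto simp: Lp_def cut_def)
  have cut_id: "cut u = u" if "u \<in> V" for u using that by (auto simp: V_def cut_def)
  have VL: "Lp p u" if "u \<in> V" for u using that by (simp add: V_def)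
  have cut_add: "cut (\<lambda>t. u t + v t) = (\<lambda>t. cut u t + cut v t)" for u v by (auto simp: cut_def)
  have cut_scale: "cut (\<lambda>t. k *\<^sub>R u t) = (\<lambda>t. k *\<^sub>R cut u t)" for u k by (auto simp: cut_def)
  obtain l where l: "Lp p l" and rep: "\<And>w. Lp p w \<Longrightarrow> ell (cut w) = (\<integral>t. p * (dual_map p (l t) \<bullet> w t) \<partial>lebesgue)"
  proof (rule Lp_Riesz_aux[OF p r, of "\<lambda>u. ell (cut u)" c])
    show "ell (cut (\<lambda>t. u t + v t)) = ell (cut u) + ell (cut v)" if "Lp p u" "Lp p v" for u v
      unfolding cut_add by (intro add cutV that)
    show "ell (cut (\<lambda>t. k *\<^sub>R u t)) = k * ell (cut u)" if "Lp p u" for k u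
      unfolding cut_scale by (intro scale cutV that)
    show "\<bar>ell (cut u)\<bar> \<le> c" if "Lp p u" "np p u \<le> r" for u
      using cut_le[OF that(1)] that by (intro bound cutV) auto
  qed (rule that)
  define f where "f = cut (\<lambda>t. p *\<^sub>R dual_map p (l t))"
  have lm: "strongly_measurable lebesgue l" by (rule Lp_meas[OF l])
  have fm: "strongly_measurable lebesgue f"
    unfolding f_def cut_def
    by (intro strongly_measurable_cut strongly_measurable_scaleR strongly_measurable_const strongly_measurable_dual_map lm) auto
  have eq: "u t \<bullet> f t = p * (dual_map p (l t) \<bullet> u t)" if "u \<in> V" for u t
    using that by (auto simp: V_def f_def cut_def inner_commute)
  show ?thesis
  proof (rule that[OF fm])
    show "integrable lebesgue (\<lambda>t. norm (f t))"
    proof (rule Bochner_Integration.integrable_bound)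
      have "integrable lebesgue (indicat_real {a<..<b})" by (rule integrable_real_indicator) (use ab in auto)
      then show "integrable lebesgue (\<lambda>t. p * (indicator {a<..<b} t + norm (l t) powr p))"
        using l by (auto simp: Lp_def)
      show "(\<lambda>t. norm (f t)) \<in> borel_measurable lebesgue" by (rule borel_measurable_norm_strongly[OF fm])
      show "AE t in lebesgue. norm (norm (f t)) \<le> norm (p * (indicator {a<..<b} t + norm (l t) powr p))"
      proof (rule AE_I2)
        fix t
        have "norm (l t) powr (p - 1) \<le> 1 + norm (l t) powr p"
        proof (cases "norm (l t) \<le> 1")
          case True
          then have "norm (l t) powr (p - 1) \<le> 1 powr (p - 1)" using p by (intro powr_mono2) auto
          then have "norm (l t) powr (p - 1) \<le> 1" by simp
          moreover have "0 \<le> norm (l t) powr p" by simp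
          ultimately show ?thesis by linarith
        next
          case False
          then have "norm (l t) powr (p - 1) \<le> norm (l t) powr p" by (intro powr_mono) auto
          then show ?thesis by simp
        qed
        then show "norm (norm (f t)) \<le> norm (p * (indicator {a<..<b} t + norm (l t) powr p))"
          using p by (auto simp: f_def cut_def norm_dual_map indicator_def intro!: mult_left_mono)
      qed
    qed
    show "f t = 0" if "t \<notin> {a<..<b}" for t using that by (auto simp: f_def cut_def)
    show "integrable lebesgue (\<lambda>t. u t \<bullet> f t)" if "u \<in> V" for u
      unfolding eq[OF that] using dual_map_pairing_integrable[OF p l VL[OF that]] by simp
    show "ell u = (\<integral>t. u t \<bullet> f t \<partial>lebesgue)" if "u \<in> V" for u
      unfolding eq[OF that] using rep[OF VL[OF that]] cut_id[OF that] by simp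
  qed
qed

section \<open>L^1-closures of subspaces of L^2\<close>

lemma finite_indicator_integrable:
  fixes a b :: real
  shows "integrable lebesgue (indicat_real {a<..<b})"
proof (rule integrable_real_indicator)
  show "emeasure lebesgue {a<..<b} < \<infinity>" by (cases "a \<le> b") auto
qed simp

text \<open>Young's inequality 2 |u| <= \<mu> + |u|^2 / \<mu>, integrated over the interval. The
  weight stays free so that it can be optimised where the bound is used.\<close>

lemma L1_bound_by_np2:
  fixes u :: "real \<Rightarrow> 'u::real_normed_vector"
  assumes u: "Lp 2 u" and supp: "\<And>t. t \<notin> {a<..<b} \<Longrightarrow> u t = 0" and ab: "a \<le> b" and lam: "\<mu> > 0"
  shows "integrable lebesgue (\<lambda>t. norm (u t))"
    and "(\<integral>t. norm (u t) \<partial>lebesgue) \<le> (\<mu> * (b - a) + np 2 u / \<mu>) / 2"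
proof -
  let ?g = "\<lambda>t. (\<mu> * indicator {a<..<b} t + norm (u t) powr 2 / \<mu>) / 2"
  have gi: "integrable lebesgue ?g"
    using u finite_indicator_integrable[of a b] by (auto simp: Lp_def)
  have le: "norm (u t) \<le> ?g t" for t
  proof (cases "t \<in> {a<..<b}")
    case True
    have "0 \<le> (norm (u t) - \<mu>)^2 / \<mu>" using lam by simp
    also have "\<dots> = norm (u t) powr 2 / \<mu> + \<mu> - 2 * norm (u t)"
      using lam by (simp add: powr_2_norm power2_diff field_simps power2_eq_square)
    finally show ?thesis using True by simp
  qed (use supp lam in auto)
  show i: "integrable lebesgue (\<lambda>t. norm (u t))"
  proof (rule Bochner_Integration.integrable_bound[OF gi])
    show "(\<lambda>t. norm (u t)) \<in> borel_measurable lebesgue"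
      by (rule borel_measurable_norm_strongly[OF Lp_meas[OF u]])
    show "AE t in lebesgue. norm (norm (u t)) \<le> norm (?g t)"
    proof (rule AE_I2)
      fix t show "norm (norm (u t)) \<le> norm (?g t)" using le[of t] by simp
    qed
  qed
  have "(\<integral>t. norm (u t) \<partial>lebesgue) \<le> (\<integral>t. ?g t \<partial>lebesgue)" by (intro integral_mono i gi le)
  also have "\<dots> = (\<mu> * (b - a) + np 2 u / \<mu>) / 2"
    using u ab finite_indicator_integrable[of a b] by (simp add: Lp_def np_def)
  finally show "(\<integral>t. norm (u t) \<partial>lebesgue) \<le> (\<mu> * (b - a) + np 2 u / \<mu>) / 2" .
qed

lemma L1_truncation:
  fixes f :: "real \<Rightarrow> 'u::real_normed_vector"
  assumes f: "strongly_measurable lebesgue f" and fi: "integrable lebesgue (\<lambda>t. norm (f t))" and e: "e > 0"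
  obtains k :: nat where "(\<integral>t. norm (f t - (if norm (f t) \<le> real k then f t else 0)) \<partial>lebesgue) < e"
proof -
  have [measurable]: "(\<lambda>t. norm (f t)) \<in> borel_measurable lebesgue"
    by (rule borel_measurable_norm_strongly[OF f])
  have eq: "norm (f t - (if norm (f t) \<le> real k then f t else 0)) = (if norm (f t) \<le> real k then 0 else norm (f t))" for k t
    by simp
  have "(\<lambda>k. \<integral>t. (if norm (f t) \<le> real k then 0 else norm (f t)) \<partial>lebesgue) \<longlonglongrightarrow> (\<integral>t. 0 \<partial>(lebesgue::real measure))"
  proof (rule integral_dominated_convergence[OF _ _ fi])
    show "AE t in lebesgue. (\<lambda>k. if norm (f t) \<le> real k then 0 else norm (f t)) \<longlonglongrightarrow> 0"
    proof (rule AE_I2)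
      fix t
      obtain N where N: "norm (f t) \<le> real N" using real_arch_simple by blast
      have "eventually (\<lambda>k. (if norm (f t) \<le> real k then 0 else norm (f t)) = 0) sequentially"
        using eventually_ge_at_top[of N] by eventually_elim (use N in auto)
      then show "(\<lambda>k. if norm (f t) \<le> real k then 0 else norm (f t)) \<longlonglongrightarrow> 0" by (rule tendsto_eventually)
    qed
  qed auto
  then have "(\<lambda>k. \<integral>t. norm (f t - (if norm (f t) \<le> real k then f t else 0)) \<partial>lebesgue) \<longlonglongrightarrow> 0"
    unfolding eq by simp
  then have "eventually (\<lambda>k. (\<integral>t. norm (f t - (if norm (f t) \<le> real k then f t else 0)) \<partial>lebesgue) < e) sequentially"
    using e by (intro order_tendstoD) auto
  then show ?thesis using that by (auto simp: eventually_sequentially)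
qed

text \<open>The variational inequality for a limit \<open>l\<close> of near-minimisers, stated
  through them because \<open>l\<close> itself may leave the convex set. Expand the square along the
  segment from v k to \<open>c\<close>, let k tend to infinity and then s to 0. The conclusion
  separates \<open>c\<close> from 0 by a hyperplane with normal \<open>l\<close>.\<close>

lemma minimal_norm_inner:
  fixes v :: "nat \<Rightarrow> real \<Rightarrow> 'u::real_inner"
  assumes v: "\<And>k. Lp 2 (v k)" and l: "Lp 2 l" and vl: "(\<lambda>k. np 2 (\<lambda>t. v k t - l t)) \<longlonglongrightarrow> 0"
    and vm: "(\<lambda>k. np 2 (v k)) \<longlonglongrightarrow> m" and c: "Lp 2 c"
    and min: "\<And>k s. 0 < s \<Longrightarrow> s \<le> 1 \<Longrightarrow> m \<le> np 2 (\<lambda>t. v k t + s *\<^sub>R (c t - v k t))"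
  shows "m \<le> (\<integral>t. l t \<bullet> c t \<partial>lebesgue)"
proof -
  define P where "P = (\<integral>t. l t \<bullet> c t \<partial>lebesgue)"
  have main: "0 \<le> 2 * (P - m) + s * (4 * (np 2 c + m))" if s: "0 < s" "s \<le> 1" for s
  proof -
    have step: "m \<le> np 2 (v k) + 2 * s * ((\<integral>t. v k t \<bullet> c t \<partial>lebesgue) - np 2 (v k)) + s^2 * (4 * (np 2 c + np 2 (v k)))" for k
    proof -
      have d: "Lp 2 (\<lambda>t. c t - v k t)" by (intro Lp_diff c v) simp
      have "m \<le> np 2 (\<lambda>t. v k t + s *\<^sub>R (c t - v k t))" by (rule min[OF s])
      also have "\<dots> = np 2 (v k) + 2 * s * (\<integral>t. v k t \<bullet> (c t - v k t) \<partial>lebesgue) + s^2 * np 2 (\<lambda>t. c t - v k t)"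
        by (rule np2_expand[OF v d])
      also have "(\<integral>t. v k t \<bullet> (c t - v k t) \<partial>lebesgue) = (\<integral>t. v k t \<bullet> c t \<partial>lebesgue) - np 2 (v k)"
        using pairing_integrable[OF v c, of k] pairing_integrable[OF v v, of k k]
        by (simp add: inner_diff_right np_def powr_2_norm power2_norm_eq_inner)
      also have "np 2 (\<lambda>t. c t - v k t) \<le> 2 powr 2 * (np 2 c + np 2 (v k))"
        using np_add_le[OF _ c Lp_scaleR[OF v, of "-1"], of k] np_scaleR[OF v, of "-1" k] by simp
      finally show ?thesis by (simp add: mult_left_mono)
    qed
    have "m \<le> m + 2 * s * (P - m) + s^2 * (4 * (np 2 c + m))"
    proof (rule LIMSEQ_le_const)
      show "(\<lambda>k. np 2 (v k) + 2 * s * ((\<integral>t. v k t \<bullet> c t \<partial>lebesgue) - np 2 (v k)) + s^2 * (4 * (np 2 c + np 2 (v k))))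
        \<longlonglongrightarrow> m + 2 * s * (P - m) + s^2 * (4 * (np 2 c + m))"
        unfolding P_def by (intro tendsto_intros vm pairing_tendsto[OF v l c vl])
    qed (use step in blast)
    then have "0 \<le> s * (2 * (P - m) + s * (4 * (np 2 c + m)))" by (simp add: power2_eq_square algebra_simps)
    then show ?thesis using s by (simp add: zero_le_mult_iff)
  qed
  have "((\<lambda>s. 2 * (P - m) + s * (4 * (np 2 c + m))) \<longlongrightarrow> 2 * (P - m) + 0 * (4 * (np 2 c + m))) (at_right 0)"
    by (intro tendsto_intros)
  moreover have "eventually (\<lambda>s::real. 0 \<le> 2 * (P - m) + s * (4 * (np 2 c + m))) (at_right 0)"
    using main by (auto simp: eventually_at_right_field intro!: exI[of _ 1])
  ultimately have "0 \<le> 2 * (P - m) + 0 * (4 * (np 2 c + m))"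
    by (intro tendsto_lowerbound) auto
  then show ?thesis by (simp add: P_def)
qed

text \<open>This replaces the duality of \<open>L\<^sup>1\<close> and \<open>L\<^sup>\<infinity>\<close>: the element of least \<open>L\<^sup>2\<close>-norm among the
  differences of \<open>f - g\<close> and small functions \<open>h\<close> is bounded, because \<open>h\<close> ranges over an \<open>L\<^sup>1\<close>-ball.\<close>

lemma L1_closure_of_annihilated:
  fixes f :: "real \<Rightarrow> 'u::{real_inner,complete_space}" and G :: "'d::real_vector \<Rightarrow> real \<Rightarrow> 'u"
  assumes ab: "a < b"
    and f: "strongly_measurable lebesgue f" "integrable lebesgue (\<lambda>t. norm (f t))" "\<And>t. t \<notin> {a<..<b} \<Longrightarrow> f t = 0"
    and G: "\<And>d. Lp 2 (G d)" "\<And>d t. t \<notin> {a<..<b} \<Longrightarrow> G d t = 0"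
    and G_add: "\<And>d e t. G (d + e) t = G d t + G e t" and G_scale: "\<And>c d t. G (c *\<^sub>R d) t = c *\<^sub>R G d t"
    and ann: "\<And>v M. strongly_measurable lebesgue v \<Longrightarrow> (\<And>t. norm (v t) \<le> M) \<Longrightarrow> (\<And>t. t \<notin> {a<..<b} \<Longrightarrow> v t = 0) \<Longrightarrow>
        (\<And>d. (\<integral>t. v t \<bullet> G d t \<partial>lebesgue) = 0) \<Longrightarrow> (\<integral>t. v t \<bullet> f t \<partial>lebesgue) = 0"
    and e: "e > 0"
  shows "\<exists>d. (\<integral>t. norm (f t - G d t) \<partial>lebesgue) < e"
proof (rule ccontr)
  assume "\<not> ?thesis"
  then have far: "e \<le> (\<integral>t. norm (f t - G d t) \<partial>lebesgue)" for d by (meson not_less)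
  let ?W = "{a<..<b}"
  \<comment> \<open>As \<open>f\<close> is only in L^1, a bounded truncation \<open>F\<close> takes
    its place in L^2. The error e/4 and the radius e/2 allowed to \<open>h\<close> below leave an
    L^1 gap of e/4 between the convex set \<open>C\<close> and 0.\<close>
  obtain k :: nat where k: "(\<integral>t. norm (f t - (if norm (f t) \<le> real k then f t else 0)) \<partial>lebesgue) < e / 4"
    using L1_truncation[OF f(1,2), of "e / 4"] e by auto
  define F where "F = (\<lambda>t. if norm (f t) \<le> real k then f t else 0)"
  have Fe: "(\<integral>t. norm (f t - F t) \<partial>lebesgue) < e / 4" using k by (simp add: F_def)
  have [measurable]: "(\<lambda>t. norm (f t)) \<in> borel_measurable lebesgue" by (rule borel_measurable_norm_strongly[OF f(1)])
  have Fm: "strongly_measurable lebesgue F"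
  proof -
    have "{t \<in> space lebesgue. norm (f t) \<le> real k} \<in> sets lebesgue" by measurable
    then have "strongly_measurable lebesgue (\<lambda>t. if t \<in> {t. norm (f t) \<le> real k} then f t else 0)"
      by (intro strongly_measurable_cut f(1)) simp
    then show ?thesis by (simp add: F_def)
  qed
  have F0: "F t = 0" if "t \<notin> ?W" for t using f(3)[OF that] by (simp add: F_def)
  have FL: "Lp 2 F" by (rule Lp_bounded[OF Fm, of "real k" 2 a b]) (use F0 ab in \<open>auto simp: F_def\<close>)
  have i1: "integrable lebesgue (\<lambda>t. norm (u t))" if "Lp 2 u" "\<And>t. t \<notin> ?W \<Longrightarrow> u t = 0" for u :: "real \<Rightarrow> 'u"
    using ab by (intro L1_bound_by_np2(1)[where a = a and b = b and \<mu> = 1] that) auto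
  have idiff: "integrable lebesgue (\<lambda>t. norm (u t - v t))"
    if "strongly_measurable lebesgue u" "strongly_measurable lebesgue v"
       "integrable lebesgue (\<lambda>t. norm (u t))" "integrable lebesgue (\<lambda>t. norm (v t))" for u v :: "real \<Rightarrow> 'u"
  proof (rule Bochner_Integration.integrable_bound)
    show "integrable lebesgue (\<lambda>t. norm (u t) + norm (v t))" using that by simp
    show "(\<lambda>t. norm (u t - v t)) \<in> borel_measurable lebesgue"
      by (intro borel_measurable_norm_strongly strongly_measurable_diff that)
    show "AE t in lebesgue. norm (norm (u t - v t)) \<le> norm (norm (u t) + norm (v t))"
      by (simp add: norm_triangle_ineq4)
  qed
  define C where "C = {u. \<exists>d h. Lp 2 h \<and> (\<forall>t. t \<notin> ?W \<longrightarrow> h t = 0) \<and> (\<integral>t. norm (h t) \<partial>lebesgue) \<le> e / 2 \<and>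
      u = (\<lambda>t. F t - G d t - h t)}"
  have CL: "Lp 2 u" and C0: "\<And>t. t \<notin> ?W \<Longrightarrow> u t = 0" if "u \<in> C" for u
    using that F0 G FL by (auto simp: C_def intro!: Lp_diff)
  have Cfar: "e / 4 \<le> (\<integral>t. norm (u t) \<partial>lebesgue)" if u: "u \<in> C" for u
  proof -
    obtain d h where h: "Lp 2 h" "\<And>t. t \<notin> ?W \<Longrightarrow> h t = 0" "(\<integral>t. norm (h t) \<partial>lebesgue) \<le> e / 2"
      and u': "u = (\<lambda>t. F t - G d t - h t)" using u by (auto simp: C_def)
    have ih: "integrable lebesgue (\<lambda>t. norm (h t))" by (rule i1[OF h(1,2)])
    have iu: "integrable lebesgue (\<lambda>t. norm (u t))" by (rule i1[OF CL[OF u] C0[OF u]])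
    have iF: "integrable lebesgue (\<lambda>t. norm (f t - F t))"
      by (intro idiff f Fm i1[OF FL F0])
    have "e \<le> (\<integral>t. norm (f t - G d t) \<partial>lebesgue)" by (rule far)
    also have "\<dots> \<le> (\<integral>t. norm (f t - F t) + norm (u t) + norm (h t) \<partial>lebesgue)"
    proof (rule integral_mono)
      show "integrable lebesgue (\<lambda>t. norm (f t - G d t))"
        by (intro idiff f Lp_meas[OF G(1)] i1[OF G])
      show "norm (f t - G d t) \<le> norm (f t - F t) + norm (u t) + norm (h t)" for t
      proof -
        have eq: "f t - G d t = (f t - F t) + u t + h t" by (simp add: u')
        show ?thesis unfolding eq
          using norm_triangle_ineq[of "(f t - F t) + u t" "h t"] norm_triangle_ineq[of "f t - F t" "u t"] by linarith
      qed
    qed (use iF iu ih in auto)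
    also have "\<dots> = (\<integral>t. norm (f t - F t) \<partial>lebesgue) + (\<integral>t. norm (u t) \<partial>lebesgue) + (\<integral>t. norm (h t) \<partial>lebesgue)"
      using iF iu ih by simp
    finally show ?thesis using Fe h(3) by linarith
  qed
  \<comment> \<open>The squared L^2 norm forced by an L^1 norm of at least e/4 on an interval of
    length b - a. The weight \<open>\<mu>\<close> below makes Young's inequality sharp at this
    value.\<close>
  define m0 where "m0 = (e / 4)^2 / (b - a)"
  have m0: "m0 > 0" using e ab by (simp add: m0_def)
  have Cm0: "m0 \<le> np 2 u" if u: "u \<in> C" for u
  proof -
    define \<mu> where "\<mu> = e / (4 * (b - a))"
    have lam: "\<mu> > 0" using e ab by (simp add: \<mu>_def)
    have "e / 4 \<le> (\<mu> * (b - a) + np 2 u / \<mu>) / 2"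
      using Cfar[OF u] L1_bound_by_np2(2)[OF CL[OF u] C0[OF u] _ lam] ab by (meson less_imp_le order.trans)
    moreover have "\<mu> * (b - a) = e / 4"
    proof -
      have "x / (4 * w) * w = x / 4" if "w \<noteq> 0" for x w :: real using that by simp
      from this[of "b - a" e] show ?thesis using ab unfolding \<mu>_def by argo
    qed
    ultimately have "e / 4 \<le> np 2 u / \<mu>" by argo
    then have "e / 4 * \<mu> \<le> np 2 u" using lam by (simp add: field_simps)
    moreover have "e / 4 * \<mu> = m0"
    proof -
      have "x / 4 * (x / (4 * w)) = (x / 4)^2 / w" for x w :: real by (simp add: power2_eq_square)
      then show ?thesis unfolding \<mu>_def m0_def .
    qed
    ultimately show ?thesis by simp
  qed
  have Cconv: "(\<lambda>t. u t + s *\<^sub>R (w t - u t)) \<in> C" if u: "u \<in> C" and w: "w \<in> C" and s: "0 \<le> s" "s \<le> 1" for u w s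
  proof -
    obtain d h where h: "Lp 2 h" "\<And>t. t \<notin> ?W \<Longrightarrow> h t = 0" "(\<integral>t. norm (h t) \<partial>lebesgue) \<le> e / 2"
      and u': "u = (\<lambda>t. F t - G d t - h t)" using u by (auto simp: C_def)
    obtain d' h' where h': "Lp 2 h'" "\<And>t. t \<notin> ?W \<Longrightarrow> h' t = 0" "(\<integral>t. norm (h' t) \<partial>lebesgue) \<le> e / 2"
      and w': "w = (\<lambda>t. F t - G d' t - h' t)" using w by (auto simp: C_def)
    let ?h = "\<lambda>t. (1 - s) *\<^sub>R h t + s *\<^sub>R h' t"
    have hL: "Lp 2 ?h" by (intro Lp_add Lp_scaleR h h') simp
    have ih: "integrable lebesgue (\<lambda>t. norm (h t))" "integrable lebesgue (\<lambda>t. norm (h' t))"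
      using i1[OF h(1,2)] i1[OF h'(1,2)] by auto
    have "(\<integral>t. norm (?h t) \<partial>lebesgue) \<le> (\<integral>t. (1 - s) * norm (h t) + s * norm (h' t) \<partial>lebesgue)"
    proof (rule integral_mono)
      show "integrable lebesgue (\<lambda>t. norm (?h t))" by (rule i1[OF hL]) (use h(2) h'(2) in auto)
      show "norm (?h t) \<le> (1 - s) * norm (h t) + s * norm (h' t)" for t
        using norm_triangle_ineq[of "(1 - s) *\<^sub>R h t" "s *\<^sub>R h' t"] s by simp
    qed (use ih in auto)
    also have "\<dots> = (1 - s) * (\<integral>t. norm (h t) \<partial>lebesgue) + s * (\<integral>t. norm (h' t) \<partial>lebesgue)" using ih by simp
    also have "\<dots> \<le> (1 - s) * (e/2) + s * (e/2)"
      using s h(3) h'(3) by (intro add_mono mult_left_mono) auto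
    also have "\<dots> = e/2" by (simp only: distrib_right[symmetric]) simp
    finally have hn: "(\<integral>t. norm (?h t) \<partial>lebesgue) \<le> e/2" .
    have "u t + s *\<^sub>R (w t - u t) = F t - G ((1 - s) *\<^sub>R d + s *\<^sub>R d') t - ?h t" for t
    proof -
      have Gc: "G ((1 - s) *\<^sub>R d + s *\<^sub>R d') t = (1 - s) *\<^sub>R G d t + s *\<^sub>R G d' t" by (simp only: G_add G_scale)
      show ?thesis unfolding Gc by (simp add: u' w' algebra_simps)
    qed
    then have "\<exists>d h. Lp 2 h \<and> (\<forall>t. t \<notin> ?W \<longrightarrow> h t = 0) \<and> (\<integral>t. norm (h t) \<partial>lebesgue) \<le> e / 2 \<and>
      (\<lambda>t. u t + s *\<^sub>R (w t - u t)) = (\<lambda>t. F t - G d t - h t)"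
      using hL hn h(2) h'(2) by (intro exI[of _ "(1 - s) *\<^sub>R d + s *\<^sub>R d'"] exI[of _ ?h]) auto
    then show ?thesis unfolding C_def by blast
  qed
  have FC: "(\<lambda>t. F t - G d t - h t) \<in> C"
    if "Lp 2 h" "\<And>t. t \<notin> ?W \<Longrightarrow> h t = 0" "(\<integral>t. norm (h t) \<partial>lebesgue) \<le> e / 2" for d h
    using that by (auto simp: C_def)
  have FC0: "F \<in> C" using FC[of "\<lambda>t. 0" 0] G_scale[of 0 0] e by simp
  obtain v l m where v: "\<And>k::nat. v k \<in> C" and l: "Lp 2 l" and vl: "(\<lambda>k. np 2 (\<lambda>t. v k t - l t)) \<longlonglongrightarrow> 0"
    and vm: "(\<lambda>k. np 2 (v k)) \<longlonglongrightarrow> m" and min: "\<And>e. e > 0 \<Longrightarrow> \<exists>k::nat. \<forall>u\<in>C. m - e \<le> np 2 u"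
  proof (rule nested_minimisers[of 2 "1 / 2 powr 2" "np 2" "\<lambda>k. C" 0 "np 2 F"])
    show "(\<lambda>t. (1 / 2) *\<^sub>R (u t + v t)) \<in> C" if "u \<in> C" "v \<in> C" for k :: nat and u v
    proof -
      have "(\<lambda>t. u t + (1/2) *\<^sub>R (v t - u t)) = (\<lambda>t. (1 / 2) *\<^sub>R (u t + v t))"
      proof
        fix t
        have "u t + (1/2) *\<^sub>R (v t - u t) = (1/2) *\<^sub>R (u t + u t) + (1/2) *\<^sub>R (v t - u t)"
          by (simp only: scaleR_half_double)
        also have "\<dots> = (1/2) *\<^sub>R ((u t + u t) + (v t - u t))" by (simp only: scaleR_add_right)
        also have "(u t + u t) + (v t - u t) = u t + v t" by simp
        finally show "u t + (1/2) *\<^sub>R (v t - u t) = (1 / 2) *\<^sub>R (u t + v t)" .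
      qed
      then show ?thesis using Cconv[OF that, of "1/2"] by simp
    qed
    show "np 2 (\<lambda>t. (1 / 2) *\<^sub>R (u t + v t)) + 1 / 2 powr 2 * np 2 (\<lambda>t. u t - v t) \<le> (np 2 u + np 2 v) / 2"
      if "Lp 2 u" "Lp 2 v" for u v :: "real \<Rightarrow> 'u"
      using np_Clarkson[OF _ that] by simp
  qed (use CL FC0 that in auto)
  have mC: "m \<le> np 2 u" if "u \<in> C" for u
  proof (rule field_le_epsilon)
    fix e :: real assume "e > 0"
    then show "m \<le> np 2 u + e" using min[of e] that by fastforce
  qed
  have m_pos: "m > 0"
    using LIMSEQ_le_const[OF vm, of m0] Cm0[OF v] m0 by fastforce
  have inner: "m \<le> (\<integral>t. l t \<bullet> c t \<partial>lebesgue)" if c: "c \<in> C" for c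
    by (rule minimal_norm_inner[OF CL[OF v] l vl vm CL[OF c]]) (intro mC Cconv v c; simp)
  define A where "A = (\<integral>t. l t \<bullet> F t \<partial>lebesgue)"
  have split: "m \<le> A - (\<integral>t. l t \<bullet> G d t \<partial>lebesgue) - (\<integral>t. l t \<bullet> h t \<partial>lebesgue)"
    if "Lp 2 h" "\<And>t. t \<notin> ?W \<Longrightarrow> h t = 0" "(\<integral>t. norm (h t) \<partial>lebesgue) \<le> e / 2" for d h
    using inner[OF FC[OF that, of d]] pairing_integrable[OF l FL] pairing_integrable[OF l G(1), of d] pairing_integrable[OF l that(1)]
    by (simp add: inner_diff_right A_def)
  have mA: "m \<le> A" using inner[OF FC0] by (simp add: A_def)
  have A0: "A > 0" using mA m_pos by linarith
  \<comment> \<open>The bound \<open>split\<close> holds for all multiples of \<open>d\<close>. At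
    the multiple A / ?x its right-hand side is 0, although m > 0.\<close>
  have lG: "(\<integral>t. l t \<bullet> G d t \<partial>lebesgue) = 0" for d
  proof (rule ccontr)
    let ?x = "\<integral>t. l t \<bullet> G d t \<partial>lebesgue"
    assume x: "?x \<noteq> 0"
    have "m \<le> A - (\<integral>t. l t \<bullet> G ((A / ?x) *\<^sub>R d) t \<partial>lebesgue) - (\<integral>t. l t \<bullet> 0 \<partial>lebesgue)"
      using e by (intro split) auto
    then show False using x m_pos by (simp add: G_scale)
  qed
  \<comment> \<open>A function parallel to \<open>l\<close>, of L^1 norm e/2 and supported where |l|
    > R, has with \<open>l\<close> a pairing of at least R e/2 = A. By \<open>split\<close> this is
    impossible, so |l| <= R almost everywhere on the interval.\<close>
  define R where "R = 2 * A / e"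
  have R0: "R > 0" using A0 e by (simp add: R_def)
  have lm: "strongly_measurable lebesgue l" by (rule Lp_meas[OF l])
  have [measurable]: "(\<lambda>t. norm (l t)) \<in> borel_measurable lebesgue" by (rule borel_measurable_norm_strongly[OF lm])
  define E where "E = {t \<in> space lebesgue. norm (l t) > R} \<inter> ?W"
  have Es: "E \<in> sets lebesgue"
  proof -
    have "{t \<in> space lebesgue. norm (l t) > R} \<in> sets lebesgue" by measurable
    then show ?thesis unfolding E_def by (intro sets.Int) auto
  qed
  have Ef: "emeasure lebesgue E < \<infinity>"
  proof -
    have "emeasure lebesgue E \<le> emeasure lebesgue ?W" using Es by (intro emeasure_mono) (auto simp: E_def)
    also have "\<dots> < \<infinity>" using ab by simp
    finally show ?thesis .
  qed
  have E_null: "E \<in> null_sets lebesgue"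
  proof (rule ccontr)
    assume "E \<notin> null_sets lebesgue"
    then have "emeasure lebesgue E \<noteq> 0" using Es by blast
    then have mE: "measure lebesgue E > 0" using Ef by (simp add: measure_def enn2real_positive_iff less_top zero_less_iff_neq_zero)
    define c where "c = e / (2 * measure lebesgue E)"
    have c0: "c > 0" using e mE by (simp add: c_def)
    define h where "h = (\<lambda>t. if t \<in> E then (c / norm (l t)) *\<^sub>R l t else 0)"
    have hm: "strongly_measurable lebesgue h"
      unfolding h_def by (intro strongly_measurable_cut Es strongly_measurable_scaleR lm strongly_measurable_borel) measurable
    have nh: "norm (h t) = c * indicator E t" for t
      using R0 c0 by (auto simp: h_def E_def indicator_def)
    have hL: "Lp 2 h"
      by (rule Lp_bounded(1)[OF hm, of c 2 a b]) (use nh c0 ab in \<open>auto simp: indicator_def h_def E_def\<close>)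
    have iE: "integrable lebesgue (indicat_real E)" using Es Ef by (rule integrable_real_indicator)
    have "(\<integral>t. norm (h t) \<partial>lebesgue) = c * measure lebesgue E" unfolding nh using Es by simp
    also have "\<dots> = e / 2" using mE by (simp add: c_def)
    finally have hn: "(\<integral>t. norm (h t) \<partial>lebesgue) \<le> e / 2" by simp
    have "R * (e / 2) = (\<integral>t. R * c * indicator E t \<partial>lebesgue)" using Es mE by (simp add: c_def)
    also have "\<dots> \<le> (\<integral>t. l t \<bullet> h t \<partial>lebesgue)"
    proof (rule integral_mono)
      show "integrable lebesgue (\<lambda>t. R * c * indicator E t)" using iE by simp
      show "integrable lebesgue (\<lambda>t. l t \<bullet> h t)" by (rule pairing_integrable[OF l hL])
      show "R * c * indicator E t \<le> l t \<bullet> h t" for t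
      proof (cases "t \<in> E")
        case True
        then have n: "norm (l t) > R" by (simp add: E_def)
        then have "l t \<bullet> h t = c * norm (l t)"
          using True R0 by (simp add: h_def power2_norm_eq_inner[symmetric] power2_eq_square)
        then show ?thesis using True n c0 by (simp add: mult.commute)
      qed (simp add: h_def)
    qed
    finally have "A \<le> (\<integral>t. l t \<bullet> h t \<partial>lebesgue)" using e by (simp add: R_def)
    moreover have "m \<le> A - (\<integral>t. l t \<bullet> G 0 t \<partial>lebesgue) - (\<integral>t. l t \<bullet> h t \<partial>lebesgue)"
      by (rule split[OF hL _ hn]) (auto simp: h_def E_def)
    ultimately show False using lG[of 0] m_pos by linarith
  qed
  define v' where "v' = (\<lambda>t. if t \<in> ?W - E then l t else 0)"
  have v'm: "strongly_measurable lebesgue v'" unfolding v'_def using Es by (intro strongly_measurable_cut lm) auto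
  have v'b: "norm (v' t) \<le> R" for t using R0 by (auto simp: v'_def E_def)
  have v'0: "v' t = 0" if "t \<notin> ?W" for t using that by (auto simp: v'_def)
  have v'L: "Lp 2 v'" by (rule Lp_bounded(1)[OF v'm v'b _ v'0]) (use ab in auto)
  have eq: "(\<integral>t. v' t \<bullet> w t \<partial>lebesgue) = (\<integral>t. l t \<bullet> w t \<partial>lebesgue)"
    if w: "strongly_measurable lebesgue w" "\<And>t. t \<notin> ?W \<Longrightarrow> w t = 0" for w
  proof (rule integral_cong_AE)
    show "AE t in lebesgue. v' t \<bullet> w t = l t \<bullet> w t"
      using AE_not_in[OF E_null] by eventually_elim (use w(2) in \<open>auto simp: v'_def\<close>)
  qed (intro borel_measurable_inner_strongly v'm lm w)+
  have vf: "(\<integral>t. v' t \<bullet> f t \<partial>lebesgue) = 0"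
    by (rule ann[OF v'm v'b v'0]) (use eq[OF Lp_meas[OF G(1)] G(2)] lG in auto)
  have vF: "(\<integral>t. v' t \<bullet> F t \<partial>lebesgue) = A" unfolding A_def by (rule eq[OF Fm F0])
  have iF: "integrable lebesgue (\<lambda>t. norm (f t - F t))" by (intro idiff f Fm i1[OF FL F0])
  have ib: "integrable lebesgue (\<lambda>t. v' t \<bullet> (f t - F t))"
  proof (rule Bochner_Integration.integrable_bound)
    show "integrable lebesgue (\<lambda>t. R * norm (f t - F t))" using iF by simp
    show "(\<lambda>t. v' t \<bullet> (f t - F t)) \<in> borel_measurable lebesgue"
      by (intro borel_measurable_inner_strongly v'm strongly_measurable_diff f Fm)
    show "AE t in lebesgue. norm (v' t \<bullet> (f t - F t)) \<le> norm (R * norm (f t - F t))"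
    proof (rule AE_I2)
      fix t
      have "\<bar>v' t \<bullet> (f t - F t)\<bar> \<le> norm (v' t) * norm (f t - F t)" by (rule Cauchy_Schwarz_ineq2)
      also have "\<dots> \<le> R * norm (f t - F t)" by (intro mult_right_mono v'b) auto
      finally show "norm (v' t \<bullet> (f t - F t)) \<le> norm (R * norm (f t - F t))" using R0 by simp
    qed
  qed
  \<comment> \<open>The truncation error changes the pairing by less than R e/4 = A/2. This
    contradicts the values 0 for the pairing of \<open>v'\<close> with \<open>f\<close> and A for
    that with \<open>F\<close>.\<close>
  have "(\<integral>t. v' t \<bullet> (f t - F t) \<partial>lebesgue) \<ge> (\<integral>t. - (R * norm (f t - F t)) \<partial>lebesgue)"
  proof (rule integral_mono)
    show "- (R * norm (f t - F t)) \<le> v' t \<bullet> (f t - F t)" for t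
    proof -
      have "\<bar>v' t \<bullet> (f t - F t)\<bar> \<le> norm (v' t) * norm (f t - F t)" by (rule Cauchy_Schwarz_ineq2)
      also have "\<dots> \<le> R * norm (f t - F t)" by (intro mult_right_mono v'b) auto
      finally show ?thesis by linarith
    qed
  qed (use iF ib in auto)
  also have "(\<integral>t. - (R * norm (f t - F t)) \<partial>lebesgue) = - (R * (\<integral>t. norm (f t - F t) \<partial>lebesgue))" by simp
  finally have "- (R * (\<integral>t. norm (f t - F t) \<partial>lebesgue)) \<le> (\<integral>t. v' t \<bullet> (f t - F t) \<partial>lebesgue)" by simp
  moreover have "(\<integral>t. v' t \<bullet> f t \<partial>lebesgue) = (\<integral>t. v' t \<bullet> F t \<partial>lebesgue) + (\<integral>t. v' t \<bullet> (f t - F t) \<partial>lebesgue)"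
  proof -
    have "(\<integral>t. v' t \<bullet> f t \<partial>lebesgue) = (\<integral>t. v' t \<bullet> F t + v' t \<bullet> (f t - F t) \<partial>lebesgue)"
      by (intro Bochner_Integration.integral_cong) (simp_all add: inner_diff_right)
    then show ?thesis using ib pairing_integrable[OF v'L FL] by simp
  qed
  moreover have "R * (\<integral>t. norm (f t - F t) \<partial>lebesgue) < R * (e / 4)"
    using Fe R0 by (rule mult_strict_left_mono)
  moreover have "R * (e / 4) = A / 2" using e by (simp add: R_def)
  ultimately show False using vf vF A0 by linarith
qed

section \<open>Continuity of translations in L^p\<close>

text \<open>Squeeze \<open>E\<close> between a compact \<open>K\<close> and an open
  \<open>Op\<close>. A shift shorter than the radius \<eta> of balls around \<open>K\<close> that
  fit into \<open>Op\<close> keeps \<open>K\<close> inside \<open>Op\<close>. A mismatch can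
  therefore occur only in Op - K or in its translate; counting this set twice explains the bounds
  e/4.\<close>

lemma measure_symmetric_difference_shift:
  fixes E :: "real set"
  assumes E: "E \<in> sets lebesgue" "E \<subseteq> {a<..<b}" and e: "e > 0"
  obtains \<eta> where "\<eta> > 0" "\<And>\<delta>. \<bar>\<delta>\<bar> < \<eta> \<Longrightarrow> \<exists>D\<in>lmeasurable. measure lebesgue D < e \<and>
     (\<forall>t. (t \<in> E) \<noteq> (t - \<delta> \<in> E) \<longrightarrow> t \<in> D)"
proof -
  obtain Op where Op: "open Op" "E \<subseteq> Op" "Op - E \<in> lmeasurable" "emeasure lebesgue (Op - E) < ennreal (e / 4)"
    using sets_lebesgue_outer_open[OF E(1), of "e / 4"] e by auto
  obtain K where K: "closed K" "K \<subseteq> E" "E - K \<in> lmeasurable" "emeasure lebesgue (E - K) < ennreal (e / 4)"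
    using sets_lebesgue_inner_closed[OF E(1), of "e / 4"] e by auto
  have "bounded K" by (rule bounded_subset[of "{a<..<b}"]) (use K E in auto)
  then have "compact K" using K(1) compact_eq_bounded_closed by blast
  moreover have "K \<subseteq> Op" using K Op by blast
  ultimately obtain \<eta> where eta: "\<eta> > 0" "(\<Union>x\<in>K. ball x \<eta>) \<subseteq> Op"
    using compact_subset_open_imp_ball_epsilon_subset[OF _ Op(1)] by blast
  define H where "H = (Op - E) \<union> (E - K)"
  have H: "H \<in> lmeasurable" using Op(3) K(3) by (simp add: H_def fmeasurable.Un)
  have "measure lebesgue H \<le> measure lebesgue (Op - E) + measure lebesgue (E - K)"
    unfolding H_def using Op(3) K(3) by (intro measure_Un_le) auto
  also have "measure lebesgue (Op - E) < e / 4"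
    using Op(4) e by (metis emeasure_eq_measure2[OF Op(3)] ennreal_less_iff measure_nonneg)
  also have "measure lebesgue (E - K) < e / 4"
    using K(4) e by (metis emeasure_eq_measure2[OF K(3)] ennreal_less_iff measure_nonneg)
  finally have mH: "measure lebesgue H < e / 2" by simp
  have "\<exists>D\<in>lmeasurable. measure lebesgue D < e \<and> (\<forall>t. (t \<in> E) \<noteq> (t - \<delta> \<in> E) \<longrightarrow> t \<in> D)"
    if d: "\<bar>\<delta>\<bar> < \<eta>" for \<delta>
  proof (intro bexI conjI allI impI)
    have HT: "(+) \<delta> ` H \<in> lmeasurable" by (rule measurable_translation[OF H])
    show "H \<union> (+) \<delta> ` H \<in> lmeasurable" using H HT by (rule fmeasurable.Un)
    have "measure lebesgue (H \<union> (+) \<delta> ` H) \<le> measure lebesgue H + measure lebesgue ((+) \<delta> ` H)"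
      using H HT by (intro measure_Un_le) auto
    then show "measure lebesgue (H \<union> (+) \<delta> ` H) < e" using mH by (simp add: measure_translation)
    fix t assume t: "(t \<in> E) \<noteq> (t - \<delta> \<in> E)"
    have near: "x + s \<in> Op" if "x \<in> K" "\<bar>s\<bar> < \<eta>" for x s
    proof -
      have "x + s \<in> ball x \<eta>" using that by (simp add: dist_norm)
      then show ?thesis using eta(2) that(1) by blast
    qed
    have im: "t \<in> (+) \<delta> ` H" if "t - \<delta> \<in> H"
    proof -
      have "t = \<delta> + (t - \<delta>)" by simp
      then show ?thesis using that by blast
    qed
    show "t \<in> H \<union> (+) \<delta> ` H"
    proof (cases "t \<in> E")
      case True
      then have n: "t - \<delta> \<notin> E" using t by blast
      show ?thesis
      proof (cases "t \<in> K")
        case True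
        then have "t - \<delta> \<in> Op" using near[of t "-\<delta>"] d by simp
        then show ?thesis using n im by (auto simp: H_def)
      qed (use \<open>t \<in> E\<close> in \<open>auto simp: H_def\<close>)
    next
      case False
      then have i: "t - \<delta> \<in> E" using t by blast
      show ?thesis
      proof (cases "t - \<delta> \<in> K")
        case True
        then have "t \<in> Op" using near[of "t - \<delta>" \<delta>] d by simp
        then show ?thesis using False by (auto simp: H_def)
      qed (use i im in \<open>auto simp: H_def\<close>)
    qed
  qed
  then show ?thesis using that eta(1) by blast
qed

text \<open>A simple approximant reduces the claim to its finitely many level sets, where the
  mismatch after a small shift has small measure. The argument is for finite p: a jump of fixed
  height is small in the mean only because it occurs on a small set.\<close>

lemma np_shift_continuous:
  fixes u :: "real \<Rightarrow> 'u::real_normed_vector"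
  assumes p: "p > 0" and u: "strongly_measurable lebesgue u" and M: "\<And>t. norm (u t) \<le> M"
    and supp: "\<And>t. t \<notin> {a<..<b} \<Longrightarrow> u t = 0" and ab: "a \<le> b" and e: "e > 0"
  obtains \<eta> where "\<eta> > 0" "\<And>\<delta>. \<bar>\<delta>\<bar> < \<eta> \<Longrightarrow> np p (\<lambda>t. u (t - \<delta>) - u t) < e"
proof -
  have p0: "p \<ge> 0" using p by simp
  have M0: "M \<ge> 0" using M[of 0] norm_ge_zero order.trans by blast
  have uL: "Lp p u" by (rule Lp_bounded(1)[OF u M p0 supp ab])
  define \<epsilon> where "\<epsilon> = e / (4 * 2 powr p * 2 powr p)"
  have eps: "\<epsilon> > 0" using e by (simp add: \<epsilon>_def)
  have "p \<noteq> 0" using p by simp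
  then obtain s where s: "simple_function lebesgue s" "Lp p s" "np p (\<lambda>t. u t - s t) < \<epsilon>" "\<And>t. norm (s t) \<le> 2 * norm (u t)"
    using Lp_simple_approximation[OF p0 _ uL eps] by blast
  have s0: "s t = 0" if "t \<notin> {a<..<b}" for t using s(4)[of t] supp[OF that] by simp
  have sM: "norm (s t) \<le> 2 * M" for t using s(4)[of t] M[of t] by linarith
  \<comment> \<open>The value 0 is left out, since its level set is unbounded. Whenever s t and s (t
    - \<delta>) differ, at least one of them lies in \<open>Y\<close>.\<close>
  define Y where "Y = s ` UNIV - {0}"
  have Yf: "finite Y" using simple_functionD(1)[OF s(1)] by (simp add: Y_def)
  have Ym: "s -` {y} \<in> sets lebesgue" for y using simple_functionD(2)[OF s(1), of "{y}"] by simp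
  have Ysub: "s -` {y} \<subseteq> {a<..<b}" if "y \<in> Y" for y
  proof
    fix t assume "t \<in> s -` {y}"
    then have "s t \<noteq> 0" using that by (auto simp: Y_def)
    then show "t \<in> {a<..<b}" using s0 by blast
  qed
  \<comment> \<open>The approximant is bounded by 2 M, so its jumps are at most 4 M. Adding 1 keeps
    \<open>c\<close> positive when M = 0.\<close>
  define c where "c = (4 * M + 1) powr p"
  have c0: "c > 0" using M0 by (simp add: c_def)
  define \<epsilon>' where "\<epsilon>' = \<epsilon> / (c * (real (card Y) + 1))"
  have eps': "\<epsilon>' > 0" using eps c0 by (simp add: \<epsilon>'_def)
  have "\<forall>y\<in>Y. \<exists>\<eta>>0. \<forall>\<delta>. \<bar>\<delta>\<bar> < \<eta> \<longrightarrow> (\<exists>D\<in>lmeasurable. measure lebesgue D < \<epsilon>' \<and>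
     (\<forall>t. (t \<in> s -` {y}) \<noteq> (t - \<delta> \<in> s -` {y}) \<longrightarrow> t \<in> D))"
    using measure_symmetric_difference_shift[OF Ym Ysub eps'] by metis
  then obtain h where h: "\<And>y. y \<in> Y \<Longrightarrow> h y > 0" "\<And>y \<delta>. y \<in> Y \<Longrightarrow> \<bar>\<delta>\<bar> < h y \<Longrightarrow> (\<exists>D\<in>lmeasurable. measure lebesgue D < \<epsilon>' \<and>
     (\<forall>t. (t \<in> s -` {y}) \<noteq> (t - \<delta> \<in> s -` {y}) \<longrightarrow> t \<in> D))" by metis
  define \<eta> where "\<eta> = Min (insert 1 (h ` Y))"
  have eta: "\<eta> > 0" unfolding \<eta>_def using Yf h(1) by (subst Min_gr_iff) auto
  have eta_le: "\<eta> \<le> h y" if "y \<in> Y" for y unfolding \<eta>_def using Yf that by (intro Min_le) auto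
  have "np p (\<lambda>t. u (t - \<delta>) - u t) < e" if d: "\<bar>\<delta>\<bar> < \<eta>" for \<delta>
  proof -
    have "\<exists>D\<in>lmeasurable. measure lebesgue D < \<epsilon>' \<and>
     (\<forall>t. (t \<in> s -` {y}) \<noteq> (t - \<delta> \<in> s -` {y}) \<longrightarrow> t \<in> D)" if "y \<in> Y" for y
      using h(2)[OF that] eta_le[OF that] d by fastforce
    then obtain D where D: "\<And>y. y \<in> Y \<Longrightarrow> D y \<in> lmeasurable" "\<And>y. y \<in> Y \<Longrightarrow> measure lebesgue (D y) < \<epsilon>'"
      "\<And>y t. y \<in> Y \<Longrightarrow> (s t = y) \<noteq> (s (t - \<delta>) = y) \<Longrightarrow> t \<in> D y" by (simp add: vimage_def) metis
    have sL: "Lp p (\<lambda>t. s (t - \<delta>))" by (rule Lp_shift[OF s(2)])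
    have uL': "Lp p (\<lambda>t. u (t - \<delta>))" by (rule Lp_shift[OF uL])
    let ?g = "\<lambda>t. c * (\<Sum>y\<in>Y. indicator (D y) t)"
    have Di: "integrable lebesgue (indicat_real (D y))" if "y \<in> Y" for y
      using D(1)[OF that] by (intro integrable_real_indicator) (auto simp: fmeasurable_def)
    have gi: "integrable lebesgue ?g" by (intro integrable_mult_right Bochner_Integration.integrable_sum Di)
    have le: "norm (s (t - \<delta>) - s t) powr p \<le> ?g t" for t
    proof (cases "s (t - \<delta>) = s t")
      case True
      then show ?thesis using p c0 by (auto intro!: mult_nonneg_nonneg sum_nonneg)
    next
      case False
      obtain y where y: "y \<in> Y" "(s t = y) \<noteq> (s (t - \<delta>) = y)"
        using False by (cases "s t = 0") (auto simp: Y_def)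
      have "norm (s (t - \<delta>) - s t) \<le> 4 * M + 1"
        using norm_triangle_ineq4[of "s (t - \<delta>)" "s t"] sM[of t] sM[of "t - \<delta>"] by linarith
      then have "norm (s (t - \<delta>) - s t) powr p \<le> c" unfolding c_def using p by (intro powr_mono2) auto
      moreover have "(1::real) \<le> (\<Sum>y\<in>Y. indicator (D y) t)"
      proof -
        have "(1::real) = indicator (D y) t" using D(3)[OF y] by simp
        also have "\<dots> \<le> (\<Sum>y\<in>Y. indicator (D y) t)"
          by (rule member_le_sum[OF y(1)]) (use Yf in auto)
        finally show ?thesis .
      qed
      then have "c * 1 \<le> ?g t" using c0 by (intro mult_left_mono) auto
      ultimately show ?thesis by linarith
    qed
    have sd: "np p (\<lambda>t. s (t - \<delta>) - s t) \<le> \<epsilon>"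
    proof -
      have "np p (\<lambda>t. s (t - \<delta>) - s t) \<le> (\<integral>t. ?g t \<partial>lebesgue)"
        using le by (intro np_mono[OF Lp_diff[OF p0 sL s(2)] gi]) auto
      also have "\<dots> = c * (\<Sum>y\<in>Y. measure lebesgue (D y))"
        using Di D(1) by (simp add: fmeasurable_def)
      also have "\<dots> \<le> c * (\<Sum>y\<in>Y. \<epsilon>')" using D(2) c0 by (intro mult_left_mono sum_mono) (auto intro: less_imp_le)
      also have "\<dots> = \<epsilon> * (real (card Y) / (real (card Y) + 1))" using c0 by (simp add: \<epsilon>'_def)
      also have "\<dots> \<le> \<epsilon> * 1" using eps by (intro mult_left_mono) auto
      finally show ?thesis by simp
    qed
    have "np p (\<lambda>t. u (t - \<delta>) - u t) \<le> 2 powr p * (np p (\<lambda>t. u (t - \<delta>) - s (t - \<delta>)) + np p (\<lambda>t. s (t - \<delta>) - u t))"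
      by (rule np_triangle[OF p0 uL' sL uL])
    also have "np p (\<lambda>t. s (t - \<delta>) - u t) \<le> 2 powr p * (np p (\<lambda>t. s (t - \<delta>) - s t) + np p (\<lambda>t. s t - u t))"
      by (rule np_triangle[OF p0 sL s(2) uL])
    also have "np p (\<lambda>t. s t - u t) < \<epsilon>" using s(3) by (subst np_minus_commute)
    also have "np p (\<lambda>t. u (t - \<delta>) - s (t - \<delta>)) = np p (\<lambda>t. u t - s t)"
      unfolding np_def using lebesgue_integral_real_affine[of 1 "\<lambda>t. norm (u t - s t) powr p" "-\<delta>"] by simp
    also have "np p (\<lambda>t. u t - s t) < \<epsilon>" by (rule s(3))
    also note sd
    finally have "np p (\<lambda>t. u (t - \<delta>) - u t) < 2 powr p * (\<epsilon> + 2 powr p * (\<epsilon> + \<epsilon>))" by simp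
    also have "\<dots> \<le> 2 powr p * (2 powr p * \<epsilon> + 2 powr p * (\<epsilon> + \<epsilon>))"
    proof -
      have "1 * \<epsilon> \<le> 2 powr p * \<epsilon>" using p eps by (intro mult_right_mono) (auto intro: ge_one_powr_ge_zero)
      then show ?thesis by (intro mult_left_mono add_right_mono) simp_all
    qed
    also have "\<dots> = 3 * (2 powr p * 2 powr p * \<epsilon>)" by (simp add: algebra_simps)
    also have "2 powr p * 2 powr p * \<epsilon> = e / 4" by (simp add: \<epsilon>_def)
    finally show ?thesis using e by simp
  qed
  then show ?thesis using that eta by blast
qed

section \<open>Strongly continuous semigroups and their adjoints\<close>

lemma norm_le_if_inner_le:
  fixes x :: "'a::real_inner"
  assumes "\<And>z. x \<bullet> z \<le> c * norm z" and "c \<ge> 0"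
  shows "norm x \<le> c"
proof (cases "x = 0")
  case False
  have "norm x * norm x \<le> c * norm x"
    using assms(1)[of x] by (simp add: power2_norm_eq_inner[symmetric] power2_eq_square)
  then show ?thesis using False by simp
qed (use assms in simp)

lemma norm_divideR_le:
  fixes x :: "'a::real_normed_vector"
  shows "h > 0 \<Longrightarrow> norm x \<le> h * c \<Longrightarrow> norm (x /\<^sub>R h) \<le> c"
  by (simp add: field_simps)

locale semigroup_system =
  fixes S :: "real \<Rightarrow> 'x::{real_inner,complete_space} \<Rightarrow> 'x"
  assumes C0: "C0_semigroup S"
begin

lemma bounded_linear_S: "t \<ge> 0 \<Longrightarrow> bounded_linear (S t)"
  and S_0 [simp]: "S 0 x = x"
  and S_add: "s \<ge> 0 \<Longrightarrow> t \<ge> 0 \<Longrightarrow> S (s + t) x = S s (S t x)"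
  and S_tendsto_0: "((\<lambda>t. S t x) \<longlongrightarrow> x) (at_right 0)"
  using C0 by (auto simp: C0_semigroup_def)

lemma S_linear:
  assumes "t \<ge> 0"
  shows "S t (x + y) = S t x + S t y" "S t (x - y) = S t x - S t y" "S t (c *\<^sub>R x) = c *\<^sub>R S t x" "S t 0 = 0"
    "S t (- x) = - S t x"
proof -
  interpret bounded_linear "S t" by (rule bounded_linear_S[OF assms])
  show "S t (x + y) = S t x + S t y" "S t (x - y) = S t x - S t y" "S t (c *\<^sub>R x) = c *\<^sub>R S t x" "S t 0 = 0" "S t (- x) = - S t x"
    by (simp_all add: add diff scaleR zero neg)
qed

lemma S_near_0:
  assumes "e > 0"
  obtains d where "d > 0" "\<And>t. 0 \<le> t \<Longrightarrow> t < d \<Longrightarrow> norm (S t x - x) < e"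
proof -
  have "eventually (\<lambda>t. dist (S t x) x < e) (at_right 0)"
    using S_tendsto_0 assms by (rule tendstoD)
  then obtain d where d: "d > 0" "\<And>t. 0 < t \<Longrightarrow> t < d \<Longrightarrow> dist (S t x) x < e"
    by (auto simp: eventually_at_right_field)
  have "norm (S t x - x) < e" if "0 \<le> t" "t < d" for t
    using that d(2)[of t] assms by (cases "t = 0") (auto simp: dist_norm)
  with d(1) show ?thesis using that by blast
qed

text \<open>If this fails, there are times \<tau> n <= 1/(n+1) at which the operator norm exceeds n
  + 1. Along these times every orbit converges, so the operators are pointwise bounded, which
  contradicts uniform boundedness.\<close>

lemma S_bounded_near_0: "\<exists>d>0. \<exists>K\<ge>1. \<forall>t x. 0 \<le> t \<longrightarrow> t \<le> d \<longrightarrow> norm (S t x) \<le> K * norm x"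
proof (rule ccontr)
  assume no: "\<not> ?thesis"
  have "\<exists>t x. 0 \<le> t \<and> t \<le> inverse (real (Suc n)) \<and> norm (S t x) > real (Suc n) * norm x" for n
  proof (rule ccontr)
    assume "\<not> ?thesis"
    then have "\<forall>t x. 0 \<le> t \<longrightarrow> t \<le> inverse (real (Suc n)) \<longrightarrow> norm (S t x) \<le> real (Suc n) * norm x"
      by (meson not_less)
    then show False using no by (metis inverse_positive_iff_positive of_nat_0_less_iff of_nat_1 of_nat_le_iff Suc_le_mono le0 zero_less_Suc One_nat_def)
  qed
  then obtain \<tau> y where \<tau>: "\<And>n. 0 \<le> \<tau> n" "\<And>n. \<tau> n \<le> inverse (real (Suc n))"
    and y: "\<And>n. norm (S (\<tau> n) (y n)) > real (Suc n) * norm (y n)" by metis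
  have "\<tau> \<longlonglongrightarrow> 0"
    by (rule tendsto_sandwich[OF _ _ tendsto_const LIMSEQ_inverse_real_of_nat]) (use \<tau> in auto)
  have "\<exists>C. \<forall>n. norm (S (\<tau> n) x) \<le> C" for x
  proof -
    have "(\<lambda>n. S (\<tau> n) x) \<longlonglongrightarrow> x"
    proof (rule LIMSEQ_I)
      fix e :: real assume "e > 0"
      then obtain d where d: "d > 0" "\<And>t. 0 \<le> t \<Longrightarrow> t < d \<Longrightarrow> norm (S t x - x) < e"
        using S_near_0 by blast
      have "eventually (\<lambda>n. \<tau> n < d) sequentially" using \<open>\<tau> \<longlonglongrightarrow> 0\<close> d(1) by (rule order_tendstoD)
      then show "\<exists>N. \<forall>n\<ge>N. norm (S (\<tau> n) x - x) < e"
        using d(2) \<tau>(1) by (auto simp: eventually_sequentially)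
    qed
    then have "Bseq (\<lambda>n. S (\<tau> n) x)" using convergentI convergent_imp_Bseq by blast
    then show ?thesis by (auto simp: Bseq_def)
  qed
  then obtain K where K: "\<And>n x. norm (S (\<tau> n) x) \<le> K * norm x"
    using uniform_boundedness[of "\<lambda>n. S (\<tau> n)"] bounded_linear_S[OF \<tau>(1)] by blast
  obtain n where n: "K \<le> real n" using real_arch_simple by blast
  have "real (Suc n) * norm (y n) < K * norm (y n)" using y[of n] K[of n "y n"] by linarith
  moreover have "K * norm (y n) \<le> real (Suc n) * norm (y n)" using n by (intro mult_right_mono) auto
  ultimately show False by linarith
qed

lemma S_bounded:
  obtains K where "K \<ge> 1" "\<And>t x. 0 \<le> t \<Longrightarrow> t \<le> T \<Longrightarrow> norm (S t x) \<le> K * norm x"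
proof -
  obtain d K where d: "d > 0" and K: "K \<ge> 1" "\<And>t x. 0 \<le> t \<Longrightarrow> t \<le> d \<Longrightarrow> norm (S t x) \<le> K * norm x"
    using S_bounded_near_0 by blast
  have iter: "norm (S t x) \<le> K ^ Suc n * norm x" if "0 \<le> t" "t \<le> real (Suc n) * d" for n t x
    using that
  proof (induction n arbitrary: t)
    case 0
    then show ?case using K(2)[of t x] by simp
  next
    case (Suc n)
    show ?case
    proof (cases "t \<le> d")
      case True
      then have "norm (S t x) \<le> K * norm x" using K(2) Suc.prems by blast
      also have "\<dots> \<le> K ^ Suc (Suc n) * norm x"
        using K(1) self_le_power[of K "Suc (Suc n)"] by (intro mult_right_mono) auto
      finally show ?thesis .
    next
      case False
      have "S t x = S d (S (t - d) x)" using S_add[of d "t - d" x] False d by simp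
      then have "norm (S t x) \<le> K * norm (S (t - d) x)" using K(2)[of d] d by simp
      also have "\<dots> \<le> K * (K ^ Suc n * norm x)"
        using K(1) Suc.prems False by (intro mult_left_mono Suc.IH) (auto simp: algebra_simps)
      finally show ?thesis by simp
    qed
  qed
  obtain n where n: "T < real n * d" using reals_Archimedean3[OF d] by blast
  show ?thesis
  proof (rule that[of "K ^ Suc n"])
    show "1 \<le> K ^ Suc n" using K(1) by (rule one_le_power)
    show "norm (S t x) \<le> K ^ Suc n * norm x" if "0 \<le> t" "t \<le> T" for t x
    proof (rule iter[OF that(1)])
      have "real n * d \<le> real (Suc n) * d" using d by (intro mult_right_mono) auto
      then show "t \<le> real (Suc n) * d" using n that(2) by linarith
    qed
  qed
qed

lemma S_uniformly_near:
  assumes "e > 0"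
  obtains d where "d > 0" "\<And>s t. 0 \<le> s \<Longrightarrow> 0 \<le> t \<Longrightarrow> s \<le> T \<Longrightarrow> t \<le> T \<Longrightarrow> \<bar>s - t\<bar> < d \<Longrightarrow> norm (S s x - S t x) < e"
proof -
  obtain K where K: "K \<ge> 1" "\<And>t x. 0 \<le> t \<Longrightarrow> t \<le> T \<Longrightarrow> norm (S t x) \<le> K * norm x"
    using S_bounded by blast
  obtain d where d: "d > 0" "\<And>t. 0 \<le> t \<Longrightarrow> t < d \<Longrightarrow> norm (S t x - x) < e / K"
    using S_near_0[of "e / K"] assms K(1) by (metis divide_pos_pos less_le_trans zero_less_one)
  have half: "norm (S t x - S s x) < e" if "0 \<le> s" "s \<le> t" "t \<le> T" "t - s < d" for s t
  proof -
    have "S t x - S s x = S s (S (t - s) x - x)"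
      using that S_add[of s "t - s" x] by (simp add: S_linear)
    then have "norm (S t x - S s x) \<le> K * norm (S (t - s) x - x)" using K(2)[of s] that by simp
    also have "\<dots> < K * (e / K)" using d(2)[of "t - s"] that K(1) by (intro mult_strict_left_mono) auto
    finally show ?thesis using K(1) by simp
  qed
  show ?thesis
  proof (rule that[OF d(1)])
    show "norm (S s x - S t x) < e" if "0 \<le> s" "0 \<le> t" "s \<le> T" "t \<le> T" "\<bar>s - t\<bar> < d" for s t
      using half[of s t] half[of t s] that by (cases "s \<le> t") (auto simp: norm_minus_commute)
  qed
qed

lemma S_continuous_on: "continuous_on {0..T} (\<lambda>t. S t x)"
  unfolding continuous_on_iff
proof (intro ballI allI impI)
  fix t e :: real assume t: "t \<in> {0..T}" and e: "e > 0"
  obtain d where d: "d > 0" "\<And>s t. 0 \<le> s \<Longrightarrow> 0 \<le> t \<Longrightarrow> s \<le> T \<Longrightarrow> t \<le> T \<Longrightarrow> \<bar>s - t\<bar> < d \<Longrightarrow> norm (S s x - S t x) < e"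
    using S_uniformly_near[OF e] by blast
  then show "\<exists>d>0. \<forall>s\<in>{0..T}. dist s t < d \<longrightarrow> dist (S s x) (S t x) < e"
    using t by (intro exI[of _ d]) (auto simp: dist_norm)
qed

text \<open>Weak integrals: the Bochner integral of the library needs a second countable space.\<close>

definition weak_integral :: "real \<Rightarrow> 'x \<Rightarrow> 'x" where
  "weak_integral h x = (SOME y. \<forall>z. y \<bullet> z = integral {0..h} (\<lambda>s. S s x \<bullet> z))"

lemma inner_S_integrable: "(\<lambda>s. S s x \<bullet> z) integrable_on {a..b}" if "0 \<le> a"
proof (rule integrable_continuous_real)
  have "continuous_on {0..b} (\<lambda>s. S s x \<bullet> z)" by (intro continuous_intros S_continuous_on)
  then show "continuous_on {a..b} (\<lambda>s. S s x \<bullet> z)" by (rule continuous_on_subset) (use that in auto)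
qed

text \<open>The comparison vector \<open>y\<close> is free: 0 yields operator bounds, while
  \<open>x\<close> and \<open>S h x\<close> yield the limits of averages and of difference
  quotients.\<close>

lemma inner_S_integral_bound:
  assumes ab: "0 \<le> a" "a \<le> b" and c: "\<And>s. a \<le> s \<Longrightarrow> s \<le> b \<Longrightarrow> norm (S s x - y) \<le> c"
  shows "\<bar>integral {a..b} (\<lambda>s. S s x \<bullet> z) - (b - a) * (y \<bullet> z)\<bar> \<le> (b - a) * (c * norm z)"
proof -
  have "integral {a..b} (\<lambda>s. S s x \<bullet> z) - (b - a) * (y \<bullet> z) = integral {a..b} (\<lambda>s. (S s x - y) \<bullet> z)"
  proof -
    have "integral {a..b} (\<lambda>s. S s x \<bullet> z - y \<bullet> z) = integral {a..b} (\<lambda>s. S s x \<bullet> z) - integral {a..b} (\<lambda>s. y \<bullet> z)"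
      by (rule Henstock_Kurzweil_Integration.integral_diff[OF inner_S_integrable[OF ab(1)] integrable_const_ivl])
    then show ?thesis using ab(2) by (simp add: inner_diff_left)
  qed
  also have "norm \<dots> \<le> (c * norm z) * (b - a)"
  proof (rule integral_bound[OF ab(2)])
    have "continuous_on {a..b} (\<lambda>s. S s x)" by (rule continuous_on_subset[OF S_continuous_on[of b]]) (use ab in auto)
    then show "continuous_on {a..b} (\<lambda>s. (S s x - y) \<bullet> z)" by (intro continuous_intros)
    fix s assume "s \<in> {a..b}"
    then have "norm (S s x - y) \<le> c" using c by auto
    then show "norm ((S s x - y) \<bullet> z) \<le> c * norm z"
      using Cauchy_Schwarz_ineq2[of "S s x - y" z] by (simp add: mult_right_mono order.trans)
  qed
  finally show ?thesis by (simp add: mult.commute)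
qed

lemma inner_weak_integral:
  assumes h: "h \<ge> 0"
  shows "weak_integral h x \<bullet> z = integral {0..h} (\<lambda>s. S s x \<bullet> z)"
proof -
  obtain K where K: "K \<ge> 1" "\<And>t x. 0 \<le> t \<Longrightarrow> t \<le> h \<Longrightarrow> norm (S t x) \<le> K * norm x"
    using S_bounded by blast
  have "bounded_linear (\<lambda>z. integral {0..h} (\<lambda>s. S s x \<bullet> z))"
  proof (rule bounded_linear_intro)
    show "integral {0..h} (\<lambda>s. S s x \<bullet> (z + z')) = integral {0..h} (\<lambda>s. S s x \<bullet> z) + integral {0..h} (\<lambda>s. S s x \<bullet> z')" for z z'
      by (simp add: inner_add_right Henstock_Kurzweil_Integration.integral_add inner_S_integrable)
    show "integral {0..h} (\<lambda>s. S s x \<bullet> (c *\<^sub>R z)) = c *\<^sub>R integral {0..h} (\<lambda>s. S s x \<bullet> z)" for c z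
      by simp
    show "norm (integral {0..h} (\<lambda>s. S s x \<bullet> z)) \<le> norm z * (h * (K * norm x))" for z
      using inner_S_integral_bound[of 0 h x 0 "K * norm x" z] K h by (simp add: algebra_simps)
  qed
  then obtain y where "\<forall>z. integral {0..h} (\<lambda>s. S s x \<bullet> z) = z \<bullet> y" using Riesz_representation by blast
  then have "\<exists>y. \<forall>z. y \<bullet> z = integral {0..h} (\<lambda>s. S s x \<bullet> z)" by (auto simp: inner_commute)
  then have "\<forall>z. weak_integral h x \<bullet> z = integral {0..h} (\<lambda>s. S s x \<bullet> z)"
    unfolding weak_integral_def by (rule someI_ex)
  then show ?thesis by blast
qed

lemma weak_integral_norm:
  assumes h: "h \<ge> 0" and K: "K \<ge> 0" "\<And>t x. 0 \<le> t \<Longrightarrow> t \<le> h \<Longrightarrow> norm (S t x) \<le> K * norm x"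
  shows "norm (weak_integral h x) \<le> h * K * norm x"
proof (rule norm_le_if_inner_le)
  show "weak_integral h x \<bullet> z \<le> h * K * norm x * norm z" for z
    using inner_S_integral_bound[of 0 h x 0 "K * norm x" z] K(2) h
    by (simp add: inner_weak_integral algebra_simps abs_le_iff)
qed (use h K in simp)

lemma bounded_linear_weak_integral:
  assumes h: "h \<ge> 0"
  shows "bounded_linear (weak_integral h)"
proof -
  obtain K where K: "K \<ge> 1" "\<And>t x. 0 \<le> t \<Longrightarrow> t \<le> h \<Longrightarrow> norm (S t x) \<le> K * norm x"
    using S_bounded by blast
  show ?thesis
  proof (rule bounded_linear_intro)
    show "weak_integral h (x + y) = weak_integral h x + weak_integral h y" for x y
    proof -
      have "(weak_integral h (x + y) - (weak_integral h x + weak_integral h y)) \<bullet> z = 0" for z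
      proof -
        have "integral {0..h} (\<lambda>s. S s (x + y) \<bullet> z) = integral {0..h} (\<lambda>s. S s x \<bullet> z + S s y \<bullet> z)"
          by (rule Henstock_Kurzweil_Integration.integral_cong) (simp add: S_linear inner_add_left)
        then show ?thesis using h by (simp add: inner_simps inner_weak_integral Henstock_Kurzweil_Integration.integral_add inner_S_integrable)
      qed
      then show ?thesis by (metis inner_eq_zero_iff right_minus_eq)
    qed
    show "weak_integral h (c *\<^sub>R x) = c *\<^sub>R weak_integral h x" for c x
    proof -
      have "(weak_integral h (c *\<^sub>R x) - c *\<^sub>R weak_integral h x) \<bullet> z = 0" for z
      proof -
        have "integral {0..h} (\<lambda>s. S s (c *\<^sub>R x) \<bullet> z) = integral {0..h} (\<lambda>s. c * (S s x \<bullet> z))"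
          by (rule Henstock_Kurzweil_Integration.integral_cong) (simp add: S_linear)
        then show ?thesis using h by (simp add: inner_simps inner_weak_integral)
      qed
      then show ?thesis by (metis inner_eq_zero_iff right_minus_eq)
    qed
    show "norm (weak_integral h x) \<le> norm x * (h * K)" for x
      using weak_integral_norm[OF h _ K(2)] K(1) by (simp add: mult.commute)
  qed
qed

text \<open>Applying S r, inside or outside the integral, moves the window [0, h] to [r, h + r]. The
  common part of the windows cancels and the two end pieces of length \<open>r\<close>
  remain.\<close>

lemma inner_weak_integral_increment:
  assumes h: "h \<ge> 0" and r: "r \<ge> 0"
  shows "(S r (weak_integral h x) - weak_integral h x) \<bullet> z =
      integral {h..h+r} (\<lambda>s. S s x \<bullet> z) - integral {0..r} (\<lambda>s. S s x \<bullet> z)"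
    and "weak_integral h (S r x - x) = S r (weak_integral h x) - weak_integral h x"
proof -
  have shift: "integral {0..h} (\<lambda>s. S (r + s) x \<bullet> z) = integral {r..h+r} (\<lambda>s. S s x \<bullet> z)" for z
    using integral_shift_Icc_real[of 0 h "\<lambda>s. S s x \<bullet> z" r]
    by (simp add: o_def add.commute)
  have SJ: "S r (weak_integral h x) \<bullet> z = integral {r..h+r} (\<lambda>s. S s x \<bullet> z)" for z
  proof -
    have "S r (weak_integral h x) \<bullet> z = integral {0..h} (\<lambda>s. S s x \<bullet> adjoint (S r) z)"
      using inner_adjoint[OF bounded_linear_S[OF r]] inner_weak_integral[OF h] by simp
    also have "\<dots> = integral {0..h} (\<lambda>s. S (r + s) x \<bullet> z)"
      by (rule Henstock_Kurzweil_Integration.integral_cong)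
        (simp add: inner_adjoint[OF bounded_linear_S[OF r], symmetric] S_add[OF r])
    finally show ?thesis by (simp add: shift)
  qed
  have split: "integral {r..h+r} (\<lambda>s. S s x \<bullet> z) - integral {0..h} (\<lambda>s. S s x \<bullet> z) =
     integral {h..h+r} (\<lambda>s. S s x \<bullet> z) - integral {0..r} (\<lambda>s. S s x \<bullet> z)" for z
  proof -
    have "integral {0..r} (\<lambda>s. S s x \<bullet> z) + integral {r..h+r} (\<lambda>s. S s x \<bullet> z) = integral {0..h+r} (\<lambda>s. S s x \<bullet> z)"
      using h r by (intro Henstock_Kurzweil_Integration.integral_combine inner_S_integrable) auto
    moreover have "integral {0..h} (\<lambda>s. S s x \<bullet> z) + integral {h..h+r} (\<lambda>s. S s x \<bullet> z) = integral {0..h+r} (\<lambda>s. S s x \<bullet> z)"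
      using h r by (intro Henstock_Kurzweil_Integration.integral_combine inner_S_integrable) auto
    ultimately show ?thesis by linarith
  qed
  show inc: "(S r (weak_integral h x) - weak_integral h x) \<bullet> z =
      integral {h..h+r} (\<lambda>s. S s x \<bullet> z) - integral {0..r} (\<lambda>s. S s x \<bullet> z)" for z
    by (simp add: inner_diff_left SJ inner_weak_integral[OF h] split)
  have "(weak_integral h (S r x - x) - (S r (weak_integral h x) - weak_integral h x)) \<bullet> z = 0" for z
  proof -
    have "weak_integral h (S r x - x) \<bullet> z = integral {0..h} (\<lambda>s. S (r + s) x \<bullet> z - S s x \<bullet> z)"
      unfolding inner_weak_integral[OF h]
    proof (rule Henstock_Kurzweil_Integration.integral_cong)
      fix s assume "s \<in> {0..h}"
      then have "S s (S r x) = S (r + s) x" using S_add[of s r x] r by (simp add: add.commute)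
      then show "S s (S r x - x) \<bullet> z = S (r + s) x \<bullet> z - S s x \<bullet> z"
        using \<open>s \<in> {0..h}\<close> by (simp add: S_linear inner_diff_left)
    qed
    also have "\<dots> = integral {0..h} (\<lambda>s. S (r + s) x \<bullet> z) - integral {0..h} (\<lambda>s. S s x \<bullet> z)"
    proof (rule Henstock_Kurzweil_Integration.integral_diff)
      have "(\<lambda>s. S s x \<bullet> z) integrable_on {r..h+r}" using r by (intro inner_S_integrable)
      then have "(\<lambda>s. S (s + r) x \<bullet> z) integrable_on {0..h}"
        using integrable_on_shift_Icc_real[of "\<lambda>s. S s x \<bullet> z" r 0 h] by (simp add: o_def add.commute)
      then show "(\<lambda>s. S (r + s) x \<bullet> z) integrable_on {0..h}" by (simp add: add.commute)
    qed (simp add: inner_S_integrable)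
    also have "\<dots> = (S r (weak_integral h x) - weak_integral h x) \<bullet> z"
      by (simp add: inc shift split)
    finally show ?thesis by (simp add: inner_diff_left)
  qed
  then show "weak_integral h (S r x - x) = S r (weak_integral h x) - weak_integral h x"
    by (metis inner_eq_zero_iff right_minus_eq)
qed

text \<open>Divided by \<open>r\<close>, the two end pieces of the increment tend to
  \<open>S h x\<close> and \<open>x\<close>. This puts weak integrals into the domain of the
  generator.\<close>

lemma weak_integral_derivative:
  assumes h: "h \<ge> 0"
  shows "((\<lambda>r. (S r (weak_integral h x) - weak_integral h x) /\<^sub>R r) \<longlongrightarrow> S h x - x) (at_right 0)"
proof (rule tendstoI)
  fix e :: real assume e: "e > 0"
  obtain d where d: "d > 0" "\<And>s t. 0 \<le> s \<Longrightarrow> 0 \<le> t \<Longrightarrow> s \<le> h + 1 \<Longrightarrow> t \<le> h + 1 \<Longrightarrow> \<bar>s - t\<bar> < d \<Longrightarrow> norm (S s x - S t x) < e/4"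
    using S_uniformly_near[of "e/4" "h + 1" x] e by auto
  have "dist ((S r (weak_integral h x) - weak_integral h x) /\<^sub>R r) (S h x - x) < e" if r: "0 < r" "r < min d 1" for r
  proof -
    let ?D = "(S r (weak_integral h x) - weak_integral h x) - r *\<^sub>R (S h x - x)"
    have "norm ?D \<le> r * (e / 2)"
    proof (rule norm_le_if_inner_le)
      fix z
      have A: "\<bar>integral {h..h+r} (\<lambda>s. S s x \<bullet> z) - (h + r - h) * (S h x \<bullet> z)\<bar> \<le> (h + r - h) * (e/4 * norm z)"
        using h r by (intro inner_S_integral_bound less_imp_le[OF d(2)]) auto
      have B: "\<bar>integral {0..r} (\<lambda>s. S s x \<bullet> z) - (r - 0) * (x \<bullet> z)\<bar> \<le> (r - 0) * (e/4 * norm z)"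
        using h r less_imp_le[OF d(2)[of _ 0]] by (intro inner_S_integral_bound) (simp_all del: le_divide_eq_numeral1)
      have "?D \<bullet> z = (integral {h..h+r} (\<lambda>s. S s x \<bullet> z) - r * (S h x \<bullet> z)) - (integral {0..r} (\<lambda>s. S s x \<bullet> z) - r * (x \<bullet> z))"
        using inner_weak_integral_increment(1)[OF h less_imp_le[OF r(1)], of x z]
        by (simp add: inner_diff_left algebra_simps)
      moreover have "integral {h..h+r} (\<lambda>s. S s x \<bullet> z) - r * (S h x \<bullet> z) \<le> r * (e/4 * norm z)"
        using abs_le_D1[OF A] by simp
      moreover have "- (integral {0..r} (\<lambda>s. S s x \<bullet> z) - r * (x \<bullet> z)) \<le> r * (e/4 * norm z)"
        using abs_le_D2[OF B] by simp
      moreover have "r * (e / 2) * norm z = r * (e/4 * norm z) + r * (e/4 * norm z)" by simp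
      ultimately show "?D \<bullet> z \<le> r * (e / 2) * norm z" by linarith
    qed (use r e in simp)
    moreover have "(S r (weak_integral h x) - weak_integral h x) /\<^sub>R r - (S h x - x) = ?D /\<^sub>R r"
      using r by (simp add: scaleR_diff_right)
    ultimately have "norm ((S r (weak_integral h x) - weak_integral h x) /\<^sub>R r - (S h x - x)) \<le> e / 2"
      using norm_divideR_le[OF r(1)] by metis
    then show ?thesis using e by (simp add: dist_norm)
  qed
  then show "eventually (\<lambda>r. dist ((S r (weak_integral h x) - weak_integral h x) /\<^sub>R r) (S h x - x) < e) (at_right 0)"
    using d(1) by (auto simp: eventually_at_right_field intro!: exI[of _ "min d 1"])
qed

lemma weak_integral_average:
  "((\<lambda>h. weak_integral h x /\<^sub>R h) \<longlongrightarrow> x) (at_right 0)"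
proof (rule tendstoI)
  fix e :: real assume e: "e > 0"
  obtain d where d: "d > 0" "\<And>t. 0 \<le> t \<Longrightarrow> t < d \<Longrightarrow> norm (S t x - x) < e/2" using S_near_0[of "e/2"] e by auto
  have "dist (weak_integral h x /\<^sub>R h) x < e" if h: "0 < h" "h < d" for h
  proof -
    have "norm (weak_integral h x - h *\<^sub>R x) \<le> h * (e/2)"
    proof (rule norm_le_if_inner_le)
      fix z
      have "\<bar>integral {0..h} (\<lambda>s. S s x \<bullet> z) - (h - 0) * (x \<bullet> z)\<bar> \<le> (h - 0) * (e/2 * norm z)"
        using h by (intro inner_S_integral_bound less_imp_le[OF d(2)]) auto
      then have "integral {0..h} (\<lambda>s. S s x \<bullet> z) - h * (x \<bullet> z) \<le> h * (e/2 * norm z)"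
        by (simp only: abs_le_iff) simp
      moreover have "(weak_integral h x - h *\<^sub>R x) \<bullet> z = integral {0..h} (\<lambda>s. S s x \<bullet> z) - h * (x \<bullet> z)"
        using h by (simp add: inner_diff_left inner_weak_integral)
      ultimately show "(weak_integral h x - h *\<^sub>R x) \<bullet> z \<le> h * (e/2) * norm z"
        by (simp only: mult.assoc)
    qed (use h e in simp)
    moreover have "weak_integral h x /\<^sub>R h - x = (weak_integral h x - h *\<^sub>R x) /\<^sub>R h"
      using h by (simp add: scaleR_diff_right)
    ultimately have "norm (weak_integral h x /\<^sub>R h - x) \<le> e/2" using norm_divideR_le[OF h(1)] by metis
    then show ?thesis using e by (simp add: dist_norm)
  qed
  then show "eventually (\<lambda>h. dist (weak_integral h x /\<^sub>R h) x < e) (at_right 0)"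
    using d(1) by (auto simp: eventually_at_right_field intro!: exI[of _ d])
qed

end

section \<open>The generator, its adjoint and the adjoint semigroup\<close>

locale generated_semigroup = semigroup_system S
  for S :: "real \<Rightarrow> 'x::{real_inner,complete_space} \<Rightarrow> 'x" +
  fixes A :: "'x \<Rightarrow> 'x" and DA :: "'x set"
  assumes gen: "generates A DA S"
begin

lemma A_tendsto: "x \<in> DA \<Longrightarrow> ((\<lambda>h. (S h x - x) /\<^sub>R h) \<longlongrightarrow> A x) (at_right 0)"
  using gen by (auto simp: generates_def)

lemma generator_eqI:
  assumes "((\<lambda>h. (S h x - x) /\<^sub>R h) \<longlongrightarrow> l) (at_right 0)"
  shows "x \<in> DA" and "A x = l"
proof -
  show x: "x \<in> DA" using assms gen by (auto simp: generates_def)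
  show "A x = l" by (rule tendsto_unique[OF _ A_tendsto[OF x] assms]) simp
qed

lemma weak_integral_in_DA:
  assumes "h \<ge> 0"
  shows "weak_integral h x \<in> DA" and "A (weak_integral h x) = S h x - x"
  using generator_eqI[OF weak_integral_derivative[OF assms]] by auto

text \<open>The integral commutes with the difference quotients of \<open>x\<close> and is
  continuous, so their limit may be taken inside or outside.\<close>

lemma weak_integral_A:
  assumes h: "h \<ge> 0" and x: "x \<in> DA"
  shows "weak_integral h (A x) = S h x - x"
proof (rule tendsto_unique)
  interpret J: bounded_linear "weak_integral h" by (rule bounded_linear_weak_integral[OF h])
  show "((\<lambda>r. weak_integral h ((S r x - x) /\<^sub>R r)) \<longlongrightarrow> weak_integral h (A x)) (at_right 0)"
    by (intro J.tendsto A_tendsto x)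
  have "eventually (\<lambda>r::real. r > 0) (at_right 0)" by (rule eventually_at_right_less)
  then have "eventually (\<lambda>r. (S r (weak_integral h x) - weak_integral h x) /\<^sub>R r = weak_integral h ((S r x - x) /\<^sub>R r)) (at_right 0)"
    by eventually_elim (simp add: J.scaleR inner_weak_integral_increment(2)[OF h])
  then show "((\<lambda>r. weak_integral h ((S r x - x) /\<^sub>R r)) \<longlongrightarrow> S h x - x) (at_right 0)"
    by (rule Lim_transform_eventually[OF weak_integral_derivative[OF h]])
qed simp

lemma S_in_DA:
  assumes t: "t \<ge> 0" and x: "x \<in> DA"
  shows "S t x \<in> DA" and "A (S t x) = S t (A x)"
proof -
  have "((\<lambda>h. S t ((S h x - x) /\<^sub>R h)) \<longlongrightarrow> S t (A x)) (at_right 0)"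
    by (intro bounded_linear.tendsto[OF bounded_linear_S[OF t]] A_tendsto x)
  moreover have "eventually (\<lambda>h::real. h > 0) (at_right 0)" by (rule eventually_at_right_less)
  then have "eventually (\<lambda>h. S t ((S h x - x) /\<^sub>R h) = (S h (S t x) - S t x) /\<^sub>R h) (at_right 0)"
  proof eventually_elim
    case (elim h)
    then have "S t (S h x) = S h (S t x)" using S_add[of t h x] S_add[of h t x] t by (simp add: add.commute)
    then show ?case using t by (simp add: S_linear)
  qed
  ultimately have "((\<lambda>h. (S h (S t x) - S t x) /\<^sub>R h) \<longlongrightarrow> S t (A x)) (at_right 0)"
    by (rule Lim_transform_eventually)
  then show "S t x \<in> DA" "A (S t x) = S t (A x)" by (rule generator_eqI)+
qed

text \<open>Density of the domain in dual form: the weak integrals of \<open>w\<close> lie in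
  \<open>DA\<close> and their averages tend to \<open>w\<close>, so \<open>w\<close> is orthogonal
  to itself.\<close>

lemma DA_orthogonal_trivial:
  assumes "\<And>x. x \<in> DA \<Longrightarrow> w \<bullet> x = 0"
  shows "w = 0"
proof -
  have "((\<lambda>h. w \<bullet> (weak_integral h w /\<^sub>R h)) \<longlongrightarrow> w \<bullet> w) (at_right 0)"
    by (intro tendsto_intros weak_integral_average)
  moreover have "eventually (\<lambda>h::real. h > 0) (at_right 0)" by (rule eventually_at_right_less)
  then have "eventually (\<lambda>h. w \<bullet> (weak_integral h w /\<^sub>R h) = 0) (at_right 0)"
    by eventually_elim (simp add: assms weak_integral_in_DA)
  ultimately have "((\<lambda>h::real. 0::real) \<longlongrightarrow> w \<bullet> w) (at_right 0)" by (rule Lim_transform_eventually)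
  then have "w \<bullet> w = 0" by (simp add: tendsto_const_iff)
  then show ?thesis by simp
qed

abbreviation "DAs \<equiv> adj_dom A DA"
abbreviation "As \<equiv> adj_op A DA"

lemma adj_op_eqI:
  assumes "\<And>x. x \<in> DA \<Longrightarrow> A x \<bullet> z = x \<bullet> w"
  shows "z \<in> DAs" and "As z = w"
proof -
  show "z \<in> DAs" using assms by (auto simp: adj_dom_def)
  show "As z = w" unfolding adj_op_def
  proof (rule the_equality)
    fix w' assume w': "\<forall>x\<in>DA. A x \<bullet> z = x \<bullet> w'"
    have "(w' - w) \<bullet> x = 0" if "x \<in> DA" for x
    proof -
      have "x \<bullet> w' = x \<bullet> w" using assms[OF that] w' that by auto
      then have "x \<bullet> (w' - w) = 0" by (simp add: inner_diff_right)
      then show ?thesis by (simp add: inner_commute)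
    qed
    then have "w' - w = 0" by (rule DA_orthogonal_trivial)
    then show "w' = w" by simp
  qed (use assms in auto)
qed

lemma inner_adj_op: "z \<in> DAs \<Longrightarrow> x \<in> DA \<Longrightarrow> A x \<bullet> z = x \<bullet> As z"
  using adj_op_eqI(2) by (fastforce simp: adj_dom_def)

lemma subspace_adj_dom: "subspace DAs"
  unfolding subspace_def
proof (intro conjI ballI allI)
  show "0 \<in> DAs" by (rule adj_op_eqI[of 0 0]) simp
  show "y + z \<in> DAs" if "y \<in> DAs" "z \<in> DAs" for y z
    by (rule adj_op_eqI[of _ "As y + As z"]) (simp add: inner_add_right inner_adj_op that)
  show "c *\<^sub>R z \<in> DAs" if "z \<in> DAs" for c z
    by (rule adj_op_eqI[of _ "c *\<^sub>R As z"]) (simp add: inner_adj_op that)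
qed

abbreviation "Ss t \<equiv> adjoint (S t)"

lemma inner_Ss: "t \<ge> 0 \<Longrightarrow> S t x \<bullet> z = x \<bullet> Ss t z"
  by (rule inner_adjoint[OF bounded_linear_S])

lemma Ss_eqI:
  assumes "t \<ge> 0" "\<And>x. S t x \<bullet> z = x \<bullet> w"
  shows "Ss t z = w"
  using assms by (metis inner_Ss vector_eq_ldot)

lemma Ss_norm:
  assumes t: "t \<ge> 0" and K: "K \<ge> 0" "\<And>x. norm (S t x) \<le> K * norm x"
  shows "norm (Ss t z) \<le> K * norm z"
proof (rule norm_le_if_inner_le)
  fix x
  have "Ss t z \<bullet> x = S t x \<bullet> z" by (simp only: inner_Ss[OF t] inner_commute[of "Ss t z" x])
  also have "\<dots> \<le> norm (S t x) * norm z" by (rule norm_cauchy_schwarz)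
  also have "\<dots> \<le> (K * norm x) * norm z" by (intro mult_right_mono K) auto
  finally show "Ss t z \<bullet> x \<le> K * norm z * norm x" by (simp add: algebra_simps)
qed (use K in simp)

lemma Ss_bounded:
  obtains K where "K \<ge> 1" "\<And>t z. 0 \<le> t \<Longrightarrow> t \<le> T \<Longrightarrow> norm (Ss t z) \<le> K * norm z"
proof -
  obtain K where K: "K \<ge> 1" "\<And>t x. 0 \<le> t \<Longrightarrow> t \<le> T \<Longrightarrow> norm (S t x) \<le> K * norm x"
    using S_bounded by blast
  show ?thesis by (rule that[OF K(1)], rule Ss_norm) (use K in auto)
qed

lemma bounded_linear_Ss:
  assumes t: "t \<ge> 0"
  shows "bounded_linear (Ss t)"
proof -
  obtain K where K: "K \<ge> 1" "\<And>s z. 0 \<le> s \<Longrightarrow> s \<le> t \<Longrightarrow> norm (Ss s z) \<le> K * norm z"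
    using Ss_bounded by blast
  show ?thesis
  proof (rule bounded_linear_intro)
    show "Ss t (y + z) = Ss t y + Ss t z" for y z
      by (rule Ss_eqI[OF t]) (simp add: inner_add_right inner_Ss[OF t])
    show "Ss t (c *\<^sub>R z) = c *\<^sub>R Ss t z" for c z
      by (rule Ss_eqI[OF t]) (simp add: inner_Ss[OF t])
    show "norm (Ss t z) \<le> norm z * K" for z using K(2)[of t z] t by (simp add: mult.commute)
  qed
qed

lemma Ss_0: "Ss 0 z = z" by (rule Ss_eqI) simp_all

lemma Ss_add: "s \<ge> 0 \<Longrightarrow> t \<ge> 0 \<Longrightarrow> Ss (s + t) z = Ss s (Ss t z)"
  by (rule Ss_eqI) (auto simp: inner_Ss[symmetric] S_add[symmetric] add.commute)

lemma Ss_in_adj_dom: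
  assumes t: "t \<ge> 0" and z: "z \<in> DAs"
  shows "Ss t z \<in> DAs" and "As (Ss t z) = Ss t (As z)"
proof -
  have *: "A x \<bullet> Ss t z = x \<bullet> Ss t (As z)" if x: "x \<in> DA" for x
    using inner_adj_op[OF z S_in_DA(1)[OF t x]] by (simp add: inner_Ss[OF t, symmetric] S_in_DA(2)[OF t x])
  show "Ss t z \<in> DAs" by (rule adj_op_eqI(1)[OF *])
  show "As (Ss t z) = Ss t (As z)" by (rule adj_op_eqI(2)[OF *])
qed

lemma adjoint_weak_integral_in_adj_dom:
  assumes h: "h \<ge> 0"
  shows "adjoint (weak_integral h) z \<in> DAs"
proof (rule adj_op_eqI)
  show "A x \<bullet> adjoint (weak_integral h) z = x \<bullet> (Ss h z - z)" if x: "x \<in> DA" for x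
    unfolding inner_adjoint[OF bounded_linear_weak_integral[OF h], symmetric] weak_integral_A[OF h x]
    by (simp add: inner_diff_left inner_diff_right inner_Ss[OF h])
qed

text \<open>The ranges of the adjoints of \<open>weak_integral h\<close> lie in the adjoint domain.
  Orthogonality to them means that all weak integrals of \<open>w\<close> vanish, while their
  averages tend to \<open>w\<close>. Consequently a state is determined by its pairings with the
  adjoint domain.\<close>

lemma adj_dom_orthogonal_trivial:
  assumes w: "\<And>z. z \<in> DAs \<Longrightarrow> w \<bullet> z = 0"
  shows "w = 0"
proof -
  have "weak_integral h w = 0" if h: "h \<ge> 0" for h
  proof -
    have "weak_integral h w \<bullet> z = 0" for z
      using w[OF adjoint_weak_integral_in_adj_dom[OF h]] inner_adjoint[OF bounded_linear_weak_integral[OF h], of w z] by simp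
    then show ?thesis using inner_eq_zero_iff by blast
  qed
  note null = this
  have "eventually (\<lambda>h::real. h > 0) (at_right 0)" by (rule eventually_at_right_less)
  then have "eventually (\<lambda>h. weak_integral h w /\<^sub>R h = 0) (at_right 0)"
    by eventually_elim (simp add: null)
  then have "((\<lambda>h::real. 0) \<longlongrightarrow> w) (at_right 0)"
    by (rule Lim_transform_eventually[OF weak_integral_average])
  then show "w = 0" by (simp add: tendsto_const_iff)
qed

lemma adj_dom_dense: "closure DAs = UNIV"
  by (rule dense_if_orthogonal_trivial[OF subspace_adj_dom adj_dom_orthogonal_trivial])

text \<open>Elements of the adjoint domain have orbits that are Lipschitz at 0: S t x - x is
  \<open>A\<close> applied to a weak integral, and \<open>A\<close> can be moved to the other side
  of the inner product.\<close>

lemma Ss_near_0: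
  assumes z: "z \<in> DAs" and t: "0 \<le> t" and K: "K \<ge> 0" "\<And>s x. 0 \<le> s \<Longrightarrow> s \<le> t \<Longrightarrow> norm (S s x) \<le> K * norm x"
  shows "norm (Ss t z - z) \<le> t * K * norm (As z)"
proof (rule norm_le_if_inner_le)
  fix x
  have "(Ss t z - z) \<bullet> x = A (weak_integral t x) \<bullet> z"
    by (simp only: weak_integral_in_DA(2)[OF t] inner_diff_left inner_Ss[OF t] inner_commute[of "Ss t z" x] inner_commute[of z x])
  also have "\<dots> = weak_integral t x \<bullet> As z" by (rule inner_adj_op[OF z weak_integral_in_DA(1)[OF t]])
  also have "\<dots> \<le> norm (weak_integral t x) * norm (As z)" by (rule norm_cauchy_schwarz)
  also have "\<dots> \<le> (t * K * norm x) * norm (As z)" by (intro mult_right_mono weak_integral_norm t K) auto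
  finally show "(Ss t z - z) \<bullet> x \<le> t * K * norm (As z) * norm x" by (simp add: algebra_simps)
qed (use t K in simp)

text \<open>Strong continuity at 0 is explicit on the adjoint domain and extends by density, with
  the operator bound on [0, 1] holding the errors together.\<close>

lemma C0_adjoint: "C0_semigroup (\<lambda>t. Ss t)"
proof -
  have "((\<lambda>t. Ss t z) \<longlongrightarrow> z) (at_right 0)" for z
  proof (rule tendstoI)
    fix e :: real assume e: "e > 0"
    obtain K where K: "K \<ge> 1" "\<And>t x. 0 \<le> t \<Longrightarrow> t \<le> 1 \<Longrightarrow> norm (S t x) \<le> K * norm x"
      using S_bounded by blast
    have "z \<in> closure DAs" by (simp add: adj_dom_dense)
    then obtain z' where z': "z' \<in> DAs" "dist z' z < e / (4 * K)"
      using closure_approachable[of z DAs] e K(1) by (metis divide_pos_pos less_le_trans mult_pos_pos zero_less_numeral zero_less_one)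
    define c where "c = K * norm (As z') + 1"
    have c: "c > 0" using K(1) by (simp add: c_def add_nonneg_pos)
    have "dist (Ss t z) z < e" if t: "0 < t" "t < min 1 (e / (2 * c))" for t
    proof -
      interpret Ssl: bounded_linear "Ss t" by (rule bounded_linear_Ss) (use t in simp)
      have n1: "norm (Ss t (z - z')) \<le> K * norm (z - z')" using t K by (intro Ss_norm) auto
      have n2: "K * norm (z - z') < e / 4"
      proof -
        have "K * norm (z - z') < K * (e / (4 * K))"
          using z'(2) K(1) by (intro mult_strict_left_mono) (auto simp: dist_norm norm_minus_commute)
        then show ?thesis using K(1) by simp
      qed
      have n3: "norm (z - z') \<le> K * norm (z - z')" using K(1) by (simp add: mult_le_cancel_right1)
      have "norm (Ss t z' - z') \<le> t * K * norm (As z')" using t K by (intro Ss_near_0 z') auto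
      also have "\<dots> \<le> t * c" using t by (simp add: c_def mult.assoc)
      also have "\<dots> < (e / (2 * c)) * c" using t c by (intro mult_strict_right_mono) auto
      also have "\<dots> = e / 2" using c by simp
      finally have n4: "norm (Ss t z' - z') < e / 2" .
      have "Ss t z - z = Ss t (z - z') + (Ss t z' - z') - (z - z')" by (simp add: Ssl.diff)
      then have "norm (Ss t z - z) \<le> norm (Ss t (z - z')) + norm (Ss t z' - z') + norm (z - z')"
        using norm_triangle_ineq[of "Ss t (z - z')" "Ss t z' - z'"] norm_triangle_ineq4[of "Ss t (z - z') + (Ss t z' - z')" "z - z'"]
        by (simp only:)
      then show ?thesis using n1 n2 n3 n4 by (simp add: dist_norm)
    qed
    then show "eventually (\<lambda>t. dist (Ss t z) z < e) (at_right 0)"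
      using e c by (auto simp: eventually_at_right_field intro!: exI[of _ "min 1 (e / (2 * c))"])
  qed
  then show ?thesis
    using bounded_linear_Ss Ss_0 Ss_add by (simp add: C0_semigroup_def)
qed

lemma Ss_continuous_on: "continuous_on {0..T} (\<lambda>t. Ss t z)"
proof -
  interpret Ss: semigroup_system "\<lambda>t. Ss t" by unfold_locales (rule C0_adjoint)
  show ?thesis by (rule Ss.S_continuous_on)
qed

end

section \<open>The input map of an admissible control operator\<close>

text \<open>Sampling \<open>g\<close> at the last grid point before \<open>t\<close> takes finitely
  many values, which works for an arbitrary normed target space. The maximum with \<open>a\<close>
  keeps the sample point inside the interval.\<close>

lemma strongly_measurable_continuous_cut:
  fixes g :: "real \<Rightarrow> 'u::real_normed_vector"
  assumes g: "continuous_on {a..b} g"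
  shows "strongly_measurable lebesgue (\<lambda>t. if t \<in> {a<..<b} then g t else 0)"
proof -
  define \<rho> where "\<rho> = (\<lambda>(n::nat) t. max a (of_int \<lfloor>real (Suc n) * t\<rfloor> / real (Suc n)))"
  have r: "a \<le> \<rho> n t" "\<rho> n t \<le> t" "t - 1 / real (Suc n) \<le> \<rho> n t" if "t \<in> {a<..<b}" for n t
  proof -
    have 1: "of_int \<lfloor>real (Suc n) * t\<rfloor> / real (Suc n) \<le> t" by (simp add: field_simps)
    have "real (Suc n) * t - 1 \<le> of_int \<lfloor>real (Suc n) * t\<rfloor>" by linarith
    then have "(real (Suc n) * t - 1) / real (Suc n) \<le> of_int \<lfloor>real (Suc n) * t\<rfloor> / real (Suc n)" by (rule divide_right_mono) simp
    then have 2: "t - 1 / real (Suc n) \<le> of_int \<lfloor>real (Suc n) * t\<rfloor> / real (Suc n)" by (simp add: diff_divide_distrib)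
    show "a \<le> \<rho> n t" "\<rho> n t \<le> t" "t - 1 / real (Suc n) \<le> \<rho> n t"
      using 1 2 that by (auto simp: \<rho>_def)
  qed
  show ?thesis
    unfolding strongly_measurable_def
  proof (intro exI conjI allI)
    fix n :: nat
    let ?f = "\<lambda>t. if t \<in> {a<..<b} then \<lfloor>real (Suc n) * t\<rfloor> else 0"
    have f: "simple_function lebesgue ?f"
      unfolding simple_function_def
    proof
      have "?f ` UNIV \<subseteq> insert 0 {\<lfloor>real (Suc n) * a\<rfloor>..\<lfloor>real (Suc n) * b\<rfloor>}"
        by (auto intro!: floor_mono mult_left_mono)
      then have "finite (?f ` UNIV)" by (rule finite_subset) simp
      then show "finite (?f ` space lebesgue)" by (simp only: space_completion space_lborel space_borel)
      show "\<forall>x\<in>?f ` space lebesgue. ?f -` {x} \<inter> space lebesgue \<in> sets lebesgue"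
      proof
        fix x
        have "{t \<in> space borel. \<lfloor>real (Suc n) * t\<rfloor> = x} \<in> sets (borel :: real measure)" by measurable
        then have m: "{t \<in> space lebesgue. \<lfloor>real (Suc n) * t\<rfloor> = x} \<in> sets lebesgue" by simp
        have "?f -` {x} \<inter> space lebesgue = ({t \<in> space lebesgue. \<lfloor>real (Suc n) * t\<rfloor> = x} \<inter> {a<..<b}) \<union> (if x = 0 then - {a<..<b} else {})"
          by (auto split: if_splits)
        also have "\<dots> \<in> sets lebesgue" using m by (intro sets.Un sets.Int) auto
        finally show "?f -` {x} \<inter> space lebesgue \<in> sets lebesgue" .
      qed
    qed
    have "simple_function lebesgue (\<lambda>t. g (max a (of_int (?f t) / real (Suc n))))"
      using f by (rule simple_function_compose1)
    then have "simple_function lebesgue (\<lambda>t. if t \<in> {a<..<b} then g (max a (of_int (?f t) / real (Suc n))) else 0)"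
      by (intro simple_function_If_set) auto
    also have "(\<lambda>t. if t \<in> {a<..<b} then g (max a (of_int (?f t) / real (Suc n))) else 0) = (\<lambda>t. if t \<in> {a<..<b} then g (\<rho> n t) else 0)"
      by (auto simp: \<rho>_def)
    finally show "simple_function lebesgue (\<lambda>t. if t \<in> {a<..<b} then g (\<rho> n t) else 0)" .
  next
    show "AE t in lebesgue. (\<lambda>n. if t \<in> {a<..<b} then g (\<rho> n t) else 0) \<longlonglongrightarrow> (if t \<in> {a<..<b} then g t else 0)"
    proof (rule AE_I2)
      fix t
      show "(\<lambda>n. if t \<in> {a<..<b} then g (\<rho> n t) else 0) \<longlonglongrightarrow> (if t \<in> {a<..<b} then g t else 0)"
      proof (cases "t \<in> {a<..<b}")
        case True
        have "(\<lambda>n. \<rho> n t) \<longlonglongrightarrow> t"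
        proof (rule tendsto_sandwich)
          show "eventually (\<lambda>n. t - 1 / real (Suc n) \<le> \<rho> n t) sequentially" using r[OF True] by simp
          show "eventually (\<lambda>n. \<rho> n t \<le> t) sequentially" using r[OF True] by simp
          show "(\<lambda>n. t - 1 / real (Suc n)) \<longlonglongrightarrow> t"
            using tendsto_diff[OF tendsto_const LIMSEQ_inverse_real_of_nat, of t] by (simp add: divide_inverse)
        qed simp
        moreover have "\<rho> n t \<in> {a..b}" for n using r[OF True, of n] True by auto
        ultimately have "(\<lambda>n. g (\<rho> n t)) \<longlonglongrightarrow> g t"
          using g True unfolding continuous_on_sequentially o_def by auto
        then show ?thesis using True by simp
      qed auto
    qed
  qed
qed

locale control_system = generated_semigroup S A DA
  for S :: "real \<Rightarrow> 'x::{real_inner,complete_space} \<Rightarrow> 'x" and A :: "'x \<Rightarrow> 'x" and DA :: "'x set" +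
  fixes \<iota> :: "'d::{real_inner,complete_space} \<Rightarrow> 'x"
    and B :: "'u::{real_inner,complete_space} \<Rightarrow>\<^sub>L ('d \<Rightarrow>\<^sub>L real)"
  assumes repr: "represents_adj_dom A DA \<iota>" and adm: "admissible_control_operator S \<iota> B"
begin

lemma iota_linear: "linear \<iota>" and iota_bij: "bij_betw \<iota> UNIV DAs"
  and inner_graph: "d \<bullet> e = \<iota> d \<bullet> \<iota> e + As (\<iota> d) \<bullet> As (\<iota> e)"
  using repr by (auto simp: represents_adj_dom_def)

lemma inj_iota: "inj \<iota>" and iota_mem: "\<iota> d \<in> DAs"
  using iota_bij by (auto simp: bij_betw_def)

lemma iota_surj: "z \<in> DAs \<Longrightarrow> \<exists>d. \<iota> d = z"
  using iota_bij unfolding bij_betw_def by (metis imageE)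

lemma adj_op_diff: "y \<in> DAs \<Longrightarrow> z \<in> DAs \<Longrightarrow> As (y - z) = As y - As z"
  by (rule adj_op_eqI) (simp add: inner_diff_right inner_adj_op)

lemma norm_graph: "(norm d)^2 = (norm (\<iota> d))^2 + (norm (As (\<iota> d)))^2"
  by (simp add: power2_norm_eq_inner inner_graph[of d d])

lemma norm_iota_le: "norm (\<iota> d) \<le> norm d"
  by (rule power2_le_imp_le) (simp_all add: norm_graph)

lemma orthogonal_iota:
  assumes "\<And>d. x \<bullet> \<iota> d = 0"
  shows "x = 0"
  by (rule adj_dom_orthogonal_trivial) (use assms iota_surj in blast)

abbreviation "Sd \<equiv> adj_semigroup_dom S \<iota>"

lemma iota_Sd: "t \<ge> 0 \<Longrightarrow> \<iota> (Sd t d) = Ss t (\<iota> d)"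
  using iota_surj[OF Ss_in_adj_dom(1)[OF _ iota_mem]] by (metis adj_semigroup_dom_def f_inv_into_f rangeI)

lemma Sd_linear:
  assumes t: "t \<ge> 0"
  shows "Sd t (d + e) = Sd t d + Sd t e" and "Sd t (c *\<^sub>R d) = c *\<^sub>R Sd t d"
proof -
  interpret Ssl: bounded_linear "Ss t" by (rule bounded_linear_Ss[OF t])
  show "Sd t (d + e) = Sd t d + Sd t e" "Sd t (c *\<^sub>R d) = c *\<^sub>R Sd t d"
    by (rule injD[OF inj_iota], simp add: iota_Sd[OF t] linear_add[OF iota_linear] linear_scale[OF iota_linear] Ssl.add Ssl.scaleR)+
qed

lemma Sd_add: "s \<ge> 0 \<Longrightarrow> t \<ge> 0 \<Longrightarrow> Sd (s + t) d = Sd s (Sd t d)"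
  by (rule injD[OF inj_iota]) (simp add: iota_Sd Ss_add)

lemma Sd_bounded:
  obtains K where "K \<ge> 1" "\<And>t d. 0 \<le> t \<Longrightarrow> t \<le> T \<Longrightarrow> norm (Sd t d) \<le> K * norm d"
proof -
  obtain K where K: "K \<ge> 1" "\<And>t z. 0 \<le> t \<Longrightarrow> t \<le> T \<Longrightarrow> norm (Ss t z) \<le> K * norm z"
    using Ss_bounded by blast
  show ?thesis
  proof (rule that[OF K(1)], rule power2_le_imp_le)
    fix t d assume t: "0 \<le> t" "t \<le> T"
    have "(norm (Sd t d))^2 = (norm (Ss t (\<iota> d)))^2 + (norm (Ss t (As (\<iota> d))))^2"
      by (simp add: norm_graph[of "Sd t d"] iota_Sd[OF t(1)] Ss_in_adj_dom(2)[OF t(1) iota_mem])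
    also have "\<dots> \<le> (K * norm (\<iota> d))^2 + (K * norm (As (\<iota> d)))^2"
      using K(2)[OF t] by (intro add_mono power_mono) auto
    also have "\<dots> = (K * norm d)^2" unfolding power_mult_distrib norm_graph[of d] by (simp add: algebra_simps)
    finally show "(norm (Sd t d))^2 \<le> (K * norm d)^2" .
  qed (use K in simp)
qed

lemma bounded_linear_Sd:
  assumes t: "t \<ge> 0"
  shows "bounded_linear (Sd t)"
proof -
  obtain K where K: "K \<ge> 1" "\<And>s d. 0 \<le> s \<Longrightarrow> s \<le> t \<Longrightarrow> norm (Sd s d) \<le> K * norm d"
    using Sd_bounded by blast
  show ?thesis
    by (rule bounded_linear_intro[where K = K]) (use t K(2)[of t] in \<open>simp_all add: Sd_linear mult.commute\<close>)
qed

text \<open>The adjoint generator commutes with the adjoint semigroup, so continuity in the graph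
  norm is continuity of the orbits of \<open>\<iota> d\<close> and of its image under the adjoint
  generator.\<close>

lemma Sd_continuous_on: "continuous_on {0..T} (\<lambda>t. Sd t d)"
proof -
  have dist_eq: "dist (Sd s d) (Sd t d) = sqrt ((norm (Ss s (\<iota> d) - Ss t (\<iota> d)))^2 + (norm (Ss s (As (\<iota> d)) - Ss t (As (\<iota> d))))^2)"
    if "s \<ge> 0" "t \<ge> 0" for s t
    using that norm_graph[of "Sd s d - Sd t d"]
    by (simp add: dist_norm real_sqrt_unique linear_diff[OF iota_linear] iota_Sd adj_op_diff Ss_in_adj_dom iota_mem)
  show ?thesis
    unfolding continuous_on_sequentially
  proof (intro allI ballI impI)
    fix x a assume a: "a \<in> {0..T}" and "(\<forall>n. x n \<in> {0..T}) \<and> x \<longlonglongrightarrow> a"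
    then have x: "\<And>n. x n \<in> {0..T}" "x \<longlonglongrightarrow> a" by auto
    have c: "(\<lambda>n. Ss (x n) z) \<longlonglongrightarrow> Ss a z" for z
      using Ss_continuous_on[of T z] x a unfolding continuous_on_sequentially o_def by auto
    have "(\<lambda>n. sqrt ((norm (Ss (x n) (\<iota> d) - Ss a (\<iota> d)))^2 + (norm (Ss (x n) (As (\<iota> d)) - Ss a (As (\<iota> d))))^2)) \<longlonglongrightarrow>
        sqrt ((norm (Ss a (\<iota> d) - Ss a (\<iota> d)))^2 + (norm (Ss a (As (\<iota> d)) - Ss a (As (\<iota> d))))^2)"
      by (intro tendsto_intros c)
    then have "(\<lambda>n. dist (Sd (x n) d) (Sd a d)) \<longlonglongrightarrow> 0" using x(1) a by (simp add: dist_eq)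
    then show "((\<lambda>t. Sd t d) \<circ> x) \<longlonglongrightarrow> Sd a d" by (simp add: o_def tendsto_dist_iff[symmetric])
  qed
qed

lemma emb_apply: "blinfun_apply (emb \<iota> x) d = x \<bullet> \<iota> d"
  unfolding emb_def
proof (subst bounded_linear_Blinfun_apply)
  show "bounded_linear (\<lambda>d. x \<bullet> \<iota> d)"
  proof (rule bounded_linear_intro)
    show "norm (x \<bullet> \<iota> d) \<le> norm d * norm x" for d
      using Cauchy_Schwarz_ineq2[of x "\<iota> d"] mult_left_mono[OF norm_iota_le, of "norm x" d]
      by (simp add: mult.commute order.trans)
  qed (simp_all add: linear_add[OF iota_linear] linear_scale[OF iota_linear] inner_add_right)
qed simp

lemma inj_emb: "inj (emb \<iota>)"
proof (rule injI)
  fix x y assume e: "emb \<iota> x = emb \<iota> y"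
  have "x - y = 0"
  proof (rule orthogonal_iota)
    show "(x - y) \<bullet> \<iota> d = 0" for d
      using emb_apply[of x d] emb_apply[of y d] e by (simp add: inner_diff_left)
  qed
  then show "x = y" by simp
qed

lemma S_ext_apply: "t \<ge> 0 \<Longrightarrow> blinfun_apply (S_ext S \<iota> t \<phi>) d = blinfun_apply \<phi> (Sd t d)"
  unfolding S_ext_def
  by (subst bounded_linear_Blinfun_apply)
    (auto intro: bounded_linear_compose[OF blinfun.bounded_linear_right bounded_linear_Sd])

abbreviation "Bs \<equiv> adj_control B"

lemma inner_Bs: "u \<bullet> Bs d = blinfun_apply (blinfun_apply B u) d"
proof -
  have "bounded_linear (\<lambda>u. blinfun_apply (blinfun_apply B u) d)"
    by (intro bounded_linear_compose[OF blinfun.bounded_linear_left blinfun.bounded_linear_right])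
  then obtain w where w: "\<And>u. blinfun_apply (blinfun_apply B u) d = u \<bullet> w" using Riesz_representation by blast
  have "\<forall>u. u \<bullet> Bs d = blinfun_apply (blinfun_apply B u) d"
    unfolding adj_control_def
  proof (rule theI)
    show "\<forall>u. u \<bullet> w = blinfun_apply (blinfun_apply B u) d" by (simp add: w)
    fix w' assume "\<forall>u. u \<bullet> w' = blinfun_apply (blinfun_apply B u) d"
    then show "w' = w" by (simp add: w vector_eq_ldot)
  qed
  then show ?thesis by blast
qed

lemma bounded_linear_Bs: "bounded_linear Bs"
proof (rule bounded_linear_intro)
  show "Bs (d + e) = Bs d + Bs e" for d e
    by (subst vector_eq_ldot[symmetric]) (simp add: inner_Bs inner_add_right blinfun.bilinear_simps)
  show "Bs (c *\<^sub>R d) = c *\<^sub>R Bs d" for c d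
    by (subst vector_eq_ldot[symmetric]) (simp add: inner_Bs blinfun.bilinear_simps)
  show "norm (Bs d) \<le> norm d * norm B" for d
  proof (rule norm_le_if_inner_le)
    fix z
    have "Bs d \<bullet> z = blinfun_apply (blinfun_apply B z) d" by (simp add: inner_Bs[symmetric] inner_commute)
    also have "\<dots> \<le> norm (blinfun_apply B z) * norm d"
      using norm_blinfun[of "blinfun_apply B z" d] by simp
    also have "\<dots> \<le> (norm B * norm z) * norm d" by (intro mult_right_mono norm_blinfun) auto
    finally show "Bs d \<bullet> z \<le> norm d * norm B * norm z" by (simp add: algebra_simps)
  qed simp
qed

section \<open>Observations, the input map and the duality between them\<close>

text \<open>The function B^* S^*(T - s) z of \<open>X_space\<close>, extended by 0 beyond (0, T) so
  that pairings become integrals over the whole line.\<close>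

definition obs :: "real \<Rightarrow> 'd \<Rightarrow> real \<Rightarrow> 'u" where
  "obs T d s = (if s \<in> {0<..<T} then Bs (Sd (T - s) d) else 0)"

lemma obs_add: "obs T (d + e) s = obs T d s + obs T e s"
  and obs_scale: "obs T (c *\<^sub>R d) s = c *\<^sub>R obs T d s"
proof -
  interpret Bs: bounded_linear Bs by (rule bounded_linear_Bs)
  show "obs T (d + e) s = obs T d s + obs T e s" "obs T (c *\<^sub>R d) s = c *\<^sub>R obs T d s"
    by (auto simp: obs_def Sd_linear Bs.add Bs.scaleR)
qed

lemma obs_Lp: "Lp 2 (obs T d)"
proof -
  have "continuous_on {0..T} (\<lambda>s. T - s)" by (intro continuous_intros)
  then have "continuous_on {0..T} (\<lambda>s. Sd (T - s) d)"
    by (rule continuous_on_compose2[OF Sd_continuous_on[of T d]]) auto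
  then have "continuous_on {0..T} (\<lambda>s. Bs (Sd (T - s) d))"
    by (rule bounded_linear.continuous_on[OF bounded_linear_Bs])
  then have m: "strongly_measurable lebesgue (obs T d)"
    unfolding obs_def[abs_def] by (rule strongly_measurable_continuous_cut)
  obtain K where K: "K \<ge> 1" "\<And>t d. 0 \<le> t \<Longrightarrow> t \<le> T \<Longrightarrow> norm (Sd t d) \<le> K * norm d"
    using Sd_bounded by blast
  obtain K' where K': "\<And>d. norm (Bs d) \<le> norm d * K'" "K' > 0"
    using bounded_linear.pos_bounded[OF bounded_linear_Bs] by blast
  have b: "norm (obs T d s) \<le> (K * norm d) * K'" for s
  proof (cases "s \<in> {0<..<T}")
    case True
    then have "norm (Sd (T - s) d) * K' \<le> (K * norm d) * K'" using K' by (intro mult_right_mono K) auto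
    then show ?thesis using True K'(1)[of "Sd (T - s) d"] by (simp add: obs_def)
  qed (use K K' in \<open>auto simp: obs_def\<close>)
  show ?thesis
  proof (cases "T \<ge> 0")
    case True
    show ?thesis by (rule Lp_bounded(1)[OF m b _ _ True]) (auto simp: obs_def)
  next
    case False
    then have "obs T d = (\<lambda>s. 0)" by (auto simp: obs_def)
    then show ?thesis by simp
  qed
qed

lemma in_Lp_restrict:
  assumes u: "Lp p u"
  shows "in_Lp p {0<..<T} u" and "p > 0 \<Longrightarrow> Lp_norm p {0<..<T} u \<le> np p u powr (1 / p)"
proof -
  have i: "integrable lebesgue (\<lambda>t. norm (u t) powr p)" using u by (simp add: Lp_def)
  then have i2: "integrable lebesgue (\<lambda>t. indicator {0<..<T} t *\<^sub>R norm (u t) powr p)"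
    by (intro integrable_mult_indicator) auto
  show "in_Lp p {0<..<T} u"
    unfolding in_Lp_def
  proof
    show "strongly_measurable (lebesgue_on {0<..<T}) u"
      by (subst strongly_measurable_lebesgue_on) (simp, intro strongly_measurable_cut Lp_meas[OF u], simp)
    show "integrable (lebesgue_on {0<..<T}) (\<lambda>t. norm (u t) powr p)"
      using i2 by (subst integrable_restrict_space) auto
  qed
  assume p: "p > 0"
  have "(LINT t|lebesgue_on {0<..<T}. norm (u t) powr p) = (\<integral>t. indicator {0<..<T} t *\<^sub>R norm (u t) powr p \<partial>lebesgue)"
    by (rule integral_restrict_space) simp
  also have "\<dots> \<le> np p u"
    unfolding np_def by (intro integral_mono i i2) (simp add: indicator_def)
  finally show "Lp_norm p {0<..<T} u \<le> np p u powr (1 / p)"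
    unfolding Lp_norm_def using p by (intro powr_mono2 integral_nonneg_AE) simp_all
qed

text \<open>The input map: the state reached at time \<open>T\<close> from rest. For square
  integrable controls and positive \<open>T\<close>, admissibility puts the integral into the range
  of \<open>emb\<close>, so that the inverse is meaningful.\<close>

definition Phi :: "real \<Rightarrow> (real \<Rightarrow> 'u) \<Rightarrow> 'x" where
  "Phi T u = inv (emb \<iota>) (integral {0..T} (\<lambda>s. S_ext S \<iota> (T - s) (blinfun_apply B (u s))))"

lemma sol_eq: "sol S \<iota> B y u T = S T y + Phi T u"
  by (simp add: sol_def Phi_def)

lemma Phi_cong:
  assumes "\<And>s. s \<in> {0<..<T} \<Longrightarrow> u s = v s"
  shows "Phi T u = Phi T v"
proof -
  have "integral {0..T} (\<lambda>s. S_ext S \<iota> (T - s) (blinfun_apply B (u s))) = integral {0..T} (\<lambda>s. S_ext S \<iota> (T - s) (blinfun_apply B (v s)))"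
    by (rule integral_spike[of "{0, T}"]) (use assms in auto)
  then show ?thesis by (simp add: Phi_def)
qed

lemma Phi_has_integral:
  assumes T: "T > 0" and u: "Lp 2 u"
  shows "((\<lambda>s. S_ext S \<iota> (T - s) (blinfun_apply B (u s))) has_integral emb \<iota> (Phi T u)) {0..T}"
proof -
  obtain x where x: "((\<lambda>s. S_ext S \<iota> (T - s) (blinfun_apply B (u s))) has_integral emb \<iota> x) {0..T}"
    using adm T in_Lp_restrict(1)[OF u] unfolding admissible_control_operator_def by blast
  then have "Phi T u = x" unfolding Phi_def by (simp add: integral_unique inv_f_f[OF inj_emb])
  with x show ?thesis by simp
qed

lemma Phi_norm:
  assumes T: "T > 0"
  obtains C where "C > 0" "\<And>u. Lp 2 u \<Longrightarrow> norm (Phi T u) \<le> C * sqrt (np 2 u)"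
proof -
  obtain C where C: "C > 0" "\<And>u :: real \<Rightarrow> 'u. (\<forall>T>0. in_Lp 2 {0<..<T} u) \<Longrightarrow>
        (\<exists>x. ((\<lambda>s. S_ext S \<iota> (T - s) (blinfun_apply B (u s))) has_integral emb \<iota> x) {0..T} \<and>
             norm x \<le> C * Lp_norm 2 {0<..<T} u)"
    using adm T unfolding admissible_control_operator_def by blast
  show ?thesis
  proof (rule that[OF C(1)])
    fix u :: "real \<Rightarrow> 'u" assume u: "Lp 2 u"
    obtain x where x: "((\<lambda>s. S_ext S \<iota> (T - s) (blinfun_apply B (u s))) has_integral emb \<iota> x) {0..T}"
      "norm x \<le> C * Lp_norm 2 {0<..<T} u" using C(2) in_Lp_restrict(1)[OF u] by blast
    have "emb \<iota> x = emb \<iota> (Phi T u)" using has_integral_unique[OF x(1) Phi_has_integral[OF T u]] .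
    then have "x = Phi T u" using inj_emb by (simp add: inj_eq)
    moreover have "Lp_norm 2 {0<..<T} u \<le> sqrt (np 2 u)"
      using in_Lp_restrict(2)[OF u, of T] by (simp add: powr_half_sqrt)
    then have "C * Lp_norm 2 {0<..<T} u \<le> C * sqrt (np 2 u)" using C(1) by (intro mult_left_mono) auto
    ultimately show "norm (Phi T u) \<le> C * sqrt (np 2 u)" using x(2) by simp
  qed
qed

text \<open>Evaluation at \<open>d\<close> is a bounded functional on the dual space, so it passes
  under the integral and moves the semigroup and B onto \<open>d\<close>. The end points of the
  interval, where \<open>obs\<close> is cut off, form a null set. Identities between states are
  afterwards checked through such pairings.\<close>

lemma Phi_pairing:
  assumes T: "T > 0" and u: "Lp 2 u"
  shows "Phi T u \<bullet> \<iota> d = (\<integral>s. u s \<bullet> obs T d s \<partial>lebesgue)"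
proof -
  have "((\<lambda>s. blinfun_apply (S_ext S \<iota> (T - s) (blinfun_apply B (u s))) d) has_integral blinfun_apply (emb \<iota> (Phi T u)) d) {0..T}"
    using has_integral_linear[OF Phi_has_integral[OF T u] blinfun.bounded_linear_left[of d]] by (simp add: o_def)
  then have "((\<lambda>s. blinfun_apply (S_ext S \<iota> (T - s) (blinfun_apply B (u s))) d) has_integral Phi T u \<bullet> \<iota> d) {0..T}"
    by (simp add: emb_apply)
  then have "((\<lambda>s. u s \<bullet> obs T d s) has_integral Phi T u \<bullet> \<iota> d) {0..T}"
    by (rule has_integral_spike[of "{0, T}", rotated 2]) (auto simp: obs_def S_ext_apply inner_Bs)
  moreover have "((\<lambda>s. u s \<bullet> obs T d s) has_integral (\<integral>s. u s \<bullet> obs T d s \<partial>lebesgue)) {0..T}"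
  proof -
    have "((\<lambda>s. u s \<bullet> obs T d s) has_integral (\<integral>s. u s \<bullet> obs T d s \<partial>lebesgue)) UNIV"
      by (rule has_integral_integral_lebesgue[OF pairing_integrable[OF u obs_Lp]])
    then have "((\<lambda>s. if s \<in> {0..T} then u s \<bullet> obs T d s else 0) has_integral (\<integral>s. u s \<bullet> obs T d s \<partial>lebesgue)) UNIV"
      by (rule has_integral_eq[rotated]) (auto simp: obs_def)
    then show ?thesis by (simp only: has_integral_restrict_UNIV)
  qed
  ultimately show ?thesis by (rule has_integral_unique)
qed

lemma Phi_eqI:
  assumes "T > 0" "Lp 2 u" "\<And>d. x \<bullet> \<iota> d = (\<integral>s. u s \<bullet> obs T d s \<partial>lebesgue)"
  shows "Phi T u = x"
proof -
  have "Phi T u - x = 0"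
    by (rule orthogonal_iota) (simp add: inner_diff_left Phi_pairing[OF assms(1,2)] assms(3))
  then show ?thesis by simp
qed

lemma Phi_add:
  assumes T: "T > 0" and u: "Lp 2 u" and v: "Lp 2 v"
  shows "Phi T (\<lambda>t. u t + v t) = Phi T u + Phi T v"
proof (rule Phi_eqI[OF T])
  show "Lp 2 (\<lambda>t. u t + v t)" by (rule Lp_add[OF _ u v]) simp
  show "(Phi T u + Phi T v) \<bullet> \<iota> d = (\<integral>s. (u s + v s) \<bullet> obs T d s \<partial>lebesgue)" for d
    unfolding inner_add_left Phi_pairing[OF T u] Phi_pairing[OF T v]
    by (rule Bochner_Integration.integral_add[symmetric]) (intro pairing_integrable u v obs_Lp)+
qed

lemma Phi_scale:
  assumes T: "T > 0" and u: "Lp 2 u"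
  shows "Phi T (\<lambda>t. c *\<^sub>R u t) = c *\<^sub>R Phi T u"
proof (rule Phi_eqI[OF T])
  show "Lp 2 (\<lambda>t. c *\<^sub>R u t)" by (rule Lp_scaleR[OF u])
  show "(c *\<^sub>R Phi T u) \<bullet> \<iota> d = (\<integral>s. (c *\<^sub>R u s) \<bullet> obs T d s \<partial>lebesgue)" for d
    by (simp add: Phi_pairing[OF T u])
qed

lemma Phi_diff:
  assumes T: "T > 0" and u: "Lp 2 u" and v: "Lp 2 v"
  shows "Phi T (\<lambda>t. u t - v t) = Phi T u - Phi T v"
proof -
  have "(\<lambda>t. u t - v t) = (\<lambda>t. u t + (-1) *\<^sub>R v t)" by simp
  then have "Phi T (\<lambda>t. u t - v t) = Phi T u + Phi T (\<lambda>t. (-1) *\<^sub>R v t)"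
    by (simp only: Phi_add[OF T u Lp_scaleR[OF v]])
  then show ?thesis by (simp only: Phi_scale[OF T v]) simp
qed


lemma Phi_zero: "T > 0 \<Longrightarrow> Phi T (\<lambda>t. 0) = 0"
  by (rule Phi_eqI) (simp_all only: Lp_zero inner_zero_left Bochner_Integration.integral_zero)

lemma Phi_cong_AE:
  assumes T: "T > 0" and u: "Lp 2 u" "Lp 2 v" and eq: "AE t in lebesgue. t \<in> {0<..<T} \<longrightarrow> u t = v t"
  shows "Phi T u = Phi T v"
proof (rule Phi_eqI[OF T u(1)])
  fix d
  have "(\<integral>s. v s \<bullet> obs T d s \<partial>lebesgue) = (\<integral>s. u s \<bullet> obs T d s \<partial>lebesgue)"
  proof (rule integral_cong_AE)
    show "AE s in lebesgue. v s \<bullet> obs T d s = u s \<bullet> obs T d s"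
      using eq
    proof eventually_elim
      case (elim s)
      then show ?case by (cases "s \<in> {0<..<T}") (simp_all add: obs_def)
    qed
  qed (intro borel_measurable_inner_strongly Lp_meas[OF u(1)] Lp_meas[OF u(2)] Lp_meas[OF obs_Lp])+
  then show "Phi T v \<bullet> \<iota> d = (\<integral>s. u s \<bullet> obs T d s \<partial>lebesgue)"
    by (simp add: Phi_pairing[OF T u(2)])
qed

text \<open>After time \<open>T\<close> the control is zero and the state moves freely under S
  \<delta>. On the dual side this is the semigroup law for T + \<delta> - s.\<close>

lemma Phi_extend:
  assumes T: "T > 0" and d: "\<delta> \<ge> 0" and u: "Lp 2 u" and supp: "\<And>t. t \<notin> {0<..<T} \<Longrightarrow> u t = 0"
  shows "Phi (T + \<delta>) u = S \<delta> (Phi T u)"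
proof (rule Phi_eqI)
  fix e
  have "S \<delta> (Phi T u) \<bullet> \<iota> e = Phi T u \<bullet> \<iota> (Sd \<delta> e)" by (simp add: inner_Ss[OF d] iota_Sd[OF d])
  also have "\<dots> = (\<integral>s. u s \<bullet> obs T (Sd \<delta> e) s \<partial>lebesgue)" by (rule Phi_pairing[OF T u])
  also have "\<dots> = (\<integral>s. u s \<bullet> obs (T + \<delta>) e s \<partial>lebesgue)"
  proof (rule Bochner_Integration.integral_cong)
    fix s
    show "u s \<bullet> obs T (Sd \<delta> e) s = u s \<bullet> obs (T + \<delta>) e s"
    proof (cases "s \<in> {0<..<T}")
      case True
      have eq: "T + \<delta> - s = (T - s) + \<delta>" by simp
      have "Sd (T + \<delta> - s) e = Sd (T - s) (Sd \<delta> e)" unfolding eq by (rule Sd_add) (use True d in auto)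
      then show ?thesis using True d by (simp add: obs_def)
    qed (simp add: supp)
  qed simp
  finally show "S \<delta> (Phi T u) \<bullet> \<iota> e = (\<integral>s. u s \<bullet> obs (T + \<delta>) e s \<partial>lebesgue)" .
qed (use T d u in simp_all)

text \<open>Starting from rest, waiting before a control is applied leaves the state reached
  unchanged. This brings controls with different horizons to a common one.\<close>

lemma Phi_shift:
  assumes T: "T > 0" and d: "\<delta> \<ge> 0" and u: "Lp 2 u" and supp: "\<And>t. t \<notin> {0<..<T} \<Longrightarrow> u t = 0"
  shows "Phi (T + \<delta>) (\<lambda>t. u (t - \<delta>)) = Phi T u"
proof (rule Phi_eqI)
  fix e
  have "(\<integral>s. u (s - \<delta>) \<bullet> obs (T + \<delta>) e s \<partial>lebesgue) = (\<integral>s. u s \<bullet> obs (T + \<delta>) e (s + \<delta>) \<partial>lebesgue)"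
    using lebesgue_integral_real_affine[of 1 "\<lambda>s. u (s - \<delta>) \<bullet> obs (T + \<delta>) e s" \<delta>] by (simp add: add.commute)
  also have "\<dots> = (\<integral>s. u s \<bullet> obs T e s \<partial>lebesgue)"
  proof (rule Bochner_Integration.integral_cong)
    fix s
    show "u s \<bullet> obs (T + \<delta>) e (s + \<delta>) = u s \<bullet> obs T e s"
      using supp[of s] d by (cases "s \<in> {0<..<T}") (auto simp: obs_def)
  qed simp
  finally show "Phi T u \<bullet> \<iota> e = (\<integral>s. u (s - \<delta>) \<bullet> obs (T + \<delta>) e s \<partial>lebesgue)"
    by (simp add: Phi_pairing[OF T u])
qed (use T d Lp_shift[OF u] in simp_all)

end

section \<open>Bounded controls\<close>

text \<open>Bound and support hold at every point, so that sums, cuts and shifts require no null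
  sets. \<open>bounded_control_of_AE\<close> supplies such a representative from a.e.
  information.\<close>

definition bounded_control :: "real \<Rightarrow> real \<Rightarrow> real \<Rightarrow> (real \<Rightarrow> 'u::real_normed_vector) \<Rightarrow> bool" where
  "bounded_control M a b u \<longleftrightarrow> strongly_measurable lebesgue u \<and> (\<forall>t. norm (u t) \<le> M) \<and> (\<forall>t. t \<notin> {a<..<b} \<longrightarrow> u t = 0)"

lemma bounded_controlD:
  assumes "bounded_control M a b u"
  shows "strongly_measurable lebesgue u" "\<And>t. norm (u t) \<le> M" "\<And>t. t \<notin> {a<..<b} \<Longrightarrow> u t = 0" "0 \<le> M"
  using assms order.trans[OF norm_ge_zero, of "u 0" M] by (auto simp: bounded_control_def)

lemma bounded_control_Lp:
  assumes u: "bounded_control M a b u" and p: "p \<ge> 0"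
  shows "Lp p u" and "np p u \<le> M powr p * max 0 (b - a)"
proof -
  have "Lp p u \<and> np p u \<le> M powr p * max 0 (b - a)"
  proof (cases "a \<le> b")
    case True
    then show ?thesis using Lp_bounded[OF bounded_controlD(1,2)[OF u] p bounded_controlD(3)[OF u] True] by simp
  next
    case False
    then have "u = (\<lambda>t. 0)" using bounded_controlD(3)[OF u] by auto
    then show ?thesis by simp
  qed
  then show "Lp p u" "np p u \<le> M powr p * max 0 (b - a)" by auto
qed

lemma bounded_control_mono:
  "bounded_control M a b u \<Longrightarrow> M \<le> M' \<Longrightarrow> a' \<le> a \<Longrightarrow> b \<le> b' \<Longrightarrow> bounded_control M' a' b' u"
  unfolding bounded_control_def by (auto intro: order.trans)

lemma bounded_control_add:
  assumes u: "bounded_control M a b u" and v: "bounded_control N a b v"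
  shows "bounded_control (M + N) a b (\<lambda>t. u t + v t)"
  unfolding bounded_control_def
proof (intro conjI allI impI)
  show "strongly_measurable lebesgue (\<lambda>t. u t + v t)"
    by (intro strongly_measurable_add bounded_controlD(1)[OF u] bounded_controlD(1)[OF v])
  show "norm (u t + v t) \<le> M + N" for t
    by (rule order.trans[OF norm_triangle_ineq]) (intro add_mono bounded_controlD(2)[OF u] bounded_controlD(2)[OF v])
  show "u t + v t = 0" if "t \<notin> {a<..<b}" for t
    using bounded_controlD(3)[OF u that] bounded_controlD(3)[OF v that] by simp
qed

lemma bounded_control_scale:
  assumes u: "bounded_control M a b u"
  shows "bounded_control (\<bar>c\<bar> * M) a b (\<lambda>t. c *\<^sub>R u t)"
  using bounded_controlD[OF u]
  by (auto simp: bounded_control_def intro!: strongly_measurable_scaleR mult_left_mono)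

lemma bounded_control_cut:
  assumes u: "bounded_control M a b u" and A: "A \<in> sets lebesgue" and "\<And>t. t \<in> A \<Longrightarrow> t \<in> {a<..<b} \<Longrightarrow> t \<in> {a'<..<b'}"
  shows "bounded_control M a' b' (\<lambda>t. if t \<in> A then u t else 0)"
  using bounded_controlD[OF u] assms(3)
  by (fastforce simp: bounded_control_def intro!: strongly_measurable_cut A)

lemma bounded_control_shift:
  assumes u: "bounded_control M a b u"
  shows "bounded_control M (a + \<delta>) (b + \<delta>) (\<lambda>t. u (t - \<delta>))"
  using bounded_controlD[OF u] by (auto simp: bounded_control_def strongly_measurable_shift)

lemma Lp_cong_AE:
  assumes u: "Lp p u" and eq: "AE t in lebesgue. u t = v t"
  shows "Lp p v"
proof (rule Lp_dominated)
  show "strongly_measurable lebesgue v" by (rule strongly_measurable_cong_AE[OF Lp_meas[OF u] eq])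
  show "integrable lebesgue (\<lambda>t. norm (u t) powr p)" using u by (simp add: Lp_def)
  show "AE t in lebesgue. norm (v t) powr p \<le> norm (u t) powr p" using eq by eventually_elim simp
qed

lemma bounded_control_of_AE:
  assumes v: "strongly_measurable (lebesgue_on {a<..<b}) v" and c: "c \<ge> 0"
    and le: "AE t in lebesgue_on {a<..<b}. norm (v t) \<le> c"
  obtains w where "bounded_control c a b w" "AE t in lebesgue. t \<in> {a<..<b} \<longrightarrow> w t = v t"
    "AE t in lebesgue. w t = (if t \<in> {a<..<b} then v t else 0)"
proof -
  define w where "w = (\<lambda>t. if t \<in> {a<..<b} \<and> norm (v t) \<le> c then v t else 0)"
  have "AE t in lebesgue. t \<in> {a<..<b} \<longrightarrow> norm (v t) \<le> c"
    using le by (subst (asm) AE_restrict_space_iff) auto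
  then have eq: "AE t in lebesgue. (if t \<in> {a<..<b} then v t else 0) = w t"
    by eventually_elim (simp add: w_def)
  have "strongly_measurable lebesgue (\<lambda>t. if t \<in> {a<..<b} then v t else 0)"
    using v by (subst (asm) strongly_measurable_lebesgue_on) auto
  then have "strongly_measurable lebesgue w" using eq by (rule strongly_measurable_cong_AE)
  then have "bounded_control c a b w" using c by (auto simp: bounded_control_def w_def)
  moreover have "AE t in lebesgue. t \<in> {a<..<b} \<longrightarrow> w t = v t" using eq by eventually_elim auto
  moreover have "AE t in lebesgue. w t = (if t \<in> {a<..<b} then v t else 0)" using eq by eventually_elim simp
  ultimately show ?thesis using that by blast
qed

lemma strongly_measurable_subset:
  fixes u :: "real \<Rightarrow> 'u::real_normed_vector"
  assumes u: "strongly_measurable (lebesgue_on A) u" and A: "A \<in> sets lebesgue" "B \<in> sets lebesgue" "B \<subseteq> A"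
  shows "strongly_measurable (lebesgue_on B) u"
proof -
  have "strongly_measurable lebesgue (\<lambda>t. if t \<in> B then (if t \<in> A then u t else 0) else 0)"
    by (rule strongly_measurable_cut[OF _ A(2)]) (use u A(1) in \<open>simp add: strongly_measurable_lebesgue_on\<close>)
  moreover have "(\<lambda>t. if t \<in> B then (if t \<in> A then u t else 0) else 0) = (\<lambda>t. if t \<in> B then u t else 0)"
    using A(3) by (simp add: fun_eq_iff subset_iff)
  ultimately show ?thesis using A(2) by (simp add: strongly_measurable_lebesgue_on)
qed

lemma bounded_control_restrict:
  assumes u: "bounded_control M a b u" and A: "A \<in> sets lebesgue"
  shows "strongly_measurable (lebesgue_on A) u" and "AE t in lebesgue_on A. norm (u t) \<le> M"
  using bounded_controlD[OF u] A by (auto simp: strongly_measurable_lebesgue_on strongly_measurable_cut)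

text \<open>A substitute for the inclusion of L^p in L^2 with a free weight: where |w|^2 <= \<eta>
  the first term suffices, elsewhere |w|^2 <= \<eta>^(1 - p/2) |w|^p. A small \<eta> later shows
  that convergence in L^p implies convergence in L^2.\<close>

lemma np2_le_np:
  fixes w :: "real \<Rightarrow> 'u::real_normed_vector"
  assumes p: "p \<ge> 2" and w: "Lp p w" and supp: "\<And>t. t \<notin> {a<..<b} \<Longrightarrow> w t = 0" and ab: "a \<le> b" and eta: "\<eta> > 0"
  shows "Lp 2 w" and "np 2 w \<le> \<eta> * (b - a) + \<eta> powr (1 - p / 2) * np p w"
proof -
  let ?g = "\<lambda>t. \<eta> * indicator {a<..<b} t + \<eta> powr (1 - p / 2) * norm (w t) powr p"
  have gi: "integrable lebesgue ?g" using w finite_indicator_integrable[of a b] by (auto simp: Lp_def)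
  have le: "norm (w t) powr 2 \<le> ?g t" for t
  proof (cases "t \<in> {a<..<b}")
    case True
    show ?thesis
    proof (cases "(norm (w t))^2 \<le> \<eta>")
      case True
      have "norm (w t) powr 2 = (norm (w t))^2" by (rule powr_2_norm)
      moreover have "0 \<le> \<eta> powr (1 - p / 2) * norm (w t) powr p" by simp
      moreover have "?g t = \<eta> + \<eta> powr (1 - p / 2) * norm (w t) powr p" using \<open>t \<in> {a<..<b}\<close> by simp
      ultimately show ?thesis using True by linarith
    next
      case False
      define x where "x = norm (w t) powr 2"
      have x: "x \<ge> \<eta>" "x > 0" using False eta by (auto simp: x_def powr_2_norm)
      have "norm (w t) powr p = x powr (p / 2)" unfolding x_def powr_powr by simp
      also have "x powr (p / 2) = x powr 1 * x powr (p / 2 - 1)" unfolding powr_add[symmetric] by simp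
      finally have 1: "norm (w t) powr p = x * x powr (p / 2 - 1)" using x by simp
      have "\<eta> powr (p / 2 - 1) \<le> x powr (p / 2 - 1)" using x eta p by (intro powr_mono2) auto
      then have "x * \<eta> powr (p / 2 - 1) \<le> norm (w t) powr p" unfolding 1 using x by (intro mult_left_mono) auto
      then have "\<eta> powr (1 - p / 2) * (x * \<eta> powr (p / 2 - 1)) \<le> \<eta> powr (1 - p / 2) * norm (w t) powr p"
        by (intro mult_left_mono) auto
      moreover have "\<eta> powr (1 - p / 2) * (x * \<eta> powr (p / 2 - 1)) = x"
      proof -
        have "\<eta> powr (1 - p / 2) * \<eta> powr (p / 2 - 1) = \<eta> powr 0" by (simp add: powr_add[symmetric])
        then have "\<eta> powr (1 - p / 2) * \<eta> powr (p / 2 - 1) = 1" using eta by simp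
        then show ?thesis by (simp add: mult.left_commute)
      qed
      ultimately have "x \<le> \<eta> powr (1 - p / 2) * norm (w t) powr p" by (simp only:)
      moreover have "?g t = \<eta> + \<eta> powr (1 - p / 2) * norm (w t) powr p" using \<open>t \<in> {a<..<b}\<close> by simp
      ultimately show ?thesis using eta unfolding x_def by linarith
    qed
  next
    case False
    then show ?thesis using supp p by simp
  qed
  show L: "Lp 2 w" by (rule Lp_dominated[OF Lp_meas[OF w] gi]) (use le in auto)
  have "np 2 w \<le> (\<integral>t. ?g t \<partial>lebesgue)" by (rule np_mono[OF L gi]) (use le in auto)
  also have "\<dots> = \<eta> * (b - a) + \<eta> powr (1 - p / 2) * np p w"
    using w ab finite_indicator_integrable[of a b] by (simp add: Lp_def np_def)
  finally show "np 2 w \<le> \<eta> * (b - a) + \<eta> powr (1 - p / 2) * np p w" .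
qed

lemma np2_tendsto_0:
  fixes w :: "nat \<Rightarrow> real \<Rightarrow> 'u::real_normed_vector"
  assumes p: "p \<ge> 2" and w: "\<And>n. Lp p (w n)" and supp: "\<And>n t. t \<notin> {a<..<b} \<Longrightarrow> w n t = 0" and ab: "a \<le> b"
    and lim: "(\<lambda>n. np p (w n)) \<longlonglongrightarrow> 0"
  shows "(\<lambda>n. np 2 (w n)) \<longlonglongrightarrow> 0"
proof (rule LIMSEQ_I)
  fix e :: real assume e: "e > 0"
  define \<eta> where "\<eta> = e / (2 * (b - a + 1))"
  have eta: "\<eta> > 0" using e ab by (simp add: \<eta>_def)
  have "\<eta> * (b - a) \<le> \<eta> * (b - a + 1)" using eta by simp
  also have "\<dots> = e / 2"
  proof -
    have "x / (2 * c) * c = x / 2" if "c \<noteq> 0" for x c :: real using that by simp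
    then show ?thesis unfolding \<eta>_def using ab by (metis add_nonneg_pos diff_ge_0_iff_ge less_irrefl zero_less_one)
  qed
  finally have h: "\<eta> * (b - a) \<le> e / 2" .
  have "(\<lambda>n. \<eta> powr (1 - p / 2) * np p (w n)) \<longlonglongrightarrow> \<eta> powr (1 - p / 2) * 0" by (intro tendsto_intros lim)
  then have "eventually (\<lambda>n. \<eta> powr (1 - p / 2) * np p (w n) < e / 2) sequentially"
    using e by (intro order_tendstoD) auto
  then obtain N where N: "\<And>n. n \<ge> N \<Longrightarrow> \<eta> powr (1 - p / 2) * np p (w n) < e / 2" by (auto simp: eventually_sequentially)
  have "norm (np 2 (w n) - 0) < e" if "n \<ge> N" for n
    using np2_le_np(2)[OF p w supp ab eta, of n] N[OF that] h by simp
  then show "\<exists>N. \<forall>n\<ge>N. norm (np 2 (w n) - 0) < e" by blast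
qed

context control_system
begin

section \<open>Limits of controls and of the states they reach\<close>

lemma Phi_tendsto:
  assumes T: "T > 0" and v: "\<And>n. Lp 2 (v n)" and l: "Lp 2 l" and lim: "(\<lambda>n. np 2 (\<lambda>t. v n t - l t)) \<longlonglongrightarrow> 0"
  shows "(\<lambda>n. Phi T (v n)) \<longlonglongrightarrow> Phi T l"
proof -
  obtain C where C: "C > 0" "\<And>u. Lp 2 u \<Longrightarrow> norm (Phi T u) \<le> C * sqrt (np 2 u)" using Phi_norm[OF T] by blast
  have "(\<lambda>n. Phi T (v n) - Phi T l) \<longlonglongrightarrow> 0"
  proof (rule Lim_null_comparison)
    have "norm (Phi T (v n) - Phi T l) \<le> C * sqrt (np 2 (\<lambda>t. v n t - l t))" for n
      using C(2)[OF Lp_diff[OF _ v l], of n] by (simp add: Phi_diff[OF T v l])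
    then show "eventually (\<lambda>n. norm (Phi T (v n) - Phi T l) \<le> C * sqrt (np 2 (\<lambda>t. v n t - l t))) sequentially" by simp
    have "(\<lambda>n. C * sqrt (np 2 (\<lambda>t. v n t - l t))) \<longlonglongrightarrow> C * sqrt 0" by (intro tendsto_intros lim)
    then show "(\<lambda>n. C * sqrt (np 2 (\<lambda>t. v n t - l t))) \<longlonglongrightarrow> 0" by simp
  qed
  then show ?thesis by (simp add: LIM_zero_iff)
qed

text \<open>Takes the place of weak-star compactness of balls of bounded controls.\<close>

lemma bounded_reachable_closed:
  assumes T: "T > 0" and approx: "\<And>e. e > 0 \<Longrightarrow> \<exists>v. bounded_control (M + e) a b v \<and> norm (Phi T v - x) \<le> e"
  obtains v where "bounded_control M a b v" "Phi T v = x"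
proof -
  \<comment> \<open>The control bound and the tolerance in the target are relaxed by the same null
    sequence. This gives nested convex sets, nonempty by \<open>approx\<close>, to which
    \<open>nested_minimisers\<close> applies.\<close>
  define C where "C = (\<lambda>k::nat. {v. bounded_control (M + inverse (real (Suc k))) a b v \<and> norm (Phi T v - x) \<le> inverse (real (Suc k))})"
  have M0: "M \<ge> 0"
  proof (rule field_le_epsilon)
    fix e :: real assume "e > 0"
    then obtain v where "bounded_control (M + e) a b (v :: real \<Rightarrow> 'u)" using approx by blast
    then show "0 \<le> M + e" by (rule bounded_controlD(4))
  qed
  define K where "K = (M + 1) powr 2 * max 0 (b - a)"
  have CL: "Lp 2 v" if "v \<in> C k" for v k using that by (auto simp: C_def intro: bounded_control_Lp)
  obtain v l where v: "\<And>k. v k \<in> C k" and l: "Lp 2 l" and vl: "(\<lambda>k. np 2 (\<lambda>t. v k t - l t)) \<longlonglongrightarrow> 0"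
    and ae: "AE t in lebesgue. (\<lambda>k. v k t) \<longlonglongrightarrow> l t"
  proof (rule nested_minimisers[of 2 "1 / 2 powr 2" "np 2" C 0 K])
    show "np 2 (\<lambda>t. (1 / 2) *\<^sub>R (u t + v t)) + 1 / 2 powr 2 * np 2 (\<lambda>t. u t - v t) \<le> (np 2 u + np 2 v) / 2"
      if "Lp 2 u" "Lp 2 v" for u v :: "real \<Rightarrow> 'u" using np_Clarkson[OF _ that] by simp
    show "C (Suc k) \<subseteq> C k" for k
    proof
      fix v assume v: "v \<in> C (Suc k)"
      have le: "inverse (real (Suc (Suc k))) \<le> inverse (real (Suc k))" by (rule le_imp_inverse_le) auto
      have b: "bounded_control (M + inverse (real (Suc (Suc k)))) a b v"
        and n: "norm (Phi T v - x) \<le> inverse (real (Suc (Suc k)))" using v by (auto simp: C_def)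
      have "bounded_control (M + inverse (real (Suc k))) a b v"
        by (rule bounded_control_mono[OF b]) (use le in \<open>simp_all del: of_nat_Suc\<close>)
      then show "v \<in> C k" using order.trans[OF n le] by (simp add: C_def)
    qed
    show "(\<lambda>t. (1 / 2) *\<^sub>R (u t + v t)) \<in> C k" if u: "u \<in> C k" and v: "v \<in> C k" for k u v
    proof -
      have b: "bounded_control (M + inverse (real (Suc k))) a b u" "bounded_control (M + inverse (real (Suc k))) a b v"
        and n: "norm (Phi T u - x) \<le> inverse (real (Suc k))" "norm (Phi T v - x) \<le> inverse (real (Suc k))"
        using u v by (auto simp: C_def)
      have "bounded_control (M + inverse (real (Suc k))) a b (\<lambda>t. (1 / 2) *\<^sub>R (u t + v t))"
      proof -
        have e: "\<bar>1/2\<bar> * (A + A) = A" for A :: real by simp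
        show ?thesis using bounded_control_scale[OF bounded_control_add[OF b], of "1/2"] unfolding e .
      qed
      moreover have "Phi T (\<lambda>t. (1 / 2) *\<^sub>R (u t + v t)) = (1/2) *\<^sub>R (Phi T u + Phi T v)"
        using Phi_scale[OF T Lp_add[OF _ CL[OF u] CL[OF v]], of "1/2"] Phi_add[OF T CL[OF u] CL[OF v]] by simp
      moreover have "norm ((1/2) *\<^sub>R (Phi T u + Phi T v) - x) \<le> inverse (real (Suc k))"
      proof -
        have "(1/2) *\<^sub>R (x + x) = x" by (rule scaleR_half_double)
        then have "(1/2) *\<^sub>R (Phi T u + Phi T v) - x = (1/2) *\<^sub>R (Phi T u + Phi T v) - (1/2) *\<^sub>R (x + x)" by (simp only:)
        also have "\<dots> = (1/2) *\<^sub>R ((Phi T u - x) + (Phi T v - x))"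
          unfolding scaleR_diff_right[symmetric] by simp
        also have "norm \<dots> \<le> (1/2) * (norm (Phi T u - x) + norm (Phi T v - x))"
          using norm_triangle_ineq[of "Phi T u - x" "Phi T v - x"] by simp
        also have "\<dots> \<le> inverse (real (Suc k))"
        proof -
          have "(1/2) * (a + b) \<le> c" if "a \<le> c" "b \<le> c" for a b c :: real using that by argo
          then show ?thesis using n by blast
        qed
        finally show ?thesis .
      qed
      ultimately show ?thesis by (simp add: C_def)
    qed
    show "\<exists>u\<in>C k. np 2 u \<le> K" for k
    proof -
      obtain v where v: "bounded_control (M + inverse (real (Suc k))) a b (v :: real \<Rightarrow> 'u)" "norm (Phi T v - x) \<le> inverse (real (Suc k))"
        using approx[of "inverse (real (Suc k))"] by auto
      have "inverse (real (Suc k)) \<le> 1" by (simp add: field_simps)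
      then have "(M + inverse (real (Suc k))) powr 2 \<le> (M + 1) powr 2" using M0 by (intro powr_mono2) auto
      then have "(M + inverse (real (Suc k))) powr 2 * max 0 (b - a) \<le> K" unfolding K_def by (intro mult_right_mono) auto
      then have "np 2 v \<le> K" using bounded_control_Lp(2)[OF v(1), of 2] by linarith
      then show ?thesis using v by (auto simp: C_def)
    qed
  qed (use CL that in auto)
  have vb: "bounded_control (M + inverse (real (Suc k))) a b (v k)" and vn: "norm (Phi T (v k) - x) \<le> inverse (real (Suc k))" for k
    using v[of k] by (auto simp: C_def)
  \<comment> \<open>The limit inherits the bound and the support only almost everywhere.
    \<open>w\<close> is the representative that has them at every point.\<close>
  define w where "w = (\<lambda>t. if t \<in> {a<..<b} \<and> norm (l t) \<le> M then l t else 0)"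
  have lw: "AE t in lebesgue. l t = w t"
    using ae
  proof eventually_elim
    fix t assume t: "(\<lambda>k. v k t) \<longlonglongrightarrow> l t"
    have "norm (l t) \<le> M + 0"
    proof (rule LIMSEQ_le[OF tendsto_norm[OF t]])
      show "(\<lambda>k. M + inverse (real (Suc k))) \<longlonglongrightarrow> M + 0" by (intro tendsto_intros LIMSEQ_inverse_real_of_nat)
      show "\<exists>N. \<forall>n\<ge>N. norm (v n t) \<le> M + inverse (real (Suc n))" using bounded_controlD(2)[OF vb] by blast
    qed
    moreover have "l t = 0" if "t \<notin> {a<..<b}"
    proof -
      have "v k t = 0" for k by (rule bounded_controlD(3)[OF vb that])
      then have "(\<lambda>k::nat. 0) \<longlonglongrightarrow> l t" using t by (simp only:)
      then show ?thesis by (simp add: LIMSEQ_const_iff)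
    qed
    ultimately show "l t = w t" by (auto simp: w_def)
  qed
  have wb: "bounded_control M a b w"
    using strongly_measurable_cong_AE[OF Lp_meas[OF l] lw] M0 by (auto simp: bounded_control_def w_def)
  have wL: "Lp 2 w" by (rule bounded_control_Lp(1)[OF wb]) simp
  have "Phi T w = Phi T l"
    by (rule Phi_cong_AE[OF T wL l]) (use lw in eventually_elim, simp)
  moreover have "Phi T l = x"
  proof -
    have "(\<lambda>k. Phi T (v k)) \<longlonglongrightarrow> Phi T l" by (rule Phi_tendsto[OF T CL[OF v] l vl])
    moreover have "(\<lambda>k. Phi T (v k)) \<longlonglongrightarrow> x"
    proof -
      have "(\<lambda>k. Phi T (v k) - x) \<longlonglongrightarrow> 0"
        by (rule Lim_null_comparison[OF _ LIMSEQ_inverse_real_of_nat]) (use vn in simp)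
      then show ?thesis by (simp add: LIM_zero_iff)
    qed
    ultimately show ?thesis by (rule LIMSEQ_unique)
  qed
  ultimately show ?thesis using that[OF wb] by simp
qed

section \<open>The minimal norm function\<close>

lemma Phi_AE_control:
  assumes T: "T > 0" and w: "bounded_control c 0 T w"
    and eq: "AE t in lebesgue. w t = (if t \<in> {0<..<T} then v t else 0)"
  shows "Phi T w = Phi T v"
proof -
  have wL: "Lp 2 w" by (rule bounded_control_Lp(1)[OF w]) simp
  have "Phi T w = Phi T (\<lambda>t. if t \<in> {0<..<T} then v t else 0)"
    by (rule Phi_cong_AE[OF T wL Lp_cong_AE[OF wL eq]]) (use eq in eventually_elim, simp)
  also have "\<dots> = Phi T v" by (rule Phi_cong) simp
  finally show ?thesis .
qed

abbreviation "steers M T y v \<equiv> bounded_control M 0 T v \<and> S T y + Phi T v = 0"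
abbreviation "N \<equiv> min_norm_fin S \<iota> B"

text \<open>Positive length matters: over a null set the essential supremum is -
  \<infinity>.\<close>

lemma Linf_norm_nonneg:
  assumes "T > 0"
  shows "0 \<le> Linf_norm {0<..<T} v"
proof (rule ccontr)
  assume "\<not> ?thesis"
  then have neg: "Linf_norm {0<..<T} v < 0" by simp
  have "AE t in lebesgue_on {0<..<T}. ereal (norm (v t)) \<le> Linf_norm {0<..<T} v"
    unfolding Linf_norm_def by (rule esssup_AE)
  then have "AE t in lebesgue_on {0<..<T}. False"
  proof eventually_elim
    fix t assume "ereal (norm (v t)) \<le> Linf_norm {0<..<T} v"
    then have "ereal (norm (v t)) < 0" using neg by (rule le_less_trans)
    then show False by simp
  qed
  then have "AE t in lebesgue. t \<notin> {0<..<T}" by (subst (asm) AE_restrict_space_iff) auto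
  then have "{0<..<T} \<in> null_sets lebesgue" by (simp add: completion.null_sets_iff_AE)
  then show False using assms by (auto simp: null_sets_def)
qed

lemma N_nonneg: "T > 0 \<Longrightarrow> 0 \<le> N T y"
  unfolding min_norm_fin_def by (intro Inf_greatest) (auto simp: Linf_norm_nonneg)

text \<open>The infimum is attained. Near-optimal controls reach the target exactly with bounds M +
  e, and \<open>bounded_reachable_closed\<close> removes the e. This turns statements about
  \<open>N\<close> into statements about controls.\<close>

lemma N_le_iff:
  assumes T: "T > 0" and M: "M \<ge> 0"
  shows "N T y \<le> ereal M \<longleftrightarrow> (\<exists>v. steers M T y v)"
proof
  assume "\<exists>v. steers M T y v"
  then obtain v where v: "bounded_control M 0 T v" "S T y + Phi T v = 0" by blast
  have m: "strongly_measurable (lebesgue_on {0<..<T}) v" and b: "AE t in lebesgue_on {0<..<T}. norm (v t) \<le> M"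
    using bounded_control_restrict[OF v(1), of "{0<..<T}"] by auto
  have "Linf_norm {0<..<T} v \<le> ereal M"
    unfolding Linf_norm_def
  proof (rule esssup_I)
    have "(\<lambda>t. norm (v t)) \<in> borel_measurable (lebesgue_on {0<..<T})"
      using borel_measurable_norm_strongly[OF bounded_controlD(1)[OF v(1)]] by (rule measurable_restrict_space1)
    then show "(\<lambda>t. ereal (norm (v t))) \<in> borel_measurable (lebesgue_on {0<..<T})" by measurable
    show "AE t in lebesgue_on {0<..<T}. ereal (norm (v t)) \<le> ereal M" using b by simp
  qed
  moreover have "in_Linf {0<..<T} v" using m b by (auto simp: in_Linf_def)
  ultimately show "N T y \<le> ereal M"
    unfolding min_norm_fin_def using v(2) by (intro Inf_lower2) (auto simp: sol_eq)
next
  assume le: "N T y \<le> ereal M"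
  have "\<exists>v. bounded_control (M + e) 0 T v \<and> norm (Phi T v - (- S T y)) \<le> e" if e: "e > 0" for e
  proof -
    have "N T y < ereal (M + e)" using le_less_trans[OF le, of "ereal (M + e)"] e by simp
    then obtain v where v: "in_Linf {0<..<T} v" "sol S \<iota> B y v T = 0" "Linf_norm {0<..<T} v < ereal (M + e)"
      unfolding min_norm_fin_def Inf_less_iff by blast
    have "AE t in lebesgue_on {0<..<T}. ereal (norm (v t)) \<le> Linf_norm {0<..<T} v"
      unfolding Linf_norm_def by (rule esssup_AE)
    then have "AE t in lebesgue_on {0<..<T}. norm (v t) \<le> M + e"
    proof eventually_elim
      fix t assume "ereal (norm (v t)) \<le> Linf_norm {0<..<T} v"
      then have "ereal (norm (v t)) < ereal (M + e)" using v(3) by (rule le_less_trans)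
      then show "norm (v t) \<le> M + e" by simp
    qed
    then obtain w where w: "bounded_control (M + e) 0 T w" "AE t in lebesgue. w t = (if t \<in> {0<..<T} then v t else 0)"
      using bounded_control_of_AE[of 0 T v "M + e"] v(1) M e by (auto simp: in_Linf_def)
    have "Phi T w = - S T y" using Phi_AE_control[OF T w] v(2) by (simp add: sol_eq eq_neg_iff_add_eq_0 add.commute)
    then show ?thesis using w(1) e by (intro exI[of _ w]) simp
  qed
  then obtain v where "bounded_control M 0 T v" "Phi T v = - S T y"
    using bounded_reachable_closed[OF T, of M 0 T "- S T y"] by blast
  then show "\<exists>v. steers M T y v" by auto
qed

text \<open>Once the state is 0, the null control keeps it there.\<close>

lemma steers_extend:
  assumes T: "T > 0" and TT: "T \<le> T'" and v: "steers M T y v"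
  shows "steers M T' y v"
proof -
  have L: "Lp 2 v" by (rule bounded_control_Lp(1)[of M 0 T]) (use v in auto)
  have "S T' y = S (T' - T) (S T y)" using S_add[of "T' - T" T y] T TT by simp
  moreover have "Phi T' v = S (T' - T) (Phi T v)"
    using Phi_extend[OF T, of "T' - T" v] TT L bounded_controlD(3) v by fastforce
  ultimately have "S T' y + Phi T' v = S (T' - T) (S T y + Phi T v)" using TT by (simp add: S_linear)
  then show ?thesis using v TT by (auto simp: S_linear elim: bounded_control_mono)
qed

lemma ereal_le_by_reals:
  assumes "0 \<le> x" and "\<And>M. M \<ge> 0 \<Longrightarrow> x \<le> ereal M \<Longrightarrow> y \<le> ereal M"
  shows "y \<le> x"
  using assms by (cases x) auto

lemma N_antimono:
  assumes T: "T > 0" and TT: "T \<le> T'"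
  shows "N T' y \<le> N T y"
proof (rule ereal_le_by_reals[OF N_nonneg[OF T]])
  fix M :: real assume M: "M \<ge> 0" and "N T y \<le> ereal M"
  then obtain v where "steers M T y v" using N_le_iff[OF T M] by blast
  then have "steers M T' y v" by (rule steers_extend[OF T TT])
  then show "N T' y \<le> ereal M" using N_le_iff[of T' M y] T TT M by auto
qed

text \<open>Monotonicity of \<open>N\<close> makes the limit exist and equal the infimum; for the
  limit at 0 in \<open>min_norm_zero\<close> it is the supremum.\<close>

lemma min_norm_infinity: "min_norm S \<iota> B \<infinity> y = (INF t\<in>{0<..}. N t y)"
proof -
  have "((\<lambda>t. N t y) \<longlongrightarrow> (INF t\<in>{0<..}. N t y)) at_top"
  proof (rule order_tendstoI)
    fix a assume a: "a < (INF t\<in>{0<..}. N t y)"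
    show "eventually (\<lambda>t. a < N t y) at_top"
      using eventually_gt_at_top[of "0::real"]
    proof eventually_elim
      fix t :: real assume "t > 0"
      then have "(INF t\<in>{0<..}. N t y) \<le> N t y" by (intro INF_lower) simp
      then show "a < N t y" using a by simp
    qed
  next
    fix a assume "(INF t\<in>{0<..}. N t y) < a"
    then obtain t0 where t0: "t0 > 0" "N t0 y < a" by (auto simp: INF_less_iff)
    show "eventually (\<lambda>t. N t y < a) at_top"
      using eventually_ge_at_top[of t0] by eventually_elim (use t0 N_antimono[OF t0(1)] in \<open>auto intro: le_less_trans\<close>)
  qed
  then show ?thesis by (simp add: min_norm_def tendsto_Lim)
qed

lemma min_norm_zero: "min_norm S \<iota> B 0 y = (SUP t\<in>{0<..}. N t y)"
proof -
  have "((\<lambda>t. N t y) \<longlongrightarrow> (SUP t\<in>{0<..}. N t y)) (at_right 0)"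
  proof (rule order_tendstoI)
    fix a assume "a < (SUP t\<in>{0<..}. N t y)"
    then obtain t0 where t0: "t0 > 0" "a < N t0 y" by (auto simp: less_SUP_iff)
    have "a < N t y" if "0 < t" "t < t0" for t using N_antimono[OF that(1), of t0 y] that t0 by (auto intro: less_le_trans)
    then show "eventually (\<lambda>t. a < N t y) (at_right 0)"
      using t0(1) by (auto simp: eventually_at_right_field)
  next
    fix a assume a: "(SUP t\<in>{0<..}. N t y) < a"
    have "N t y < a" if "t > 0" for t
    proof -
      have "N t y \<le> (SUP t\<in>{0<..}. N t y)" using that by (intro SUP_upper) simp
      then show ?thesis using a by simp
    qed
    then show "eventually (\<lambda>t. N t y < a) (at_right 0)"
      by (auto simp: eventually_at_right_field intro!: exI[of _ 1])
  qed
  then show ?thesis by (simp add: min_norm_def tendsto_Lim)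
qed

lemma min_norm_pos: "0 < t \<Longrightarrow> min_norm S \<iota> B (ereal t) y = N t y"
  by (simp add: min_norm_def)

lemma min_norm_nonneg:
  assumes "0 \<le> \<tau>"
  shows "0 \<le> min_norm S \<iota> B \<tau> y"
proof (cases \<tau>)
  case (real t)
  show ?thesis
  proof (cases "t = 0")
    case True
    have "0 \<le> N 1 y" by (rule N_nonneg) simp
    also have "\<dots> \<le> (SUP t\<in>{0<..}. N t y)" by (rule SUP_upper) simp
    finally show ?thesis using True real min_norm_zero[of y] by (simp add: zero_ereal_def)
  next
    case False
    then show ?thesis using assms real by (simp add: min_norm_pos N_nonneg)
  qed
next
  case PInf
  then show ?thesis by (simp add: min_norm_infinity) (intro INF_greatest N_nonneg, simp)
qed (use assms in simp)

text \<open>If one bound \<open>R\<close> sufficed for all short times, S t y would be minus the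
  effect of a control of L^2 norm at most R sqrt t, hence tend to 0, although it tends to
  \<open>y\<close>. Delaying the control to the horizon 1 makes the admissibility constant
  independent of t.\<close>

lemma min_norm_zero_infinite:
  assumes y: "y \<noteq> 0"
  shows "min_norm S \<iota> B 0 y = \<infinity>"
proof (rule ccontr)
  assume "\<not> ?thesis"
  then have "(SUP t\<in>{0<..}. N t y) \<noteq> \<infinity>" by (simp add: min_norm_zero)
  moreover have "0 \<le> (SUP t\<in>{0<..}. N t y)"
    using min_norm_nonneg[of 0 y] by (simp add: min_norm_zero)
  ultimately obtain R where R: "(SUP t\<in>{0<..}. N t y) \<le> ereal R" "R \<ge> 0"
    by (cases "SUP t\<in>{0<..}. N t y") auto
  obtain C where C: "C > 0" "\<And>u. Lp 2 u \<Longrightarrow> norm (Phi 1 u) \<le> C * sqrt (np 2 u)" using Phi_norm[of 1] by auto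
  have bound: "norm (S t y) \<le> C * sqrt (R powr 2 * t)" if t: "0 < t" "t < 1" for t
  proof -
    have "N t y \<le> (SUP t\<in>{0<..}. N t y)" using t by (intro SUP_upper) simp
    then have "N t y \<le> ereal R" using R(1) by simp
    then obtain v where v: "bounded_control R 0 t v" "S t y + Phi t v = 0" using N_le_iff[OF t(1) R(2)] by blast
    have L: "Lp 2 v" by (rule bounded_control_Lp(1)[OF v(1)]) simp
    have "Phi t v = Phi (t + (1 - t)) (\<lambda>s. v (s - (1 - t)))"
      by (rule Phi_shift[OF t(1) _ L bounded_controlD(3)[OF v(1)], symmetric]) (use t in auto)
    then have "norm (Phi t v) \<le> C * sqrt (np 2 (\<lambda>s. v (s - (1 - t))))" using C(2)[OF Lp_shift[OF L]] by simp
    also have "np 2 (\<lambda>s. v (s - (1 - t))) \<le> R powr 2 * max 0 (t + (1 - t) - (0 + (1 - t)))"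
      by (rule bounded_control_Lp(2)[OF bounded_control_shift[OF v(1)]]) simp
    then have "C * sqrt (np 2 (\<lambda>s. v (s - (1 - t)))) \<le> C * sqrt (R powr 2 * t)"
      using C(1) t by (intro mult_left_mono) auto
    finally have "norm (Phi t v) \<le> C * sqrt (R powr 2 * t)" .
    moreover have "S t y = - Phi t v" using v(2) by (simp add: eq_neg_iff_add_eq_0)
    ultimately show ?thesis by simp
  qed
  have "((\<lambda>t. S t y) \<longlongrightarrow> 0) (at_right 0)"
  proof (rule Lim_null_comparison)
    show "eventually (\<lambda>t. norm (S t y) \<le> C * sqrt (R powr 2 * t)) (at_right 0)"
      using bound by (auto simp: eventually_at_right_field intro!: exI[of _ 1])
    have "((\<lambda>t. C * sqrt (R powr 2 * t)) \<longlongrightarrow> C * sqrt (R powr 2 * 0)) (at_right 0)"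
      by (intro tendsto_intros)
    then show "((\<lambda>t. C * sqrt (R powr 2 * t)) \<longlongrightarrow> 0) (at_right 0)" by simp
  qed
  then have "y = 0" by (rule tendsto_unique[rotated, OF S_tendsto_0]) simp
  with y show False by simp
qed

end

lemma AE_interval_nonempty:
  assumes "AE t in lebesgue. t \<in> {a<..<b} \<longrightarrow> P t" and "a < (b::real)"
  obtains t where "t \<in> {a<..<b}" "P t"
proof -
  have "\<exists>t. t \<in> {a<..<b} \<and> P t"
  proof (rule ccontr)
    assume no: "\<nexists>t. t \<in> {a<..<b} \<and> P t"
    have "AE t in lebesgue. t \<notin> {a<..<b}" using assms(1) by eventually_elim (use no in blast)
    then have "{a<..<b} \<in> null_sets lebesgue" by (simp add: completion.null_sets_iff_AE)
    then show False using assms(2) by (auto simp: null_sets_def)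
  qed
  then show ?thesis using that by blast
qed

lemma bounded_control_controls: "bounded_control M a b v \<Longrightarrow> v \<in> controls M"
  unfolding controls_def using bounded_control_restrict[of M a b v "{0..}"] by auto

context control_system
begin

section \<open>The times T^0 and T^1 and the minimal time\<close>

lemma Phi_0: "Phi 0 u = 0"
proof -
  have "emb \<iota> 0 = 0" by (rule blinfun_eqI) (simp add: emb_apply)
  then show ?thesis unfolding Phi_def using inv_f_f[OF inj_emb, of 0] by simp
qed

lemma control_steers:
  assumes u: "strongly_measurable (lebesgue_on {0..}) u" "AE t in lebesgue_on {0..}. norm (u t) \<le> M"
    and M: "M \<ge> 0" and T: "T > 0" and sol: "sol S \<iota> B y u T = 0"
  obtains w where "steers M T y w" "AE t in lebesgue. t \<in> {0<..<T} \<longrightarrow> w t = u t"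
proof -
  have m: "strongly_measurable (lebesgue_on {0<..<T}) u"
    by (rule strongly_measurable_subset[OF u(1)]) auto
  have "AE t in lebesgue. t \<in> {0..} \<longrightarrow> norm (u t) \<le> M" using u(2) by (subst (asm) AE_restrict_space_iff) auto
  then have "AE t in lebesgue. t \<in> {0<..<T} \<longrightarrow> norm (u t) \<le> M" by eventually_elim auto
  then have "AE t in lebesgue_on {0<..<T}. norm (u t) \<le> M" by (subst AE_restrict_space_iff) auto
  then obtain w where w: "bounded_control M 0 T w" "AE t in lebesgue. t \<in> {0<..<T} \<longrightarrow> w t = u t"
    "AE t in lebesgue. w t = (if t \<in> {0<..<T} then u t else 0)"
    using bounded_control_of_AE[OF m M] by blast
  have "Phi T w = Phi T u" by (rule Phi_AE_control[OF T w(1,3)])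
  then have "steers M T y w" using w(1) sol by (simp add: sol_eq)
  then show ?thesis using that w(2) by blast
qed

lemma T0_nonneg: "0 \<le> T0 S \<iota> B y"
  unfolding T0_def by (rule Inf_greatest) auto

lemma T0_le:
  assumes "t > 0" "steers M t y v"
  shows "T0 S \<iota> B y \<le> ereal t"
  unfolding T0_def
proof (rule Inf_lower, intro CollectI exI conjI)
  show "in_Linf {0..} v" unfolding in_Linf_def
    using bounded_control_restrict[of M 0 t v "{0..}"] assms(2) by auto
qed (use assms in \<open>auto simp: sol_eq\<close>)

lemma N_finite_steers:
  assumes "T > 0" "N T y < \<infinity>"
  obtains M v where "M \<ge> 0" "steers M T y v" "N T y = ereal M"
proof -
  obtain M where M: "N T y = ereal M" "M \<ge> 0"
    using N_nonneg[OF assms(1), of y] assms(2) by (cases "N T y") auto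
  then show ?thesis using N_le_iff[OF assms(1) M(2), of y] that by auto
qed

lemma T0_less:
  assumes y: "y \<noteq> 0" and less: "T0 S \<iota> B y < ereal t"
  shows "t > 0" and "N t y < \<infinity>"
proof -
  obtain s u where s: "0 \<le> s" "s < t" and u: "in_Linf {0..} u" "sol S \<iota> B y u s = 0"
    using less unfolding T0_def Inf_less_iff by auto
  have "s \<noteq> 0"
  proof
    assume "s = 0"
    then show False using u(2) y by (simp add: sol_eq Phi_0)
  qed
  then have s0: "s > 0" using s by simp
  then show t: "t > 0" using s by simp
  obtain C where C: "strongly_measurable (lebesgue_on {0..}) u" "AE t in lebesgue_on {0..}. norm (u t) \<le> C"
    using u(1) by (auto simp: in_Linf_def)
  define K where "K = max C 0"
  have K: "K \<ge> 0" by (simp add: K_def)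
  have "AE t in lebesgue_on {0..}. norm (u t) \<le> K" using C(2) by eventually_elim (simp add: K_def)
  then obtain w where "steers K s y w" using control_steers[OF C(1) _ K s0 u(2)] by blast
  then have "N s y \<le> ereal K" using N_le_iff[OF s0 K] by blast
  then have "N t y \<le> ereal K" using N_antimono[OF s0, of t y] s by auto
  then show "N t y < \<infinity>" by auto
qed

lemma T0_infinite:
  assumes inf: "T0 S \<iota> B y = \<infinity>" and t: "t > 0"
  shows "N t y = \<infinity>"
proof (rule ccontr)
  assume "N t y \<noteq> \<infinity>"
  then have "N t y < \<infinity>" by simp
  then obtain M v where "steers M t y v" using N_finite_steers[OF t] by blast
  then show False using T0_le[OF t] inf by fastforce
qed

text \<open>T^0 = 0 makes the minimal norm there infinite by \<open>min_norm_zero_infinite\<close>,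
  and T^0 = \<infinity> makes it infinite at every time.\<close>

lemma T0_finite_positive:
  assumes y: "y \<noteq> 0" and fin: "min_norm S \<iota> B (T0 S \<iota> B y) y < \<infinity>"
  obtains t where "t > 0" "T0 S \<iota> B y = ereal t"
proof (cases "T0 S \<iota> B y")
  case (real t)
  have "t \<noteq> 0"
  proof
    assume "t = 0"
    then show False using fin real min_norm_zero_infinite[OF y] by (simp add: zero_ereal_def)
  qed
  then show ?thesis using real T0_nonneg[of y] that by auto
next
  case PInf
  then have "min_norm S \<iota> B (T0 S \<iota> B y) y = (INF t\<in>{0<..}. N t y)" by (simp add: min_norm_infinity)
  also have "\<dots> = (INF t\<in>{0::real<..}. (\<infinity>::ereal))"
    by (rule INF_cong) (auto simp: T0_infinite[OF PInf])
  also have "\<dots> = \<infinity>" by (rule INF_const) auto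
  finally show ?thesis using fin by simp
next
  case MInf
  then show ?thesis using T0_nonneg[of y] by simp
qed

text \<open>By strong continuity the infimum T^1 is attained, and from there the null control shows
  that the minimal norm is 0.\<close>

lemma T1_finite:
  assumes y: "y \<noteq> 0" and fin: "T1 S y < \<infinity>"
  obtains t where "t > 0" "T1 S y = ereal t" "N t y \<le> 0"
proof -
  have nn: "0 \<le> T1 S y" unfolding T1_def by (rule Inf_greatest) auto
  then obtain t where t: "T1 S y = ereal t" "t \<ge> 0" using fin by (cases "T1 S y") auto
  have St: "S t y = 0"
  proof (rule ccontr)
    assume "S t y \<noteq> 0"
    then have e: "norm (S t y) > 0" by simp
    obtain d where d: "d > 0" "\<And>s r. 0 \<le> s \<Longrightarrow> 0 \<le> r \<Longrightarrow> s \<le> t + 1 \<Longrightarrow> r \<le> t + 1 \<Longrightarrow> \<bar>s - r\<bar> < d \<Longrightarrow> norm (S s y - S r y) < norm (S t y)"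
      using S_uniformly_near[OF e, of "t + 1" y] by blast
    have "T1 S y < ereal (t + min d 1)" using t d(1) by simp
    then obtain s where s: "0 \<le> s" "S s y = 0" "s < t + min d 1"
      unfolding T1_def Inf_less_iff by auto
    have "T1 S y \<le> ereal s" unfolding T1_def using s by (intro Inf_lower) auto
    then have "t \<le> s" using t by simp
    moreover have "s < t + 1" "s < t + d" using s(3) by linarith+
    ultimately show False using d(2)[of s t] s t by simp
  qed
  have "t \<noteq> 0" using St y by auto
  then have t0: "t > 0" using t by simp
  have "bounded_control 0 0 t (\<lambda>_. 0 :: 'u)" by (simp add: bounded_control_def)
  then have "steers 0 t y (\<lambda>_. 0)" using St Phi_zero[OF t0] by simp
  then have "N t y \<le> ereal 0" using N_le_iff[OF t0, of 0 y] by blast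
  then show ?thesis using that t0 t by (simp add: zero_ereal_def)
qed

lemma min_time_le: "t > 0 \<Longrightarrow> steers M t y v \<Longrightarrow> min_time S \<iota> B M y \<le> ereal t"
  unfolding min_time_def
  by (rule Inf_lower) (auto simp: sol_eq intro!: exI[of _ t] bexI[of _ v] bounded_control_controls)

lemma T0_le_min_time:
  assumes M: "M \<ge> 0"
  shows "T0 S \<iota> B y \<le> min_time S \<iota> B M y"
  unfolding min_time_def
proof (rule Inf_greatest)
  fix x assume "x \<in> {ereal t |t. 0 < t \<and> (\<exists>u\<in>controls M. sol S \<iota> B y u t = 0)}"
  then obtain t u where t: "x = ereal t" "t > 0" and u: "u \<in> controls M" "sol S \<iota> B y u t = 0" by blast
  obtain w where "steers M t y w" using control_steers[of u M t y] u M t(2) by (auto simp: controls_def)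
  then show "T0 S \<iota> B y \<le> x" using T0_le[OF t(2)] t(1) by blast
qed

lemma admissible_iff:
  assumes M: "M \<ge> 0"
  shows "(\<exists>u. admissible_control S \<iota> B M y u) \<longleftrightarrow> (\<exists>t>0. N t y \<le> ereal M)"
proof
  assume "\<exists>u. admissible_control S \<iota> B M y u"
  then obtain u t where t: "t > 0" and u: "u \<in> controls M" "sol S \<iota> B y u t = 0"
    by (auto simp: admissible_control_def)
  obtain w where "steers M t y w" using control_steers[of u M t y] u M t by (auto simp: controls_def)
  then show "\<exists>t>0. N t y \<le> ereal M" using N_le_iff[OF t M] t by blast
next
  assume "\<exists>t>0. N t y \<le> ereal M"
  then obtain t v where "t > 0" "steers M t y v" using N_le_iff[OF _ M] by blast
  then show "\<exists>u. admissible_control S \<iota> B M y u"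
    unfolding admissible_control_def by (auto simp: sol_eq intro!: exI[of _ v] exI[of _ t] bounded_control_controls)
qed

lemma steers_min_time_control:
  assumes t: "t > 0" and mt: "min_time S \<iota> B M y = ereal t" and v: "steers M t y v"
  shows "min_time_control S \<iota> B M y v"
proof -
  have "AE s in lebesgue_on {t<..}. v s = 0"
    using v by (subst AE_restrict_space_iff) (auto simp: bounded_control_def)
  then show ?thesis
    unfolding min_time_control_def mt real_of_ereal.simps(1)
    using v by (auto simp: sol_eq intro: bounded_control_controls)
qed

section \<open>Consequences of condition (a)\<close>

text \<open>Condition (a) in the form in which it is applied: a control is postponed without
  changing its effect at \<open>T\<close>.\<close>

lemma condition_a_move:
  assumes a: "condition_a S \<iota> B"
  obtains p where "p \<ge> 2" "\<And>t T u. 0 < t \<Longrightarrow> t < T \<Longrightarrow> Lp p u \<Longrightarrow> (\<And>s. s \<notin> {0<..<t} \<Longrightarrow> u s = 0) \<Longrightarrow>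
     \<exists>C v. bounded_control C t T v \<and> Phi T v = Phi T u"
proof -
  obtain p where p: "p \<ge> 2" "\<And>t T. 0 < t \<Longrightarrow> t < T \<Longrightarrow> reach_Lp S \<iota> B p T t \<subseteq> reach_Linf S \<iota> B T t"
    using a unfolding condition_a_def by blast
  show ?thesis
  proof (rule that[OF p(1)])
    fix t T :: real and u :: "real \<Rightarrow> 'u"
    assume tT: "0 < t" "t < T" and u: "Lp p u" and supp: "\<And>s. s \<notin> {0<..<t} \<Longrightarrow> u s = 0"
    have T: "T > 0" using tT by simp
    have "AE s in lebesgue_on {t<..<T}. u s = 0" by (subst AE_restrict_space_iff) (auto simp: supp)
    then have "sol S \<iota> B 0 u T \<in> reach_Lp S \<iota> B p T t"
      using in_Lp_restrict(1)[OF u] unfolding reach_Lp_def by blast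
    then obtain v where v: "in_Linf {0<..<T} v" "AE s in lebesgue_on {0<..<t}. v s = 0" "sol S \<iota> B 0 u T = sol S \<iota> B 0 v T"
      using p(2)[OF tT] unfolding reach_Linf_def by blast
    obtain C where C: "AE s in lebesgue_on {0<..<T}. norm (v s) \<le> C" using v(1) by (auto simp: in_Linf_def)
    have C': "AE s in lebesgue_on {0<..<T}. norm (v s) \<le> max C 0" using C by eventually_elim simp
    obtain w where w: "bounded_control (max C 0) 0 T w" "AE s in lebesgue. s \<in> {0<..<T} \<longrightarrow> w s = v s"
      "AE s in lebesgue. w s = (if s \<in> {0<..<T} then v s else 0)"
      using bounded_control_of_AE[OF _ _ C'] v(1) by (auto simp: in_Linf_def)
    let ?w = "\<lambda>s. if s \<in> {t<..<T} then w s else 0"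
    have b: "bounded_control (max C 0) t T ?w" by (rule bounded_control_cut[OF w(1)]) auto
    have "Phi T ?w = Phi T w"
    proof (rule Phi_cong_AE[OF T bounded_control_Lp(1)[OF b] bounded_control_Lp(1)[OF w(1)]])
      have "AE s in lebesgue. s \<in> {0<..<t} \<longrightarrow> v s = 0" using v(2) by (subst (asm) AE_restrict_space_iff) auto
      \<comment> \<open>The point \<open>t\<close> belongs to neither of the two open
        intervals.\<close>
      moreover have "AE s in lebesgue. s \<noteq> t" by (rule AE_I'[of "{t}"]) auto
      ultimately show "AE s in lebesgue. s \<in> {0<..<T} \<longrightarrow> ?w s = w s"
        using w(2) by eventually_elim (use tT in auto)
    qed auto
    also have "\<dots> = Phi T v" by (rule Phi_AE_control[OF T w(1,3)])
    also have "\<dots> = Phi T u" using v(3) T by (simp add: sol_eq)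
    finally show "\<exists>C v. bounded_control C t T v \<and> Phi T v = Phi T u" using b by blast
  qed
qed

text \<open>The sets of controls that can be traded for one bounded by \<open>k\<close> cover the
  L^p controls on (0, t), and they are closed by \<open>bounded_reachable_closed\<close>. By Baire
  one of them contains a ball. Subtracting the trade for its centre doubles the bound and leaves a
  ball around 0.\<close>

lemma condition_a_uniform:
  assumes a: "condition_a S \<iota> B"
  obtains p where "p \<ge> 2" "\<And>t T. 0 < t \<Longrightarrow> t < T \<Longrightarrow> \<exists>r>0. \<exists>C\<ge>0. \<forall>u. Lp p u \<longrightarrow> (\<forall>s. s \<notin> {0<..<t} \<longrightarrow> u s = 0) \<longrightarrow>
     np p u \<le> r \<longrightarrow> (\<exists>v. bounded_control C t T v \<and> Phi T v = Phi T u)"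
proof -
  obtain p where p: "p \<ge> 2" and move: "\<And>t T u. 0 < t \<Longrightarrow> t < T \<Longrightarrow> Lp p u \<Longrightarrow> (\<And>s. s \<notin> {0<..<t} \<Longrightarrow> u s = 0) \<Longrightarrow>
     \<exists>C v. bounded_control C t T v \<and> Phi T v = Phi T u" using condition_a_move[OF a] by blast
  have p0: "p \<ge> 0" "p > 0" using p by auto
  show ?thesis
  proof (rule that[OF p])
    fix t T :: real assume tT: "0 < t" "t < T"
    have T: "T > 0" using tT by simp
    define V where "V = {u :: real \<Rightarrow> 'u. Lp p u \<and> (\<forall>s. s \<notin> {0<..<t} \<longrightarrow> u s = 0)}"
    define F where "F = (\<lambda>k::nat. {u. \<exists>v. bounded_control (real k) t T v \<and> Phi T v = Phi T u})"
    define d where "d = (\<lambda>u v :: real \<Rightarrow> 'u. np p (\<lambda>s. u s - v s))"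
    have VL: "Lp p u" and V0: "\<And>s. s \<notin> {0<..<t} \<Longrightarrow> u s = 0" if "u \<in> V" for u using that by (auto simp: V_def)
    have V2: "Lp 2 u" if "u \<in> V" for u
      by (rule np2_le_np(1)[OF p VL[OF that] V0[OF that], where \<eta> = 1]) (use tT in auto)
    have "\<exists>k. \<exists>u\<in>V. \<exists>r>0. \<forall>v\<in>V. d u v < r \<longrightarrow> v \<in> F k"
    proof (rule quasi_metric_Baire[where K = "2 powr p"])
      show "V \<noteq> {}" unfolding V_def by (auto intro!: exI[of _ "\<lambda>s. 0"])
      show "1 \<le> 2 powr p" using p0 by (simp add: ge_one_powr_ge_zero)
      show "d u u = 0" if "u \<in> V" for u by (simp add: d_def)
      show "0 \<le> d u v" for u v by (simp add: d_def)
      show "d u v = d v u" for u v unfolding d_def by (rule np_minus_commute)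
      show "d u w \<le> 2 powr p * (d u v + d v w)" if "u \<in> V" "v \<in> V" "w \<in> V" for u v w
        unfolding d_def by (rule np_triangle[OF p0(1) VL VL VL]) (rule that)+
      show "V \<subseteq> (\<Union>k. F k)"
      proof
        fix u assume u: "u \<in> V"
        obtain C v where v: "bounded_control C t T v" "Phi T v = Phi T u"
          using move[OF tT VL[OF u] V0[OF u]] by blast
        obtain k where "C \<le> real k" using real_arch_simple by blast
        then have "u \<in> F k" using v bounded_control_mono[OF v(1)] by (auto simp: F_def)
        then show "u \<in> (\<Union>k. F k)" by blast
      qed
    next
      fix x :: "nat \<Rightarrow> real \<Rightarrow> 'u"
      assume x: "\<And>n. x n \<in> V" and cauchy: "\<And>e. e > 0 \<Longrightarrow> \<exists>N. \<forall>i\<ge>N. \<forall>j\<ge>N. d (x i) (x j) < e"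
      have cauchy': "\<And>e. e > 0 \<Longrightarrow> \<exists>N. \<forall>i\<ge>N. \<forall>j\<ge>N. np p (\<lambda>s. x i s - x j s) < e"
        using cauchy by (simp add: d_def)
      obtain l where l: "Lp p l" "(\<lambda>n. np p (\<lambda>s. x n s - l s)) \<longlonglongrightarrow> 0"
        by (rule Lp_complete[OF p0(2) VL[OF x] cauchy'])
      \<comment> \<open>The limit may differ from 0 outside (0, t). Cutting it off puts it into
        \<open>V\<close> and can only reduce its distance to the members of the sequence.\<close>
      let ?l = "\<lambda>s. if s \<in> {0<..<t} then l s else 0"
      have lL: "Lp p ?l" by (rule Lp_cut[OF l(1)]) simp
      have "(\<lambda>n. d (x n) ?l) \<longlonglongrightarrow> 0"
      proof (rule tendsto_sandwich[OF _ _ tendsto_const l(2)])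
        have "d (x n) ?l \<le> np p (\<lambda>s. x n s - l s)" for n
          unfolding d_def np_def
        proof (rule integral_mono)
          show "integrable lebesgue (\<lambda>s. norm (x n s - ?l s) powr p)" "integrable lebesgue (\<lambda>s. norm (x n s - l s) powr p)"
            using Lp_diff[OF p0(1) VL[OF x[of n]] lL] Lp_diff[OF p0(1) VL[OF x[of n]] l(1)] by (simp_all only: Lp_def)
          show "norm (x n s - ?l s) powr p \<le> norm (x n s - l s) powr p" for s
            by (cases "s \<in> {0<..<t}") (simp_all add: V0[OF x] p0)
        qed
        then show "eventually (\<lambda>n. d (x n) ?l \<le> np p (\<lambda>s. x n s - l s)) sequentially" by simp
        show "eventually (\<lambda>n. 0 \<le> d (x n) ?l) sequentially" by (simp add: d_def)
      qed
      moreover have "?l \<in> V" using lL by (auto simp: V_def)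
      ultimately show "\<exists>l\<in>V. (\<lambda>n. d (x n) l) \<longlonglongrightarrow> 0" by blast
    next
      fix k :: nat and x :: "nat \<Rightarrow> real \<Rightarrow> 'u" and l
      assume x: "\<And>n. x n \<in> F k \<inter> V" and l: "l \<in> V" and lim: "(\<lambda>n. d (x n) l) \<longlonglongrightarrow> 0"
      have xV: "x n \<in> V" for n using x by blast
      have "(\<lambda>n. np 2 (\<lambda>s. x n s - l s)) \<longlonglongrightarrow> 0"
      proof (rule np2_tendsto_0[OF p])
        show "Lp p (\<lambda>s. x n s - l s)" for n by (rule Lp_diff[OF p0(1) VL[OF xV] VL[OF l]])
        show "x n s - l s = 0" if "s \<notin> {0<..<t}" for n s using V0[OF xV that] V0[OF l that] by simp
        show "(\<lambda>n. np p (\<lambda>s. x n s - l s)) \<longlonglongrightarrow> 0" using lim by (simp add: d_def)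
      qed (use tT in simp)
      then have P: "(\<lambda>n. Phi T (x n)) \<longlonglongrightarrow> Phi T l" by (rule Phi_tendsto[OF T V2[OF xV] V2[OF l]])
      have "\<exists>v. bounded_control (real k + e) t T v \<and> norm (Phi T v - Phi T l) \<le> e" if e: "e > 0" for e
      proof -
        obtain n where n: "norm (Phi T (x n) - Phi T l) < e" using LIMSEQ_D[OF P e] by blast
        obtain v where v: "bounded_control (real k) t T v" "Phi T v = Phi T (x n)" using x[of n] by (auto simp: F_def)
        have "bounded_control (real k + e) t T v" by (rule bounded_control_mono[OF v(1)]) (use e in auto)
        then show ?thesis using n v(2) by (intro exI[of _ v]) simp
      qed
      then show "l \<in> F k" using bounded_reachable_closed[OF T, of "real k" t T "Phi T l"] by (auto simp: F_def)
    qed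
    then obtain k u0 r where u0: "u0 \<in> V" and r: "r > 0" and ball: "\<And>v. v \<in> V \<Longrightarrow> d u0 v < r \<Longrightarrow> v \<in> F k" by blast
    have "\<exists>v. bounded_control (2 * real k) t T v \<and> Phi T v = Phi T u"
      if u: "Lp p u" "\<forall>s. s \<notin> {0<..<t} \<longrightarrow> u s = 0" "np p u \<le> r / 2" for u
    proof -
      have uV: "u \<in> V" using u by (simp add: V_def)
      have "(\<lambda>s. u0 s + u s) \<in> V" using Lp_add[OF p0(1) VL[OF u0] u(1)] V0[OF u0] u(2) by (auto simp: V_def)
      moreover have "d u0 (\<lambda>s. u0 s + u s) < r"
        using u(3) r np_minus_commute[of p "\<lambda>s. 0" u] by (simp add: d_def)
      ultimately have "(\<lambda>s. u0 s + u s) \<in> F k" by (rule ball)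
      then obtain v1 where v1: "bounded_control (real k) t T v1" "Phi T v1 = Phi T (\<lambda>s. u0 s + u s)" by (auto simp: F_def)
      have "u0 \<in> F k" by (rule ball[OF u0]) (use r in \<open>simp add: d_def\<close>)
      then obtain v0 where v0: "bounded_control (real k) t T v0" "Phi T v0 = Phi T u0" by (auto simp: F_def)
      have "bounded_control (real k + real k) t T (\<lambda>s. v1 s + (-1) *\<^sub>R v0 s)"
        using bounded_control_add[OF v1(1) bounded_control_scale[OF v0(1), of "-1"]] by simp
      then have "bounded_control (2 * real k) t T (\<lambda>s. v1 s - v0 s)" by simp
      moreover have "Phi T (\<lambda>s. v1 s - v0 s) = Phi T u"
        using Phi_diff[OF T bounded_control_Lp(1)[OF v1(1)] bounded_control_Lp(1)[OF v0(1)]]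
          Phi_add[OF T V2[OF u0] V2[OF uV]] v0(2) v1(2) by simp
      ultimately show ?thesis by blast
    qed
    then show "\<exists>r>0. \<exists>C\<ge>0. \<forall>u. Lp p u \<longrightarrow> (\<forall>s. s \<notin> {0<..<t} \<longrightarrow> u s = 0) \<longrightarrow>
     np p u \<le> r \<longrightarrow> (\<exists>v. bounded_control C t T v \<and> Phi T v = Phi T u)"
      using r by (intro exI[of _ "r / 2"] conjI exI[of _ "2 * real k"]) auto
  qed
qed

text \<open>A control \<open>v\<close> on (0, T) and its trade \<open>w\<close> on (T, T') have the
  same effect, hence so has every convex combination. Their supports are disjoint, so the bound of
  the combination is the larger of (1 - e) M and e C.\<close>

lemma N_strictly_decreasing:
  assumes a: "condition_a S \<iota> B" and T: "0 < T" "T < T'" and M: "M > 0" and le: "N T y \<le> ereal M"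
  shows "\<exists>M'<M. N T' y \<le> ereal M'"
proof -
  obtain p where p: "p \<ge> 2" and move: "\<And>t T u. 0 < t \<Longrightarrow> t < T \<Longrightarrow> Lp p u \<Longrightarrow> (\<And>s. s \<notin> {0<..<t} \<Longrightarrow> u s = 0) \<Longrightarrow>
     \<exists>C v. bounded_control C t T v \<and> Phi T v = Phi T u" using condition_a_move[OF a] by blast
  have T': "T' > 0" using T by simp
  obtain v where v: "steers M T y v" using le N_le_iff[OF T(1), of M y] M by auto
  have vT: "steers M T' y v" by (rule steers_extend[OF T(1) _ v]) (use T in simp)
  have "Lp p v" by (rule bounded_control_Lp(1)[of M 0 T]) (use v p in auto)
  then obtain C w where w: "bounded_control C T T' w" "Phi T' w = Phi T' v"
    using move[OF T, of v] bounded_controlD(3)[of M 0 T v] v by blast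
  \<comment> \<open>This weight lies strictly between 0 and 1 and satisfies e C < M.\<close>
  define e where "e = M / (M + C + 1)"
  have C0: "C \<ge> 0" by (rule bounded_controlD(4)[OF w(1)])
  have e: "0 < e" "e < 1" using M C0 by (auto simp: e_def)
  define z where "z = (\<lambda>s. (1 - e) *\<^sub>R v s + e *\<^sub>R w s)"
  have vL: "Lp 2 v" by (rule bounded_control_Lp(1)[of M 0 T]) (use v in auto)
  have wL: "Lp 2 w" by (rule bounded_control_Lp(1)[OF w(1)]) simp
  define M' where "M' = max ((1 - e) * M) (e * C)"
  have "bounded_control M' 0 T' z"
    unfolding bounded_control_def
  proof (intro conjI allI impI)
    show "strongly_measurable lebesgue z" unfolding z_def
      by (intro strongly_measurable_add strongly_measurable_scaleR strongly_measurable_const Lp_meas[OF vL] Lp_meas[OF wL])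
    fix s
    show "norm (z s) \<le> M'"
    proof (cases "s < T")
      case True
      then have "w s = 0" using bounded_controlD(3)[OF w(1), of s] by simp
      then have "norm (z s) \<le> (1 - e) * M" using bounded_controlD(2)[of M 0 T v s] v e by (simp add: z_def mult_left_mono)
      then show ?thesis by (simp add: M'_def)
    next
      case False
      then have "v s = 0" using bounded_controlD(3)[of M 0 T v s] v by simp
      then have "norm (z s) \<le> e * C" using bounded_controlD(2)[OF w(1), of s] e by (simp add: z_def mult_left_mono)
      then show ?thesis by (simp add: M'_def)
    qed
    assume "s \<notin> {0<..<T'}"
    then show "z s = 0" using bounded_controlD(3)[of M 0 T v s] bounded_controlD(3)[OF w(1), of s] v T by (auto simp: z_def)
  qed
  moreover have "Phi T' z = Phi T' v"
    unfolding z_def Phi_add[OF T' Lp_scaleR[OF vL] Lp_scaleR[OF wL]] Phi_scale[OF T' vL] Phi_scale[OF T' wL] w(2)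
    by (simp add: scaleR_add_left[symmetric])
  ultimately have "steers M' T' y z" using vT by simp
  moreover have "M' \<ge> 0" using e M by (simp add: M'_def le_max_iff_disj)
  ultimately have "N T' y \<le> ereal M'" using N_le_iff[OF T'] by blast
  moreover have "M' < M"
  proof -
    have "e * C < M"
    proof -
      have "C / (M + C + 1) < 1" using M C0 by simp
      then have "M * (C / (M + C + 1)) < M * 1" using M by (rule mult_strict_left_mono)
      then show ?thesis by (simp add: e_def)
    qed
    moreover have "(1 - e) * M < M" using e M by (simp add: algebra_simps)
    ultimately show ?thesis by (simp add: M'_def)
  qed
  ultimately show ?thesis by blast
qed

text \<open>Drop the part of \<open>v\<close> before \<delta> and start the rest \<delta> earlier.
  Since \<open>v'\<close> already reaches 0 at T', the free motion at T - \<delta> is minus the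
  effect of \<open>v'\<close> delayed by \<delta>, seen at T. The mismatch is \<open>q\<close>: the
  translate difference of \<open>v'\<close> plus the dropped part of \<open>v\<close>. It lives on
  (0, t) and is small in L^p, so the uniform form of (a) replaces it by a control on (t, T) of size
  at most M - M'.\<close>

lemma N_left_continuous:
  assumes a: "condition_a S \<iota> B" and T': "0 < T'" "T' < T" and fin: "N T' y < \<infinity>"
    and le: "N T y \<le> ereal M'" and M': "0 \<le> M'" "M' < M"
  shows "\<exists>s. 0 < s \<and> s < T \<and> N s y \<le> ereal M"
proof -
  obtain p where p: "p \<ge> 2" and unif: "\<And>t T. 0 < t \<Longrightarrow> t < T \<Longrightarrow> \<exists>r>0. \<exists>C\<ge>0. \<forall>u. Lp p u \<longrightarrow> (\<forall>s. s \<notin> {0<..<t} \<longrightarrow> u s = 0) \<longrightarrow>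
     np p u \<le> r \<longrightarrow> (\<exists>v. bounded_control C t T v \<and> Phi T v = Phi T u)"
    using condition_a_uniform[OF a] by blast
  have p0: "p \<ge> 0" "p > 0" using p by auto
  define t where "t = (T' + T) / 2"
  have t: "0 < t" "T' < t" "t < T" using T' by (auto simp: t_def)
  have T: "T > 0" using T' by simp
  obtain r C where r: "r > 0" and C: "C \<ge> 0" and mv: "\<And>u. Lp p u \<Longrightarrow> (\<forall>s. s \<notin> {0<..<t} \<longrightarrow> u s = 0) \<Longrightarrow>
     np p u \<le> r \<Longrightarrow> (\<exists>v. bounded_control C t T v \<and> Phi T v = Phi T u)" using unif[OF t(1,3)] by blast
  obtain R v' where R: "R \<ge> 0" and v': "steers R T' y v'" using N_finite_steers[OF T'(1) fin] by blast
  obtain v where v: "steers M' T y v" using le N_le_iff[OF T M'(1)] by blast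
  \<comment> \<open>C \<theta> will be the size of the correcting control and has to fit into the
    slack M - M'. The denominator is positive also for C = 0.\<close>
  define \<theta> where "\<theta> = (M - M') / (C + 1)"
  have th: "\<theta> > 0" "C * \<theta> \<le> M - M'"
  proof -
    show "\<theta> > 0" using M' C by (simp add: \<theta>_def)
    have "C * \<theta> \<le> (C + 1) * \<theta>" using \<open>\<theta> > 0\<close> by (simp add: algebra_simps)
    also have "\<dots> = M - M'" using C by (simp add: \<theta>_def)
    finally show "C * \<theta> \<le> M - M'" .
  qed
  \<comment> \<open>Two errors of this size, added with the constant 2 powr p, amount to r
    \<theta>^p. After scaling by 1/\<theta> this is the radius r on which the uniform trade
    works.\<close>
  define \<epsilon> where "\<epsilon> = r * \<theta> powr p / (2 * 2 powr p)"
  have eps: "\<epsilon> > 0" using r th by (simp add: \<epsilon>_def)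
  have v'b: "bounded_control R 0 T' v'" and vb: "bounded_control M' 0 T v" using v v' by auto
  obtain \<eta> where eta: "\<eta> > 0" "\<And>\<delta>. \<bar>\<delta>\<bar> < \<eta> \<Longrightarrow> np p (\<lambda>s. v' (s - \<delta>) - v' s) < \<epsilon>"
    using np_shift_continuous[OF p0(2) bounded_controlD(1)[OF v'b] bounded_controlD(2)[OF v'b]
        bounded_controlD(3)[OF v'b] less_imp_le[OF T'(1)] eps] by blast
  \<comment> \<open>The three terms ensure that the translation error is below \<epsilon>, that the
    delayed \<open>v'\<close> still ends before t, and that the dropped piece satisfies M'^p
    \<delta> <= \<epsilon>.\<close>
  define \<delta> where "\<delta> = min (\<eta> / 2) (min (t - T') (\<epsilon> / (M' powr p + 1)))"
  have d: "\<delta> > 0" "\<delta> < \<eta>" "T' + \<delta> \<le> t"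
    using eta t eps by (auto simp: \<delta>_def min_less_iff_disj add_nonneg_pos)
  have dM: "M' powr p * \<delta> \<le> \<epsilon>"
  proof -
    have "\<delta> \<le> \<epsilon> / (M' powr p + 1)" by (simp add: \<delta>_def)
    then have "M' powr p * \<delta> \<le> M' powr p * (\<epsilon> / (M' powr p + 1))" by (intro mult_left_mono) auto
    also have "\<dots> = \<epsilon> * (M' powr p / (M' powr p + 1))" by simp
    also have "\<dots> \<le> \<epsilon> * 1" using eps by (intro mult_left_mono) (auto simp: add_nonneg_pos)
    finally show ?thesis by simp
  qed
  define v1 where "v1 = (\<lambda>s. if s \<in> {..\<delta>} then v s else 0)"
  define v2 where "v2 = (\<lambda>s. if s \<in> {\<delta><..} then v s else 0)"
  \<comment> \<open>\<open>v1\<close> contains the point \<delta> itself, so a larger open interval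
    is taken. The exact length \<delta> is recovered almost everywhere in
    \<open>v1n\<close>.\<close>
  have v1b: "bounded_control M' 0 (2 * \<delta>) v1"
    unfolding v1_def by (rule bounded_control_cut[OF vb]) (use d in auto)
  have v2b: "bounded_control M' \<delta> T v2"
    unfolding v2_def by (rule bounded_control_cut[OF vb]) auto
  have vs: "v s = v1 s + v2 s" for s by (simp add: v1_def v2_def)
  define q where "q = (\<lambda>s. (v' (s - \<delta>) - v' s) + v1 s)"
  have shb: "bounded_control R \<delta> (T' + \<delta>) (\<lambda>s. v' (s - \<delta>))"
    using bounded_control_shift[OF v'b, of \<delta>] by simp
  have L1: "Lp p (\<lambda>s. v' (s - \<delta>) - v' s)" "Lp p v1"
    by (intro Lp_diff p0 bounded_control_Lp(1)[OF shb] bounded_control_Lp(1)[OF v'b]) (rule bounded_control_Lp(1)[OF v1b p0(1)])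
  have qL: "Lp p q" unfolding q_def by (rule Lp_add[OF p0(1) L1])
  have q0: "q s = 0" if "s \<notin> {0<..<t}" for s
  proof -
    have "v' (s - \<delta>) = 0" "v' s = 0" using bounded_controlD(3)[OF v'b, of "s - \<delta>"] bounded_controlD(3)[OF v'b, of s] that d t by auto
    moreover have "v1 s = 0" using bounded_controlD(3)[OF vb, of s] that d t T' by (auto simp: v1_def)
    ultimately show ?thesis by (simp add: q_def)
  qed
  have v1n: "np p v1 \<le> \<epsilon>"
  proof -
    have "bounded_control M' 0 \<delta> (\<lambda>s. if s \<in> {..<\<delta>} then v s else 0)" by (rule bounded_control_cut[OF vb]) auto
    then have "np p (\<lambda>s. if s \<in> {..<\<delta>} then v s else 0) \<le> M' powr p * \<delta>"
      using bounded_control_Lp(2)[of M' 0 \<delta> _ p] p0 d by fastforce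
    moreover have "np p v1 = np p (\<lambda>s. if s \<in> {..<\<delta>} then v s else 0)"
      unfolding np_def
    proof (rule integral_cong_AE)
      have "AE s in lebesgue. s \<noteq> \<delta>" by (rule AE_I'[of "{\<delta>}"]) auto
      then show "AE s in lebesgue. norm (v1 s) powr p = norm (if s \<in> {..<\<delta>} then v s else 0) powr p"
        by eventually_elim (auto simp: v1_def)
      show "(\<lambda>s. norm (v1 s) powr p) \<in> borel_measurable lebesgue"
        using L1(2) by (auto simp: Lp_def)
      show "(\<lambda>s. norm (if s \<in> {..<\<delta>} then v s else 0) powr p) \<in> borel_measurable lebesgue"
        using bounded_control_Lp(1)[OF \<open>bounded_control M' 0 \<delta> (\<lambda>s. if s \<in> {..<\<delta>} then v s else 0)\<close> p0(1)] by (simp only: Lp_def) auto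
    qed
    ultimately show ?thesis using dM by linarith
  qed
  have "np p q \<le> 2 powr p * (np p (\<lambda>s. v' (s - \<delta>) - v' s) + np p v1)"
    unfolding q_def by (rule np_add_le[OF p0(1) L1])
  also have "\<dots> \<le> 2 powr p * (\<epsilon> + \<epsilon>)"
    using eta(2)[of \<delta>] d v1n by (intro mult_left_mono add_mono) auto
  also have "\<dots> = r * \<theta> powr p" by (simp add: \<epsilon>_def)
  finally have qn: "np p q \<le> r * \<theta> powr p" .
  have "np p (\<lambda>s. (1 / \<theta>) *\<^sub>R q s) = np p q / \<theta> powr p"
    using np_scaleR[OF qL, of "1 / \<theta>"] th by (simp add: powr_divide)
  also have "\<dots> \<le> r" using qn th by (simp add: field_simps)
  finally obtain w where w: "bounded_control C t T w" "Phi T w = Phi T (\<lambda>s. (1 / \<theta>) *\<^sub>R q s)"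
    using mv[OF Lp_scaleR[OF qL], of "1 / \<theta>"] q0 by auto
  have q2: "Lp 2 q" by (rule np2_le_np(1)[OF p qL q0, where \<eta> = 1]) (use t in auto)
  have wL: "Lp 2 w" by (rule bounded_control_Lp(1)[OF w(1)]) simp
  have Pq: "Phi T (\<lambda>s. \<theta> *\<^sub>R w s) = Phi T q"
    unfolding Phi_scale[OF T wL] w(2) Phi_scale[OF T q2] using th by simp
  define z where "z = (\<lambda>s. v2 s + \<theta> *\<^sub>R w s)"
  have zb: "bounded_control M \<delta> T z"
  proof -
    have "bounded_control (\<bar>\<theta>\<bar> * C) \<delta> T (\<lambda>s. \<theta> *\<^sub>R w s)"
      by (rule bounded_control_mono[OF bounded_control_scale[OF w(1)]]) (use d t T' in auto)
    then have "bounded_control (M' + \<bar>\<theta>\<bar> * C) \<delta> T z" unfolding z_def by (rule bounded_control_add[OF v2b])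
    then show ?thesis by (rule bounded_control_mono) (use th in \<open>auto simp: mult.commute\<close>)
  qed
  have L2: "Lp 2 v" "Lp 2 v1" "Lp 2 v2" "Lp 2 v'" "Lp 2 (\<lambda>s. v' (s - \<delta>))"
    by (rule bounded_control_Lp(1)[OF vb], simp, rule bounded_control_Lp(1)[OF v1b], simp, rule bounded_control_Lp(1)[OF v2b], simp,
      rule bounded_control_Lp(1)[OF v'b], simp, rule bounded_control_Lp(1)[OF shb], simp)
  \<comment> \<open>The terms in \<open>v\<close> and \<open>v'\<close> cancel because both controls
    carry \<open>y\<close> to 0 at T and so have the same effect there.\<close>
  have Pz: "Phi T z = Phi T (\<lambda>s. v' (s - \<delta>))"
  proof -
    have "Phi T z = Phi T v2 + Phi T q" unfolding z_def by (simp add: Phi_add[OF T L2(3) Lp_scaleR[OF wL]] Pq)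
    also have "Phi T q = Phi T (\<lambda>s. v' (s - \<delta>)) - Phi T v' + Phi T v1"
      unfolding q_def using Phi_add[OF T Lp_diff[OF _ L2(5,4)] L2(2)] Phi_diff[OF T L2(5,4)] by simp
    also have "Phi T v = Phi T v1 + Phi T v2"
      using Phi_add[OF T L2(2,3)] by (simp add: vs[abs_def])
    then have "Phi T v2 + (Phi T (\<lambda>s. v' (s - \<delta>)) - Phi T v' + Phi T v1) = Phi T (\<lambda>s. v' (s - \<delta>)) + (Phi T v - Phi T v')"
      by simp
    also have "Phi T v - Phi T v' = 0"
    proof -
      have "S T y + Phi T v' = 0" using steers_extend[OF T'(1) _ v', of T] T' by simp
      moreover have "S T y + Phi T v = 0" using v by simp
      ultimately show ?thesis by (metis add_left_imp_eq right_minus_eq)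
    qed
    finally show ?thesis by simp
  qed
  \<comment> \<open>\<open>z\<close> is zero up to time \<delta>. Started \<delta> earlier it has at
    \<open>s\<close> the effect that \<open>v'\<close> has at \<open>s\<close>.\<close>
  define s where "s = T - \<delta>"
  have s: "0 < s" "s < T" "T' \<le> s" using d t T' by (auto simp: s_def)
  have v's: "v' \<tau> = 0" if "\<tau> \<notin> {0<..<s}" for \<tau>
    using bounded_controlD(3)[OF v'b, of \<tau>] that s(3) by auto
  have "bounded_control M 0 s (\<lambda>\<tau>. z (\<tau> + \<delta>))"
    using bounded_control_shift[OF zb, of "- \<delta>"] by (simp add: s_def)
  moreover have "Phi s (\<lambda>\<tau>. z (\<tau> + \<delta>)) = Phi T z"
    using Phi_shift[OF s(1), of \<delta> "\<lambda>\<tau>. z (\<tau> + \<delta>)"] calculation d bounded_control_Lp(1)[OF calculation, of 2]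
      bounded_controlD(3)[OF calculation] by (simp add: s_def)
  moreover have "Phi T (\<lambda>\<tau>. v' (\<tau> - \<delta>)) = Phi s v'"
    using Phi_shift[OF s(1) less_imp_le[OF d(1)] L2(4) v's] by (simp add: s_def)
  moreover have "S s y + Phi s v' = 0" using steers_extend[OF T'(1) s(3) v'] by simp
  ultimately have "steers M s y (\<lambda>\<tau>. z (\<tau> + \<delta>))" using Pz by simp
  then have "N s y \<le> ereal M" using N_le_iff[OF s(1), of M y] M' by auto
  then show ?thesis using s by blast
qed


section \<open>The bang-bang property\<close>

text \<open>A bounded control orthogonal to all observations has no effect at \<open>T\<close> by
  duality. The hypothesis on \<open>f\<close> is therefore the annihilation property in
  \<open>L1_closure_of_annihilated\<close>.\<close>

lemma Y_space_of_annihilated: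
  assumes T: "T > 0" and f: "strongly_measurable lebesgue f" "integrable lebesgue (\<lambda>t. norm (f t))" "\<And>t. t \<notin> {0<..<T} \<Longrightarrow> f t = 0"
    and ann: "\<And>v M. bounded_control M 0 T v \<Longrightarrow> Phi T v = 0 \<Longrightarrow> (\<integral>t. v t \<bullet> f t \<partial>lebesgue) = 0"
  shows "f \<in> Y_space S \<iota> B T"
proof -
  have "in_Lp 1 {0<..<T} f"
    using in_Lp_restrict(1)[of 1 f T] f(1,2) by (simp add: Lp_def)
  moreover have "\<exists>g\<in>X_space S \<iota> B T. Lp_norm 1 {0<..<T} (\<lambda>t. f t - g t) < e" if e: "e > 0" for e
  proof -
    have "\<exists>d. (\<integral>t. norm (f t - obs T d t) \<partial>lebesgue) < e"
    proof (rule L1_closure_of_annihilated[OF T f obs_Lp _ obs_add obs_scale _ e])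
      show "obs T d t = 0" if "t \<notin> {0<..<T}" for d t using that by (auto simp: obs_def)
      fix v :: "real \<Rightarrow> 'u" and M
      assume v: "strongly_measurable lebesgue v" "\<And>t. norm (v t) \<le> M" "\<And>t. t \<notin> {0<..<T} \<Longrightarrow> v t = 0"
        "\<And>d. (\<integral>t. v t \<bullet> obs T d t \<partial>lebesgue) = 0"
      have b: "bounded_control M 0 T v" using v by (simp add: bounded_control_def)
      have "Phi T v = 0" by (rule Phi_eqI[OF T bounded_control_Lp(1)[OF b]]) (simp_all add: v(4))
      then show "(\<integral>t. v t \<bullet> f t \<partial>lebesgue) = 0" by (rule ann[OF b])
    qed
    then obtain d where d: "(\<integral>t. norm (f t - obs T d t) \<partial>lebesgue) < e" by blast
    let ?g = "\<lambda>t. adj_control B (adj_semigroup_dom S \<iota> (T - t) d)"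
    have "Lp_norm 1 {0<..<T} (\<lambda>t. f t - ?g t) = (LINT t|lebesgue_on {0<..<T}. norm (f t - ?g t))"
      unfolding Lp_norm_def by (simp add: integral_nonneg_AE)
    also have "\<dots> = (\<integral>t. indicator {0<..<T} t *\<^sub>R norm (f t - ?g t) \<partial>lebesgue)"
      by (rule integral_restrict_space) simp
    also have "\<dots> = (\<integral>t. norm (f t - obs T d t) \<partial>lebesgue)"
      by (rule Bochner_Integration.integral_cong) (auto simp: indicator_def obs_def f(3))
    finally have "Lp_norm 1 {0<..<T} (\<lambda>t. f t - ?g t) < e" using d by simp
    moreover have "?g \<in> X_space S \<iota> B T" by (auto simp: X_space_def)
    ultimately show ?thesis by (rule bexI)
  qed
  ultimately show ?thesis by (simp add: Y_space_def)
qed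

section \<open>The gauge of reachable states and its supporting functional\<close>

text \<open>The Minkowski functional of the set of states reachable with controls bounded by 1. At -
  S T y it is the minimal norm N(T, y).\<close>

definition gauge :: "real \<Rightarrow> 'x \<Rightarrow> real" where
  "gauge T x = Inf {C. \<exists>v. bounded_control C 0 T v \<and> Phi T v = x}"

definition reachable :: "real \<Rightarrow> 'x set" where
  "reachable T = {Phi T v | v C. bounded_control C 0 T v}"

lemma gauge_le:
  assumes "bounded_control C 0 T v" "Phi T v = x"
  shows "gauge T x \<le> C"
  unfolding gauge_def
proof (rule cInf_lower)
  show "bdd_below {C. \<exists>v. bounded_control C 0 T v \<and> Phi T v = x}"
    by (rule bdd_belowI[of _ 0]) (auto dest: bounded_controlD(4))
qed (use assms in auto)

lemma gauge_ge:
  assumes "x \<in> reachable T" "\<And>C v. bounded_control C 0 T v \<Longrightarrow> Phi T v = x \<Longrightarrow> m \<le> C"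
  shows "m \<le> gauge T x"
  unfolding gauge_def by (rule cInf_greatest) (use assms in \<open>auto simp: reachable_def\<close>)

lemma gauge_approx:
  assumes "x \<in> reachable T" "e > 0"
  obtains C v where "bounded_control C 0 T v" "Phi T v = x" "C < gauge T x + e"
proof -
  have "\<exists>C\<in>{C. \<exists>v. bounded_control C 0 T v \<and> Phi T v = x}. C < gauge T x + e"
    unfolding gauge_def by (rule cInf_lessD[of _ "Inf _ + e"]) (use assms in \<open>auto simp: reachable_def\<close>)
  then show ?thesis using that by blast
qed

lemma subspace_reachable:
  assumes T: "T > 0"
  shows "subspace (reachable T)"
  unfolding subspace_def
proof (intro conjI ballI allI)
  have "bounded_control 0 0 T (\<lambda>_. 0 :: 'u)" by (simp add: bounded_control_def)
  then show "0 \<in> reachable T" using Phi_zero[OF T, symmetric] unfolding reachable_def by blast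
  show "x + y \<in> reachable T" if xy: "x \<in> reachable T" "y \<in> reachable T" for x y
  proof -
    obtain u v C D where u: "bounded_control C 0 T u" "x = Phi T u" and v: "bounded_control D 0 T v" "y = Phi T v"
      using xy by (auto simp: reachable_def)
    have "x + y = Phi T (\<lambda>t. u t + v t)"
      using Phi_add[OF T bounded_control_Lp(1)[OF u(1)] bounded_control_Lp(1)[OF v(1)]] u(2) v(2) by simp
    then show ?thesis using bounded_control_add[OF u(1) v(1)] by (auto simp: reachable_def)
  qed
  show "c *\<^sub>R x \<in> reachable T" if x: "x \<in> reachable T" for c x
  proof -
    obtain u C where u: "bounded_control C 0 T u" "x = Phi T u" using x by (auto simp: reachable_def)
    have "c *\<^sub>R x = Phi T (\<lambda>t. c *\<^sub>R u t)" using Phi_scale[OF T bounded_control_Lp(1)[OF u(1)]] u(2) by simp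
    then show ?thesis using bounded_control_scale[OF u(1)] by (auto simp: reachable_def)
  qed
qed

lemma sublinear_gauge:
  assumes T: "T > 0"
  shows "sublinear_on (reachable T) (gauge T)"
  unfolding sublinear_on_def
proof (intro conjI ballI allI impI)
  fix x y assume x: "x \<in> reachable T" and y: "y \<in> reachable T"
  show "gauge T (x + y) \<le> gauge T x + gauge T y"
  proof (rule field_le_epsilon)
    fix e :: real assume "e > 0"
    then obtain C u D v where u: "bounded_control C 0 T u" "Phi T u = x" "C < gauge T x + e/2"
      and v: "bounded_control D 0 T v" "Phi T v = y" "D < gauge T y + e/2"
      using gauge_approx[OF x, of "e/2"] gauge_approx[OF y, of "e/2"] by (metis half_gt_zero)
    have "gauge T (x + y) \<le> C + D"
      by (rule gauge_le[OF bounded_control_add[OF u(1) v(1)]])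
        (simp add: Phi_add[OF T bounded_control_Lp(1)[OF u(1)] bounded_control_Lp(1)[OF v(1)]] u v)
    then show "gauge T (x + y) \<le> gauge T x + gauge T y + e" using u(3) v(3) by linarith
  qed
next
  fix c :: real and x assume c: "c > 0" and x: "x \<in> reachable T"
  show "gauge T (c *\<^sub>R x) \<le> c * gauge T x"
  proof (rule field_le_epsilon)
    fix e :: real assume e: "e > 0"
    then obtain C u where u: "bounded_control C 0 T u" "Phi T u = x" "C < gauge T x + e/c"
      using gauge_approx[OF x, of "e/c"] c by auto
    have "gauge T (c *\<^sub>R x) \<le> \<bar>c\<bar> * C"
      by (rule gauge_le[OF bounded_control_scale[OF u(1)]])
        (simp add: Phi_scale[OF T bounded_control_Lp(1)[OF u(1)]] u)
    also have "\<dots> \<le> c * (gauge T x + e/c)" using c u(3) by simp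
    also have "\<dots> = c * gauge T x + e" using c by (simp add: field_simps)
    finally show "gauge T (c *\<^sub>R x) \<le> c * gauge T x + e" .
  qed
qed

text \<open>A Hahn--Banach functional that supports the ball of controls at the optimal one is, by (a),
  given on each \<open>(0, t)\<close> with \<open>t < T\<close> by a function \<open>f\<close> in \<open>Y\<^sub>t\<close>.  If the optimal control had slack on a set of
  positive measure, \<open>f\<close> would vanish there, hence everywhere by (b), although the functional
  is positive at a state reached by a control that stops at \<open>T' < T\<close>.\<close>

lemma bang_bang_at:
  assumes a: "condition_a S \<iota> B" and b: "condition_b S \<iota> B" and M: "M > 0"
    and T': "0 < T'" "T' < T" and fin: "N T' y < \<infinity>"
    and u: "steers M T y u" and opt: "\<And>M'. 0 \<le> M' \<Longrightarrow> M' < M \<Longrightarrow> \<not> N T y \<le> ereal M'"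
  shows "AE t in lebesgue. t \<in> {0<..<T} \<longrightarrow> norm (u t) = M"
proof (rule ccontr)
  assume not_bb: "\<not> ?thesis"
  have T: "T > 0" using T' by simp
  have ub: "bounded_control M 0 T u" using u by simp
  obtain p where p: "p \<ge> 2" and unif: "\<And>t T. 0 < t \<Longrightarrow> t < T \<Longrightarrow> \<exists>r>0. \<exists>C\<ge>0. \<forall>u. Lp p u \<longrightarrow> (\<forall>s. s \<notin> {0<..<t} \<longrightarrow> u s = 0) \<longrightarrow>
     np p u \<le> r \<longrightarrow> (\<exists>v. bounded_control C t T v \<and> Phi T v = Phi T u)"
    using condition_a_uniform[OF a] by blast
  have p0: "p \<ge> 0" using p by simp
  have [measurable]: "(\<lambda>t. norm (u t)) \<in> borel_measurable lebesgue"
    by (rule borel_measurable_norm_strongly[OF bounded_controlD(1)[OF ub]])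
  \<comment> \<open>Slack of at least 1/(n+1) is collected only up to T - 1/(n+1), because the
    functional will be represented only on intervals that end before T.\<close>
  define E where "E = (\<lambda>n::nat. {t \<in> space lebesgue. norm (u t) \<le> M - 1 / real (Suc n)} \<inter> {0<..<T - 1 / real (Suc n)})"
  have Es: "E n \<in> sets lebesgue" for n
  proof -
    have "{t \<in> space lebesgue. norm (u t) \<le> M - 1 / real (Suc n)} \<in> sets lebesgue" by measurable
    then show ?thesis unfolding E_def by (intro sets.Int) auto
  qed
  have Emono: "E n \<subseteq> E m" if "n \<le> m" for n m
  proof -
    have "1 / real (Suc m) \<le> 1 / real (Suc n)" using that by (intro divide_left_mono) auto
    then show ?thesis unfolding E_def by (auto simp del: of_nat_Suc)
  qed
  have "\<exists>n. E n \<notin> null_sets lebesgue"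
  proof (rule ccontr)
    assume "\<nexists>n. E n \<notin> null_sets lebesgue"
    then have "AE t in lebesgue. t \<notin> E n" for n by (intro AE_not_in) auto
    then have "AE t in lebesgue. \<forall>n. t \<notin> E n" by (simp add: AE_all_countable)
    then have "AE t in lebesgue. t \<in> {0<..<T} \<longrightarrow> norm (u t) = M"
    proof eventually_elim
      fix t assume t: "\<forall>n. t \<notin> E n"
      show "t \<in> {0<..<T} \<longrightarrow> norm (u t) = M"
      proof (rule impI, rule ccontr)
        assume tT: "t \<in> {0<..<T}" and "norm (u t) \<noteq> M"
        then have "norm (u t) < M" using bounded_controlD(2)[OF ub, of t] by linarith
        then have "0 < min (M - norm (u t)) (T - t)" using tT by simp
        then obtain n where "inverse (real (Suc n)) < min (M - norm (u t)) (T - t)" using reals_Archimedean by blast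
        then have "t \<in> E n" using tT by (auto simp: E_def inverse_eq_divide simp del: of_nat_Suc)
        then show False using t by blast
      qed
    qed
    with not_bb show False by blast
  qed
  then obtain n where n: "E n \<notin> null_sets lebesgue" by blast
  have "0 < T - T'" using T' by simp
  then obtain k0 where k0: "inverse (real (Suc k0)) < T - T'" using reals_Archimedean by blast
  \<comment> \<open>A single index serves for a slack set of positive measure and for a cut-off time
    t beyond T'.\<close>
  define k where "k = max n k0"
  define t where "t = T - 1 / real (Suc k)"
  define \<epsilon> where "\<epsilon> = 1 / real (Suc k)"
  have eps: "\<epsilon> > 0" by (simp add: \<epsilon>_def)
  have "1 / real (Suc k) \<le> 1 / real (Suc k0)" unfolding k_def by (intro divide_left_mono) auto
  then have t: "T' < t" "t < T" "0 < t" using k0 T' eps by (auto simp: t_def \<epsilon>_def inverse_eq_divide simp del: of_nat_Suc)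
  have Ek: "E k \<notin> null_sets lebesgue"
  proof
    assume "E k \<in> null_sets lebesgue"
    moreover have "E n \<subseteq> E k" by (rule Emono) (simp add: k_def)
    ultimately have "E n \<in> null_sets lebesgue" by (rule completion.complete2[rotated])
    with n show False by blast
  qed
  have Et: "E k \<subseteq> {0<..<t}" by (auto simp: E_def t_def)
  have Eu: "norm (u s) \<le> M - \<epsilon>" if "s \<in> E k" for s using that by (simp add: E_def \<epsilon>_def)
  obtain R v' where v': "steers R T' y v'" using N_finite_steers[OF T'(1) fin] by blast
  have v'T: "steers R T y v'" by (rule steers_extend[OF T'(1) _ v']) (use T' in simp)
  define x where "x = - S T y"
  have xu: "Phi T u = x" and xv': "Phi T v' = x" using u v'T by (simp_all add: x_def eq_neg_iff_add_eq_0 add.commute)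
  have xR: "x \<in> reachable T" unfolding reachable_def using ub xu by blast
  have gM: "M \<le> gauge T x"
  proof (rule gauge_ge[OF xR])
    fix C v assume v: "bounded_control C 0 T v" "Phi T v = x"
    then have "steers C T y v" by (simp add: x_def)
    then have "N T y \<le> ereal C" using N_le_iff[OF T bounded_controlD(4)[OF v(1)]] by blast
    then show "M \<le> C" using opt[OF bounded_controlD(4)[OF v(1)]] by (meson not_le)
  qed
  obtain \<xi> where xi_add: "\<And>x y. x \<in> reachable T \<Longrightarrow> y \<in> reachable T \<Longrightarrow> \<xi> (x + y) = \<xi> x + \<xi> y"
    and xi_scale: "\<And>c x. x \<in> reachable T \<Longrightarrow> \<xi> (c *\<^sub>R x) = c * \<xi> x"
    and xi_le: "\<And>x. x \<in> reachable T \<Longrightarrow> \<xi> x \<le> gauge T x" and xi_x: "\<xi> x = gauge T x"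
    using Hahn_Banach_dominated[OF subspace_reachable[OF T] sublinear_gauge[OF T] xR] by blast
  have xi_bound: "\<xi> (Phi T v) \<le> C" "- C \<le> \<xi> (Phi T v)" if v: "bounded_control C 0 T v" for v C
  proof -
    have r: "Phi T v \<in> reachable T" using v by (auto simp: reachable_def)
    show "\<xi> (Phi T v) \<le> C" using xi_le[OF r] gauge_le[OF v refl] by linarith
    have m: "bounded_control C 0 T (\<lambda>s. (-1) *\<^sub>R v s)" using bounded_control_scale[OF v, of "-1"] by simp
    have "Phi T (\<lambda>s. (-1) *\<^sub>R v s) = (-1) *\<^sub>R Phi T v" by (rule Phi_scale[OF T bounded_control_Lp(1)[OF v]]) simp
    then have "gauge T ((-1) *\<^sub>R Phi T v) \<le> C" by (rule gauge_le[OF m])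
    then have "\<xi> ((-1) *\<^sub>R Phi T v) \<le> C"
      using xi_le[OF subspace_scale[OF subspace_reachable[OF T] r, of "-1"]] by linarith
    then show "- C \<le> \<xi> (Phi T v)" using xi_scale[OF r, of "-1"] by simp
  qed
  \<comment> \<open>The gauge bounds the functional by sup norms of controls. The uniform trade
    turns this into a bound on an L^p ball of controls on (0, t), which is what the representation
    requires.\<close>
  obtain r C where r: "r > 0" and mv: "\<And>u. Lp p u \<Longrightarrow> (\<forall>s. s \<notin> {0<..<t} \<longrightarrow> u s = 0) \<Longrightarrow>
     np p u \<le> r \<Longrightarrow> (\<exists>v. bounded_control C t T v \<and> Phi T v = Phi T u)" using unif[OF t(3,2)] by blast
  let ?V = "{w. Lp p w \<and> (\<forall>s. s \<notin> {0<..<t} \<longrightarrow> w s = (0::'u))}"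
  have V2: "Lp 2 w" if "w \<in> ?V" for w
  proof (rule np2_le_np(1)[OF p, where a = 0 and b = t and \<eta> = 1])
    show "Lp p w" using that by simp
    show "w s = 0" if "s \<notin> {0<..<t}" for s using that \<open>w \<in> ?V\<close> by blast
  qed (use t in simp_all)
  have small: "\<exists>v. bounded_control C 0 T v \<and> Phi T v = Phi T w" if w: "w \<in> ?V" "np p w \<le> r" for w
  proof -
    obtain v where v: "bounded_control C t T v" "Phi T v = Phi T w" using mv[of w] w by blast
    have "bounded_control C 0 T v" by (rule bounded_control_mono[OF v(1)]) (use t in auto)
    then show ?thesis using v(2) by blast
  qed
  have Vreach: "Phi T w \<in> reachable T" if w: "w \<in> ?V" for w
  proof -
    \<comment> \<open>Chosen so that c^p times np p w is r np p w / (np p w + r), hence at most r,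
      without a case distinction for np p w = 0.\<close>
    define c where "c = (r / (np p w + r)) powr (1/p)"
    have pos: "np p w + r > 0" using r by (simp add: add_nonneg_pos)
    have c: "c > 0" using r pos by (simp add: c_def)
    have cp: "c powr p = r / (np p w + r)" using p r pos by (simp add: c_def powr_powr)
    have wL: "Lp p w" using w by simp
    have "np p (\<lambda>s. c *\<^sub>R w s) = c powr p * np p w" using np_scaleR[OF wL, of c] c by simp
    also have "\<dots> = r * (np p w / (np p w + r))" by (simp add: cp)
    also have "\<dots> \<le> r * 1" using r pos by (intro mult_left_mono) auto
    finally have "np p (\<lambda>s. c *\<^sub>R w s) \<le> r" by simp
    moreover have "(\<lambda>s. c *\<^sub>R w s) \<in> ?V" using w Lp_scaleR[OF wL, of c] by simp
    ultimately obtain v where v: "bounded_control C 0 T v" "Phi T v = Phi T (\<lambda>s. c *\<^sub>R w s)" using small by blast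
    then have "Phi T (\<lambda>s. c *\<^sub>R w s) \<in> reachable T" unfolding reachable_def v(2)[symmetric] by blast
    then have "(1/c) *\<^sub>R Phi T (\<lambda>s. c *\<^sub>R w s) \<in> reachable T" by (rule subspace_scale[OF subspace_reachable[OF T]])
    then show ?thesis using c by (simp add: Phi_scale[OF T V2[OF w]])
  qed
  obtain f where f: "strongly_measurable lebesgue f" "integrable lebesgue (\<lambda>s. norm (f s))" "\<And>s. s \<notin> {0<..<t} \<Longrightarrow> f s = 0"
    and fi: "\<And>w. w \<in> ?V \<Longrightarrow> integrable lebesgue (\<lambda>s. w s \<bullet> f s)"
    and rep: "\<And>w. w \<in> ?V \<Longrightarrow> \<xi> (Phi T w) = (\<integral>s. w s \<bullet> f s \<partial>lebesgue)"
  proof (rule Lp_Riesz[OF p r, of 0 t "\<lambda>w. \<xi> (Phi T w)" C])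
    show "\<xi> (Phi T (\<lambda>s. w s + w' s)) = \<xi> (Phi T w) + \<xi> (Phi T w')" if "w \<in> ?V" "w' \<in> ?V" for w w'
      unfolding Phi_add[OF T V2[OF that(1)] V2[OF that(2)]] by (intro xi_add Vreach that)
    show "\<xi> (Phi T (\<lambda>s. c *\<^sub>R w s)) = c * \<xi> (Phi T w)" if "w \<in> ?V" for c w
      unfolding Phi_scale[OF T V2[OF that]] by (intro xi_scale Vreach that)
    show "\<bar>\<xi> (Phi T w)\<bar> \<le> C" if w: "w \<in> ?V" "np p w \<le> r" for w
    proof -
      obtain v where v: "bounded_control C 0 T v" "Phi T v = Phi T w" using small[OF w] by blast
      show ?thesis using xi_bound[OF v(1)] unfolding v(2) by (simp add: abs_le_iff)
    qed
  qed (use t that in auto)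
  have bV: "w \<in> ?V" if "bounded_control D 0 t w" for w D
    using bounded_control_Lp(1)[OF that p0] bounded_controlD(3)[OF that] by blast
  \<comment> \<open>Adding \<epsilon> w keeps the control within the bound M, so the functional at
    the new state is at most M, whereas it is already at least M at x.\<close>
  have slack: "\<xi> (Phi T w) \<le> 0" if w: "bounded_control 1 0 t w" "\<And>s. s \<notin> E k \<Longrightarrow> w s = 0" for w
  proof -
    have wT: "bounded_control 1 0 T w" by (rule bounded_control_mono[OF w(1)]) (use t in auto)
    have L: "Lp 2 u" "Lp 2 w" by (rule bounded_control_Lp(1)[OF ub], simp, rule bounded_control_Lp(1)[OF wT], simp)
    have "bounded_control M 0 T (\<lambda>s. u s + \<epsilon> *\<^sub>R w s)"
      unfolding bounded_control_def
    proof (intro conjI allI impI)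
      show "strongly_measurable lebesgue (\<lambda>s. u s + \<epsilon> *\<^sub>R w s)"
        by (intro strongly_measurable_add strongly_measurable_scaleR strongly_measurable_const Lp_meas[OF L(1)] Lp_meas[OF L(2)])
      show "norm (u s + \<epsilon> *\<^sub>R w s) \<le> M" for s
      proof (cases "s \<in> E k")
        case True
        have "norm (\<epsilon> *\<^sub>R w s) \<le> \<epsilon>" using bounded_controlD(2)[OF w(1), of s] eps by (simp add: mult_left_le)
        then show ?thesis using norm_triangle_ineq[of "u s" "\<epsilon> *\<^sub>R w s"] Eu[OF True] by linarith
      next
        case False
        then show ?thesis using w(2) bounded_controlD(2)[OF ub] by simp
      qed
      show "u s + \<epsilon> *\<^sub>R w s = 0" if "s \<notin> {0<..<T}" for s
        using bounded_controlD(3)[OF ub that] bounded_controlD(3)[OF wT that] by simp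
    qed
    then have "\<xi> (Phi T (\<lambda>s. u s + \<epsilon> *\<^sub>R w s)) \<le> M" by (rule xi_bound)
    moreover have "Phi T (\<lambda>s. u s + \<epsilon> *\<^sub>R w s) = x + \<epsilon> *\<^sub>R Phi T w"
      using Phi_add[OF T L(1) Lp_scaleR[OF L(2), of \<epsilon>]] Phi_scale[OF T L(2), of \<epsilon>] xu by simp
    moreover have "\<xi> (x + \<epsilon> *\<^sub>R Phi T w) = \<xi> x + \<epsilon> * \<xi> (Phi T w)"
      using xi_add[OF xR subspace_scale[OF subspace_reachable[OF T] Vreach[OF bV[OF w(1)]], of \<epsilon>]]
        xi_scale[OF Vreach[OF bV[OF w(1)]], of \<epsilon>] by simp
    ultimately have "\<epsilon> * \<xi> (Phi T w) \<le> 0" using gM xi_x by simp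
    then show ?thesis using eps by (simp add: mult_le_0_iff)
  qed
  have fE: "AE s in lebesgue_on (E k). f s = 0"
  proof -
    have [measurable]: "(\<lambda>s. norm (f s)) \<in> borel_measurable lebesgue" by (rule borel_measurable_norm_strongly[OF f(1)])
    \<comment> \<open>The direction of \<open>f\<close> on the slack set, with the value 0 where
      \<open>f\<close> vanishes by the convention for division by 0. Its pairing with
      \<open>f\<close> is the integral of |f| over that set, so \<open>slack\<close> forces
      \<open>f\<close> to vanish there.\<close>
    define w where "w = (\<lambda>s. if s \<in> E k then (1 / norm (f s)) *\<^sub>R f s else 0)"
    have wm: "strongly_measurable lebesgue w"
      unfolding w_def by (intro strongly_measurable_cut Es strongly_measurable_scaleR f strongly_measurable_borel) measurable
    have wb: "bounded_control 1 0 t w"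
      using wm f(3) by (auto simp: bounded_control_def w_def)
    have wE: "w s = 0" if "s \<notin> E k" for s using that by (simp add: w_def)
    have wf: "w s \<bullet> f s = indicator (E k) s *\<^sub>R norm (f s)" for s
      by (auto simp: w_def indicator_def power2_norm_eq_inner[symmetric] power2_eq_square)
    have "\<xi> (Phi T w) \<le> 0" by (rule slack[OF wb wE])
    then have "(\<integral>s. indicator (E k) s *\<^sub>R norm (f s) \<partial>lebesgue) \<le> 0"
      unfolding rep[OF bV[OF wb]] by (simp only: wf)
    moreover have "0 \<le> (\<integral>s. indicator (E k) s *\<^sub>R norm (f s) \<partial>lebesgue)" by (intro integral_nonneg_AE) auto
    ultimately have z: "(\<integral>s. indicator (E k) s *\<^sub>R norm (f s) \<partial>lebesgue) = 0" by linarith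
    have i: "integrable lebesgue (\<lambda>s. indicator (E k) s *\<^sub>R norm (f s))"
      using fi[OF bV[OF wb]] by (simp only: wf)
    have "AE s in lebesgue. indicator (E k) s *\<^sub>R norm (f s) = 0"
      using z integral_nonneg_eq_0_iff_AE[OF i] by simp
    then have "AE s in lebesgue. s \<in> E k \<longrightarrow> f s = 0" by eventually_elim (simp add: indicator_def split: if_splits)
    moreover have "E k \<inter> space lebesgue \<in> sets lebesgue" using Es[of k] by simp
    ultimately show ?thesis by (simp only: AE_restrict_space_iff)
  qed
  \<comment> \<open>The horizon changes from T to t. A control without effect at t has none at T
    either, so the functional annihilates it.\<close>
  have fY: "f \<in> Y_space S \<iota> B t"
  proof (rule Y_space_of_annihilated[OF t(3) f])
    fix v D assume v: "bounded_control D 0 t v" "Phi t v = 0"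
    have "Phi T v = S (T - t) (Phi t v)"
      using Phi_extend[OF t(3), of "T - t" v] bounded_control_Lp(1)[OF v(1), of 2] bounded_controlD(3)[OF v(1)] t by simp
    then have "Phi T v = 0" using v(2) t by (simp add: S_linear)
    moreover have "\<xi> 0 = 0" using xi_scale[OF xR, of 0] by simp
    ultimately show "(\<integral>s. v s \<bullet> f s \<partial>lebesgue) = 0" using rep[OF bV[OF v(1)]] by simp
  qed
  have "emeasure lebesgue (E k) > 0"
    using Ek Es[of k] by (auto simp: null_sets_def zero_less_iff_neq_zero)
  then have "AE s in lebesgue_on {0<..<t}. f s = 0"
    using b[unfolded condition_b_def, rule_format, OF t(3) Es[of k] conjI[OF Et] fY fE] by simp
  then have f0: "AE s in lebesgue. f s = 0"
  proof -
    have "AE s in lebesgue. s \<in> {0<..<t} \<longrightarrow> f s = 0"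
      using \<open>AE s in lebesgue_on {0<..<t}. f s = 0\<close> by (subst (asm) AE_restrict_space_iff) auto
    then show ?thesis by eventually_elim (use f(3) in blast)
  qed
  \<comment> \<open>\<open>v'\<close> reaches the same state x as u but is supported before t, so
    the value of the functional at x is an integral against f and equals 0, contrary to M >
    0.\<close>
  have v'b: "bounded_control R 0 t v'" by (rule bounded_control_mono[of R 0 T']) (use v' t in auto)
  have "\<xi> (Phi T v') = (\<integral>s. v' s \<bullet> f s \<partial>lebesgue)" by (rule rep[OF bV[OF v'b]])
  also have "\<dots> = (\<integral>s. 0 \<partial>(lebesgue :: real measure))"
  proof (rule integral_cong_AE)
    show "AE s in lebesgue. v' s \<bullet> f s = 0" using f0 by eventually_elim simp
    show "(\<lambda>s. v' s \<bullet> f s) \<in> borel_measurable lebesgue"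
      by (intro borel_measurable_inner_strongly bounded_controlD(1)[OF v'b] f)
  qed simp
  finally have "\<xi> x = 0" by (simp add: xv')
  then show False using xi_x gM M by simp
qed

section \<open>The cases of the decomposition\<close>

text \<open>As N(T^0) exceeds M, the minimal time lies strictly after T^0, where left continuity is
  available. It makes M the exact minimal norm at that time, as \<open>bang_bang_at\<close>
  requires. Existence comes from the bound below M at T^1 or in the limit at infinity.\<close>

lemma bang_bang_if_between:
  assumes a: "condition_a S \<iota> B" and b: "condition_b S \<iota> B" and M: "M > 0" and y: "y \<noteq> 0"
    and lower: "min_norm S \<iota> B (T1 S y) y < ereal M" and upper: "ereal M < min_norm S \<iota> B (T0 S \<iota> B y) y"
  shows "bang_bang S \<iota> B M y"
  unfolding bang_bang_def
proof (intro conjI allI impI)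
  have "\<exists>t>0. N t y \<le> ereal M"
  proof (cases "T1 S y < \<infinity>")
    case True
    then obtain t where "t > 0" "N t y \<le> 0" using T1_finite[OF y] by blast
    moreover have "(0::ereal) \<le> ereal M" using M by simp
    ultimately show ?thesis by (meson order.trans)
  next
    case False
    then have "(INF t\<in>{0<..}. N t y) < ereal M" using lower by (simp add: min_norm_infinity)
    then show ?thesis by (auto simp: INF_less_iff intro: less_imp_le)
  qed
  then show "\<exists>u. admissible_control S \<iota> B M y u" using admissible_iff M by simp
  fix u assume u: "min_time_control S \<iota> B M y u"
  define \<tau> where "\<tau> = real_of_ereal (min_time S \<iota> B M y)"
  have mt: "min_time S \<iota> B M y = ereal \<tau>"
    using u T0_le_min_time[of M y] T0_nonneg[of y] M unfolding \<tau>_def min_time_control_def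
    by (cases "min_time S \<iota> B M y") auto
  have sol: "sol S \<iota> B y u \<tau> = 0" and uc: "u \<in> controls M" using u by (auto simp: min_time_control_def \<tau>_def)
  have "\<tau> \<noteq> 0" using sol y by (auto simp: sol_eq Phi_0)
  moreover have T0t: "T0 S \<iota> B y \<le> ereal \<tau>" using T0_le_min_time[of M y] M mt by simp
  then have "0 \<le> \<tau>" using T0_nonneg[of y] by (metis ereal_less_eq(5) order.trans)
  ultimately have t0: "\<tau> > 0" by simp
  obtain w where w: "steers M \<tau> y w" "AE t in lebesgue. t \<in> {0<..<\<tau>} \<longrightarrow> w t = u t"
    using control_steers[of u M \<tau> y] uc M t0 sol by (auto simp: controls_def)
  have Nt: "N \<tau> y \<le> ereal M" using N_le_iff[OF t0, of M y] w(1) M by auto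
  have "T0 S \<iota> B y \<noteq> ereal \<tau>"
  proof
    assume "T0 S \<iota> B y = ereal \<tau>"
    then have "ereal M < N \<tau> y" using upper t0 by (simp add: min_norm_pos)
    with Nt show False by simp
  qed
  then have "T0 S \<iota> B y < ereal \<tau>" using T0t by simp
  then obtain T' where T': "T0 S \<iota> B y < ereal T'" "T' < \<tau>" using ereal_dense2 by (metis ereal_less_eq(3) not_le)
  have fin: "0 < T'" "N T' y < \<infinity>" using T0_less[OF y T'(1)] by auto
  \<comment> \<open>A smaller bound at the minimal time would, by left continuity, allow an earlier
    arrival with bound M.\<close>
  have opt: "\<not> N \<tau> y \<le> ereal M'" if M': "0 \<le> M'" "M' < M" for M'
  proof
    assume "N \<tau> y \<le> ereal M'"
    then obtain s where s: "0 < s" "s < \<tau>" "N s y \<le> ereal M"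
      using N_left_continuous[OF a fin(1) T'(2) fin(2) _ M'] by blast
    then obtain v where "steers M s y v" using N_le_iff[OF s(1), of M y] M by auto
    then have "min_time S \<iota> B M y \<le> ereal s" by (rule min_time_le[OF s(1)])
    then show False using mt s(2) by simp
  qed
  have "AE t in lebesgue. t \<in> {0<..<\<tau>} \<longrightarrow> norm (w t) = M"
    by (rule bang_bang_at[OF a b M fin(1) T'(2) fin(2) w(1) opt])
  then have "AE t in lebesgue. t \<in> {0<..<\<tau>} \<longrightarrow> norm (u t) = M" using w(2) by eventually_elim auto
  then show "AE t in lebesgue_on {0<..<real_of_ereal (min_time S \<iota> B M y)}. norm (u t) = M"
    unfolding \<tau>_def[symmetric] by (subst AE_restrict_space_iff) auto
qed

lemma min_time_eq_T0:
  assumes "t > 0" "T0 S \<iota> B y = ereal t" "M \<ge> 0" "N t y \<le> ereal M"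
  shows "min_time S \<iota> B M y = ereal t"
proof (rule antisym)
  obtain v where "steers M t y v" using N_le_iff[OF assms(1,3)] assms(4) by blast
  then show "min_time S \<iota> B M y \<le> ereal t" by (rule min_time_le[OF assms(1)])
  show "ereal t \<le> min_time S \<iota> B M y" using T0_le_min_time[OF assms(3), of y] assms(2) by simp
qed

section \<open>Multiplicity and absence of minimal time controls\<close>

text \<open>A constant control on the first half of the interval is traded for one on the second
  half. The difference has no effect but still equals the constant on the first half. That B is
  nonzero guarantees a nonzero vector in U.\<close>

lemma nonzero_null_control:
  assumes a: "condition_a S \<iota> B" and B: "B \<noteq> 0" and t: "t > 0"
  obtains R z u0 where "R > 0" "bounded_control R 0 t z" "Phi t z = 0" "u0 \<noteq> 0" "\<And>s. s \<in> {0<..<t/2} \<Longrightarrow> z s = u0"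
proof -
  obtain u0 where "blinfun_apply B u0 \<noteq> 0" using B by (metis blinfun_eqI zero_blinfun.rep_eq)
  then have u0: "u0 \<noteq> 0" by auto
  obtain p where p: "p \<ge> 2" and move: "\<And>t T u. 0 < t \<Longrightarrow> t < T \<Longrightarrow> Lp p u \<Longrightarrow> (\<And>s. s \<notin> {0<..<t} \<Longrightarrow> u s = 0) \<Longrightarrow>
     \<exists>C v. bounded_control C t T v \<and> Phi T v = Phi T u" using condition_a_move[OF a] by blast
  define u where "u = (\<lambda>s. if s \<in> {0<..<t/2} then u0 else 0)"
  have ub: "bounded_control (norm u0) 0 (t/2) u"
    unfolding bounded_control_def u_def by (auto intro!: strongly_measurable_cut[of "\<lambda>_. u0" "{0<..<t/2}", simplified])
  have "Lp p u" by (rule bounded_control_Lp(1)[OF ub]) (use p in simp)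
  then obtain C v where v: "bounded_control C (t/2) t v" "Phi t v = Phi t u"
    using move[of "t/2" t u] t bounded_controlD(3)[OF ub] by auto
  have ub': "bounded_control (norm u0) 0 t u" by (rule bounded_control_mono[OF ub]) (use t in auto)
  have vb: "bounded_control C 0 t v" by (rule bounded_control_mono[OF v(1)]) (use t in auto)
  have "bounded_control (norm u0 + C) 0 t (\<lambda>s. u s + (-1) *\<^sub>R v s)"
    using bounded_control_add[OF ub' bounded_control_scale[OF vb, of "-1"]] by simp
  then have zb: "bounded_control (norm u0 + C) 0 t (\<lambda>s. u s - v s)" by simp
  have Pz: "Phi t (\<lambda>s. u s - v s) = 0"
    using Phi_diff[OF t bounded_control_Lp(1)[OF ub'] bounded_control_Lp(1)[OF vb]] v(2) by simp
  have "u s - v s = u0" if "s \<in> {0<..<t/2}" for s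
    using bounded_controlD(3)[OF v(1), of s] that by (simp add: u_def)
  moreover have "norm u0 + C > 0" using u0 bounded_controlD(4)[OF vb] by (simp add: add_pos_nonneg)
  ultimately show ?thesis using that zb Pz u0 by blast
qed

text \<open>At T^0 a control of bound M' < M leaves the slack M - M' for multiples of a nonzero null
  control. Different multiples differ on a whole interval, hence are different classes. The control
  of bound M' is itself a minimal time control and violates the bang-bang property.\<close>

lemma many_min_time_controls:
  assumes a: "condition_a S \<iota> B" and B: "B \<noteq> 0" and t: "t > 0" "T0 S \<iota> B y = ereal t" and less: "N t y < ereal M" and M: "M > 0"
  shows "infinitely_many_min_time_controls S \<iota> B M y" and "\<not> bang_bang S \<iota> B M y"
proof -
  obtain M' v where M': "M' \<ge> 0" and v: "steers M' t y v" and "N t y = ereal M'"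
    using N_finite_steers[OF t(1), of y] less by (metis less_ereal.simps(2) less_trans ereal_less_PInfty)
  then have MM: "M' < M" using less by simp
  have mt: "min_time S \<iota> B M y = ereal t" by (rule min_time_eq_T0[OF t]) (use M less in auto)
  have vb: "bounded_control M' 0 t v" using v by simp
  have vM: "steers M t y v" using v MM by (auto elim: bounded_control_mono)
  obtain R z u0 where R: "R > 0" and z: "bounded_control R 0 t z" "Phi t z = 0" and u0: "u0 \<noteq> 0" "\<And>s. s \<in> {0<..<t/2} \<Longrightarrow> z s = u0"
    using nonzero_null_control[OF a B t(1)] by blast
  \<comment> \<open>Pairwise different multiples whose size after multiplication by R stays within
    the slack.\<close>
  define c where "c = (\<lambda>k::nat. (M - M') / (R * real (Suc k)))"
  define w where "w = (\<lambda>k s. v s + c k *\<^sub>R z s)"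
  have L: "Lp 2 v" "Lp 2 z" by (rule bounded_control_Lp(1)[OF vb], simp, rule bounded_control_Lp(1)[OF z(1)], simp)
  have wc: "min_time_control S \<iota> B M y (w k)" for k
  proof (rule steers_min_time_control[OF t(1) mt])
    have "\<bar>c k\<bar> * R \<le> M - M'"
    proof -
      have "\<bar>c k\<bar> * R = (M - M') / real (Suc k)" using R MM by (simp add: c_def)
      also have "\<dots> \<le> (M - M') / 1" using MM by (intro divide_left_mono) auto
      finally show ?thesis by simp
    qed
    then have "bounded_control M 0 t (w k)"
      unfolding w_def by (intro bounded_control_mono[OF bounded_control_add[OF vb bounded_control_scale[OF z(1)]]]) auto
    moreover have "Phi t (w k) = Phi t v"
      unfolding w_def by (simp add: Phi_add[OF t(1) L(1) Lp_scaleR[OF L(2)]] Phi_scale[OF t(1) L(2)] z(2))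
    ultimately show "steers M t y (w k)" using v by simp
  qed
  have "inj (\<lambda>k. control_class (w k))"
  proof (rule injI)
    fix j k assume "control_class (w j) = control_class (w k)"
    moreover have "w j \<in> control_class (w j)" by (simp add: control_class_def)
    ultimately have "AE s in lebesgue_on {0..}. w j s = w k s" by (auto simp: control_class_def)
    then have "AE s in lebesgue. s \<in> {0..} \<longrightarrow> w j s = w k s" by (subst (asm) AE_restrict_space_iff) auto
    then have "AE s in lebesgue. s \<in> {0<..<t/2} \<longrightarrow> w j s = w k s" by eventually_elim auto
    then obtain s where "s \<in> {0<..<t/2}" "w j s = w k s" by (rule AE_interval_nonempty) (use t(1) that in auto)
    then have "c j = c k" using u0 by (simp add: w_def)
    then have "real (Suc j) = real (Suc k)"
      unfolding c_def using R MM by (simp add: frac_eq_eq)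
    then show "j = k" by simp
  qed
  then have "infinite (range (\<lambda>k. control_class (w k)))" by (rule range_inj_infinite)
  moreover have "range (\<lambda>k. control_class (w k)) \<subseteq> control_class ` {u. min_time_control S \<iota> B M y u}" using wc by auto
  ultimately show "infinitely_many_min_time_controls S \<iota> B M y"
    unfolding infinitely_many_min_time_controls_def by (rule infinite_super[rotated])
  show "\<not> bang_bang S \<iota> B M y"
  proof
    assume "bang_bang S \<iota> B M y"
    then have "AE s in lebesgue_on {0<..<real_of_ereal (min_time S \<iota> B M y)}. norm (v s) = M"
      using steers_min_time_control[OF t(1) mt vM] unfolding bang_bang_def by blast
    then have "AE s in lebesgue_on {0<..<t}. norm (v s) = M" unfolding mt real_of_ereal.simps .
    then have "AE s in lebesgue. s \<in> {0<..<t} \<longrightarrow> norm (v s) = M" by (subst (asm) AE_restrict_space_iff) auto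
    then obtain s where "norm (v s) = M" by (rule AE_interval_nonempty) (use t(1) that in auto)
    then show False using bounded_controlD(2)[OF vb, of s] MM by simp
  qed
qed

text \<open>Minimal norm 0 is attained, and a control bounded by 0 is the null control.\<close>

lemma null_min_time_control_iff:
  assumes t: "t > 0" "T0 S \<iota> B y = ereal t" and M: "M \<ge> 0" and le: "N t y \<le> ereal M"
  shows "min_time_control S \<iota> B M y (\<lambda>t. 0) \<longleftrightarrow> N t y = 0"
proof -
  have mt: "min_time S \<iota> B M y = ereal t" by (rule min_time_eq_T0[OF t M le])
  have b: "bounded_control C 0 t (\<lambda>t. 0 :: 'u)" if "C \<ge> 0" for C using that by (simp add: bounded_control_def)
  show ?thesis
  proof
    assume "min_time_control S \<iota> B M y (\<lambda>t. 0)"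
    then have "steers 0 t y (\<lambda>t. 0)" using b[of 0] by (simp add: min_time_control_def mt sol_eq)
    then have "N t y \<le> ereal 0" using N_le_iff[OF t(1), of 0 y] by blast
    then show "N t y = 0" using N_nonneg[OF t(1), of y] by (simp add: zero_ereal_def antisym)
  next
    assume "N t y = 0"
    then have "N t y \<le> ereal 0" by (simp add: zero_ereal_def)
    then obtain v where v: "steers 0 t y v" using N_le_iff[OF t(1), of 0 y] by auto
    then have "v = (\<lambda>t. 0)" using bounded_controlD(2)[of 0 0 t v] by auto
    then have "steers M t y (\<lambda>t. 0)" using v b[OF M] by simp
    then show "min_time_control S \<iota> B M y (\<lambda>t. 0)" by (rule steers_min_time_control[OF t(1) mt])
  qed
qed

lemma no_admissible_if_T0_infinite:
  assumes "T0 S \<iota> B y = \<infinity>" and M: "M > 0"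
  shows "\<nexists>u. admissible_control S \<iota> B M y u"
proof
  assume "\<exists>u. admissible_control S \<iota> B M y u"
  then obtain t where t: "t > 0" "N t y \<le> ereal M" using admissible_iff[of M y] M by auto
  then show False using T0_infinite[OF assms(1), of t] by simp
qed

text \<open>For finite T^1 the minimal norm there is 0, which is below M. Otherwise M is at most the
  infimum of \<open>N\<close>, and by strict decrease a time with N(t) <= M would be followed by one
  with a value below M.\<close>

lemma no_admissible_if_below:
  assumes a: "condition_a S \<iota> B" and M: "M > 0" and y: "y \<noteq> 0" and le: "ereal M \<le> min_norm S \<iota> B (T1 S y) y"
  shows "\<nexists>u. admissible_control S \<iota> B M y u"
proof
  assume "\<exists>u. admissible_control S \<iota> B M y u"
  then obtain t where t: "t > 0" "N t y \<le> ereal M" using admissible_iff[of M y] M by auto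
  show False
  proof (cases "T1 S y < \<infinity>")
    case True
    then obtain s where s: "s > 0" "T1 S y = ereal s" "N s y \<le> 0" using T1_finite[OF y] by blast
    have "ereal M \<le> N s y" using le s(1,2) by (simp add: min_norm_pos)
    from order.trans[OF this s(3)] have "ereal M \<le> ereal 0" by (simp add: zero_ereal_def)
    then show False using M by simp
  next
    case False
    then have "ereal M \<le> (INF t\<in>{0<..}. N t y)" using le by (simp add: min_norm_infinity)
    also have "\<dots> \<le> N (t + 1) y" using t by (intro INF_lower) simp
    finally have "ereal M \<le> N (t + 1) y" .
    moreover obtain M' where "M' < M" "N (t + 1) y \<le> ereal M'"
      using N_strictly_decreasing[OF a t(1) _ M t(2), of "t + 1"] by auto
    ultimately show False by (metis ereal_less_eq(3) not_le order.trans)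
  qed
qed

end

section \<open>Assembly of the six assertions\<close>

theorem theorem1p5:
  fixes A :: "'x::{real_inner, complete_space} \<Rightarrow> 'x"
    and DA :: "'x set"
    and S :: "real \<Rightarrow> 'x \<Rightarrow> 'x"
    and \<iota> :: "'d::{real_inner, complete_space} \<Rightarrow> 'x"
    and B :: "'u::{real_inner, complete_space} \<Rightarrow>\<^sub>L ('d \<Rightarrow>\<^sub>L real)"
  assumes "C0_semigroup S"
    and "generates A DA S"
    and "represents_adj_dom A DA \<iota>"
    and "admissible_control_operator S \<iota> B"
    and "B \<noteq> 0"
  shows
    "(let Vs = [V1 S \<iota> B, V21 S \<iota> B, V22 S \<iota> B, V23 S \<iota> B, V24 S \<iota> B,
                V31 S \<iota> B, V32 S \<iota> B, V33 S \<iota> B]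
      in VV = \<Union> (set Vs) \<and> disjoint_family_on (\<lambda>k. Vs ! k) {..<length Vs}) \<and>
     (condition_a S \<iota> B \<and> condition_b S \<iota> B \<longrightarrow>
        (\<forall>(M, y0) \<in> V22 S \<iota> B \<union> V32 S \<iota> B. bang_bang S \<iota> B M y0)) \<and>
     (condition_a S \<iota> B \<longrightarrow>
        (\<forall>(M, y0) \<in> V24 S \<iota> B.
           infinitely_many_min_time_controls S \<iota> B M y0 \<and>
           \<not> min_time_control S \<iota> B M y0 (\<lambda>t. 0) \<and>
           \<not> bang_bang S \<iota> B M y0)) \<and>
     (condition_a S \<iota> B \<longrightarrow>
        (\<forall>(M, y0) \<in> V1 S \<iota> B.
           infinitely_many_min_time_controls S \<iota> B M y0 \<and>
           min_time_control S \<iota> B M y0 (\<lambda>t. 0) \<and>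
           \<not> bang_bang S \<iota> B M y0)) \<and>
     (\<forall>(M, y0) \<in> V33 S \<iota> B.
        (\<nexists>u. admissible_control S \<iota> B M y0 u) \<and> \<not> bang_bang S \<iota> B M y0) \<and>
     (condition_a S \<iota> B \<longrightarrow>
        (\<forall>(M, y0) \<in> V21 S \<iota> B \<union> V31 S \<iota> B.
           (\<nexists>u. admissible_control S \<iota> B M y0 u) \<and> \<not> bang_bang S \<iota> B M y0)) \<and>
     (\<forall>(M, y0) \<in> V23 S \<iota> B. \<exists>u. min_time_control S \<iota> B M y0 u)"
proof -
  interpret control_system S A DA \<iota> B using assms(1-4) by unfold_locales
  note V = V1_def V21_def V22_def V23_def V24_def V31_def V32_def V33_def V2_def V3_def VV_def
  have n0: "0 \<le> min_norm S \<iota> B (T0 S \<iota> B y) y" for y by (rule min_norm_nonneg[OF T0_nonneg])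
  have not_bb: "(\<nexists>u. admissible_control S \<iota> B M y u) \<Longrightarrow> \<not> bang_bang S \<iota> B M y" for M y
    by (simp add: bang_bang_def)
  have T0_time: "\<exists>t>0. T0 S \<iota> B y = ereal t \<and> N t y = min_norm S \<iota> B (T0 S \<iota> B y) y"
    if y: "min_norm S \<iota> B (T0 S \<iota> B y) y < \<infinity>" "y \<noteq> 0" for y
  proof -
    obtain t where "t > 0" "T0 S \<iota> B y = ereal t" using T0_finite_positive[OF y(2,1)] by blast
    then show ?thesis by (auto simp: min_norm_pos)
  qed
  let ?Vs = "[V1 S \<iota> B, V21 S \<iota> B, V22 S \<iota> B, V23 S \<iota> B, V24 S \<iota> B, V31 S \<iota> B, V32 S \<iota> B, V33 S \<iota> B]"
  let ?n0 = "\<lambda>y. min_norm S \<iota> B (T0 S \<iota> B y) y" and ?n1 = "\<lambda>y. min_norm S \<iota> B (T1 S y) y"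
  \<comment> \<open>The index of the class of a pair. Describing each class as a fibre of
    \<open>k\<close> over \<open>VV\<close> yields covering and disjointness together.\<close>
  define k where "k = (\<lambda>(M, y). if ?n0 y = 0 then 0 else if ?n0 y = \<infinity> then (if T0 S \<iota> B y = \<infinity> then 7
    else if ereal M \<le> ?n1 y then 5 else 6) else if ereal M \<le> ?n1 y then 1 else if ereal M < ?n0 y then 2
    else if ereal M = ?n0 y then 3 else 4 :: nat)"
  have iff: "x \<in> ?Vs ! j \<longleftrightarrow> x \<in> VV \<and> k x = j" if j: "j < 8" for j x
  proof -
    obtain M y where x: "x = (M, y)" by (cases x)
    define n0 n1 where "n0 = ?n0 y" and "n1 = ?n1 y"
    have pos: "0 < n0 \<longleftrightarrow> n0 \<noteq> 0" using n0[of y] by (auto simp: n0_def order_le_less)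
    have le: "n1 < ereal M \<longleftrightarrow> \<not> ereal M \<le> n1" by (rule not_le[symmetric])
    have less: "n0 < ereal M \<longleftrightarrow> \<not> ereal M < n0 \<and> ereal M \<noteq> n0" by auto
    have fin: "n0 < \<infinity> \<longleftrightarrow> n0 \<noteq> \<infinity>" "T0 S \<iota> B y < \<infinity> \<longleftrightarrow> T0 S \<iota> B y \<noteq> \<infinity>" by simp_all
    have mem: "x \<in> V1 S \<iota> B \<longleftrightarrow> x \<in> VV \<and> n0 = 0"
      "x \<in> V21 S \<iota> B \<longleftrightarrow> x \<in> VV \<and> n0 \<noteq> 0 \<and> n0 \<noteq> \<infinity> \<and> ereal M \<le> n1"
      "x \<in> V22 S \<iota> B \<longleftrightarrow> x \<in> VV \<and> n0 \<noteq> 0 \<and> n0 \<noteq> \<infinity> \<and> \<not> ereal M \<le> n1 \<and> ereal M < n0"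
      "x \<in> V23 S \<iota> B \<longleftrightarrow> x \<in> VV \<and> n0 \<noteq> 0 \<and> n0 \<noteq> \<infinity> \<and> \<not> ereal M \<le> n1 \<and> ereal M = n0"
      "x \<in> V24 S \<iota> B \<longleftrightarrow> x \<in> VV \<and> n0 \<noteq> 0 \<and> n0 \<noteq> \<infinity> \<and> \<not> ereal M \<le> n1 \<and> \<not> ereal M < n0 \<and> ereal M \<noteq> n0"
      "x \<in> V31 S \<iota> B \<longleftrightarrow> x \<in> VV \<and> n0 = \<infinity> \<and> T0 S \<iota> B y \<noteq> \<infinity> \<and> ereal M \<le> n1"
      "x \<in> V32 S \<iota> B \<longleftrightarrow> x \<in> VV \<and> n0 = \<infinity> \<and> T0 S \<iota> B y \<noteq> \<infinity> \<and> \<not> ereal M \<le> n1"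
      "x \<in> V33 S \<iota> B \<longleftrightarrow> x \<in> VV \<and> n0 = \<infinity> \<and> T0 S \<iota> B y = \<infinity>"
      unfolding x V1_def V21_def V22_def V23_def V24_def V31_def V32_def V33_def V2_def V3_def
        mem_Collect_eq prod.case n0_def[symmetric] n1_def[symmetric] pos le less fin by blast+
    have k: "k x = (if n0 = 0 then 0 else if n0 = \<infinity> then (if T0 S \<iota> B y = \<infinity> then 7
      else if ereal M \<le> n1 then 5 else 6) else if ereal M \<le> n1 then 1 else if ereal M < n0 then 2
      else if ereal M = n0 then 3 else 4)"
      unfolding k_def x prod.case n0_def n1_def ..
    consider "j = 0" | "j = 1" | "j = 2" | "j = 3" | "j = 4" | "j = 5" | "j = 6" | "j = 7" using j by linarith
    then show ?thesis by cases (simp_all add: mem k)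
  qed
  have "k x < 8" for x by (simp add: k_def split: prod.split)
  then have k8: "k x < 8" "k x < length ?Vs" for x by (simp_all only: list.size) (simp_all add: eval_nat_numeral)
  have "x \<in> \<Union> (set ?Vs)" if "x \<in> VV" for x
  proof (rule UnionI[OF nth_mem[OF k8(2)]])
    show "x \<in> ?Vs ! k x" using iff[OF k8(1)] that by blast
  qed
  moreover have "x \<in> VV" if "x \<in> \<Union> (set ?Vs)" for x using that by (auto simp: V)
  moreover have "disjoint_family_on (\<lambda>k. ?Vs ! k) {..<length ?Vs}"
    unfolding disjoint_family_on_def using iff by auto
  ultimately have i: "VV = \<Union> (set ?Vs) \<and> disjoint_family_on (\<lambda>k. ?Vs ! k) {..<length ?Vs}" by blast
  have ii: "bang_bang S \<iota> B M y"
    if "condition_a S \<iota> B" "condition_b S \<iota> B" "(M, y) \<in> V22 S \<iota> B \<union> V32 S \<iota> B" for M y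
    using bang_bang_if_between[OF that(1,2), of M y] that(3) by (auto simp: V)
  \<comment> \<open>Both V1 and V24 are cases of N(T^0) < M. They differ only in whether N(T^0) is
    0, which decides about the null control.\<close>
  have iii_iv: "infinitely_many_min_time_controls S \<iota> B M y \<and>
      (min_time_control S \<iota> B M y (\<lambda>t. 0) \<longleftrightarrow> min_norm S \<iota> B (T0 S \<iota> B y) y = 0) \<and> \<not> bang_bang S \<iota> B M y"
    if a: "condition_a S \<iota> B" and M: "M > 0" "y \<noteq> 0" and less: "min_norm S \<iota> B (T0 S \<iota> B y) y < ereal M" for M y
  proof -
    have "min_norm S \<iota> B (T0 S \<iota> B y) y < \<infinity>" using less by (rule less_trans) simp
    then obtain t where t: "t > 0" "T0 S \<iota> B y = ereal t" and N: "N t y = min_norm S \<iota> B (T0 S \<iota> B y) y"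
      using T0_time[OF _ M(2)] by blast
    have less': "N t y < ereal M" using less N by simp
    show ?thesis
      using many_min_time_controls[OF a assms(5) t less' M(1)]
        null_min_time_control_iff[OF t less_imp_le[OF M(1)] less_imp_le[OF less']] N by simp
  qed
  have v: "\<nexists>u. admissible_control S \<iota> B M y u" if "(M, y) \<in> V33 S \<iota> B" for M y
    using no_admissible_if_T0_infinite[of y M] that by (simp add: V)
  have v': "\<nexists>u. admissible_control S \<iota> B M y u"
    if "condition_a S \<iota> B" "(M, y) \<in> V21 S \<iota> B \<union> V31 S \<iota> B" for M y
    using no_admissible_if_below[OF that(1), of M y] that(2) by (auto simp: V)
  have vi: "\<exists>u. min_time_control S \<iota> B M y u" if V23: "(M, y) \<in> V23 S \<iota> B" for M y
  proof -
    have M: "M \<ge> 0" and y: "y \<noteq> 0" and eq: "ereal M = min_norm S \<iota> B (T0 S \<iota> B y) y" using V23 by (auto simp: V)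
    obtain t where t: "t > 0" "T0 S \<iota> B y = ereal t" and N: "N t y = ereal M"
      using T0_time[of y] y eq[symmetric] by auto
    then have le: "N t y \<le> ereal M" by simp
    then obtain v where "steers M t y v" using N_le_iff[OF t(1) M] by blast
    then show ?thesis using steers_min_time_control[OF t(1) min_time_eq_T0[OF t M le]] by blast
  qed
  have iii: "infinitely_many_min_time_controls S \<iota> B M y \<and> \<not> min_time_control S \<iota> B M y (\<lambda>t. 0) \<and> \<not> bang_bang S \<iota> B M y"
    if "condition_a S \<iota> B" "(M, y) \<in> V24 S \<iota> B" for M y
    using iii_iv[OF that(1), of M y] that(2) by (auto simp: V)
  have iv: "infinitely_many_min_time_controls S \<iota> B M y \<and> min_time_control S \<iota> B M y (\<lambda>t. 0) \<and> \<not> bang_bang S \<iota> B M y"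
    if "condition_a S \<iota> B" "(M, y) \<in> V1 S \<iota> B" for M y
    using iii_iv[OF that(1), of M y] that(2) by (simp add: V)
  show ?thesis
    unfolding Let_def
  proof (intro conjI impI ballI conjunct1[OF i] conjunct2[OF i])
    fix x assume "condition_a S \<iota> B \<and> condition_b S \<iota> B" "x \<in> V22 S \<iota> B \<union> V32 S \<iota> B"
    then show "case x of (M, y0) \<Rightarrow> bang_bang S \<iota> B M y0" using ii by (cases x) blast
  next
    fix x assume "condition_a S \<iota> B" "x \<in> V24 S \<iota> B"
    then show "case x of (M, y0) \<Rightarrow> infinitely_many_min_time_controls S \<iota> B M y0 \<and>
      \<not> min_time_control S \<iota> B M y0 (\<lambda>t. 0) \<and> \<not> bang_bang S \<iota> B M y0" using iii by (cases x) simp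
  next
    fix x assume "condition_a S \<iota> B" "x \<in> V1 S \<iota> B"
    then show "case x of (M, y0) \<Rightarrow> infinitely_many_min_time_controls S \<iota> B M y0 \<and>
      min_time_control S \<iota> B M y0 (\<lambda>t. 0) \<and> \<not> bang_bang S \<iota> B M y0" using iv by (cases x) simp
  next
    fix x assume "x \<in> V33 S \<iota> B"
    then show "case x of (M, y0) \<Rightarrow> (\<nexists>u. admissible_control S \<iota> B M y0 u) \<and> \<not> bang_bang S \<iota> B M y0"
      using v not_bb by (cases x) blast
  next
    fix x assume "condition_a S \<iota> B" "x \<in> V21 S \<iota> B \<union> V31 S \<iota> B"
    then show "case x of (M, y0) \<Rightarrow> (\<nexists>u. admissible_control S \<iota> B M y0 u) \<and> \<not> bang_bang S \<iota> B M y0"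
      using v' not_bb by (cases x) blast
  next
    fix x assume "x \<in> V23 S \<iota> B"
    then show "case x of (M, y0) \<Rightarrow> \<exists>u. min_time_control S \<iota> B M y0 u" using vi by (cases x) blast
  qed
qed

end
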